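(* Let $k$ be a field, let $A$ be a finite dimensional elementary $k$-algebra of finite global dimension, and let $\{e_1,\dots,e_n\}$ be a complete set of orthogonal primitive idempotents of $A$. Let $C_A$ be the Cartan matrix of $A$. Then the following four equivalent statements hold (as identities in $\mathbb{Z}$): (1) For all finite dimensional right $A$-modules $M$ and $N$, $$\dim(\mathrm{RHom}_A(M,N)) := \sum_{l\ge 0} (-1)^l \dim\mathrm{Ext}_A^l(M,N) = \langle \underline{\dim}\, M,\underline{\dim}\, N \rangle_A,$$ where $\langle -,- \rangle_A : \mathbb{Z}^n\times\mathbb{Z}^n\to\mathbb{Z}$, $(x,y)\mapsto x^T C_A^{-T} y$, is the Ringel form of $A$. (2) For every finite dimensional right $A$-module $M$ and every finite dimensional left $A$-module $N$, $$\dim(M\otimes^L_A N) := \sum_{l\ge 0} (-1)^l \dim\mathrm{Tor}^A_l(M,N) = \langle (\underline{\dim}\, N)^T,\underline{\dim}\, M \rangle_{A^{\mathrm{op}}},$$ where $\langle -,- \rangle_{A^{\mathrm{op}}} : \mathbb{Z}^n\times\mathbb{Z}^n\to\mathbb{Z}$, $(x,y)\mapsto x^T C_A^{-1} y$, is the Ringel form of $A^{\mathrm{op}}$. (3) For any finite dimensional $A$-bimodule $M$, $$\dim(\mathrm{RHom}_{A^e}(A,M)) := \sum_{l\ge 0} (-1)^l \dim HH^l(A,M) = \mathrm{tr}(C_A^{-T}\cdot \underline{\underline{\dim}}\, M),$$ where $HH^l(A,M):=\mathrm{Ext}_{A^e}^l(A,M)$ is the $l$-th Hochschild cohomology of $A$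 with coefficients in $M$. (4) For any finite dimensional $A$-bimodule $M$, $$\dim(A\otimes^L_{A^e}M) := \sum_{l\ge 0} (-1)^l \dim HH_l(A,M) = \mathrm{tr}(C_A^{-1}\cdot \underline{\underline{\dim}}\, M),$$ where $HH_l(A,M):=\mathrm{Tor}^{A^e}_l(A,M)$ is the $l$-th Hochschild homology of $A$ with coefficients in $M$.
   Context: $k$ is a fixed field; algebras are associative unital $k$-algebras; $\dim=\dim_k$; $\otimes=\otimes_k$; $T$ denotes transpose and $C^{-T}=(C^{-1})^T$. Elements of $\mathbb{Z}^n$ in the domain of a bilinear form are column vectors. A finite dimensional algebra $A$ is elementary if $A/\mathrm{rad}\,A$ is isomorphic to a direct product of finitely many copies of $k$. $A^{\mathrm{op}}$ is the opposite algebra and $A^e:=A^{\mathrm{op}}\otimes A$ the enveloping algebra; $A$-bimodules (with $k$ acting centrally) are viewed as $A^e$-modules. Cartan matrix: $C_A=(c_{ij})\in\mathbb{Z}^{n\times n}$ with $c_{ij}=\dim\mathrm{Hom}_A(e_iA,e_jA)=\dim e_jAe_i$. When $A$ has finite global dimension, $\det C_A=\pm1$, so $C_A^{-1}$ is an integer matrix. Dimension vectors: for a finite dimensional right $A$-module $M$, $\underline{\dim}\,M\in\mathbb{Z}^n$ is the column vector with entries $\dim Me_1,\dots,\dim Me_n$. For a finite dimensional left $A$-module $N$, $\underline{\dim}\,N$ is the row vector $(\dim e_1N,\dots,\dim e_nN)$. Dimension matrix: for a finite dimensional $A$-bimodule $M$, $\underline{\underline{\dim}}\,M\in\mathbb{Z}^{n\times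 n}$ is the matrix with $(i,j)$ entry $\dim e_jMe_i$. *)

theory Defs
  imports "HOL-Algebra.QuotRing" "HOL-Algebra.Chinese_Remainder" "Jordan_Normal_Form.Missing_VectorSpace" "Jordan_Normal_Form.Matrix"
begin

section \<open>Algebras and modules over a field\<close>

text \<open>
  Everything is carrier based. Vector spaces over \<^term>\<open>K\<close> are records of type
  \<^typ>\<open>('k, 'v) module\<close> satisfying \<^locale>\<open>vectorspace\<close>; the ring multiplication and unit
  of such a record are only meaningful for algebras.
\<close>

locale k_algebra = vec?: vectorspace K A + ring?: ring A
  for K :: "('k, 'x) ring_scheme" (structure) and A :: "('k, 'a, 'y) module_scheme" (structure) +
  assumes smult_mult_left:
      "\<lbrakk>c \<in> carrier K; x \<in> carrier A; y \<in> carrier A\<rbrakk>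
        \<Longrightarrow> (c \<odot>\<^bsub>A\<^esub> x) \<otimes>\<^bsub>A\<^esub> y = c \<odot>\<^bsub>A\<^esub> (x \<otimes>\<^bsub>A\<^esub> y)"
    and smult_mult_right:
      "\<lbrakk>c \<in> carrier K; x \<in> carrier A; y \<in> carrier A\<rbrakk>
        \<Longrightarrow> x \<otimes>\<^bsub>A\<^esub> (c \<odot>\<^bsub>A\<^esub> y) = c \<odot>\<^bsub>A\<^esub> (x \<otimes>\<^bsub>A\<^esub> y)"

record ('k, 'm, 'a) rmod = "('k, 'm) module" +
  ract :: "'m \<Rightarrow> 'a \<Rightarrow> 'm"

record ('k, 'm, 'a) lmod = "('k, 'm) module" +
  lact :: "'a \<Rightarrow> 'm \<Rightarrow> 'm"

record ('k, 'm, 'a) bimod = "('k, 'm, 'a) lmod" +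
  bract :: "'m \<Rightarrow> 'a \<Rightarrow> 'm"

locale right_module = alg?: k_algebra K A + vec?: vectorspace K M
  for K :: "('k, 'x) ring_scheme" and A :: "('k, 'a, 'y) module_scheme"
    and M :: "('k, 'm, 'a, 'z) rmod_scheme" +
  assumes ract_closed: "\<lbrakk>m \<in> carrier M; a \<in> carrier A\<rbrakk> \<Longrightarrow> ract M m a \<in> carrier M"
    and ract_add: "\<lbrakk>m \<in> carrier M; a \<in> carrier A; b \<in> carrier A\<rbrakk>
      \<Longrightarrow> ract M m (a \<oplus>\<^bsub>A\<^esub> b) = ract M m a \<oplus>\<^bsub>M\<^esub> ract M m b"
    and add_ract: "\<lbrakk>m \<in> carrier M; m' \<in> carrier M; a \<in> carrier A\<rbrakk>
      \<Longrightarrow> ract M (m \<oplus>\<^bsub>M\<^esub> m') a = ract M m a \<oplus>\<^bsub>M\<^esub> ract M m' a"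
    and ract_smult: "\<lbrakk>c \<in> carrier K; m \<in> carrier M; a \<in> carrier A\<rbrakk>
      \<Longrightarrow> ract M m (c \<odot>\<^bsub>A\<^esub> a) = c \<odot>\<^bsub>M\<^esub> ract M m a"
    and smult_ract: "\<lbrakk>c \<in> carrier K; m \<in> carrier M; a \<in> carrier A\<rbrakk>
      \<Longrightarrow> ract M (c \<odot>\<^bsub>M\<^esub> m) a = c \<odot>\<^bsub>M\<^esub> ract M m a"
    and ract_mult: "\<lbrakk>m \<in> carrier M; a \<in> carrier A; b \<in> carrier A\<rbrakk>
      \<Longrightarrow> ract M m (a \<otimes>\<^bsub>A\<^esub> b) = ract M (ract M m a) b"
    and ract_one: "m \<in> carrier M \<Longrightarrow> ract M m \<one>\<^bsub>A\<^esub> = m"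

locale left_module = alg?: k_algebra K A + vec?: vectorspace K N
  for K :: "('k, 'x) ring_scheme" and A :: "('k, 'a, 'y) module_scheme"
    and N :: "('k, 'n, 'a, 'z) lmod_scheme" +
  assumes lact_closed: "\<lbrakk>m \<in> carrier N; a \<in> carrier A\<rbrakk> \<Longrightarrow> lact N a m \<in> carrier N"
    and lact_add: "\<lbrakk>m \<in> carrier N; a \<in> carrier A; b \<in> carrier A\<rbrakk>
      \<Longrightarrow> lact N (a \<oplus>\<^bsub>A\<^esub> b) m = lact N a m \<oplus>\<^bsub>N\<^esub> lact N b m"
    and add_lact: "\<lbrakk>m \<in> carrier N; m' \<in> carrier N; a \<in> carrier A\<rbrakk>
      \<Longrightarrow> lact N a (m \<oplus>\<^bsub>N\<^esub> m') = lact N a m \<oplus>\<^bsub>N\<^esub> lact N a m'"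
    and lact_smult: "\<lbrakk>c \<in> carrier K; m \<in> carrier N; a \<in> carrier A\<rbrakk>
      \<Longrightarrow> lact N (c \<odot>\<^bsub>A\<^esub> a) m = c \<odot>\<^bsub>N\<^esub> lact N a m"
    and smult_lact: "\<lbrakk>c \<in> carrier K; m \<in> carrier N; a \<in> carrier A\<rbrakk>
      \<Longrightarrow> lact N a (c \<odot>\<^bsub>N\<^esub> m) = c \<odot>\<^bsub>N\<^esub> lact N a m"
    and lact_mult: "\<lbrakk>m \<in> carrier N; a \<in> carrier A; b \<in> carrier A\<rbrakk>
      \<Longrightarrow> lact N (a \<otimes>\<^bsub>A\<^esub> b) m = lact N a (lact N b m)"
    and lact_one: "m \<in> carrier N \<Longrightarrow> lact N \<one>\<^bsub>A\<^esub> m = m"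

definition as_rmod :: "('k, 'm, 'z) module_scheme \<Rightarrow> ('m \<Rightarrow> 'a \<Rightarrow> 'm) \<Rightarrow> ('k, 'm, 'a) rmod" where
  "as_rmod M r = module.extend (module.truncate M) (rmod.fields r)"

definition as_lmod :: "('k, 'm, 'z) module_scheme \<Rightarrow> ('a \<Rightarrow> 'm \<Rightarrow> 'm) \<Rightarrow> ('k, 'm, 'a) lmod" where
  "as_lmod M l = module.extend (module.truncate M) (lmod.fields l)"

text \<open>That \<^term>\<open>K\<close> acts centrally is part of the one-sided module axioms: both actions are
  compatible with the same scalar multiplication.\<close>

locale bimodule = left?: left_module K A M + right?: right_module K A "as_rmod M (bract M)"
  for K :: "('k, 'x) ring_scheme" and A :: "('k, 'a, 'y) module_scheme"
    and M :: "('k, 'm, 'a) bimod" +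
  assumes lact_bract: "\<lbrakk>m \<in> carrier M; a \<in> carrier A; b \<in> carrier A\<rbrakk>
    \<Longrightarrow> bract M (lact M a m) b = lact M a (bract M m b)"

definition fd_right_module where
  "fd_right_module K A M \<longleftrightarrow> right_module K A M \<and> vectorspace.fin_dim K M"

definition fd_left_module where
  "fd_left_module K A N \<longleftrightarrow> left_module K A N \<and> vectorspace.fin_dim K N"

definition fd_bimodule where
  "fd_bimodule K A M \<longleftrightarrow> bimodule K A M \<and> vectorspace.fin_dim K M"

definition right_hom :: "('k, 'x) ring_scheme \<Rightarrow> ('k, 'a, 'y) module_scheme
    \<Rightarrow> ('k, 'm, 'a) rmod \<Rightarrow> ('k, 'n, 'a) rmod \<Rightarrow> ('m \<Rightarrow> 'n) set" where
  "right_hom K A M N = {h \<in> LinearCombinations.module_hom K M N.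
     \<forall>m\<in>carrier M. \<forall>a\<in>carrier A. h (ract M m a) = ract N (h m) a}"

definition hom_space :: "('k, 'x) ring_scheme \<Rightarrow> ('k, 'a, 'y) module_scheme
    \<Rightarrow> ('k, 'm, 'a) rmod \<Rightarrow> ('k, 'n, 'a) rmod \<Rightarrow> ('k, 'm \<Rightarrow> 'n) module" where
  "hom_space K A M N = \<lparr>
     carrier = right_hom K A M N \<inter> extensional (carrier M),
     monoid.mult = undefined, monoid.one = undefined,
     ring.zero = (\<lambda>m\<in>carrier M. \<zero>\<^bsub>N\<^esub>),
     add = (\<lambda>f g. \<lambda>m\<in>carrier M. f m \<oplus>\<^bsub>N\<^esub> g m),
     smult = (\<lambda>c f. \<lambda>m\<in>carrier M. c \<odot>\<^bsub>N\<^esub> f m)\<rparr>"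


section \<open>Elementary algebras and idempotents\<close>

definition right_ideal :: "('a, 'x) ring_scheme \<Rightarrow> 'a set \<Rightarrow> bool" where
  "right_ideal A I \<longleftrightarrow> additive_subgroup I A \<and> (\<forall>x\<in>I. \<forall>a\<in>carrier A. x \<otimes>\<^bsub>A\<^esub> a \<in> I)"

definition maximal_right_ideal :: "('a, 'x) ring_scheme \<Rightarrow> 'a set \<Rightarrow> bool" where
  "maximal_right_ideal A I \<longleftrightarrow> right_ideal A I \<and> I \<noteq> carrier A \<and>
     (\<forall>J. right_ideal A J \<and> I \<subseteq> J \<longrightarrow> J = I \<or> J = carrier A)"

definition jacobson_radical :: "('a, 'x) ring_scheme \<Rightarrow> 'a set" where
  "jacobson_radical A = carrier A \<inter> \<Inter> {I. maximal_right_ideal A I}"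

text \<open>The second condition makes the ring isomorphism from \<open>A / rad A\<close> to \<open>K\<^sup>m\<close> an
  isomorphism of \<^term>\<open>K\<close>-algebras.\<close>

definition elementary :: "('k, 'x) ring_scheme \<Rightarrow> ('k, 'a, 'y) module_scheme \<Rightarrow> bool" where
  "elementary K A \<longleftrightarrow>
     (\<exists>m. \<exists>\<phi> \<in> ring_iso (A Quot jacobson_radical A) (RDirProd_list (replicate m K)).
        \<forall>c\<in>carrier K. \<forall>x\<in>carrier A.
          \<phi> (jacobson_radical A +>\<^bsub>A\<^esub> (c \<odot>\<^bsub>A\<^esub> x))
            = map (\<lambda>y. c \<otimes>\<^bsub>K\<^esub> y) (\<phi> (jacobson_radical A +>\<^bsub>A\<^esub> x)))"

definition primitive_idempotent :: "('a, 'x) ring_scheme \<Rightarrow> 'a \<Rightarrow> bool" where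
  "primitive_idempotent A e \<longleftrightarrow> e \<in> carrier A \<and> e \<otimes>\<^bsub>A\<^esub> e = e \<and> e \<noteq> \<zero>\<^bsub>A\<^esub> \<and>
     (\<forall>f\<in>carrier A. \<forall>g\<in>carrier A.
        f \<otimes>\<^bsub>A\<^esub> f = f \<and> g \<otimes>\<^bsub>A\<^esub> g = g \<and> f \<otimes>\<^bsub>A\<^esub> g = \<zero>\<^bsub>A\<^esub> \<and> g \<otimes>\<^bsub>A\<^esub> f = \<zero>\<^bsub>A\<^esub> \<and> e = f \<oplus>\<^bsub>A\<^esub> g
        \<longrightarrow> f = \<zero>\<^bsub>A\<^esub> \<or> g = \<zero>\<^bsub>A\<^esub>)"

text \<open>The idempotents are indexed by \<open>0, \<dots>, n - 1\<close>.\<close>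

definition complete_primitive_idempotents ::
    "('a, 'x) ring_scheme \<Rightarrow> nat \<Rightarrow> (nat \<Rightarrow> 'a) \<Rightarrow> bool" where
  "complete_primitive_idempotents A n e \<longleftrightarrow>
     (\<forall>i<n. primitive_idempotent A (e i)) \<and>
     (\<forall>i<n. \<forall>j<n. i \<noteq> j \<longrightarrow> e i \<otimes>\<^bsub>A\<^esub> e j = \<zero>\<^bsub>A\<^esub>) \<and>
     (\<Oplus>\<^bsub>A\<^esub> i\<in>{..<n}. e i) = \<one>\<^bsub>A\<^esub>"


section \<open>Quotients, presentations and tensor products\<close>

definition quotient_space :: "('k, 'v, 'z) module_scheme \<Rightarrow> 'v set \<Rightarrow> ('k, 'v set) module" where
  "quotient_space V W = \<lparr>
     carrier = a_rcosets\<^bsub>V\<^esub> W,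
     monoid.mult = undefined, monoid.one = undefined,
     ring.zero = W,
     add = set_add V,
     smult = (\<lambda>c X. \<Union>x\<in>X. W +>\<^bsub>V\<^esub> (c \<odot>\<^bsub>V\<^esub> x))\<rparr>"

definition subquotient :: "('k, 'v, 'z) module_scheme \<Rightarrow> 'v set \<Rightarrow> 'v set \<Rightarrow> ('k, 'v set) module" where
  "subquotient V Z B = quotient_space (V\<lparr>carrier := Z\<rparr>) B"

definition free_space :: "('k, 'x) ring_scheme \<Rightarrow> 'i set \<Rightarrow> ('k, 'i \<Rightarrow> 'k) module" where
  "free_space K X = \<lparr>
     carrier = {f. (\<forall>i. f i \<in> carrier K) \<and> (\<forall>i. i \<notin> X \<longrightarrow> f i = \<zero>\<^bsub>K\<^esub>) \<and> finite {i. f i \<noteq> \<zero>\<^bsub>K\<^esub>}},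
     monoid.mult = undefined, monoid.one = undefined,
     ring.zero = (\<lambda>i. \<zero>\<^bsub>K\<^esub>),
     add = (\<lambda>f g i. f i \<oplus>\<^bsub>K\<^esub> g i),
     smult = (\<lambda>c f i. c \<otimes>\<^bsub>K\<^esub> f i)\<rparr>"

definition unit_fun :: "('k, 'x) ring_scheme \<Rightarrow> 'i \<Rightarrow> 'i \<Rightarrow> 'k" where
  "unit_fun K x = (\<lambda>y. if y = x then \<one>\<^bsub>K\<^esub> else \<zero>\<^bsub>K\<^esub>)"

text \<open>The vector space with generators \<^term>\<open>X\<close> and relations \<^term>\<open>R\<close>, its generators, and
  the linear map out of it that is given by \<^term>\<open>g\<close> on generators (meaningful if \<^term>\<open>g\<close>
  respects the relations, so that the image below is a singleton).\<close>

definition presented_space ::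
    "('k, 'x) ring_scheme \<Rightarrow> 'i set \<Rightarrow> ('i \<Rightarrow> 'k) set \<Rightarrow> ('k, ('i \<Rightarrow> 'k) set) module" where
  "presented_space K X R =
     quotient_space (free_space K X) (LinearCombinations.module.span K (free_space K X) R)"

definition presented_gen ::
    "('k, 'x) ring_scheme \<Rightarrow> 'i set \<Rightarrow> ('i \<Rightarrow> 'k) set \<Rightarrow> 'i \<Rightarrow> ('i \<Rightarrow> 'k) set" where
  "presented_gen K X R x =
     LinearCombinations.module.span K (free_space K X) R +>\<^bsub>free_space K X\<^esub> unit_fun K x"

definition presented_lift ::
    "('k, 'x) ring_scheme \<Rightarrow> ('k, 'v, 'z) module_scheme \<Rightarrow> ('i \<Rightarrow> 'v) \<Rightarrow> ('i \<Rightarrow> 'k) set \<Rightarrow> 'v" where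
  "presented_lift K V g t =
     the_elem ((\<lambda>f. \<Oplus>\<^bsub>V\<^esub> x\<in>{x. f x \<noteq> \<zero>\<^bsub>K\<^esub>}. f x \<odot>\<^bsub>V\<^esub> g x) ` t)"

definition bilinear_relations :: "('k, 'x) ring_scheme \<Rightarrow> ('k, 'm, 'y) module_scheme
    \<Rightarrow> ('k, 'n, 'z) module_scheme \<Rightarrow> ('m \<times> 'n \<Rightarrow> 'k) set" where
  "bilinear_relations K M N =
     (let F = free_space K (carrier M \<times> carrier N); u = (\<lambda>m n. unit_fun K (m, n)) in
      {u (m \<oplus>\<^bsub>M\<^esub> m') n \<ominus>\<^bsub>F\<^esub> (u m n \<oplus>\<^bsub>F\<^esub> u m' n) | m m' n.
          m \<in> carrier M \<and> m' \<in> carrier M \<and> n \<in> carrier N} \<union>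
      {u m (n \<oplus>\<^bsub>N\<^esub> n') \<ominus>\<^bsub>F\<^esub> (u m n \<oplus>\<^bsub>F\<^esub> u m n') | m n n'.
          m \<in> carrier M \<and> n \<in> carrier N \<and> n' \<in> carrier N} \<union>
      {u (c \<odot>\<^bsub>M\<^esub> m) n \<ominus>\<^bsub>F\<^esub> c \<odot>\<^bsub>F\<^esub> u m n | c m n.
          c \<in> carrier K \<and> m \<in> carrier M \<and> n \<in> carrier N} \<union>
      {u m (c \<odot>\<^bsub>N\<^esub> n) \<ominus>\<^bsub>F\<^esub> c \<odot>\<^bsub>F\<^esub> u m n | c m n.
          c \<in> carrier K \<and> m \<in> carrier M \<and> n \<in> carrier N})"

definition balanced_relations :: "('k, 'x) ring_scheme \<Rightarrow> ('k, 'a, 'y) module_scheme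
    \<Rightarrow> ('k, 'm, 'a) rmod \<Rightarrow> ('k, 'n, 'a) lmod \<Rightarrow> ('m \<times> 'n \<Rightarrow> 'k) set" where
  "balanced_relations K A M N =
     {unit_fun K (ract M m a, n) \<ominus>\<^bsub>free_space K (carrier M \<times> carrier N)\<^esub> unit_fun K (m, lact N a n)
       | m a n. m \<in> carrier M \<and> a \<in> carrier A \<and> n \<in> carrier N}"

definition tensor_relations where
  "tensor_relations K A M N = bilinear_relations K M N \<union> balanced_relations K A M N"

text \<open>\<open>M \<otimes>\<^sub>K N\<close> and \<open>M \<otimes>\<^sub>A N\<close>.\<close>

definition field_tensor where
  "field_tensor K M N = presented_space K (carrier M \<times> carrier N) (bilinear_relations K M N)"

definition tensor where
  "tensor K A M N = presented_space K (carrier M \<times> carrier N) (tensor_relations K A M N)"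

definition opposite_algebra :: "('k, 'a) module \<Rightarrow> ('k, 'a) module" where
  "opposite_algebra A = A\<lparr>monoid.mult := (\<lambda>x y. y \<otimes>\<^bsub>A\<^esub> x)\<rparr>"

definition tensor_algebra :: "('k, 'x) ring_scheme \<Rightarrow> ('k, 'a) module \<Rightarrow> ('k, 'b) module
    \<Rightarrow> ('k, ('a \<times> 'b \<Rightarrow> 'k) set) module" where
  "tensor_algebra K A B =
     (let T = field_tensor K A B;
          u = presented_gen K (carrier A \<times> carrier B) (bilinear_relations K A B)
      in T\<lparr>monoid.mult := (\<lambda>s t. presented_lift K T (\<lambda>(a, b).
                        presented_lift K T (\<lambda>(a', b'). u (a \<otimes>\<^bsub>A\<^esub> a', b \<otimes>\<^bsub>B\<^esub> b')) t) s),
           monoid.one := u (\<one>\<^bsub>A\<^esub>, \<one>\<^bsub>B\<^esub>)\<rparr>)"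

definition enveloping_algebra where
  "enveloping_algebra K A = tensor_algebra K (opposite_algebra A) A"

text \<open>Since \<open>A\<^sup>e = A\<^sup>o\<^sup>p \<otimes> A\<close>, a bimodule is a right \<open>A\<^sup>e\<close>-module by \<open>m (a \<otimes> b) = a m b\<close>
  and a left \<open>A\<^sup>e\<close>-module by \<open>(a \<otimes> b) m = b m a\<close>.\<close>

definition env_rmod :: "('k, 'x) ring_scheme \<Rightarrow> ('k, 'm, 'a) bimod
    \<Rightarrow> ('k, 'm, ('a \<times> 'a \<Rightarrow> 'k) set) rmod" where
  "env_rmod K M = as_rmod M (\<lambda>m. presented_lift K M (\<lambda>(a, b). bract M (lact M a m) b))"

definition env_lmod :: "('k, 'x) ring_scheme \<Rightarrow> ('k, 'm, 'a) bimod
    \<Rightarrow> ('k, 'm, ('a \<times> 'a \<Rightarrow> 'k) set) lmod" where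
  "env_lmod K M = as_lmod M (\<lambda>t m. presented_lift K M (\<lambda>(a, b). lact M b (bract M m a)) t)"

definition regular_bimodule :: "('k, 'a) module \<Rightarrow> ('k, 'a, 'a) bimod" where
  "regular_bimodule A =
     lmod.extend (as_lmod A (monoid.mult A)) (bimod.fields (monoid.mult A))"


section \<open>Projective resolutions and derived functors\<close>

definition free_rmod :: "('k, 'a, 'y) module_scheme \<Rightarrow> 'i set \<Rightarrow> ('k, 'i \<Rightarrow> 'a, 'a) rmod" where
  "free_rmod A I = \<lparr>
     carrier = {f. (\<forall>i. f i \<in> carrier A) \<and> (\<forall>i. i \<notin> I \<longrightarrow> f i = \<zero>\<^bsub>A\<^esub>) \<and> finite {i. f i \<noteq> \<zero>\<^bsub>A\<^esub>}},
     monoid.mult = undefined, monoid.one = undefined,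
     ring.zero = (\<lambda>i. \<zero>\<^bsub>A\<^esub>),
     add = (\<lambda>f g i. f i \<oplus>\<^bsub>A\<^esub> g i),
     smult = (\<lambda>c f i. c \<odot>\<^bsub>A\<^esub> f i),
     ract = (\<lambda>f a i. f i \<otimes>\<^bsub>A\<^esub> a)\<rparr>"

text \<open>Projective means being a direct summand of a free module. Index sets contained in the type of
  elements of \<^term>\<open>P\<close> suffice, since \<^term>\<open>P\<close> is a quotient of the free module on its carrier.\<close>

definition projective_rmod :: "('k, 'x) ring_scheme \<Rightarrow> ('k, 'a, 'y) module_scheme
    \<Rightarrow> ('k, 'p, 'a) rmod \<Rightarrow> bool" where
  "projective_rmod K A P \<longleftrightarrow> right_module K A P \<and>
     (\<exists>I :: 'p set. \<exists>s \<in> right_hom K A P (free_rmod A I). \<exists>r \<in> right_hom K A (free_rmod A I) P.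
        \<forall>x\<in>carrier P. r (s x) = x)"

definition projective_resolution :: "('k, 'x) ring_scheme \<Rightarrow> ('k, 'a, 'y) module_scheme
    \<Rightarrow> ('k, 'm, 'a) rmod \<Rightarrow> (nat \<Rightarrow> ('k, 'p, 'a) rmod) \<Rightarrow> (nat \<Rightarrow> 'p \<Rightarrow> 'p) \<Rightarrow> ('p \<Rightarrow> 'm) \<Rightarrow> bool" where
  "projective_resolution K A M P d \<epsilon> \<longleftrightarrow>
     (\<forall>l. projective_rmod K A (P l)) \<and>
     (\<forall>l. d l \<in> right_hom K A (P (Suc l)) (P l)) \<and>
     \<epsilon> \<in> right_hom K A (P 0) M \<and>
     \<epsilon> ` carrier (P 0) = carrier M \<and>
     d 0 ` carrier (P 1) = {x \<in> carrier (P 0). \<epsilon> x = \<zero>\<^bsub>M\<^esub>} \<and>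
     (\<forall>l. d (Suc l) ` carrier (P (Suc (Suc l))) = {x \<in> carrier (P (Suc l)). d l x = \<zero>\<^bsub>P l\<^esub>})"

text \<open>
  HOL has no quantification over types, so the terms of resolutions of a module with elements
  in \<^typ>\<open>'m\<close> are taken in the type \<^typ>\<open>'m \<times> 'a list \<Rightarrow> 'a\<close>. Its free modules on subsets of
  \<^typ>\<open>'m \<times> 'a list\<close> are large enough to resolve every such module over every algebra with elements
  in \<^typ>\<open>'a\<close>: \<^typ>\<open>'m \<times> 'a list\<close> is infinite and at least as large as \<^typ>\<open>'m\<close> and \<^typ>\<open>'a\<close>,
  so it can index generators of each syzygy. A syzygy of a projective resolution lives in the same
  type, hence resolutions of minimal length are available as well.
\<close>

definition some_resolution :: "('k, 'x) ring_scheme \<Rightarrow> ('k, 'a, 'y) module_scheme \<Rightarrow> ('k, 'm, 'a) rmod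
    \<Rightarrow> (nat \<Rightarrow> ('k, 'm \<times> 'a list \<Rightarrow> 'a, 'a) rmod)
       \<times> (nat \<Rightarrow> ('m \<times> 'a list \<Rightarrow> 'a) \<Rightarrow> ('m \<times> 'a list \<Rightarrow> 'a))" where
  "some_resolution K A M = (SOME (P, d). \<exists>\<epsilon>. projective_resolution K A M P d \<epsilon>)"

definition proj_dim_le :: "('k, 'x) ring_scheme \<Rightarrow> ('k, 'a, 'y) module_scheme
    \<Rightarrow> ('k, 'm, 'a) rmod \<Rightarrow> nat \<Rightarrow> bool" where
  "proj_dim_le K A M b \<longleftrightarrow>
     (\<exists>(P :: nat \<Rightarrow> ('k, 'm \<times> 'a list \<Rightarrow> 'a, 'a) rmod) d \<epsilon>.
        projective_resolution K A M P d \<epsilon> \<and> (\<forall>l>b. carrier (P l) = {\<zero>\<^bsub>P l\<^esub>}))"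

text \<open>The modules range over those with elements in \<^typ>\<open>nat \<Rightarrow> 'k\<close>. Every finite dimensional
  module is isomorphic to one of these; over a finite dimensional algebra, the projective dimensions
  of finite dimensional (even of cyclic) modules already determine the global dimension.\<close>

definition finite_global_dimension ::
    "('k, 'x) ring_scheme \<Rightarrow> ('k, 'a, 'y) module_scheme \<Rightarrow> bool" where
  "finite_global_dimension K A \<longleftrightarrow>
     (\<exists>b. \<forall>M :: ('k, nat \<Rightarrow> 'k, 'a) rmod. right_module K A M \<longrightarrow> proj_dim_le K A M b)"

definition Ext :: "('k, 'x) ring_scheme \<Rightarrow> ('k, 'a, 'y) module_scheme \<Rightarrow> ('k, 'm, 'a) rmod
    \<Rightarrow> ('k, 'n, 'a) rmod \<Rightarrow> nat \<Rightarrow> ('k, (('m \<times> 'a list \<Rightarrow> 'a) \<Rightarrow> 'n) set) module" where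
  "Ext K A M N l =
     (let (P, d) = some_resolution K A M;
          C = (\<lambda>i. hom_space K A (P i) N);
          \<delta> = (\<lambda>i f. compose (carrier (P (Suc i))) f (d i))
      in subquotient (C l)
           {f \<in> carrier (C l). \<delta> l f = \<zero>\<^bsub>C (Suc l)\<^esub>}
           (case l of 0 \<Rightarrow> {\<zero>\<^bsub>C 0\<^esub>} | Suc i \<Rightarrow> \<delta> i ` carrier (C i)))"

definition Tor :: "('k, 'x) ring_scheme \<Rightarrow> ('k, 'a, 'y) module_scheme \<Rightarrow> ('k, 'm, 'a) rmod
    \<Rightarrow> ('k, 'n, 'a) lmod \<Rightarrow> nat \<Rightarrow> ('k, (('m \<times> 'a list \<Rightarrow> 'a) \<times> 'n \<Rightarrow> 'k) set set) module" where
  "Tor K A M N l =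
     (let (P, d) = some_resolution K A M;
          T = (\<lambda>i. tensor K A (P i) N);
          u = (\<lambda>i. presented_gen K (carrier (P i) \<times> carrier N) (tensor_relations K A (P i) N));
          bd = (\<lambda>i. presented_lift K (T i) (\<lambda>(p, n). u i (d i p, n)))
      in subquotient (T l)
           (case l of 0 \<Rightarrow> carrier (T 0) | Suc i \<Rightarrow> {t \<in> carrier (T (Suc i)). bd i t = \<zero>\<^bsub>T i\<^esub>})
           (bd l ` carrier (T (Suc l))))"

definition hochschild_cohomology where
  "hochschild_cohomology K A M l =
     Ext K (enveloping_algebra K A) (env_rmod K (regular_bimodule A)) (env_rmod K M) l"

definition hochschild_homology where
  "hochschild_homology K A M l =
     Tor K (enveloping_algebra K A) (env_rmod K (regular_bimodule A)) (env_lmod K M) l"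

text \<open>The alternating sum of dimensions is a well-defined integer: all terms of \<^term>\<open>H\<close> are finite
  dimensional, and, \<^typ>\<open>int\<close> being discrete, convergence means that almost all of them vanish.\<close>

definition has_euler_characteristic ::
    "('k, 'x) ring_scheme \<Rightarrow> (nat \<Rightarrow> ('k, 'v) module) \<Rightarrow> int \<Rightarrow> bool" where
  "has_euler_characteristic K H \<chi> \<longleftrightarrow>
     (\<forall>l. vectorspace.fin_dim K (H l)) \<and>
     (\<lambda>l. (-1) ^ l * int (vectorspace.dim K (H l))) sums \<chi>"


section \<open>Cartan matrix, dimension vectors and Ringel forms\<close>

definition principal_rmod :: "('k, 'a) module \<Rightarrow> 'a \<Rightarrow> ('k, 'a, 'a) rmod" where
  "principal_rmod A e = as_rmod (A\<lparr>carrier := (\<lambda>a. e \<otimes>\<^bsub>A\<^esub> a) ` carrier A\<rparr>) (monoid.mult A)"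

definition cartan_matrix ::
    "('k, 'x) ring_scheme \<Rightarrow> ('k, 'a) module \<Rightarrow> nat \<Rightarrow> (nat \<Rightarrow> 'a) \<Rightarrow> int mat" where
  "cartan_matrix K A n e = mat n n (\<lambda>(i, j).
     int (vectorspace.dim K (hom_space K A (principal_rmod A (e i)) (principal_rmod A (e j)))))"

definition dim_vec_right ::
    "('k, 'x) ring_scheme \<Rightarrow> nat \<Rightarrow> (nat \<Rightarrow> 'a) \<Rightarrow> ('k, 'm, 'a) rmod \<Rightarrow> int vec" where
  "dim_vec_right K n e M = vec n (\<lambda>i.
     int (vectorspace.dim K (M\<lparr>carrier := (\<lambda>m. ract M m (e i)) ` carrier M\<rparr>)))"

text \<open>Type \<^typ>\<open>int vec\<close> does not distinguish rows from columns, so this is the transpose of the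
  row vector of a left module.\<close>

definition dim_vec_left ::
    "('k, 'x) ring_scheme \<Rightarrow> nat \<Rightarrow> (nat \<Rightarrow> 'a) \<Rightarrow> ('k, 'm, 'a) lmod \<Rightarrow> int vec" where
  "dim_vec_left K n e N = vec n (\<lambda>i.
     int (vectorspace.dim K (N\<lparr>carrier := (\<lambda>m. lact N (e i) m) ` carrier N\<rparr>)))"

text \<open>The \<open>(i, j)\<close> entry is the dimension of \<open>e\<^sub>j M e\<^sub>i\<close>.\<close>

definition dim_matrix ::
    "('k, 'x) ring_scheme \<Rightarrow> nat \<Rightarrow> (nat \<Rightarrow> 'a) \<Rightarrow> ('k, 'm, 'a) bimod \<Rightarrow> int mat" where
  "dim_matrix K n e M = mat n n (\<lambda>(i, j).
     int (vectorspace.dim K (M\<lparr>carrier := (\<lambda>m. bract M (lact M (e j) m) (e i)) ` carrier M\<rparr>)))"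

definition inverse_matrix :: "int mat \<Rightarrow> int mat" where
  "inverse_matrix C = (THE D. inverts_mat C D \<and> inverts_mat D C)"

definition matrix_trace :: "int mat \<Rightarrow> int" where
  "matrix_trace C = (\<Sum>i<dim_row C. C $$ (i, i))"

text \<open>\<open>x\<^sup>T C\<^sup>-\<^sup>T y\<close>, and its counterpart \<open>x\<^sup>T C\<^sup>-\<^sup>1 y\<close> for the opposite algebra, whose
  Cartan matrix is the transpose of \<open>C\<close>.\<close>

definition ringel_form :: "int mat \<Rightarrow> int vec \<Rightarrow> int vec \<Rightarrow> int" where
  "ringel_form C x y = x \<bullet> (transpose_mat (inverse_matrix C) *\<^sub>v y)"

definition ringel_form_op :: "int mat \<Rightarrow> int vec \<Rightarrow> int vec \<Rightarrow> int" where
  "ringel_form_op C x y = x \<bullet> (inverse_matrix C *\<^sub>v y)"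

end

(*
Suppose that the simple right modules of a finite dimensional algebra A are one-dimensional, given by
characters chi_s dual to idempotents e_s, and let Q be a finite resolution of M by finite dimensional
projectives. Put x_s = sum_l (-1)^l dim Hom(Q_l, S_s). Since dim Hom(Q_l, N) is additive along a
composition series of N, chi(Ext(M, N)) = sum_s x_s dim N e_s, and dually chi(Tor(M, N)) =
sum_s x_s dim e_s N. For N = A e_t the second formula reads dim M e_t = sum_s x_s dim e_s A e_t, that
is, dim M = C x. Taking M simple shows that C is invertible, hence x = C^-1 dim M, and (1) and (2)
follow.

The enveloping algebra is of the same kind, with idempotents e_p (x) e_q and characters
chi_p (x) chi_q; for it and M = A the equation becomes C X C = C, so that X = C^-1, which gives (3)
and (4). What remains is a finite resolution of A over A^e. Reducing a free resolution F of A over A^e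
along chi_p in the first factor gives a free resolution of the simple A-module S_p, because F is
contractible as a complex of left modules. This resolution splits beyond the global dimension of A, so
every map from a high syzygy of F to a simple A^e-module extends to F. By induction on the length the
same holds for maps to any finite dimensional module, in particular for the identity of the syzygy,
which is therefore a direct summand of F and projective.
*)

theory Submission
 imports Defs "Jordan_Normal_Form.Determinant"
begin

text \<open>Krull-Schmidt and minimal resolutions are avoided. dim Hom(Q, S_s) is the multiplicity
  of e_s A in a projective Q, but Q is never decomposed, only tested against modules: Hom(Q, D(A
  e_t)) is the dual of Q e_t, where D is the k-dual. The same duality, Hom(Q, D N) = D(Q \<otimes>
  N), carries Tor back to Hom, so one induction along composition series serves all four statements.
  \<open>Ext\<close> and \<open>Tor\<close> use a resolution picked by choice, of which nothing more
  is known; each Euler characteristic is therefore transported to a finite resolution along a chain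
  homotopy equivalence. The obstacle is the enveloping algebra: finite global dimension is assumed
  for A alone, and only for modules in one fixed type. Even that the simple A^e-modules are
  one-dimensional needs an argument; it comes from the two commuting actions on a space of linear
  forms (\<open>env_proper\<close>). The characters of A itself are the coordinates of A/rad = k^m,
  and a Fitting argument matches them with the given idempotents.\<close>

hide_const (open) Polynomial.smult

section \<open>Finite dimensional linear algebra\<close>

lemmas module_hom_defs = LinearCombinations.module_hom_def

abbreviation lin where "lin K V W \<equiv> LinearCombinations.module_hom K V W"

abbreviation sspace where "sspace K W V \<equiv> VectorSpace.subspace K W V"

abbreviation in_carrier (infix "<:" 50) where "x <: V \<equiv> x \<in> carrier V"

abbreviation on_carrier ("_\<langle>_\<rangle>" [900, 0] 900) where "V\<langle>W\<rangle> \<equiv> V\<lparr>carrier := W\<rparr>"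

locale base_field =
 fixes K :: "('k, 'x) ring_scheme" (structure)
 assumes field_K: "field K"

sublocale base_field \<subseteq> field K
 by (rule field_K)

context base_field
begin

abbreviation findim where "findim \<equiv> vectorspace.fin_dim K"

abbreviation vdim where "vdim \<equiv> vectorspace.dim K"

text \<open>Stated with \<open>vectorspace K V\<close> as a premise rather than inside a locale,
  because records are cut down, restricted and rebuilt all the time. Negatives are normalised to
  multiples by \<open>\<ominus> \<one>\<close>; a linear map then respects differences through its
  rules for sums and multiples alone.\<close>

lemma vs_add_zero [simp]:
 assumes "vectorspace K V"
 shows vs_zero: "\<zero>\<^bsub>V\<^esub> <: V"
  and vs_add: "\<And>x y. x <: V ==> y <: V ==> x \<oplus>\<^bsub>V\<^esub> y <: V"
  and vs_smult: "\<And>c x. c <: K ==> x <: V ==> c \<odot>\<^bsub>V\<^esub> x <: V"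
  and vs_l_zero: "\<And>x. x <: V ==> \<zero>\<^bsub>V\<^esub> \<oplus>\<^bsub>V\<^esub> x = x"
  and vs_r_zero: "\<And>x. x <: V ==> x \<oplus>\<^bsub>V\<^esub> \<zero>\<^bsub>V\<^esub> = x"
  and vs_smult_one: "\<And>x. x <: V ==> \<one> \<odot>\<^bsub>V\<^esub> x = x"
  and vs_smult_zero: "\<And>x. x <: V ==> \<zero> \<odot>\<^bsub>V\<^esub> x = \<zero>\<^bsub>V\<^esub>"
  and vs_smult_r_zero: "\<And>c. c <: K ==> c \<odot>\<^bsub>V\<^esub> \<zero>\<^bsub>V\<^esub> = \<zero>\<^bsub>V\<^esub>"
  and vs_neg: "\<And>x. x <: V ==> x \<oplus>\<^bsub>V\<^esub> (\<ominus> \<one>) \<odot>\<^bsub>V\<^esub> x = \<zero>\<^bsub>V\<^esub>"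
  and vs_neg': "\<And>x. x <: V ==> (\<ominus> \<one>) \<odot>\<^bsub>V\<^esub> x \<oplus>\<^bsub>V\<^esub> x = \<zero>\<^bsub>V\<^esub>"
  and vs_a_inv: "\<And>x. x <: V ==> \<ominus>\<^bsub>V\<^esub> x = (\<ominus> \<one>) \<odot>\<^bsub>V\<^esub> x"
  and vs_minus: "\<And>x y. x <: V ==> y <: V ==> x \<ominus>\<^bsub>V\<^esub> y = x \<oplus>\<^bsub>V\<^esub> (\<ominus> \<one>) \<odot>\<^bsub>V\<^esub> y"
proof -
 interpret V: vectorspace K V by fact
 show "\<zero>\<^bsub>V\<^esub> <: V" by simp
 show add: "x \<oplus>\<^bsub>V\<^esub> y <: V" if "x <: V" "y <: V" for x y using that by simp
 show "c \<odot>\<^bsub>V\<^esub> x <: V" if "c <: K" "x <: V" for c x using that by simp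
 show "\<zero>\<^bsub>V\<^esub> \<oplus>\<^bsub>V\<^esub> x = x" if "x <: V" for x using that by simp
 show "x \<oplus>\<^bsub>V\<^esub> \<zero>\<^bsub>V\<^esub> = x" if "x <: V" for x using that by simp
 show "\<one> \<odot>\<^bsub>V\<^esub> x = x" if "x <: V" for x using that by simp
 show "\<zero> \<odot>\<^bsub>V\<^esub> x = \<zero>\<^bsub>V\<^esub>" if "x <: V" for x using that by simp
 show "c \<odot>\<^bsub>V\<^esub> \<zero>\<^bsub>V\<^esub> = \<zero>\<^bsub>V\<^esub>" if "c <: K" for c using that by simp
 have n: "(\<ominus> \<one>) \<odot>\<^bsub>V\<^esub> x = \<ominus>\<^bsub>V\<^esub> x" if "x <: V" for x
  using that by (simp add: V.smult_l_minus)
 show "x \<oplus>\<^bsub>V\<^esub> (\<ominus> \<one>) \<odot>\<^bsub>V\<^esub> x = \<zero>\<^bsub>V\<^esub>" if "x <: V" for x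
  using that by (simp add: n V.M.r_neg)
 show "(\<ominus> \<one>) \<odot>\<^bsub>V\<^esub> x \<oplus>\<^bsub>V\<^esub> x = \<zero>\<^bsub>V\<^esub>" if "x <: V" for x
  using that by (simp add: n V.M.l_neg)
 show "\<ominus>\<^bsub>V\<^esub> x = (\<ominus> \<one>) \<odot>\<^bsub>V\<^esub> x" if "x <: V" for x
  using that by (simp add: n)
 show "x \<ominus>\<^bsub>V\<^esub> y = x \<oplus>\<^bsub>V\<^esub> (\<ominus> \<one>) \<odot>\<^bsub>V\<^esub> y" if "x <: V" "y <: V" for x y
  using that by (simp add: n a_minus_def)
qed

lemma
 assumes "vectorspace K V"
 shows vs_comm: "\<And>x y. x <: V ==> y <: V ==> x \<oplus>\<^bsub>V\<^esub> y = y \<oplus>\<^bsub>V\<^esub> x"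
  and vs_assoc: "\<And>x y z. x <: V ==> y <: V ==> z <: V
   ==> (x \<oplus>\<^bsub>V\<^esub> y) \<oplus>\<^bsub>V\<^esub> z = x \<oplus>\<^bsub>V\<^esub> (y \<oplus>\<^bsub>V\<^esub> z)"
  and vs_lcomm: "\<And>x y z. x <: V ==> y <: V ==> z <: V
   ==> x \<oplus>\<^bsub>V\<^esub> (y \<oplus>\<^bsub>V\<^esub> z) = y \<oplus>\<^bsub>V\<^esub> (x \<oplus>\<^bsub>V\<^esub> z)"
  and vs_smult_add: "\<And>c x y. c <: K ==> x <: V ==> y <: V
   ==> c \<odot>\<^bsub>V\<^esub> (x \<oplus>\<^bsub>V\<^esub> y) = c \<odot>\<^bsub>V\<^esub> x \<oplus>\<^bsub>V\<^esub> c \<odot>\<^bsub>V\<^esub> y"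
  and vs_add_smult: "\<And>c d x. c <: K ==> d <: K ==> x <: V
   ==> (c \<oplus> d) \<odot>\<^bsub>V\<^esub> x = c \<odot>\<^bsub>V\<^esub> x \<oplus>\<^bsub>V\<^esub> d \<odot>\<^bsub>V\<^esub> x"
  and vs_smult_smult: "\<And>c d x. c <: K ==> d <: K ==> x <: V
   ==> c \<odot>\<^bsub>V\<^esub> (d \<odot>\<^bsub>V\<^esub> x) = (c \<otimes> d) \<odot>\<^bsub>V\<^esub> x"
  and vs_cancel: "\<And>x y z. x <: V ==> y <: V ==> z <: V
   ==> x \<oplus>\<^bsub>V\<^esub> y = x \<oplus>\<^bsub>V\<^esub> z \<longleftrightarrow> y = z"
  and vs_neg_add: "\<And>x y. x <: V ==> y <: V
   ==> x \<oplus>\<^bsub>V\<^esub> ((\<ominus> \<one>) \<odot>\<^bsub>V\<^esub> x \<oplus>\<^bsub>V\<^esub> y) = y"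
proof -
 interpret V: vectorspace K V by fact
 show "x \<oplus>\<^bsub>V\<^esub> y = y \<oplus>\<^bsub>V\<^esub> x" if "x <: V" "y <: V" for x y
  using that by (rule V.M.a_comm)
 show a: "(x \<oplus>\<^bsub>V\<^esub> y) \<oplus>\<^bsub>V\<^esub> z = x \<oplus>\<^bsub>V\<^esub> (y \<oplus>\<^bsub>V\<^esub> z)"
  if "x <: V" "y <: V" "z <: V" for x y z
  using that by (rule V.M.a_assoc)
 show "x \<oplus>\<^bsub>V\<^esub> (y \<oplus>\<^bsub>V\<^esub> z) = y \<oplus>\<^bsub>V\<^esub> (x \<oplus>\<^bsub>V\<^esub> z)"
  if "x <: V" "y <: V" "z <: V" for x y z
  using that by (rule V.M.a_lcomm)
 show "c \<odot>\<^bsub>V\<^esub> (x \<oplus>\<^bsub>V\<^esub> y) = c \<odot>\<^bsub>V\<^esub> x \<oplus>\<^bsub>V\<^esub> c \<odot>\<^bsub>V\<^esub> y"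
  if "c <: K" "x <: V" "y <: V" for c x y
  using that by (rule V.smult_r_distr)
 show "(c \<oplus> d) \<odot>\<^bsub>V\<^esub> x = c \<odot>\<^bsub>V\<^esub> x \<oplus>\<^bsub>V\<^esub> d \<odot>\<^bsub>V\<^esub> x"
  if "c <: K" "d <: K" "x <: V" for c d x
  using that by (rule V.smult_l_distr)
 show "c \<odot>\<^bsub>V\<^esub> (d \<odot>\<^bsub>V\<^esub> x) = (c \<otimes> d) \<odot>\<^bsub>V\<^esub> x"
  if "c <: K" "d <: K" "x <: V" for c d x
  using that V.smult_assoc1 by simp
 show "x \<oplus>\<^bsub>V\<^esub> y = x \<oplus>\<^bsub>V\<^esub> z \<longleftrightarrow> y = z"
  if "x <: V" "y <: V" "z <: V" for x y z
  using that by simp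
 show "x \<oplus>\<^bsub>V\<^esub> ((\<ominus> \<one>) \<odot>\<^bsub>V\<^esub> x \<oplus>\<^bsub>V\<^esub> y) = y" if "x <: V" "y <: V" for x y
  using that by (simp add: assms a[symmetric])
qed

lemmas vs_ac = vs_assoc vs_comm vs_lcomm

lemma vs_sub_eq_zero:
 assumes "vectorspace K V" "x <: V" "y <: V"
 shows "x \<oplus>\<^bsub>V\<^esub> (\<ominus> \<one>) \<odot>\<^bsub>V\<^esub> y = \<zero>\<^bsub>V\<^esub> \<longleftrightarrow> x = y"
 using assms by (metis one_closed a_inv_closed vs_cancel vs_comm vs_neg vs_smult)

lemma vs_addI:
 assumes "vectorspace K V"
 shows "abelian_group V" "Module.module K V"
proof -
 interpret V: vectorspace K V by fact
 show "abelian_group V" "Module.module K V" by unfold_locales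
qed

lemma vsI:
 assumes "\<zero>\<^bsub>V\<^esub> <: V"
  and "\<And>v w. v <: V ==> w <: V ==> v \<oplus>\<^bsub>V\<^esub> w <: V"
  and "\<And>c v. c <: K ==> v <: V ==> c \<odot>\<^bsub>V\<^esub> v <: V"
  and "\<And>v w. v <: V ==> w <: V ==> v \<oplus>\<^bsub>V\<^esub> w = w \<oplus>\<^bsub>V\<^esub> v"
  and "\<And>v w x. v <: V ==> w <: V ==> x <: V
    ==> (v \<oplus>\<^bsub>V\<^esub> w) \<oplus>\<^bsub>V\<^esub> x = v \<oplus>\<^bsub>V\<^esub> (w \<oplus>\<^bsub>V\<^esub> x)"
  and "\<And>v. v <: V ==> v \<oplus>\<^bsub>V\<^esub> \<zero>\<^bsub>V\<^esub> = v"
  and "\<And>v. v <: V ==> v \<oplus>\<^bsub>V\<^esub> (\<ominus> \<one>) \<odot>\<^bsub>V\<^esub> v = \<zero>\<^bsub>V\<^esub>"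
  and "\<And>a b v. a <: K ==> b <: K ==> v <: V ==> (a \<otimes> b) \<odot>\<^bsub>V\<^esub> v = a \<odot>\<^bsub>V\<^esub> (b \<odot>\<^bsub>V\<^esub> v)"
  and "\<And>v. v <: V ==> \<one> \<odot>\<^bsub>V\<^esub> v = v"
  and "\<And>a b v. a <: K ==> b <: K ==> v <: V
    ==> (a \<oplus> b) \<odot>\<^bsub>V\<^esub> v = a \<odot>\<^bsub>V\<^esub> v \<oplus>\<^bsub>V\<^esub> b \<odot>\<^bsub>V\<^esub> v"
  and "\<And>a v w. a <: K ==> v <: V ==> w <: V
    ==> a \<odot>\<^bsub>V\<^esub> (v \<oplus>\<^bsub>V\<^esub> w) = a \<odot>\<^bsub>V\<^esub> v \<oplus>\<^bsub>V\<^esub> a \<odot>\<^bsub>V\<^esub> w"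
 shows "vectorspace K V"
proof (rule vs_criteria[OF field_K])
 show "\<forall>v\<in>carrier V. \<exists>neg_v\<in>carrier V. v \<oplus>\<^bsub>V\<^esub> neg_v = \<zero>\<^bsub>V\<^esub>"
  using assms(3,7) by (metis a_inv_closed one_closed)
qed ((intro allI ballI impI)?; (elim conjE)?; rule assms; assumption)+

lemmas vs_finsum_cong = abelian_monoid.finsum_cong'[OF abelian_group.axioms(1)[OF vs_addI(1)]]

text \<open>Most vector space axioms below are verified by embedding the operations at hand into a space
 that is already known.\<close>

lemma vs_embed:
 assumes V: "vectorspace K V"
  and f: "\<And>x. x <: U ==> f x <: V" and inj: "inj_on f (carrier U)"
  and z: "\<zero>\<^bsub>U\<^esub> <: U"
  and a: "\<And>v w. v <: U ==> w <: U ==> v \<oplus>\<^bsub>U\<^esub> w <: U"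
  and s: "\<And>c v. c <: K ==> v <: U ==> c \<odot>\<^bsub>U\<^esub> v <: U"
  and fz: "f \<zero>\<^bsub>U\<^esub> = \<zero>\<^bsub>V\<^esub>"
  and fa: "\<And>v w. v <: U ==> w <: U ==> f (v \<oplus>\<^bsub>U\<^esub> w) = f v \<oplus>\<^bsub>V\<^esub> f w"
  and fs: "\<And>c v. c <: K ==> v <: U ==> f (c \<odot>\<^bsub>U\<^esub> v) = c \<odot>\<^bsub>V\<^esub> f v"
 shows "vectorspace K U"
proof (rule vsI)
 note [simp] = V f z a s fz fa fs
 have eq: "x = y" if "f x = f y" "x <: U" "y <: U" for x y
  using inj that by (auto dest: inj_onD)
 show "v \<oplus>\<^bsub>U\<^esub> w = w \<oplus>\<^bsub>U\<^esub> v" if "v <: U" "w <: U" for v w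
  using that by (intro eq) (simp_all add: vs_comm)
 show "v \<oplus>\<^bsub>U\<^esub> w \<oplus>\<^bsub>U\<^esub> x = v \<oplus>\<^bsub>U\<^esub> (w \<oplus>\<^bsub>U\<^esub> x)" if "v <: U" "w <: U" "x <: U" for v w x
  using that by (intro eq) (simp_all add: vs_assoc)
 show "v \<oplus>\<^bsub>U\<^esub> \<zero>\<^bsub>U\<^esub> = v" if "v <: U" for v using that by (intro eq) simp_all
 show "v \<oplus>\<^bsub>U\<^esub> (\<ominus> \<one>) \<odot>\<^bsub>U\<^esub> v = \<zero>\<^bsub>U\<^esub>" if "v <: U" for v using that by (intro eq) simp_all
 show "(c \<otimes> d) \<odot>\<^bsub>U\<^esub> v = c \<odot>\<^bsub>U\<^esub> (d \<odot>\<^bsub>U\<^esub> v)" if "c <: K" "d <: K" "v <: U" for c d v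
  using that by (intro eq) (simp_all add: vs_smult_smult)
 show "\<one> \<odot>\<^bsub>U\<^esub> v = v" if "v <: U" for v using that by (intro eq) simp_all
 show "(c \<oplus> d) \<odot>\<^bsub>U\<^esub> v = c \<odot>\<^bsub>U\<^esub> v \<oplus>\<^bsub>U\<^esub> d \<odot>\<^bsub>U\<^esub> v"
  if "c <: K" "d <: K" "v <: U" for c d v
  using that by (intro eq) (simp_all add: vs_add_smult)
 show "c \<odot>\<^bsub>U\<^esub> (v \<oplus>\<^bsub>U\<^esub> w) = c \<odot>\<^bsub>U\<^esub> v \<oplus>\<^bsub>U\<^esub> c \<odot>\<^bsub>U\<^esub> w"
  if "c <: K" "v <: U" "w <: U" for c v w
  using that by (intro eq) (simp_all add: vs_smult_add)
qed (use z a s in auto)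

lemma vs_cong:
 assumes "vectorspace K V" "carrier U = carrier V" "\<zero>\<^bsub>U\<^esub> = \<zero>\<^bsub>V\<^esub>" "add U = add V" "smult U = smult V"
 shows "vectorspace K U"
 by (rule vs_embed[where f="\<lambda>x. x", OF assms(1)]) (simp_all add: assms)

subsection \<open>Subspaces\<close>

lemma subI:
 assumes "vectorspace K V" "W \<subseteq> carrier V" "\<zero>\<^bsub>V\<^esub> \<in> W"
  "\<And>x y. x \<in> W ==> y \<in> W ==> x \<oplus>\<^bsub>V\<^esub> y \<in> W"
  "\<And>c x. c <: K ==> x \<in> W ==> c \<odot>\<^bsub>V\<^esub> x \<in> W"
 shows "sspace K W V"
 using assms vs_addI by (simp add: VectorSpace.subspace_def submodule_def)

lemma subD:
 assumes "sspace K W V"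
 shows "vectorspace K V" "W \<subseteq> carrier V" "\<zero>\<^bsub>V\<^esub> \<in> W"
  "\<And>x y. x \<in> W ==> y \<in> W ==> x \<oplus>\<^bsub>V\<^esub> y \<in> W"
  "\<And>c x. c <: K ==> x \<in> W ==> c \<odot>\<^bsub>V\<^esub> x \<in> W"
  "\<And>x. x \<in> W ==> x <: V"
 using assms by (auto simp: VectorSpace.subspace_def submodule_def)

lemma sub_vs:
 assumes "sspace K W V"
 shows "vectorspace K (V\<langle>W\<rangle>)"
 using assms vectorspace.subspace_is_vs subD(1) by blast

lemma sub_self: "vectorspace K V ==> sspace K (carrier V) V"
 by (rule subI) auto

lemma sub_zero: "vectorspace K V ==> sspace K {\<zero>\<^bsub>V\<^esub>} V"
 by (rule subI) auto

lemma sub_trans: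
 assumes "sspace K W V" "sspace K U V" "U \<subseteq> W"
 shows "sspace K U (V\<langle>W\<rangle>)"
 using sub_vs[OF assms(1)] assms(3) subD[OF assms(2)] by (intro subI) auto

subsection \<open>Linear maps\<close>

lemma linI:
 assumes "\<And>x. x <: V ==> f x <: W"
  "\<And>x y. x <: V ==> y <: V ==> f (x \<oplus>\<^bsub>V\<^esub> y) = f x \<oplus>\<^bsub>W\<^esub> f y"
  "\<And>c x. c <: K ==> x <: V ==> f (c \<odot>\<^bsub>V\<^esub> x) = c \<odot>\<^bsub>W\<^esub> f x"
 shows "f \<in> lin K V W"
 using assms by (auto simp: module_hom_defs)

lemma linD:
 assumes "f \<in> lin K V W"
 shows "\<And>x. x <: V ==> f x <: W"
  "\<And>x y. x <: V ==> y <: V ==> f (x \<oplus>\<^bsub>V\<^esub> y) = f x \<oplus>\<^bsub>W\<^esub> f y"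
  "\<And>c x. c <: K ==> x <: V ==> f (c \<odot>\<^bsub>V\<^esub> x) = c \<odot>\<^bsub>W\<^esub> f x"
 using assms by (auto simp: module_hom_defs)

lemma lin_zero:
 assumes "vectorspace K V" "vectorspace K W" "f \<in> lin K V W"
 shows "f \<zero>\<^bsub>V\<^esub> = \<zero>\<^bsub>W\<^esub>"
proof -
 have "f (\<zero> \<odot>\<^bsub>V\<^esub> \<zero>\<^bsub>V\<^esub>) = \<zero> \<odot>\<^bsub>W\<^esub> f \<zero>\<^bsub>V\<^esub>"
  using assms by (intro linD(3)[OF assms(3)]) auto
 then show ?thesis using assms linD(1)[OF assms(3)] by simp
qed

lemma lin_comp:
 assumes "f \<in> lin K U V" "g \<in> lin K V W"
 shows "(\<lambda>x. g (f x)) \<in> lin K U W"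
 using assms by (auto simp: module_hom_defs Pi_def)

lemma lin_linear_map:
 assumes "vectorspace K V" "vectorspace K W" "f \<in> lin K V W"
 shows "linear_map K V W f"
 using assms(3) vs_addI(2)[OF assms(1)] vs_addI(2)[OF assms(2)] assms(1,2)
 by (simp add: linear_map_def mod_hom_def mod_hom_axioms_def)

lemma lin_im_sub:
 assumes V: "vectorspace K V" and W: "vectorspace K W" and f: "f \<in> lin K V W" and U: "sspace K U V"
 shows "sspace K (f ` U) W"
proof (rule subI[OF W])
 note u = subD[OF U]
 show "f ` U \<subseteq> carrier W" using u(6) linD(1)[OF f] by blast
 show "\<zero>\<^bsub>W\<^esub> \<in> f ` U" using lin_zero[OF V W f] u(3) by (metis image_eqI)
 show "x \<oplus>\<^bsub>W\<^esub> y \<in> f ` U" if "x \<in> f ` U" "y \<in> f ` U" for x y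
  using that u linD(2)[OF f] by (smt (verit) image_iff)
 show "c \<odot>\<^bsub>W\<^esub> x \<in> f ` U" if "c <: K" "x \<in> f ` U" for c x
  using that u linD(3)[OF f] by (smt (verit) image_iff)
qed

lemma lin_ker_sub:
 assumes V: "vectorspace K V" and W: "vectorspace K W" and f: "f \<in> lin K V W"
 shows "sspace K {x \<in> carrier V. f x = \<zero>\<^bsub>W\<^esub>} V"
 using linD[OF f] V W lin_zero[OF V W f] by (intro subI) auto

lemma lin_inj:
 assumes V: "vectorspace K V" and W: "vectorspace K W" and f: "f \<in> lin K V W"
  and z: "\<And>x. x <: V ==> f x = \<zero>\<^bsub>W\<^esub> ==> x = \<zero>\<^bsub>V\<^esub>"
 shows "inj_on f (carrier V)"
proof (rule inj_onI)
 fix x y assume x: "x <: V" and y: "y <: V" and e: "f x = f y"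
 have "f (x \<oplus>\<^bsub>V\<^esub> (\<ominus> \<one>) \<odot>\<^bsub>V\<^esub> y) = \<zero>\<^bsub>W\<^esub>"
  using x y e V W linD[OF f] by simp
 then have "x \<oplus>\<^bsub>V\<^esub> (\<ominus> \<one>) \<odot>\<^bsub>V\<^esub> y = \<zero>\<^bsub>V\<^esub>"
  using z V x y by simp
 then show "x = y" using vs_sub_eq_zero[OF V x y] by blast
qed

lemma lin_finsum:
 assumes V: "vectorspace K V" and W: "vectorspace K W" and f: "f \<in> lin K V W"
  and g: "g \<in> I \<rightarrow> carrier V"
 shows "f (\<Oplus>\<^bsub>V\<^esub> i\<in>I. g i) = (\<Oplus>\<^bsub>W\<^esub> i\<in>I. f (g i))"
proof -
 interpret V: abelian_group V using vs_addI(1)[OF V] .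
 interpret W: abelian_group W using vs_addI(1)[OF W] .
 show ?thesis
  using g
 proof (induction I rule: infinite_finite_induct)
  case (infinite A)
  then show ?case using lin_zero[OF V W f] by simp
 next
  case empty
  then show ?case using lin_zero[OF V W f] by simp
 next
  case (insert x F)
  then have "(\<Oplus>\<^bsub>V\<^esub> i\<in>F. g i) <: V" "(\<lambda>i. f (g i)) \<in> F \<rightarrow> carrier W" "f (g x) <: W"
   using linD(1)[OF f] by (auto intro: V.finsum_closed)
  with insert show ?case using linD(2)[OF f] by (simp add: Pi_def)
 qed
qed

lemma lin_sum:
 assumes W: "vectorspace K W" and "\<And>i. i \<in> I ==> f i \<in> lin K V W"
 shows "(\<lambda>x. \<Oplus>\<^bsub>W\<^esub> i\<in>I. f i x) \<in> lin K V W"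
proof -
 interpret W: vectorspace K W by (rule W)
 have m: "(\<lambda>i. f i x) \<in> I \<rightarrow> carrier W" if "x <: V" for x
  using linD(1)[OF assms(2)] that by auto
 show ?thesis
 proof (rule linI)
  show "(\<Oplus>\<^bsub>W\<^esub> i\<in>I. f i x) <: W" if "x <: V" for x
   using m[OF that] by (rule W.M.finsum_closed)
  show "(\<Oplus>\<^bsub>W\<^esub> i\<in>I. f i (x \<oplus>\<^bsub>V\<^esub> y)) = (\<Oplus>\<^bsub>W\<^esub> i\<in>I. f i x) \<oplus>\<^bsub>W\<^esub> (\<Oplus>\<^bsub>W\<^esub> i\<in>I. f i y)"
   if "x <: V" "y <: V" for x y
  proof -
   have "(\<Oplus>\<^bsub>W\<^esub> i\<in>I. f i (x \<oplus>\<^bsub>V\<^esub> y)) = (\<Oplus>\<^bsub>W\<^esub> i\<in>I. f i x \<oplus>\<^bsub>W\<^esub> f i y)"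
    using that m linD(2)[OF assms(2)] by (intro W.M.finsum_cong') auto
   then show ?thesis using W.M.finsum_addf[OF m m] that by simp
  qed
  show "(\<Oplus>\<^bsub>W\<^esub> i\<in>I. f i (c \<odot>\<^bsub>V\<^esub> x)) = c \<odot>\<^bsub>W\<^esub> (\<Oplus>\<^bsub>W\<^esub> i\<in>I. f i x)"
   if "c <: K" "x <: V" for c x
  proof -
   have "(\<Oplus>\<^bsub>W\<^esub> i\<in>I. f i (c \<odot>\<^bsub>V\<^esub> x)) = (\<Oplus>\<^bsub>W\<^esub> i\<in>I. c \<odot>\<^bsub>W\<^esub> f i x)"
    using that m linD(3)[OF assms(2)] by (intro W.M.finsum_cong') auto
   also have "\<dots> = c \<odot>\<^bsub>W\<^esub> (\<Oplus>\<^bsub>W\<^esub> i\<in>I. f i x)"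
   proof -
    have "(\<lambda>x. c \<odot>\<^bsub>W\<^esub> x) \<in> lin K W W"
     using that W by (intro linI) (simp_all add: vs_smult_add vs_smult_smult m_comm)
    from lin_finsum[OF W W this m[OF that(2)]] show ?thesis by simp
   qed
   finally show ?thesis .
  qed
 qed
qed

subsection \<open>Dimension\<close>

lemma rank_nullity:
 assumes V: "vectorspace K V" and W: "vectorspace K W" and f: "f \<in> lin K V W"
  and fin: "findim V"
 shows "vdim V = vdim (W\<langle>f ` carrier V\<rangle>)
   + vdim (V\<langle>{x \<in> carrier V. f x = \<zero>\<^bsub>W\<^esub>}\<rangle>)"
proof -
 interpret f: linear_map K V W f using lin_linear_map[OF V W f] .
 show ?thesis
  using f.rank_nullity_main(1)[OF fin] f.mod_hom_axioms
  by (simp add: mod_hom.im_def[OF f.mod_hom_axioms] mod_hom.ker_def[OF f.mod_hom_axioms])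
qed

lemma fin_dim_surj:
 assumes V: "vectorspace K V" and W: "vectorspace K W" and f: "f \<in> lin K V W"
  and fin: "findim V" and s: "f ` carrier V = carrier W"
 shows "findim W"
proof -
 interpret f: linear_map K V W f using lin_linear_map[OF V W f] .
 show ?thesis using f.rank_nullity_main(2)[OF fin s] .
qed

lemma dim_zero:
 assumes V: "vectorspace K V" and "carrier V = {\<zero>\<^bsub>V\<^esub>}"
 shows "findim V" "vdim V = 0"
proof -
 interpret V: vectorspace K V by (rule V)
 have g: "V.span {} = carrier V" using assms V.span_empty by simp
 then show "V.fin_dim" unfolding V.fin_dim_def by (metis empty_subsetI finite.emptyI)
 have "V.basis {}" unfolding V.basis_def using g by (simp add: V.finite_lin_indpt2)
 then show "V.dim = 0" using V.dim_basis by fastforce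
qed

lemma dim_bij:
 assumes V: "vectorspace K V" and W: "vectorspace K W" and f: "f \<in> lin K V W"
  and b: "bij_betw f (carrier V) (carrier W)" and fin: "findim V"
 shows "findim W" "vdim W = vdim V"
proof -
 interpret f: linear_map K V W f using lin_linear_map[OF V W f] .
 show "findim W" using fin_dim_surj[OF V W f fin] b by (simp add: bij_betw_def)
 show "vdim W = vdim V"
  using f.dim_eq[OF fin] b by (simp add: bij_betw_def)
qed

lemma lin_bij_inv:
 assumes V: "vectorspace K V" and W: "vectorspace K W" and f: "f \<in> lin K V W"
  and b: "bij_betw f (carrier V) (carrier W)"
 shows "the_inv_into (carrier V) f \<in> lin K W V"
  "bij_betw (the_inv_into (carrier V) f) (carrier W) (carrier V)"
proof -
 let ?g = "the_inv_into (carrier V) f"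
 have i: "inj_on f (carrier V)" and s: "f ` carrier V = carrier W" using b by (auto simp: bij_betw_def)
 show "bij_betw ?g (carrier W) (carrier V)" using b by (rule bij_betw_the_inv_into)
 have g: "?g y <: V" "f (?g y) = y" if "y <: W" for y
  using that s i by (auto simp: f_the_inv_into_f the_inv_into_into)
 have e: "?g y = x" if "f x = y" "x <: V" for x y
  using that i the_inv_into_f_f by fastforce
 show "?g \<in> lin K W V"
  by (rule linI) (use g linD[OF f] V W in \<open>auto intro!: e\<close>)
qed

lemma dim_bij_iff:
 assumes V: "vectorspace K V" and W: "vectorspace K W" and f: "f \<in> lin K V W"
  and b: "bij_betw f (carrier V) (carrier W)"
 shows "findim V \<longleftrightarrow> findim W"
  "findim V ==> vdim V = vdim W"
 using dim_bij[OF V W f b] dim_bij[OF W V lin_bij_inv[OF V W f b]] by auto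

text \<open>The form in which dimensions are compared below: only one of the two mutually inverse
  maps has to be linear, and finiteness may be known on either side.\<close>

lemma lin_bij:
 assumes V: "vectorspace K V" and W: "vectorspace K W" and f: "f \<in> lin K V W" and g: "\<And>y. y <: W ==> g y <: V"
  and gf: "\<And>x. x <: V ==> g (f x) = x" and fg: "\<And>y. y <: W ==> f (g y) = y"
  and fin: "findim V \<or> findim W"
 shows "findim V" "findim W" "vdim V = vdim W"
proof -
 have "bij_betw f (carrier V) (carrier W)"
  by (rule bij_betw_byWitness[where f'=g]) (use gf fg g linD(1)[OF f] in auto)
 from dim_bij_iff[OF V W f this] fin
 show "findim V" "findim W" "vdim V = vdim W" by auto
qed

lemma dim_cong:
 assumes "vectorspace K V" "carrier U = carrier V" "\<zero>\<^bsub>U\<^esub> = \<zero>\<^bsub>V\<^esub>" "add U = add V" "smult U = smult V"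
 shows "findim U \<longleftrightarrow> findim V"
  "findim V ==> vdim U = vdim V"
proof -
 have l: "(\<lambda>x. x) \<in> lin K V U" and b: "bij_betw (\<lambda>x. x) (carrier V) (carrier U)"
  using assms vs_cong[OF assms] by (auto intro!: linI simp: bij_betw_def)
 show "findim U \<longleftrightarrow> findim V"
  "findim V ==> vdim U = vdim V"
  using dim_bij_iff[OF assms(1) vs_cong[OF assms] l b] by auto
qed

text \<open>Independent subsets of W remain independent in V, so their size is bounded by the
  dimension of V; a maximal one generates W.\<close>

lemma sub_fin:
 assumes W: "sspace K W V" and fin: "findim V"
 shows "findim (V\<langle>W\<rangle>)"
proof -
 interpret V: vectorspace K V using subD(1)[OF W] .
 interpret W: vectorspace K "V\<langle>W\<rangle>" using sub_vs[OF W] .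
 have sm: "submodule K W V" using W by (simp add: VectorSpace.subspace_def)
 let ?P = "\<lambda>S. S \<subseteq> carrier (V\<langle>W\<rangle>) \<and> W.lin_indpt S"
 have "\<exists>A. finite A \<and> maximal A ?P"
 proof (rule maximal_exists)
  show "finite A \<and> card A \<le> V.dim" if "?P A" for A
  proof -
   have "V.lin_indpt A" using that V.span_li_not_depend(2)[OF _ sm, of A] by auto
   moreover have "A \<subseteq> carrier V" using that subD(2)[OF W] by auto
   ultimately show ?thesis using V.li_le_dim[OF fin] by blast
  qed
  show "?P {}" by (simp add: W.finite_lin_indpt2)
 qed
 then obtain A where "finite A" "maximal A ?P" by blast
 then have "finite A \<and> A \<subseteq> carrier (V\<langle>W\<rangle>) \<and> W.gen_set A"
  using W.max_li_is_basis[of A] by (auto simp: W.basis_def)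
 then show ?thesis unfolding W.fin_dim_def by blast
qed

text \<open>A basis of W is independent in V, hence has at most dim V elements, and with exactly
  that many it is a basis of V.\<close>

lemma sub_dim:
 assumes W: "sspace K W V" and fin: "findim V"
 shows "vdim (V\<langle>W\<rangle>) \<le> vdim V"
  and "vdim (V\<langle>W\<rangle>) = vdim V ==> W = carrier V"
proof -
 interpret V: vectorspace K V using subD(1)[OF W] .
 interpret W: vectorspace K "V\<langle>W\<rangle>" using sub_vs[OF W] .
 have sm: "submodule K W V" using W by (simp add: VectorSpace.subspace_def)
 obtain B where B: "finite B" "W.basis B" using W.finite_basis_exists[OF sub_fin[OF assms]] by blast
 then have d: "W.dim = card B" using W.dim_basis by blast
 have BW: "B \<subseteq> W" and Wli: "W.lin_indpt B" and Wspan: "W.span B = W"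
  using B(2) by (auto simp: W.basis_def)
 have li: "V.lin_indpt B" and sp: "V.span B = W"
  using V.span_li_not_depend[OF BW sm] Wli Wspan by auto
 have BV: "B \<subseteq> carrier V" using BW subD(2)[OF W] by auto
 show "W.dim \<le> V.dim" using d V.li_le_dim(2)[OF fin BV li] by simp
 show "W = carrier V" if "W.dim = V.dim"
 proof -
  have "V.basis B" using V.dim_li_is_basis[OF fin B(1) BV li] that d by simp
  then show ?thesis using sp by (simp add: V.basis_def)
 qed
qed

subsection \<open>Bases with dual bases\<close>

text \<open>The field as a space over itself. \<open>K\<close> is only a ring record and has no
  scalar multiplication, so it cannot be the target of a linear form.\<close>

definition scal :: "('k, 'k) module" where
 "scal = \<lparr>carrier = carrier K, monoid.mult = (\<otimes>), monoid.one = \<one>, ring.zero = \<zero>,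
   add = (\<oplus>), smult = (\<otimes>)\<rparr>"

lemma scal_simps [simp]:
 "carrier scal = carrier K" "x \<otimes>\<^bsub>scal\<^esub> y = x \<otimes> y" "\<one>\<^bsub>scal\<^esub> = \<one>" "\<zero>\<^bsub>scal\<^esub> = \<zero>"
 "x \<oplus>\<^bsub>scal\<^esub> y = x \<oplus> y" "x \<odot>\<^bsub>scal\<^esub> y = x \<otimes> y"
 by (simp_all add: scal_def)

lemma scal_vs [simp]: "vectorspace K scal"
 by (rule vsI) (auto simp: m_assoc l_distr r_distr a_ac l_minus r_neg)

text \<open>A basis indexed by an arbitrary finite set and given together with its dual basis.
  Spaces of maps and of finitely supported functions thereby get bases from explicit formulas, and
  coordinates are linear forms from the start.\<close>

definition has_basis :: "('k, 'v, 'z) module_scheme \<Rightarrow> 'i set \<Rightarrow> ('i \<Rightarrow> 'v) \<Rightarrow> ('i \<Rightarrow> 'v \<Rightarrow> 'k) \<Rightarrow> bool" where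
 "has_basis V I b c \<longleftrightarrow> finite I \<and> (\<forall>i\<in>I. b i <: V) \<and> (\<forall>i\<in>I. c i \<in> lin K V scal) \<and>
   (\<forall>v\<in>carrier V. (\<Oplus>\<^bsub>V\<^esub> i\<in>I. c i v \<odot>\<^bsub>V\<^esub> b i) = v) \<and>
   (\<forall>i\<in>I. \<forall>j\<in>I. c i (b j) = (if i = j then \<one> else \<zero>))"

lemma has_basisD:
 assumes "has_basis V I b c"
 shows "finite I" "\<And>i. i \<in> I ==> b i <: V" "\<And>i. i \<in> I ==> c i \<in> lin K V scal"
  "\<And>v. v <: V ==> (\<Oplus>\<^bsub>V\<^esub> i\<in>I. c i v \<odot>\<^bsub>V\<^esub> b i) = v"
  "\<And>i j. i \<in> I ==> j \<in> I ==> c i (b j) = (if i = j then \<one> else \<zero>)"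
  "\<And>i v. i \<in> I ==> v <: V ==> c i v <: K"
proof -
 note a = assms[unfolded has_basis_def]
 show "finite I" using a by simp
 show "b i <: V" if "i \<in> I" for i using a that by simp
 show c: "c i \<in> lin K V scal" if "i \<in> I" for i using a that by simp
 show "(\<Oplus>\<^bsub>V\<^esub> i\<in>I. c i v \<odot>\<^bsub>V\<^esub> b i) = v" if "v <: V" for v using a that by simp
 show "c i (b j) = (if i = j then \<one> else \<zero>)" if "i \<in> I" "j \<in> I" for i j using a that by simp
 show "c i v <: K" if "i \<in> I" "v <: V" for i v
  using linD(1)[OF c[OF that(1)] that(2)] by simp
qed

lemma finsum_delta:
 assumes V: "vectorspace K V" and "finite I" "j \<in> I" "\<And>i. i \<in> I ==> x i <: V"
 shows "(\<Oplus>\<^bsub>V\<^esub> i\<in>I. (if i = j then \<one> else \<zero>) \<odot>\<^bsub>V\<^esub> x i) = x j"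
  and "(\<Oplus>\<^bsub>V\<^esub> i\<in>I. (if j = i then \<one> else \<zero>) \<odot>\<^bsub>V\<^esub> x i) = x j"
proof -
 interpret V: vectorspace K V by (rule V)
 have "(\<Oplus>\<^bsub>V\<^esub> i\<in>I. (if i = j then \<one> else \<zero>) \<odot>\<^bsub>V\<^esub> x i) = (\<Oplus>\<^bsub>V\<^esub> i\<in>I. if j = i then x i else \<zero>\<^bsub>V\<^esub>)"
  using assms by (intro V.M.finsum_cong') auto
 also have "\<dots> = x j" using assms by (intro V.M.finsum_singleton) auto
 finally show "(\<Oplus>\<^bsub>V\<^esub> i\<in>I. (if i = j then \<one> else \<zero>) \<odot>\<^bsub>V\<^esub> x i) = x j" .
 moreover have "(\<lambda>i. (if j = i then \<one> else \<zero>) \<odot>\<^bsub>V\<^esub> x i) = (\<lambda>i. (if i = j then \<one> else \<zero>) \<odot>\<^bsub>V\<^esub> x i)"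
  by (rule ext) auto
 ultimately show "(\<Oplus>\<^bsub>V\<^esub> i\<in>I. (if j = i then \<one> else \<zero>) \<odot>\<^bsub>V\<^esub> x i) = x j"
  by simp
qed

lemma basis_dim:
 assumes V: "vectorspace K V" and B: "has_basis V I b c"
 shows "findim V" "vdim V = card I"
proof -
 interpret V: vectorspace K V by (rule V)
 note B = has_basisD[OF B]
 have inj: "inj_on b I"
 proof (rule inj_onI)
  fix i j assume "i \<in> I" "j \<in> I" "b i = b j"
  then show "i = j" using B(5)[of i i] B(5)[of i j] by (auto split: if_splits)
 qed
 have lc: "V.lincomb a (b ` I) = (\<Oplus>\<^bsub>V\<^esub> i\<in>I. a (b i) \<odot>\<^bsub>V\<^esub> b i)" if "a \<in> b ` I \<rightarrow> carrier K" for a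
  unfolding V.lincomb_def using that B inj by (intro V.M.finsum_reindex) auto
 have sub: "b ` I \<subseteq> carrier V" and fin: "finite (b ` I)" using B by auto
 have "v \<in> V.span (b ` I)" if v: "v <: V" for v
 proof -
  let ?a = "\<lambda>w. c (the_inv_into I b w) v"
  have a: "?a \<in> b ` I \<rightarrow> carrier K" using B(6)[OF _ v] inj by (auto simp: the_inv_into_f_f)
  have "V.lincomb ?a (b ` I) = (\<Oplus>\<^bsub>V\<^esub> i\<in>I. c i v \<odot>\<^bsub>V\<^esub> b i)"
   unfolding lc[OF a] using B(6)[OF _ v] B(2) inj by (intro V.M.finsum_cong') (auto simp: the_inv_into_f_f)
  then have "V.lincomb ?a (b ` I) = v" using B(4) v by simp
  then show ?thesis unfolding V.span_def mem_Collect_eq using a fin by (intro exI[of _ ?a] exI[of _ "b ` I"]) simp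
 qed
 moreover have "V.span (b ` I) \<subseteq> carrier V" using sub by (rule V.span_is_subset2)
 ultimately have gen: "V.span (b ` I) = carrier V" by auto
 have "V.lin_indpt (b ` I)"
 proof (rule V.finite_lin_indpt2[OF fin sub])
  fix a assume a: "a \<in> b ` I \<rightarrow> carrier K" and z: "V.lincomb a (b ` I) = \<zero>\<^bsub>V\<^esub>"
  have "a (b j) = \<zero>" if j: "j \<in> I" for j
  proof -
   have "c j (V.lincomb a (b ` I)) = (\<Oplus>\<^bsub>scal\<^esub> i\<in>I. c j (a (b i) \<odot>\<^bsub>V\<^esub> b i))"
    unfolding lc[OF a] using a B by (intro lin_finsum[OF V scal_vs B(3)[OF j]]) auto
   also have "\<dots> = (\<Oplus>\<^bsub>scal\<^esub> i\<in>I. (if j = i then \<one> else \<zero>) \<odot>\<^bsub>scal\<^esub> a (b i))"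
   proof (rule abelian_monoid.finsum_cong'[OF _ refl])
    show "abelian_monoid scal" using vs_addI(1)[OF scal_vs] by (rule abelian_group.axioms)
   qed (use a B(2,5) j linD(3)[OF B(3)[OF j]] in \<open>auto simp: m_comm Pi_iff\<close>)
   also have "\<dots> = a (b j)" using finsum_delta(2)[OF scal_vs B(1) j, of "\<lambda>i. a (b i)"] a by auto
   finally show ?thesis using z lin_zero[OF V scal_vs B(3)[OF j]] by simp
  qed
  then show "\<forall>v\<in>b ` I. a v = \<zero>" by blast
 qed
 then have "V.basis (b ` I)" using gen sub by (simp add: V.basis_def)
 then show "V.dim = card I" using V.dim_basis[OF fin] card_image[OF inj] by simp
 show "V.fin_dim" unfolding V.fin_dim_def using gen sub fin by blast
qed

lemma basis_exists:
 assumes V: "vectorspace K V" and fin: "findim V"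
 shows "\<exists>b c. has_basis V {..<vdim V} b c"
proof -
 interpret V: vectorspace K V by (rule V)
 obtain B where B: "finite B" "V.basis B" using V.finite_basis_exists[OF fin] by blast
 have BV: "B \<subseteq> carrier V" and d: "V.dim = card B" using B V.dim_basis by (auto simp: V.basis_def)
 obtain h where h: "bij_betw h {..<card B} B" using ex_bij_betw_nat_finite[OF B(1)]
  by (auto simp: atLeast0LessThan)
 \<comment> \<open>The coefficient function is unique only among functions that are extensional on
   B; restricting to those makes the definite description legitimate.\<close>
 define co where "co v = (THE a. a \<in> B \<rightarrow>\<^sub>E carrier K \<and> V.lincomb a B = v)" for v
 have ex: "\<exists>!a. a \<in> B \<rightarrow>\<^sub>E carrier K \<and> V.lincomb a B = v" if "v <: V" for v
  using V.basis_criterion[OF B(1) BV] B(2) that by blast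
 have co: "co v \<in> B \<rightarrow>\<^sub>E carrier K" "V.lincomb (co v) B = v" if "v <: V" for v
  using theI'[OF ex[OF that]] by (auto simp: co_def)
 have co_eq: "co v w = a w" if "a \<in> B \<rightarrow> carrier K" "V.lincomb a B = v" "w \<in> B" for v a w
 proof -
  have "v <: V" using that BV by auto
  moreover have "V.lincomb (restrict a B) B = v"
   using that BV V.lincomb_cong[OF refl BV, of "restrict a B" a] by auto
  moreover have "restrict a B \<in> B \<rightarrow>\<^sub>E carrier K" using that(1) by auto
  ultimately have "co v = restrict a B" using ex co by blast
  then show ?thesis using that by simp
 qed
 have lin: "(\<lambda>v. co v w) \<in> lin K V scal" if w: "w \<in> B" for w
 proof (rule linI)
  show "co x w <: scal" if "x <: V" for x using co(1)[OF that] w by auto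
  show "co (x \<oplus>\<^bsub>V\<^esub> y) w = co x w \<oplus>\<^bsub>scal\<^esub> co y w" if "x <: V" "y <: V" for x y
   using co_eq[of "\<lambda>v. co x v \<oplus> co y v" "x \<oplus>\<^bsub>V\<^esub> y" w] co that w
    V.lincomb_sum[OF B(1) BV, of "co x" "co y"] by (auto simp: PiE_def Pi_def)
  show "co (k \<odot>\<^bsub>V\<^esub> x) w = k \<odot>\<^bsub>scal\<^esub> co x w" if "k <: K" "x <: V" for k x
   using co_eq[of "\<lambda>v. k \<otimes> co x v" "k \<odot>\<^bsub>V\<^esub> x" w] co that w
    V.lincomb_smult[OF BV, of "co x" k] by (auto simp: PiE_def Pi_def)
 qed
 have hB: "h i \<in> B" if "i < card B" for i using h that by (auto simp: bij_betw_def)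
 have "has_basis V {..<card B} h (\<lambda>i v. co v (h i))"
  unfolding has_basis_def
 proof (intro conjI ballI)
  fix v assume v: "v <: V"
  have "(\<Oplus>\<^bsub>V\<^esub> w\<in>h ` {..<card B}. co v w \<odot>\<^bsub>V\<^esub> w) = (\<Oplus>\<^bsub>V\<^esub> i\<in>{..<card B}. co v (h i) \<odot>\<^bsub>V\<^esub> h i)"
   using h co(1)[OF v] BV by (intro V.M.finsum_reindex) (auto simp: bij_betw_def)
  then show "(\<Oplus>\<^bsub>V\<^esub> i\<in>{..<card B}. co v (h i) \<odot>\<^bsub>V\<^esub> h i) = v"
   using co(2)[OF v] h by (simp add: V.lincomb_def bij_betw_def)
 next
  fix i j assume i: "i \<in> {..<card B}" and j: "j \<in> {..<card B}"
  have "V.lincomb (\<lambda>w. if w = h j then \<one> else \<zero>) B = h j"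
   unfolding V.lincomb_def using hB j BV B(1) by (intro finsum_delta[OF V]) auto
  then have "co (h j) (h i) = (if h i = h j then \<one> else \<zero>)"
   using hB i by (intro co_eq) auto
  then show "co (h j) (h i) = (if i = j then \<one> else \<zero>)"
   using h i j by (auto simp: bij_betw_def inj_on_def)
 qed (use hB BV lin in auto)
 then show ?thesis using d by auto
qed

lemma lin_eq_on_basis:
 assumes V: "vectorspace K V" and W: "vectorspace K W" and B: "has_basis V I b c"
  and f: "f \<in> lin K V W" and v: "v <: V"
 shows "f v = (\<Oplus>\<^bsub>W\<^esub> i\<in>I. c i v \<odot>\<^bsub>W\<^esub> f (b i))"
proof -
 note B = has_basisD[OF B]
 interpret W: vectorspace K W by (rule W)
 have "f (\<Oplus>\<^bsub>V\<^esub> i\<in>I. c i v \<odot>\<^bsub>V\<^esub> b i) = (\<Oplus>\<^bsub>W\<^esub> i\<in>I. f (c i v \<odot>\<^bsub>V\<^esub> b i))"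
  using B v V by (intro lin_finsum[OF V W f]) auto
 also have "\<dots> = (\<Oplus>\<^bsub>W\<^esub> i\<in>I. c i v \<odot>\<^bsub>W\<^esub> f (b i))"
  using B v linD[OF f] by (intro W.M.finsum_cong') auto
 finally show ?thesis using B(4) v by simp
qed

end

context base_field
begin

subsection \<open>Quotient spaces\<close>

lemma quotient_coset_simps:
 assumes W: "sspace K W V"
 shows "x <: V ==> y <: V ==>
   W +>\<^bsub>V\<^esub> x = W +>\<^bsub>V\<^esub> y \<longleftrightarrow> x \<oplus>\<^bsub>V\<^esub> (\<ominus> \<one>) \<odot>\<^bsub>V\<^esub> y \<in> W"
  and "x <: V ==> y <: V ==>
   (W +>\<^bsub>V\<^esub> x) \<oplus>\<^bsub>quotient_space V W\<^esub> (W +>\<^bsub>V\<^esub> y) = W +>\<^bsub>V\<^esub> (x \<oplus>\<^bsub>V\<^esub> y)"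
  and "c <: K ==> x <: V ==>
   c \<odot>\<^bsub>quotient_space V W\<^esub> (W +>\<^bsub>V\<^esub> x) = W +>\<^bsub>V\<^esub> (c \<odot>\<^bsub>V\<^esub> x)"
  and "carrier (quotient_space V W) = (\<lambda>x. W +>\<^bsub>V\<^esub> x) ` carrier V"
  and "\<zero>\<^bsub>quotient_space V W\<^esub> = W +>\<^bsub>V\<^esub> \<zero>\<^bsub>V\<^esub>"
  and "x <: V ==> x \<in> W +>\<^bsub>V\<^esub> x"
  and "x <: V ==> y \<in> W +>\<^bsub>V\<^esub> x ==> y <: V \<and> y \<oplus>\<^bsub>V\<^esub> (\<ominus> \<one>) \<odot>\<^bsub>V\<^esub> x \<in> W"
proof -
 note w = subD[OF W]
 have V: "vectorspace K V" by fact
 interpret V: vectorspace K V by fact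
 have mem: "y \<in> W +>\<^bsub>V\<^esub> x \<longleftrightarrow> y <: V \<and> y \<oplus>\<^bsub>V\<^esub> (\<ominus> \<one>) \<odot>\<^bsub>V\<^esub> x \<in> W" if "x <: V" for x y
 proof
  assume "y \<in> W +>\<^bsub>V\<^esub> x"
  then obtain h where h: "h \<in> W" "y = h \<oplus>\<^bsub>V\<^esub> x" by (auto simp: a_r_coset_def r_coset_def)
  then have "y \<oplus>\<^bsub>V\<^esub> (\<ominus> \<one>) \<odot>\<^bsub>V\<^esub> x = h" using that w(6) V by (simp add: vs_assoc)
  then show "y <: V \<and> y \<oplus>\<^bsub>V\<^esub> (\<ominus> \<one>) \<odot>\<^bsub>V\<^esub> x \<in> W" using h that w(6) V by simp
 next
  assume a: "y <: V \<and> y \<oplus>\<^bsub>V\<^esub> (\<ominus> \<one>) \<odot>\<^bsub>V\<^esub> x \<in> W"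
  have "y = (y \<oplus>\<^bsub>V\<^esub> (\<ominus> \<one>) \<odot>\<^bsub>V\<^esub> x) \<oplus>\<^bsub>V\<^esub> x" using that a V by (simp add: vs_assoc)
  then show "y \<in> W +>\<^bsub>V\<^esub> x" using a by (auto simp: a_r_coset_def r_coset_def)
 qed
 have neg: "x \<oplus>\<^bsub>V\<^esub> (\<ominus> \<one>) \<odot>\<^bsub>V\<^esub> y = (\<ominus> \<one>) \<odot>\<^bsub>V\<^esub> (y \<oplus>\<^bsub>V\<^esub> (\<ominus> \<one>) \<odot>\<^bsub>V\<^esub> x)"
  if "x <: V" "y <: V" for x y
  using that V by (simp add: vs_smult_add vs_smult_smult l_minus r_minus vs_comm)
 show self: "x \<in> W +>\<^bsub>V\<^esub> x" if "x <: V" for x using that mem w V by simp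
 show "y <: V \<and> y \<oplus>\<^bsub>V\<^esub> (\<ominus> \<one>) \<odot>\<^bsub>V\<^esub> x \<in> W" if "x <: V" "y \<in> W +>\<^bsub>V\<^esub> x"
  using that mem by blast
 show eq: "W +>\<^bsub>V\<^esub> x = W +>\<^bsub>V\<^esub> y \<longleftrightarrow> x \<oplus>\<^bsub>V\<^esub> (\<ominus> \<one>) \<odot>\<^bsub>V\<^esub> y \<in> W"
  if x: "x <: V" and y: "y <: V" for x y
 proof
  assume "W +>\<^bsub>V\<^esub> x = W +>\<^bsub>V\<^esub> y"
  then have "x \<in> W +>\<^bsub>V\<^esub> y" using self x by blast
  then show "x \<oplus>\<^bsub>V\<^esub> (\<ominus> \<one>) \<odot>\<^bsub>V\<^esub> y \<in> W" using mem y by blast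
 next
  assume d: "x \<oplus>\<^bsub>V\<^esub> (\<ominus> \<one>) \<odot>\<^bsub>V\<^esub> y \<in> W"
  have d': "y \<oplus>\<^bsub>V\<^esub> (\<ominus> \<one>) \<odot>\<^bsub>V\<^esub> x \<in> W" using neg[OF y x] d w(5) by simp
  have tr: "z \<oplus>\<^bsub>V\<^esub> (\<ominus> \<one>) \<odot>\<^bsub>V\<^esub> q = (z \<oplus>\<^bsub>V\<^esub> (\<ominus> \<one>) \<odot>\<^bsub>V\<^esub> p) \<oplus>\<^bsub>V\<^esub> (p \<oplus>\<^bsub>V\<^esub> (\<ominus> \<one>) \<odot>\<^bsub>V\<^esub> q)"
   if "z <: V" "p <: V" "q <: V" for z p q
  proof -
   have "(z \<oplus>\<^bsub>V\<^esub> (\<ominus> \<one>) \<odot>\<^bsub>V\<^esub> p) \<oplus>\<^bsub>V\<^esub> (p \<oplus>\<^bsub>V\<^esub> (\<ominus> \<one>) \<odot>\<^bsub>V\<^esub> q)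
    = z \<oplus>\<^bsub>V\<^esub> ((\<ominus> \<one>) \<odot>\<^bsub>V\<^esub> p \<oplus>\<^bsub>V\<^esub> (p \<oplus>\<^bsub>V\<^esub> (\<ominus> \<one>) \<odot>\<^bsub>V\<^esub> q))"
    using that V by (simp add: vs_assoc)
   also have "(\<ominus> \<one>) \<odot>\<^bsub>V\<^esub> p \<oplus>\<^bsub>V\<^esub> (p \<oplus>\<^bsub>V\<^esub> (\<ominus> \<one>) \<odot>\<^bsub>V\<^esub> q) = (\<ominus> \<one>) \<odot>\<^bsub>V\<^esub> q"
    using that V by (simp add: vs_assoc[symmetric])
   finally show ?thesis by simp
  qed
  show "W +>\<^bsub>V\<^esub> x = W +>\<^bsub>V\<^esub> y"
  proof (rule Set.set_eqI)
   fix z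
   show "z \<in> W +>\<^bsub>V\<^esub> x \<longleftrightarrow> z \<in> W +>\<^bsub>V\<^esub> y"
    unfolding mem[OF x] mem[OF y] using tr[OF _ x y, of z] tr[OF _ y x, of z] d d' w(4) by fastforce
  qed
 qed
 have ag: "abelian_subgroup W V"
 proof (rule abelian_subgroupI3)
  have "subgroup W (add_monoid V)"
  proof (rule group.subgroupI)
   show "group (add_monoid V)" by (rule V.M.a_group)
   show "inv\<^bsub>add_monoid V\<^esub> a \<in> W" if "a \<in> W" for a
   proof -
    have "\<ominus>\<^bsub>V\<^esub> a \<in> W" using that w(5,6) V by simp
    then show ?thesis by (simp add: a_inv_def)
   qed
  qed (use w in auto)
  then show "additive_subgroup W V" by (simp add: additive_subgroup_def)
 qed (rule V.M.abelian_group_axioms)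
 show "(W +>\<^bsub>V\<^esub> x) \<oplus>\<^bsub>quotient_space V W\<^esub> (W +>\<^bsub>V\<^esub> y) = W +>\<^bsub>V\<^esub> (x \<oplus>\<^bsub>V\<^esub> y)"
  if "x <: V" "y <: V"
  using abelian_subgroup.a_rcos_sum[OF ag that] by (simp add: quotient_space_def)
 show "c \<odot>\<^bsub>quotient_space V W\<^esub> (W +>\<^bsub>V\<^esub> x) = W +>\<^bsub>V\<^esub> (c \<odot>\<^bsub>V\<^esub> x)"
  if c: "c <: K" and x: "x <: V"
 proof -
  \<comment> \<open>A multiple of a coset is defined as a union over the representatives of the
    coset; all members of that union are one and the same coset.\<close>
  have "W +>\<^bsub>V\<^esub> (c \<odot>\<^bsub>V\<^esub> y) = W +>\<^bsub>V\<^esub> (c \<odot>\<^bsub>V\<^esub> x)" if "y \<in> W +>\<^bsub>V\<^esub> x" for y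
  proof -
   have y: "y <: V" "y \<oplus>\<^bsub>V\<^esub> (\<ominus> \<one>) \<odot>\<^bsub>V\<^esub> x \<in> W" using that mem x by auto
   have "c \<odot>\<^bsub>V\<^esub> y \<oplus>\<^bsub>V\<^esub> (\<ominus> \<one>) \<odot>\<^bsub>V\<^esub> (c \<odot>\<^bsub>V\<^esub> x) = c \<odot>\<^bsub>V\<^esub> (y \<oplus>\<^bsub>V\<^esub> (\<ominus> \<one>) \<odot>\<^bsub>V\<^esub> x)"
    using c x y V by (simp add: vs_smult_add vs_smult_smult m_comm)
   then show ?thesis using eq[of "c \<odot>\<^bsub>V\<^esub> y" "c \<odot>\<^bsub>V\<^esub> x"] y c x V w(5) by simp
  qed
  then have "(\<Union>y\<in>W +>\<^bsub>V\<^esub> x. W +>\<^bsub>V\<^esub> (c \<odot>\<^bsub>V\<^esub> y)) = (\<Union>y\<in>W +>\<^bsub>V\<^esub> x. W +>\<^bsub>V\<^esub> (c \<odot>\<^bsub>V\<^esub> x))"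
   by (rule SUP_cong[OF refl])
  also have "\<dots> = W +>\<^bsub>V\<^esub> (c \<odot>\<^bsub>V\<^esub> x)" using self[OF x] by blast
  finally show ?thesis by (simp add: quotient_space_def)
 qed
 show "carrier (quotient_space V W) = (\<lambda>x. W +>\<^bsub>V\<^esub> x) ` carrier V"
  by (auto simp: quotient_space_def A_RCOSETS_def RCOSETS_def a_r_coset_def)
 have "W +>\<^bsub>V\<^esub> \<zero>\<^bsub>V\<^esub> = W"
  using mem[of "\<zero>\<^bsub>V\<^esub>"] V w(6) by (intro Set.set_eqI) (metis a_inv_closed one_closed vs_r_zero vs_smult_r_zero vs_zero)
 then show "\<zero>\<^bsub>quotient_space V W\<^esub> = W +>\<^bsub>V\<^esub> \<zero>\<^bsub>V\<^esub>" by (simp add: quotient_space_def)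
qed

lemma quotient_vs:
 assumes W: "sspace K W V"
 shows "vectorspace K (quotient_space V W)"
  and "(\<lambda>x. W +>\<^bsub>V\<^esub> x) \<in> lin K V (quotient_space V W)"
proof -
 note q = quotient_coset_simps[OF W]
 have V: "vectorspace K V" using subD(1)[OF W] .
 note [simp] = q(2,3,5) V
 show "vectorspace K (quotient_space V W)"
  by (rule vsI; (clarsimp simp: q(4))?)
    (simp_all add: vs_ac vs_smult_add vs_add_smult vs_smult_smult)
 show "(\<lambda>x. W +>\<^bsub>V\<^esub> x) \<in> lin K V (quotient_space V W)"
  by (rule linI) (auto simp: q(4))
qed

lemma quotient_ker:
 assumes W: "sspace K W V" and x: "x <: V"
 shows "W +>\<^bsub>V\<^esub> x = \<zero>\<^bsub>quotient_space V W\<^esub> \<longleftrightarrow> x \<in> W"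
 using quotient_coset_simps(1)[OF W x, of "\<zero>\<^bsub>V\<^esub>"] quotient_coset_simps(5)[OF W] x subD(1)[OF W]
 by simp

lemma quotient_lift:
 assumes W: "sspace K W V" and U: "vectorspace K U" and f: "f \<in> lin K V U"
  and k: "\<And>x. x \<in> W ==> f x = \<zero>\<^bsub>U\<^esub>"
 shows "(\<lambda>X. the_elem (f ` X)) \<in> lin K (quotient_space V W) U"
  and "\<And>x. x <: V ==> the_elem (f ` (W +>\<^bsub>V\<^esub> x)) = f x"
proof -
 note q = quotient_coset_simps[OF W]
 have V: "vectorspace K V" using subD(1)[OF W] .
 have e: "f y = f x" if x: "x <: V" and y: "y \<in> W +>\<^bsub>V\<^esub> x" for x y
 proof -
  have y: "y <: V" and "y \<oplus>\<^bsub>V\<^esub> (\<ominus> \<one>) \<odot>\<^bsub>V\<^esub> x \<in> W" using q(7) x y by auto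
  then have "f (y \<oplus>\<^bsub>V\<^esub> (\<ominus> \<one>) \<odot>\<^bsub>V\<^esub> x) = \<zero>\<^bsub>U\<^esub>" using k by blast
  then have "f y \<oplus>\<^bsub>U\<^esub> (\<ominus> \<one>) \<odot>\<^bsub>U\<^esub> f x = \<zero>\<^bsub>U\<^esub>" using x y linD[OF f] V by simp
  then show ?thesis using vs_sub_eq_zero[OF U] linD(1)[OF f] x y by blast
 qed
 show s: "the_elem (f ` (W +>\<^bsub>V\<^esub> x)) = f x" if "x <: V" for x
 proof -
  have "f ` (W +>\<^bsub>V\<^esub> x) = {f x}"
   using q(6)[OF that] by (intro equalityI image_subsetI singleton_iff[THEN iffD2] e[OF that]) auto
  then show ?thesis by simp
 qed
 show "(\<lambda>X. the_elem (f ` X)) \<in> lin K (quotient_space V W) U"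
  by (rule linI) (use s linD[OF f] V in \<open>auto simp: q(2,3,4)\<close>)
qed

lemma first_iso:
 assumes V: "vectorspace K V" and U: "vectorspace K U" and f: "f \<in> lin K V U"
  and s: "f ` carrier V = carrier U" and k: "{x \<in> carrier V. f x = \<zero>\<^bsub>U\<^esub>} = W"
  and fin: "findim U"
 shows "findim (quotient_space V W)"
  "vdim (quotient_space V W) = vdim U"
proof -
 have W: "sspace K W V" using lin_ker_sub[OF V U f] k by simp
 note q = quotient_coset_simps[OF W] and Q = quotient_vs[OF W]
 have k': "f x = \<zero>\<^bsub>U\<^esub>" if "x \<in> W" for x using k that by blast
 note l = quotient_lift[OF W U f k']
 let ?h = "\<lambda>X. the_elem (f ` X)"
 have "inj_on ?h (carrier (quotient_space V W))"
 proof (rule lin_inj[OF Q(1) U l(1)])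
  fix X assume X: "X <: (quotient_space V W)" and z: "?h X = \<zero>\<^bsub>U\<^esub>"
  then obtain x where x: "x <: V" "X = W +>\<^bsub>V\<^esub> x" using q(4) by auto
  then have "f x = \<zero>\<^bsub>U\<^esub>" using z l(2) by simp
  then show "X = \<zero>\<^bsub>quotient_space V W\<^esub>" using k x quotient_ker[OF W] by blast
 qed
 moreover have "?h ` carrier (quotient_space V W) = carrier U"
  using l(2) s by (auto simp: q(4) image_image)
 ultimately have "bij_betw ?h (carrier (quotient_space V W)) (carrier U)" by (simp add: bij_betw_def)
 from dim_bij_iff[OF Q(1) U l(1) this] fin
 show "findim (quotient_space V W)"
  "vdim (quotient_space V W) = vdim U" by auto
qed

lemma quotient_dim:
 assumes W: "sspace K W V" and fin: "findim V"
 shows "findim (quotient_space V W)"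
  "vdim (quotient_space V W) + vdim (V\<langle>W\<rangle>) = vdim V"
proof -
 have V: "vectorspace K V" using subD(1)[OF W] .
 note Q = quotient_vs[OF W]
 have s: "(\<lambda>x. W +>\<^bsub>V\<^esub> x) ` carrier V = carrier (quotient_space V W)"
  using quotient_coset_simps(4)[OF W] by simp
 show "findim (quotient_space V W)" using fin_dim_surj[OF V Q fin s] .
 have "{x \<in> carrier V. W +>\<^bsub>V\<^esub> x = \<zero>\<^bsub>quotient_space V W\<^esub>} = W"
  using quotient_ker[OF W] subD(6)[OF W] by blast
 then show "vdim (quotient_space V W) + vdim (V\<langle>W\<rangle>) = vdim V"
  using rank_nullity[OF V Q fin] s by simp
qed

text \<open>The maps f and g need to be inverse to each other only modulo B and B', which is all
  that a homotopy gives: Z \<rightarrow> Z'/B' is then onto with kernel B. Finiteness is assumed on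
  the primed side only, since the other side will come from a resolution of unknown size. The
  dimension formula is additive to avoid truncated subtraction.\<close>

lemma subquotient_iso:
 assumes Z: "sspace K Z V" and B: "sspace K B V" and BZ: "B \<subseteq> Z"
  and Z': "sspace K Z' V'" and B': "sspace K B' V'" and BZ': "B' \<subseteq> Z'"
  and f: "f \<in> lin K (V\<langle>Z\<rangle>) (V'\<langle>Z'\<rangle>)" and fB: "\<And>x. x \<in> B ==> f x \<in> B'"
  and g: "g \<in> lin K (V'\<langle>Z'\<rangle>) (V\<langle>Z\<rangle>)" and gB: "\<And>x. x \<in> B' ==> g x \<in> B"
  and gf: "\<And>z. z \<in> Z ==> \<exists>b\<in>B. z = g (f z) \<oplus>\<^bsub>V\<^esub> b"
  and fg: "\<And>z. z \<in> Z' ==> \<exists>b\<in>B'. z = f (g z) \<oplus>\<^bsub>V'\<^esub> b"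
  and fin: "findim (V'\<langle>Z'\<rangle>)"
 shows "findim (subquotient V Z B)"
  "vdim (subquotient V Z B) + vdim (V'\<langle>B'\<rangle>)
   = vdim (V'\<langle>Z'\<rangle>)"
proof -
 let ?V = "V\<langle>Z\<rangle>" and ?V' = "V'\<langle>Z'\<rangle>"
 have V: "vectorspace K ?V" and V': "vectorspace K ?V'" using sub_vs Z Z' by auto
 have sB: "sspace K B ?V" and sB': "sspace K B' ?V'" using sub_trans Z B BZ Z' B' BZ' by auto
 let ?Q = "quotient_space ?V' B'" and ?p = "\<lambda>x. B' +>\<^bsub>?V'\<^esub> x"
 note Q = quotient_vs[OF sB'] and q = quotient_coset_simps[OF sB']
 have l: "(\<lambda>x. ?p (f x)) \<in> lin K ?V ?Q" using lin_comp[OF f Q(2)] .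
 have fZ: "f z \<in> Z'" if "z \<in> Z" for z using linD(1)[OF f] that by simp
 have gZ: "g z \<in> Z" if "z \<in> Z'" for z using linD(1)[OF g] that by simp
 have "?p z \<in> (\<lambda>x. ?p (f x)) ` Z" if z: "z \<in> Z'" for z
 proof -
  obtain b where b: "b \<in> B'" "z = f (g z) \<oplus>\<^bsub>V'\<^esub> b" using fg z by blast
  have "?p z = ?p (f (g z)) \<oplus>\<^bsub>?Q\<^esub> ?p b"
   using b q(2)[of "f (g z)" b] z fZ gZ BZ' by auto
  also have "?p b = \<zero>\<^bsub>?Q\<^esub>" using quotient_ker[OF sB', of b] b BZ' by auto
  also have "?p (f (g z)) \<oplus>\<^bsub>?Q\<^esub> \<zero>\<^bsub>?Q\<^esub> = ?p (f (g z))"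
   using Q(1) q(4) z fZ gZ by simp
  finally show ?thesis using gZ z by blast
 qed
 then have s: "(\<lambda>x. ?p (f x)) ` carrier ?V = carrier ?Q" using q(4) fZ by auto
 have k: "{x \<in> carrier ?V. ?p (f x) = \<zero>\<^bsub>?Q\<^esub>} = B"
 proof -
  have "x \<in> B" if "x \<in> Z" "f x \<in> B'" for x
   using gf[OF that(1)] gB[OF that(2)] subD(4)[OF B] by metis
  moreover have "?p (f x) = \<zero>\<^bsub>?Q\<^esub> \<longleftrightarrow> f x \<in> B'" if "x \<in> Z" for x
   using quotient_ker[OF sB', of "f x"] fZ[OF that] by simp
  ultimately show ?thesis using fB BZ by fastforce
 qed
 note d = quotient_dim[OF sB' fin]
 from first_iso[OF V Q(1) l s k d(1)] d(2)
 show "findim (subquotient V Z B)"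
  "vdim (subquotient V Z B) + vdim (V'\<langle>B'\<rangle>)
   = vdim (V'\<langle>Z'\<rangle>)"
  by (simp_all add: subquotient_def)
qed

subsection \<open>Spaces of functions\<close>

definition fun_space :: "'i set \<Rightarrow> ('k, 'v, 'z) module_scheme \<Rightarrow> ('k, 'i \<Rightarrow> 'v) module" where
 "fun_space X V = \<lparr>carrier = X \<rightarrow>\<^sub>E carrier V, monoid.mult = undefined, monoid.one = undefined,
   ring.zero = (\<lambda>x\<in>X. \<zero>\<^bsub>V\<^esub>), add = (\<lambda>f g. \<lambda>x\<in>X. f x \<oplus>\<^bsub>V\<^esub> g x), smult = (\<lambda>c f. \<lambda>x\<in>X. c \<odot>\<^bsub>V\<^esub> f x)\<rparr>"

lemma fun_space_simps [simp]:
 "carrier (fun_space X V) = X \<rightarrow>\<^sub>E carrier V" "\<zero>\<^bsub>fun_space X V\<^esub> = (\<lambda>x\<in>X. \<zero>\<^bsub>V\<^esub>)"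
 "f \<oplus>\<^bsub>fun_space X V\<^esub> g = (\<lambda>x\<in>X. f x \<oplus>\<^bsub>V\<^esub> g x)" "c \<odot>\<^bsub>fun_space X V\<^esub> f = (\<lambda>x\<in>X. c \<odot>\<^bsub>V\<^esub> f x)"
 by (simp_all add: fun_space_def)

lemma fun_space_vs:
 assumes V: "vectorspace K V"
 shows "vectorspace K (fun_space X V)"
proof (rule vsI)
 note [simp] = V
 have m: "f x <: V" if "f <: (fun_space X V)" "x \<in> X" for f x using that by auto
 have r: "f = (\<lambda>x\<in>X. g x)" if "f <: (fun_space X V)" "\<And>x. x \<in> X ==> f x = g x" for f g
  using that by (auto simp: PiE_def extensional_def fun_eq_iff)
 show "f \<oplus>\<^bsub>fun_space X V\<^esub> g = g \<oplus>\<^bsub>fun_space X V\<^esub> f"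
  if "f <: (fun_space X V)" "g <: (fun_space X V)" for f g
  using m[OF that(1)] m[OF that(2)] by (auto simp: vs_comm fun_eq_iff)
 show "f \<oplus>\<^bsub>fun_space X V\<^esub> g \<oplus>\<^bsub>fun_space X V\<^esub> h = f \<oplus>\<^bsub>fun_space X V\<^esub> (g \<oplus>\<^bsub>fun_space X V\<^esub> h)"
  if "f <: (fun_space X V)" "g <: (fun_space X V)" "h <: (fun_space X V)" for f g h
  using m[OF that(1)] m[OF that(2)] m[OF that(3)] by (auto simp: vs_assoc fun_eq_iff)
 show "f \<oplus>\<^bsub>fun_space X V\<^esub> \<zero>\<^bsub>fun_space X V\<^esub> = f" if f: "f <: (fun_space X V)" for f
  using m[OF f] by (simp, intro r[OF f, symmetric]) auto
 show "f \<oplus>\<^bsub>fun_space X V\<^esub> \<ominus> \<one> \<odot>\<^bsub>fun_space X V\<^esub> f = \<zero>\<^bsub>fun_space X V\<^esub>"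
  if f: "f <: (fun_space X V)" for f
  using m[OF f] by (auto simp: fun_eq_iff)
 show "\<one> \<odot>\<^bsub>fun_space X V\<^esub> f = f" if f: "f <: (fun_space X V)" for f
  using m[OF f] by (simp, intro r[OF f, symmetric]) auto
 show "(a \<otimes> b) \<odot>\<^bsub>fun_space X V\<^esub> f = a \<odot>\<^bsub>fun_space X V\<^esub> (b \<odot>\<^bsub>fun_space X V\<^esub> f)"
  if "a <: K" "b <: K" "f <: (fun_space X V)" for a b f
  using that m[OF that(3)] by (auto simp: vs_smult_smult fun_eq_iff)
 show "(a \<oplus> b) \<odot>\<^bsub>fun_space X V\<^esub> f = a \<odot>\<^bsub>fun_space X V\<^esub> f \<oplus>\<^bsub>fun_space X V\<^esub> b \<odot>\<^bsub>fun_space X V\<^esub> f"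
  if "a <: K" "b <: K" "f <: (fun_space X V)" for a b f
  using that m[OF that(3)] by (auto simp: vs_add_smult fun_eq_iff)
 show "a \<odot>\<^bsub>fun_space X V\<^esub> (f \<oplus>\<^bsub>fun_space X V\<^esub> g) = a \<odot>\<^bsub>fun_space X V\<^esub> f \<oplus>\<^bsub>fun_space X V\<^esub> a \<odot>\<^bsub>fun_space X V\<^esub> g"
  if "a <: K" "f <: (fun_space X V)" "g <: (fun_space X V)" for a f g
  using that m[OF that(2)] m[OF that(3)] by (auto simp: vs_smult_add fun_eq_iff)
qed (use V in \<open>auto intro!: vs_add vs_smult[OF V] dest: PiE_mem\<close>)

definition lin_space :: "('k, 'u, 'y) module_scheme \<Rightarrow> ('k, 'v, 'z) module_scheme \<Rightarrow> ('k, 'u \<Rightarrow> 'v) module" where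
 "lin_space U V = (fun_space (carrier U) V)\<langle>lin K U V \<inter> extensional (carrier U)\<rangle>"

lemma lin_space_simps [simp]:
 "carrier (lin_space U V) = lin K U V \<inter> extensional (carrier U)"
 "\<zero>\<^bsub>lin_space U V\<^esub> = (\<lambda>x\<in>carrier U. \<zero>\<^bsub>V\<^esub>)"
 "f \<oplus>\<^bsub>lin_space U V\<^esub> g = (\<lambda>x\<in>carrier U. f x \<oplus>\<^bsub>V\<^esub> g x)"
 "c \<odot>\<^bsub>lin_space U V\<^esub> f = (\<lambda>x\<in>carrier U. c \<odot>\<^bsub>V\<^esub> f x)"
 by (simp_all add: lin_space_def)

lemma lin_restrict:
 assumes "vectorspace K U" "f \<in> lin K U V"
 shows "restrict f (carrier U) <: (lin_space U V)"
 using assms by (auto intro!: linI simp: linD[OF assms(2)])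

lemma lin_space_vs:
 assumes U: "vectorspace K U" and V: "vectorspace K V"
 shows "vectorspace K (lin_space U V)"
 unfolding lin_space_def
proof (rule sub_vs, rule subI[OF fun_space_vs[OF V]])
 show "lin K U V \<inter> extensional (carrier U) \<subseteq> carrier (fun_space (carrier U) V)"
  using linD(1) by (fastforce simp: PiE_def)
 show "\<zero>\<^bsub>fun_space (carrier U) V\<^esub> \<in> lin K U V \<inter> extensional (carrier U)"
  using U V by (auto intro!: linI)
 show "f \<oplus>\<^bsub>fun_space (carrier U) V\<^esub> g \<in> lin K U V \<inter> extensional (carrier U)"
  if "f \<in> lin K U V \<inter> extensional (carrier U)" "g \<in> lin K U V \<inter> extensional (carrier U)" for f g
 proof -
  have "f \<in> lin K U V" "g \<in> lin K U V" using that by auto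
  note f = linD[OF this(1)] and g = linD[OF this(2)]
  show ?thesis using f g U V by (auto intro!: linI simp: vs_smult_add vs_ac)
 qed
 show "c \<odot>\<^bsub>fun_space (carrier U) V\<^esub> f \<in> lin K U V \<inter> extensional (carrier U)"
  if c: "c <: K" and "f \<in> lin K U V \<inter> extensional (carrier U)" for c f
 proof -
  have "f \<in> lin K U V" using that by auto
  note f = linD[OF this]
  show ?thesis using f c U V by (auto intro!: linI simp: vs_smult_add vs_smult_smult m_comm)
 qed
qed

lemma fun_finsum_apply:
 assumes U: "vectorspace K U" and V: "vectorspace K V" and F: "F \<in> I \<rightarrow> carrier (lin_space U V)" and x: "x <: U"
 shows "(\<Oplus>\<^bsub>lin_space U V\<^esub> i\<in>I. F i) x = (\<Oplus>\<^bsub>V\<^esub> i\<in>I. F i x)"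
proof -
 have e: "(\<lambda>f. f x) \<in> lin K (lin_space U V) V"
  using x by (intro linI) (auto simp: linD(1))
 show ?thesis using lin_finsum[OF lin_space_vs[OF U V] V e F] .
qed

text \<open>These are the matrix units for the two bases, with the functionals that read off matrix
  entries.\<close>

lemma lin_space_basis:
 assumes U: "vectorspace K U" and V: "vectorspace K V"
  and B: "has_basis U I b c" and B': "has_basis V J b' c'"
 shows "has_basis (lin_space U V) (I \<times> J) (\<lambda>(i, j). \<lambda>u\<in>carrier U. c i u \<odot>\<^bsub>V\<^esub> b' j) (\<lambda>(i, j) f. c' j (f (b i)))"
 unfolding has_basis_def
proof (intro conjI ballI)
 note b = has_basisD[OF B] and b' = has_basisD[OF B']
 interpret V: vectorspace K V by (rule V)
 interpret L: vectorspace K "lin_space U V" by (rule lin_space_vs[OF U V])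
 have mem: "(\<lambda>u\<in>carrier U. c i u \<odot>\<^bsub>V\<^esub> b' j) <: (lin_space U V)" if "i \<in> I" "j \<in> J" for i j
 proof (rule lin_restrict[OF U])
  show "(\<lambda>u. c i u \<odot>\<^bsub>V\<^esub> b' j) \<in> lin K U V"
   using that b(6)[OF that(1)] b'(2)[OF that(2)] linD[OF b(3)[OF that(1)]] V
   by (intro linI) (simp_all add: vs_add_smult vs_smult_smult)
 qed
 show "finite (I \<times> J)" using b b' by simp
 show "(case p of (i, j) \<Rightarrow> \<lambda>u\<in>carrier U. c i u \<odot>\<^bsub>V\<^esub> b' j) <: (lin_space U V)" if "p \<in> I \<times> J" for p
  using that mem by (cases p) (auto simp del: lin_space_simps)
 show "(case p of (i, j) \<Rightarrow> \<lambda>f. c' j (f (b i))) \<in> lin K (lin_space U V) scal" if pIJ: "p \<in> I \<times> J" for p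
 proof -
  obtain i j where p: "p = (i, j)" "i \<in> I" "j \<in> J" using pIJ by auto
  have bi: "b i <: U" using b p by simp
  have "(\<lambda>f. c' j (f (b i))) \<in> lin K (lin_space U V) scal"
  proof (rule linI)
   fix f g k assume f: "f <: (lin_space U V)"
   then have fb: "f (b i) <: V" using linD(1) bi by fastforce
   then show "c' j (f (b i)) <: scal" using b'(6) p by simp
   show "c' j ((f \<oplus>\<^bsub>lin_space U V\<^esub> g) (b i)) = c' j (f (b i)) \<oplus>\<^bsub>scal\<^esub> c' j (g (b i))"
    if g: "g <: (lin_space U V)"
   proof -
    have "g (b i) <: V" using linD(1) bi g by fastforce
    then show ?thesis using fb linD(2)[OF b'(3)[OF p(3)]] bi by simp
   qed
   show "c' j ((k \<odot>\<^bsub>lin_space U V\<^esub> f) (b i)) = k \<odot>\<^bsub>scal\<^esub> c' j (f (b i))" if "k <: K"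
    using fb linD(3)[OF b'(3)[OF p(3)]] bi that by simp
  qed
  then show ?thesis using p by simp
 qed
 show "(case p of (i, j) \<Rightarrow> \<lambda>f. c' j (f (b i))) (case q of (i, j) \<Rightarrow> \<lambda>u\<in>carrier U. c i u \<odot>\<^bsub>V\<^esub> b' j)
   = (if p = q then \<one> else \<zero>)" if pq: "p \<in> I \<times> J" "q \<in> I \<times> J" for p q
 proof -
  obtain i j i' j' where p: "p = (i, j)" "i \<in> I" "j \<in> J" and q: "q = (i', j')" "i' \<in> I" "j' \<in> J"
   using pq by auto
  have "c' j (c i' (b i) \<odot>\<^bsub>V\<^esub> b' j') = c i' (b i) \<otimes> c' j (b' j')"
   using linD(3)[OF b'(3)[OF p(3)], of "c i' (b i)" "b' j'"] b b' p q by simp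
  then show ?thesis using p q b b' by auto
 qed
 fix f assume f: "f <: (lin_space U V)"
 then have fl: "f \<in> lin K U V" by simp
 have fb: "f (b i) <: V" if "i \<in> I" for i using linD(1)[OF fl] b(2) that by simp
 let ?S = "\<Oplus>\<^bsub>lin_space U V\<^esub> p\<in>I \<times> J. (case p of (i, j) \<Rightarrow> \<lambda>f. c' j (f (b i))) f
   \<odot>\<^bsub>lin_space U V\<^esub> (case p of (i, j) \<Rightarrow> \<lambda>u\<in>carrier U. c i u \<odot>\<^bsub>V\<^esub> b' j)"
 have m: "(\<lambda>p. (case p of (i, j) \<Rightarrow> \<lambda>f. c' j (f (b i))) f
   \<odot>\<^bsub>lin_space U V\<^esub> (case p of (i, j) \<Rightarrow> \<lambda>u\<in>carrier U. c i u \<odot>\<^bsub>V\<^esub> b' j)) \<in> I \<times> J \<rightarrow> carrier (lin_space U V)"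
  using fb b'(6) by (intro Pi_I) (auto intro!: vs_smult[OF lin_space_vs[OF U V]] mem simp del: lin_space_simps)
 have SL: "?S <: (lin_space U V)" using m by (rule L.M.finsum_closed)
 have Sb: "?S (b i) = f (b i)" if i: "i \<in> I" for i
 proof -
  have bi: "b i <: U" using b i by simp
  have "?S (b i) = (\<Oplus>\<^bsub>V\<^esub> p\<in>I \<times> J. ((case p of (i, j) \<Rightarrow> \<lambda>f. c' j (f (b i))) f
   \<odot>\<^bsub>lin_space U V\<^esub> (case p of (i, j) \<Rightarrow> \<lambda>u\<in>carrier U. c i u \<odot>\<^bsub>V\<^esub> b' j)) (b i))"
   by (rule fun_finsum_apply[OF U V m bi])
  also have "\<dots> = (\<Oplus>\<^bsub>V\<^esub> p\<in>(\<lambda>j. (i, j)) ` J. c' (snd p) (f (b (fst p))) \<odot>\<^bsub>V\<^esub> (c (fst p) (b i) \<odot>\<^bsub>V\<^esub> b' (snd p)))"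
   using b b' i bi fb V by (intro V.M.add.finprod_mono_neutral_cong_right) auto
  also have "\<dots> = (\<Oplus>\<^bsub>V\<^esub> j\<in>J. c' j (f (b i)) \<odot>\<^bsub>V\<^esub> (c i (b i) \<odot>\<^bsub>V\<^esub> b' j))"
   using b(5)[OF i i] b'(2,6) fb[OF i] V
   by (subst V.M.finsum_reindex) (auto intro!: inj_onI)
  also have "\<dots> = (\<Oplus>\<^bsub>V\<^esub> j\<in>J. c' j (f (b i)) \<odot>\<^bsub>V\<^esub> b' j)"
   using b(5)[OF i i] b'(2,6) fb[OF i] V by (intro V.M.finsum_cong') auto
  also have "\<dots> = f (b i)" using b'(4) fb[OF i] by simp
  finally show ?thesis .
 qed
 show "?S = f"
 proof (rule extensionalityI)
  show "?S \<in> extensional (carrier U)" "f \<in> extensional (carrier U)" using SL f by auto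
  fix x assume x: "x <: U"
  have "?S x = (\<Oplus>\<^bsub>V\<^esub> i\<in>I. c i x \<odot>\<^bsub>V\<^esub> ?S (b i))" using lin_eq_on_basis[OF U V B _ x, of ?S] SL by simp
  also have "\<dots> = (\<Oplus>\<^bsub>V\<^esub> i\<in>I. c i x \<odot>\<^bsub>V\<^esub> f (b i))"
   using Sb fb b(6) x V by (intro V.M.finsum_cong') auto
  also have "\<dots> = f x" using lin_eq_on_basis[OF U V B fl x] by simp
  finally show "?S x = f x" .
 qed
qed

lemma scal_basis: "has_basis scal {()} (\<lambda>_. \<one>) (\<lambda>_ x. x)"
proof -
 interpret S: vectorspace K scal by (rule scal_vs)
 have "(\<Oplus>\<^bsub>scal\<^esub>i\<in>{()}. v \<odot>\<^bsub>scal\<^esub> \<one>) = v" if "v <: K" for v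
  using S.M.finsum_insert[of "{}" "()" "\<lambda>_. v \<odot>\<^bsub>scal\<^esub> \<one>"] that by simp
 then show ?thesis by (auto simp: has_basis_def intro!: linI)
qed

lemma scal_dim: "findim scal" "vdim scal = 1"
 using basis_dim[OF scal_vs scal_basis] by auto

lemma lin_space_dim:
 assumes U: "vectorspace K U" and V: "vectorspace K V"
  and f: "findim U" "findim V"
 shows "findim (lin_space U V)"
  "vdim (lin_space U V) = vdim U * vdim V"
proof -
 obtain b c b' c' where B: "has_basis U {..<vdim U} b c" "has_basis V {..<vdim V} b' c'"
  using basis_exists[OF U f(1)] basis_exists[OF V f(2)] by blast
 from basis_dim[OF lin_space_vs[OF U V] lin_space_basis[OF U V this]]
 show "findim (lin_space U V)"
  "vdim (lin_space U V) = vdim U * vdim V"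
  by (simp_all add: card_cartesian_product)
qed

lemma dual_dim:
 assumes "vectorspace K U" "findim U"
 shows "findim (lin_space U scal)"
  "vdim (lin_space U scal) = vdim U"
 using lin_space_dim[OF assms(1) scal_vs assms(2) scal_dim(1)] scal_dim(2) by simp_all

end

context base_field
begin

subsection \<open>Finitely supported functions\<close>

text \<open>A property of a given record rather than a construction, because
  \<open>free_space K X\<close> and \<open>free_rmod A I\<close> are different records of the same
  shape (coefficients in \<open>scal\<close> and in A). Induction, extension and bases are proved
  once for both.\<close>

definition fs_space :: "('k, 'i \<Rightarrow> 'v, 'y) module_scheme \<Rightarrow> ('k, 'v, 'z) module_scheme \<Rightarrow> 'i set \<Rightarrow> bool" where
 "fs_space F V I \<longleftrightarrow>
   carrier F = {f. (\<forall>i. f i <: V) \<and> (\<forall>i. i \<notin> I \<longrightarrow> f i = \<zero>\<^bsub>V\<^esub>) \<and> finite {i. f i \<noteq> \<zero>\<^bsub>V\<^esub>}} \<and>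
   \<zero>\<^bsub>F\<^esub> = (\<lambda>i. \<zero>\<^bsub>V\<^esub>) \<and> add F = (\<lambda>f g i. f i \<oplus>\<^bsub>V\<^esub> g i) \<and> smult F = (\<lambda>c f i. c \<odot>\<^bsub>V\<^esub> f i)"

definition single :: "('k, 'v, 'z) module_scheme \<Rightarrow> 'i \<Rightarrow> 'v \<Rightarrow> 'i \<Rightarrow> 'v" where
 "single V j a = (\<lambda>i. if i = j then a else \<zero>\<^bsub>V\<^esub>)"

lemma fs_vs:
 assumes V: "vectorspace K V" and F: "fs_space F V I"
 shows "vectorspace K F"
proof (rule vs_embed[OF fun_space_vs[OF V, of UNIV], where f="\<lambda>f. f"])
 show "f \<oplus>\<^bsub>F\<^esub> g <: F" if "f <: F" "g <: F" for f g
 proof -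
  have "{i. f i \<oplus>\<^bsub>V\<^esub> g i \<noteq> \<zero>\<^bsub>V\<^esub>} \<subseteq> {i. f i \<noteq> \<zero>\<^bsub>V\<^esub>} \<union> {i. g i \<noteq> \<zero>\<^bsub>V\<^esub>}" using V by auto
  then have "finite {i. f i \<oplus>\<^bsub>V\<^esub> g i \<noteq> \<zero>\<^bsub>V\<^esub>}"
   using that F by (auto simp: fs_space_def intro: finite_subset)
  then show ?thesis using that F V by (auto simp: fs_space_def)
 qed
 show "c \<odot>\<^bsub>F\<^esub> f <: F" if "c <: K" "f <: F" for c f
 proof -
  have "{i. c \<odot>\<^bsub>V\<^esub> f i \<noteq> \<zero>\<^bsub>V\<^esub>} \<subseteq> {i. f i \<noteq> \<zero>\<^bsub>V\<^esub>}" using V that by auto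
  then have "finite {i. c \<odot>\<^bsub>V\<^esub> f i \<noteq> \<zero>\<^bsub>V\<^esub>}"
   using that F by (auto simp: fs_space_def intro: finite_subset)
  then show ?thesis using that F V by (auto simp: fs_space_def)
 qed
qed (use F V in \<open>auto simp: fs_space_def\<close>)

lemma single_mem:
 assumes V: "vectorspace K V" and F: "fs_space F V I" and "i \<in> I" "a <: V"
 shows "single V i a <: F"
proof -
 have "{j. single V i a j \<noteq> \<zero>\<^bsub>V\<^esub>} \<subseteq> {i}" by (auto simp: single_def)
 then have "finite {j. single V i a j \<noteq> \<zero>\<^bsub>V\<^esub>}" by (rule finite_subset) simp
 then show ?thesis using assms by (auto simp: fs_space_def single_def)
qed

lemma single_lin:
 assumes V: "vectorspace K V" and F: "fs_space F V I" and i: "i \<in> I"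
 shows "single V i \<in> lin K V F"
 by (rule linI) (use single_mem[OF V F i] V F in \<open>auto simp: fs_space_def single_def fun_eq_iff\<close>)

text \<open>Induction on the size of the support, splitting off one nonzero coordinate.\<close>

lemma fs_induct [consumes 3, case_names zero add single]:
 assumes V: "vectorspace K V" and F: "fs_space F V I" and f: "f <: F"
  and z: "P \<zero>\<^bsub>F\<^esub>" and a: "\<And>f g. f <: F ==> g <: F ==> P f ==> P g ==> P (f \<oplus>\<^bsub>F\<^esub> g)"
  and s: "\<And>i x. i \<in> I ==> x <: V ==> P (single V i x)"
 shows "P f"
 using f
proof (induction "card {i. f i \<noteq> \<zero>\<^bsub>V\<^esub>}" arbitrary: f)
 case 0
 then have "f = (\<lambda>i. \<zero>\<^bsub>V\<^esub>)" using F by (auto simp: fs_space_def fun_eq_iff)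
 then show ?case using z F by (simp add: fs_space_def)
next
 case (Suc n)
 have fin: "finite {i. f i \<noteq> \<zero>\<^bsub>V\<^esub>}" and fV: "\<And>i. f i <: V" and fI: "\<And>i. i \<notin> I ==> f i = \<zero>\<^bsub>V\<^esub>"
  using Suc.prems F by (auto simp: fs_space_def)
 obtain j where j: "f j \<noteq> \<zero>\<^bsub>V\<^esub>" using Suc.hyps(2) by (metis (mono_tags, lifting) Collect_empty_eq Suc_not_Zero card.empty)
 define g where "g = f(j := \<zero>\<^bsub>V\<^esub>)"
 have supp: "{i. g i \<noteq> \<zero>\<^bsub>V\<^esub>} = {i. f i \<noteq> \<zero>\<^bsub>V\<^esub>} - {j}" by (auto simp: g_def)
 then have "card {i. g i \<noteq> \<zero>\<^bsub>V\<^esub>} = n" using Suc.hyps(2) fin j by simp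
 moreover have g: "g <: F" using F V fV fI fin supp by (auto simp: fs_space_def g_def)
 ultimately have "P g" using Suc.hyps(1) by blast
 have jI: "j \<in> I" using fI j by blast
 have f: "f = single V j (f j) \<oplus>\<^bsub>F\<^esub> g"
  using F V fV by (auto simp: fs_space_def g_def single_def fun_eq_iff)
 show ?case
  by (subst f) (rule a[OF single_mem[OF V F jI fV[of j]] g s[OF jI fV[of j]] \<open>P g\<close>])
qed

lemma fs_lin_eq:
 assumes V: "vectorspace K V" and F: "fs_space F V I" and W: "vectorspace K W"
  and t: "t \<in> lin K F W" "t' \<in> lin K F W"
  and e: "\<And>i x. i \<in> I ==> x <: V ==> t (single V i x) = t' (single V i x)" and f: "f <: F"
 shows "t f = t' f"
 using V F f
proof (induction rule: fs_induct)
 case zero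
 then show ?case using lin_zero[OF fs_vs[OF V F] W t(1)] lin_zero[OF fs_vs[OF V F] W t(2)] by simp
qed (use linD[OF t(1)] linD[OF t(2)] e in auto)

lemma fs_lift:
 assumes V: "vectorspace K V" and F: "fs_space F V I" and W: "vectorspace K W"
  and g: "\<And>i. i \<in> I ==> g i \<in> lin K V W"
 shows "(\<lambda>f. \<Oplus>\<^bsub>W\<^esub> i\<in>{i. f i \<noteq> \<zero>\<^bsub>V\<^esub>}. g i (f i)) \<in> lin K F W"
  and "\<And>i x. i \<in> I ==> x <: V
   ==> (\<Oplus>\<^bsub>W\<^esub> j\<in>{j. single V i x j \<noteq> \<zero>\<^bsub>V\<^esub>}. g j (single V i x j)) = g i x"
proof -
 interpret W: vectorspace K W by (rule W)
 have supp: "{i. f i \<noteq> \<zero>\<^bsub>V\<^esub>} \<subseteq> I" "finite {i. f i \<noteq> \<zero>\<^bsub>V\<^esub>}" "\<And>i. f i <: V"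
  if "f <: F" for f using that F by (auto simp: fs_space_def)
 have gz: "g i \<zero>\<^bsub>V\<^esub> = \<zero>\<^bsub>W\<^esub>" if "i \<in> I" for i using lin_zero[OF V W g[OF that]] .
 have gW: "g i x <: W" if "i \<in> I" "x <: V" for i x using linD(1)[OF g] that by simp
 \<comment> \<open>The sum runs over the support, which changes with f. Over a common finite
   superset of supports the sums become comparable, the extra terms being zero.\<close>
 have ext: "(\<Oplus>\<^bsub>W\<^esub> i\<in>{i. f i \<noteq> \<zero>\<^bsub>V\<^esub>}. g i (f i)) = (\<Oplus>\<^bsub>W\<^esub> i\<in>J. g i (f i))"
  if "f <: F" "finite J" "{i. f i \<noteq> \<zero>\<^bsub>V\<^esub>} \<subseteq> J" "J \<subseteq> I" for f J
  using that gz gW supp[OF that(1)] by (intro W.M.add.finprod_mono_neutral_cong_left) auto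
 show "(\<lambda>f. \<Oplus>\<^bsub>W\<^esub> i\<in>{i. f i \<noteq> \<zero>\<^bsub>V\<^esub>}. g i (f i)) \<in> lin K F W"
 proof (rule linI)
  fix f f' c assume f: "f <: F"
  note sf = supp[OF f]
  show "(\<Oplus>\<^bsub>W\<^esub> i\<in>{i. f i \<noteq> \<zero>\<^bsub>V\<^esub>}. g i (f i)) <: W"
   using sf gW by (intro W.M.finsum_closed) auto
  show "(\<Oplus>\<^bsub>W\<^esub> i\<in>{i. (f \<oplus>\<^bsub>F\<^esub> f') i \<noteq> \<zero>\<^bsub>V\<^esub>}. g i ((f \<oplus>\<^bsub>F\<^esub> f') i))
   = (\<Oplus>\<^bsub>W\<^esub> i\<in>{i. f i \<noteq> \<zero>\<^bsub>V\<^esub>}. g i (f i)) \<oplus>\<^bsub>W\<^esub> (\<Oplus>\<^bsub>W\<^esub> i\<in>{i. f' i \<noteq> \<zero>\<^bsub>V\<^esub>}. g i (f' i))"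
   if f': "f' <: F"
  proof -
   note sf' = supp[OF f']
   let ?J = "{i. f i \<noteq> \<zero>\<^bsub>V\<^esub>} \<union> {i. f' i \<noteq> \<zero>\<^bsub>V\<^esub>}"
   have J: "finite ?J" "?J \<subseteq> I" using sf sf' by auto
   have ff: "f \<oplus>\<^bsub>F\<^esub> f' <: F" using fs_vs[OF V F] f f' by simp
   have app: "(f \<oplus>\<^bsub>F\<^esub> f') i = f i \<oplus>\<^bsub>V\<^esub> f' i" for i using F by (simp add: fs_space_def)
   have sub: "{i. (f \<oplus>\<^bsub>F\<^esub> f') i \<noteq> \<zero>\<^bsub>V\<^esub>} \<subseteq> ?J" unfolding app using V by auto
   have "(\<Oplus>\<^bsub>W\<^esub> i\<in>?J. g i ((f \<oplus>\<^bsub>F\<^esub> f') i)) = (\<Oplus>\<^bsub>W\<^esub> i\<in>?J. g i (f i) \<oplus>\<^bsub>W\<^esub> g i (f' i))"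
    using J gW sf(3) sf'(3) linD(2)[OF g] by (intro W.M.finsum_cong') (auto simp: app)
   also have "\<dots> = (\<Oplus>\<^bsub>W\<^esub> i\<in>?J. g i (f i)) \<oplus>\<^bsub>W\<^esub> (\<Oplus>\<^bsub>W\<^esub> i\<in>?J. g i (f' i))"
    using J gW sf(3) sf'(3) by (intro W.M.finsum_addf) auto
   finally show ?thesis using ext[OF ff J(1) sub J(2)] ext[OF f J(1) _ J(2)] ext[OF f' J(1) _ J(2)] by simp
  qed
  show "(\<Oplus>\<^bsub>W\<^esub> i\<in>{i. (c \<odot>\<^bsub>F\<^esub> f) i \<noteq> \<zero>\<^bsub>V\<^esub>}. g i ((c \<odot>\<^bsub>F\<^esub> f) i))
   = c \<odot>\<^bsub>W\<^esub> (\<Oplus>\<^bsub>W\<^esub> i\<in>{i. f i \<noteq> \<zero>\<^bsub>V\<^esub>}. g i (f i))" if c: "c <: K"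
  proof -
   let ?J = "{i. f i \<noteq> \<zero>\<^bsub>V\<^esub>}"
   have cf: "c \<odot>\<^bsub>F\<^esub> f <: F" using fs_vs[OF V F] f c by simp
   have app: "(c \<odot>\<^bsub>F\<^esub> f) i = c \<odot>\<^bsub>V\<^esub> f i" for i using F by (simp add: fs_space_def)
   have sub: "{i. (c \<odot>\<^bsub>F\<^esub> f) i \<noteq> \<zero>\<^bsub>V\<^esub>} \<subseteq> ?J" unfolding app using V c by auto
   have "(\<Oplus>\<^bsub>W\<^esub> i\<in>?J. g i ((c \<odot>\<^bsub>F\<^esub> f) i)) = (\<Oplus>\<^bsub>W\<^esub> i\<in>?J. c \<odot>\<^bsub>W\<^esub> g i (f i))"
    using sf gW W c linD(3)[OF g] by (intro W.M.finsum_cong') (auto simp: app)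
   also have "\<dots> = c \<odot>\<^bsub>W\<^esub> (\<Oplus>\<^bsub>W\<^esub> i\<in>?J. g i (f i))"
    using sf gW c by (intro W.finsum_smult[symmetric]) auto
   finally show ?thesis using ext[OF cf sf(2) sub sf(1)] by simp
  qed
 qed
 show "(\<Oplus>\<^bsub>W\<^esub> j\<in>{j. single V i x j \<noteq> \<zero>\<^bsub>V\<^esub>}. g j (single V i x j)) = g i x"
  if i: "i \<in> I" and x: "x <: V" for i x
 proof -
  have "(\<Oplus>\<^bsub>W\<^esub> j\<in>{j. single V i x j \<noteq> \<zero>\<^bsub>V\<^esub>}. g j (single V i x j)) = (\<Oplus>\<^bsub>W\<^esub> j\<in>{i}. g j (single V i x j))"
   by (rule ext[OF single_mem[OF V F i x]]) (use i in \<open>auto simp: single_def\<close>)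
  also have "\<dots> = g i x" using gW[OF i x] by (simp add: single_def W.M.finsum_insert[of "{}"])
  finally show ?thesis .
 qed
qed

lemma fs_basis:
 assumes V: "vectorspace K V" and F: "fs_space F V I" and I: "finite I" and B: "has_basis V J b c"
 shows "has_basis F (I \<times> J) (\<lambda>(i, j). single V i (b j)) (\<lambda>(i, j) f. c j (f i))"
 unfolding has_basis_def
proof (intro conjI ballI)
 note b = has_basisD[OF B]
 note Fv = fs_vs[OF V F]
 interpret V: vectorspace K V by (rule V)
 interpret F: vectorspace K F by (rule Fv)
 have ev: "(\<lambda>f. f i) \<in> lin K F V" for i by (rule linI) (use F in \<open>auto simp: fs_space_def\<close>)
 show "finite (I \<times> J)" using I b by simp
 show "(case p of (i, j) \<Rightarrow> single V i (b j)) <: F" if "p \<in> I \<times> J" for p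
  using that single_mem[OF V F] b by auto
 show "(case p of (i, j) \<Rightarrow> \<lambda>f. c j (f i)) \<in> lin K F scal" if "p \<in> I \<times> J" for p
  using that lin_comp[OF ev b(3)] by (cases p) simp
 show "(case p of (i, j) \<Rightarrow> \<lambda>f. c j (f i)) (case q of (i, j) \<Rightarrow> single V i (b j)) = (if p = q then \<one> else \<zero>)"
  if "p \<in> I \<times> J" "q \<in> I \<times> J" for p q
  using that b lin_zero[OF V scal_vs b(3)] by (cases p; cases q) (auto simp: single_def)
 fix f assume f: "f <: F"
 have fV: "f i <: V" for i using f F by (auto simp: fs_space_def)
 let ?S = "\<Oplus>\<^bsub>F\<^esub> p\<in>I \<times> J. (case p of (i, j) \<Rightarrow> \<lambda>f. c j (f i)) f \<odot>\<^bsub>F\<^esub> (case p of (i, j) \<Rightarrow> single V i (b j))"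
 have m: "(\<lambda>p. (case p of (i, j) \<Rightarrow> \<lambda>f. c j (f i)) f \<odot>\<^bsub>F\<^esub> (case p of (i, j) \<Rightarrow> single V i (b j))) \<in> I \<times> J \<rightarrow> carrier F"
  using b fV single_mem[OF V F] Fv by auto
 have app: "(k \<odot>\<^bsub>F\<^esub> h) i = k \<odot>\<^bsub>V\<^esub> h i" for k h i using F by (simp add: fs_space_def)
 show "?S = f"
 proof
  fix i
  have e: "?S i = (\<Oplus>\<^bsub>V\<^esub> p\<in>I \<times> J. c (snd p) (f (fst p)) \<odot>\<^bsub>V\<^esub> single V (fst p) (b (snd p)) i)"
   using lin_finsum[OF Fv V ev m, of i] by (simp add: app case_prod_unfold)
  show "?S i = f i"
  proof (cases "i \<in> I")
   case False
   have "?S <: F" using m by (rule F.M.finsum_closed)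
   then show ?thesis using False f F by (simp add: fs_space_def)
  next
   case True
   have "?S i = (\<Oplus>\<^bsub>V\<^esub> p\<in>(\<lambda>j. (i, j)) ` J. c (snd p) (f (fst p)) \<odot>\<^bsub>V\<^esub> single V (fst p) (b (snd p)) i)"
    unfolding e using b fV V I True by (intro V.M.add.finprod_mono_neutral_cong_right) (auto simp: single_def)
   also have "\<dots> = (\<Oplus>\<^bsub>V\<^esub> j\<in>J. c j (f i) \<odot>\<^bsub>V\<^esub> b j)"
    using b fV V by (subst V.M.finsum_reindex) (auto intro!: inj_onI simp: single_def)
   finally show ?thesis using b(4)[OF fV] by simp
  qed
 qed
qed

lemma fs_fin:
 assumes V: "vectorspace K V" and F: "fs_space F V I" and I: "finite I" and fin: "findim V"
 shows "findim F"
proof -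
 obtain b c where "has_basis V {..<vdim V} b c" using basis_exists[OF V fin] by blast
 from basis_dim(1)[OF fs_vs[OF V F] fs_basis[OF V F I this]] show ?thesis .
qed

end

section \<open>Modules over an algebra\<close>

lemma as_rmod_simps [simp]:
 "carrier (as_rmod M r) = carrier M" "\<zero>\<^bsub>as_rmod M r\<^esub> = \<zero>\<^bsub>M\<^esub>" "add (as_rmod M r) = add M"
 "smult (as_rmod M r) = smult M" "ract (as_rmod M r) = r"
 by (simp_all add: as_rmod_def module.defs rmod.defs)

lemma as_lmod_simps [simp]:
 "carrier (as_lmod M l) = carrier M" "\<zero>\<^bsub>as_lmod M l\<^esub> = \<zero>\<^bsub>M\<^esub>" "add (as_lmod M l) = add M"
 "smult (as_lmod M l) = smult M" "lact (as_lmod M l) = l"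
 by (simp_all add: as_lmod_def module.defs lmod.defs)

locale alg_over = base_field K for K :: "('k, 'x) ring_scheme" (structure) +
 fixes A :: "('k, 'a) module"
 assumes alg: "k_algebra K A"
begin

abbreviation rmodule where "rmodule \<equiv> right_module K A"

lemma alg_simps [simp]:
 "vectorspace K A" "ring A"
 "x <: A ==> y <: A ==> x \<otimes>\<^bsub>A\<^esub> y <: A"
 "\<one>\<^bsub>A\<^esub> <: A" "x <: A ==> \<one>\<^bsub>A\<^esub> \<otimes>\<^bsub>A\<^esub> x = x" "x <: A ==> x \<otimes>\<^bsub>A\<^esub> \<one>\<^bsub>A\<^esub> = x"
 "x <: A ==> x \<otimes>\<^bsub>A\<^esub> \<zero>\<^bsub>A\<^esub> = \<zero>\<^bsub>A\<^esub>" "x <: A ==> \<zero>\<^bsub>A\<^esub> \<otimes>\<^bsub>A\<^esub> x = \<zero>\<^bsub>A\<^esub>"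
 "c <: K ==> x <: A ==> y <: A ==> (c \<odot>\<^bsub>A\<^esub> x) \<otimes>\<^bsub>A\<^esub> y = c \<odot>\<^bsub>A\<^esub> (x \<otimes>\<^bsub>A\<^esub> y)"
 "c <: K ==> x <: A ==> y <: A ==> x \<otimes>\<^bsub>A\<^esub> (c \<odot>\<^bsub>A\<^esub> y) = c \<odot>\<^bsub>A\<^esub> (x \<otimes>\<^bsub>A\<^esub> y)"
proof -
 interpret A: k_algebra K A by (rule alg)
 show "vectorspace K A" "ring A" by unfold_locales
 show "x <: A ==> y <: A ==> x \<otimes>\<^bsub>A\<^esub> y <: A"
  "\<one>\<^bsub>A\<^esub> <: A" "x <: A ==> \<one>\<^bsub>A\<^esub> \<otimes>\<^bsub>A\<^esub> x = x" "x <: A ==> x \<otimes>\<^bsub>A\<^esub> \<one>\<^bsub>A\<^esub> = x"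
  "x <: A ==> x \<otimes>\<^bsub>A\<^esub> \<zero>\<^bsub>A\<^esub> = \<zero>\<^bsub>A\<^esub>" "x <: A ==> \<zero>\<^bsub>A\<^esub> \<otimes>\<^bsub>A\<^esub> x = \<zero>\<^bsub>A\<^esub>"
  by (simp_all add: A.ring.m_closed)
 show "c <: K ==> x <: A ==> y <: A ==> (c \<odot>\<^bsub>A\<^esub> x) \<otimes>\<^bsub>A\<^esub> y = c \<odot>\<^bsub>A\<^esub> (x \<otimes>\<^bsub>A\<^esub> y)"
  "c <: K ==> x <: A ==> y <: A ==> x \<otimes>\<^bsub>A\<^esub> (c \<odot>\<^bsub>A\<^esub> y) = c \<odot>\<^bsub>A\<^esub> (x \<otimes>\<^bsub>A\<^esub> y)"
  by (simp_all add: A.smult_mult_left A.smult_mult_right)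
qed

lemma alg_assoc: "x <: A ==> y <: A ==> z <: A ==>
  (x \<otimes>\<^bsub>A\<^esub> y) \<otimes>\<^bsub>A\<^esub> z = x \<otimes>\<^bsub>A\<^esub> (y \<otimes>\<^bsub>A\<^esub> z)"
 and alg_l_distr: "x <: A ==> y <: A ==> z <: A ==>
  (x \<oplus>\<^bsub>A\<^esub> y) \<otimes>\<^bsub>A\<^esub> z = x \<otimes>\<^bsub>A\<^esub> z \<oplus>\<^bsub>A\<^esub> y \<otimes>\<^bsub>A\<^esub> z"
 and alg_r_distr: "x <: A ==> y <: A ==> z <: A ==>
  z \<otimes>\<^bsub>A\<^esub> (x \<oplus>\<^bsub>A\<^esub> y) = z \<otimes>\<^bsub>A\<^esub> x \<oplus>\<^bsub>A\<^esub> z \<otimes>\<^bsub>A\<^esub> y"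
 using ring.ring_simprules[OF alg_simps(2)] by simp_all

lemmas alg_rules = alg_assoc alg_l_distr alg_r_distr

lemma rmodI:
 assumes "vectorspace K M"
  and "\<And>m a. m <: M ==> a <: A ==> ract M m a <: M"
  and "\<And>m a b. m <: M ==> a <: A ==> b <: A ==>
   ract M m (a \<oplus>\<^bsub>A\<^esub> b) = ract M m a \<oplus>\<^bsub>M\<^esub> ract M m b"
  and "\<And>m m' a. m <: M ==> m' <: M ==> a <: A ==>
   ract M (m \<oplus>\<^bsub>M\<^esub> m') a = ract M m a \<oplus>\<^bsub>M\<^esub> ract M m' a"
  and "\<And>c m a. c <: K ==> m <: M ==> a <: A ==>
   ract M m (c \<odot>\<^bsub>A\<^esub> a) = c \<odot>\<^bsub>M\<^esub> ract M m a"
  and "\<And>c m a. c <: K ==> m <: M ==> a <: A ==>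
   ract M (c \<odot>\<^bsub>M\<^esub> m) a = c \<odot>\<^bsub>M\<^esub> ract M m a"
  and "\<And>m a b. m <: M ==> a <: A ==> b <: A ==>
   ract M m (a \<otimes>\<^bsub>A\<^esub> b) = ract M (ract M m a) b"
  and "\<And>m. m <: M ==> ract M m \<one>\<^bsub>A\<^esub> = m"
 shows "rmodule M"
 using assms alg by (simp add: right_module_def right_module_axioms_def)

lemma lmodI:
 assumes "vectorspace K M"
  and "\<And>m a. m <: M ==> a <: A ==> lact M a m <: M"
  and "\<And>m a b. m <: M ==> a <: A ==> b <: A ==>
   lact M (a \<oplus>\<^bsub>A\<^esub> b) m = lact M a m \<oplus>\<^bsub>M\<^esub> lact M b m"
  and "\<And>m m' a. m <: M ==> m' <: M ==> a <: A ==>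
   lact M a (m \<oplus>\<^bsub>M\<^esub> m') = lact M a m \<oplus>\<^bsub>M\<^esub> lact M a m'"
  and "\<And>c m a. c <: K ==> m <: M ==> a <: A ==>
   lact M (c \<odot>\<^bsub>A\<^esub> a) m = c \<odot>\<^bsub>M\<^esub> lact M a m"
  and "\<And>c m a. c <: K ==> m <: M ==> a <: A ==>
   lact M a (c \<odot>\<^bsub>M\<^esub> m) = c \<odot>\<^bsub>M\<^esub> lact M a m"
  and "\<And>m a b. m <: M ==> a <: A ==> b <: A ==>
   lact M (a \<otimes>\<^bsub>A\<^esub> b) m = lact M a (lact M b m)"
  and "\<And>m. m <: M ==> lact M \<one>\<^bsub>A\<^esub> m = m"
 shows "left_module K A M"
 using assms alg by (simp add: left_module_def left_module_axioms_def)

lemma rmodD: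
 assumes "rmodule M"
 shows "vectorspace K M"
  "\<And>m a. m <: M ==> a <: A ==> ract M m a <: M"
  "\<And>m a b. m <: M ==> a <: A ==> b <: A ==>
   ract M m (a \<oplus>\<^bsub>A\<^esub> b) = ract M m a \<oplus>\<^bsub>M\<^esub> ract M m b"
  "\<And>m m' a. m <: M ==> m' <: M ==> a <: A ==>
   ract M (m \<oplus>\<^bsub>M\<^esub> m') a = ract M m a \<oplus>\<^bsub>M\<^esub> ract M m' a"
  "\<And>c m a. c <: K ==> m <: M ==> a <: A ==>
   ract M m (c \<odot>\<^bsub>A\<^esub> a) = c \<odot>\<^bsub>M\<^esub> ract M m a"
  "\<And>c m a. c <: K ==> m <: M ==> a <: A ==>
   ract M (c \<odot>\<^bsub>M\<^esub> m) a = c \<odot>\<^bsub>M\<^esub> ract M m a"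
  "\<And>m a b. m <: M ==> a <: A ==> b <: A ==>
   ract M (ract M m a) b = ract M m (a \<otimes>\<^bsub>A\<^esub> b)"
  "\<And>m. m <: M ==> ract M m \<one>\<^bsub>A\<^esub> = m"
  "\<And>a. a <: A ==> ract M \<zero>\<^bsub>M\<^esub> a = \<zero>\<^bsub>M\<^esub>"
  "\<And>m. m <: M ==> ract M m \<zero>\<^bsub>A\<^esub> = \<zero>\<^bsub>M\<^esub>"
proof -
 interpret M: right_module K A M by fact
 show V: "vectorspace K M" by unfold_locales
 note M.ract_closed [simp] M.ract_add [simp] M.add_ract [simp] M.ract_mult [simp] M.ract_one [simp]
  M.ract_smult [simp] M.smult_ract [simp]
 show "m <: M ==> a <: A ==> ract M m a <: M" for m a by simp
 show "m <: M ==> a <: A ==> b <: A ==>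
   ract M m (a \<oplus>\<^bsub>A\<^esub> b) = ract M m a \<oplus>\<^bsub>M\<^esub> ract M m b" for m a b by simp
 show "m <: M ==> m' <: M ==> a <: A ==>
   ract M (m \<oplus>\<^bsub>M\<^esub> m') a = ract M m a \<oplus>\<^bsub>M\<^esub> ract M m' a" for m m' a by simp
 show s: "c <: K ==> m <: M ==> a <: A ==>
   ract M m (c \<odot>\<^bsub>A\<^esub> a) = c \<odot>\<^bsub>M\<^esub> ract M m a" for c m a by simp
 show s': "c <: K ==> m <: M ==> a <: A ==>
   ract M (c \<odot>\<^bsub>M\<^esub> m) a = c \<odot>\<^bsub>M\<^esub> ract M m a" for c m a by simp
 show "m <: M ==> a <: A ==> b <: A ==>
   ract M (ract M m a) b = ract M m (a \<otimes>\<^bsub>A\<^esub> b)" for m a b by simp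
 show "m <: M ==> ract M m \<one>\<^bsub>A\<^esub> = m" for m by simp
 show "ract M \<zero>\<^bsub>M\<^esub> a = \<zero>\<^bsub>M\<^esub>" if "a <: A" for a
  using s'[of \<zero> "\<zero>\<^bsub>M\<^esub>" a] that V by (simp del: M.smult_ract)
 show "ract M m \<zero>\<^bsub>A\<^esub> = \<zero>\<^bsub>M\<^esub>" if "m <: M" for m
  using s[of \<zero> m "\<zero>\<^bsub>A\<^esub>"] that V by (simp del: M.ract_smult)
qed

lemma lmodD:
 assumes "left_module K A M"
 shows "vectorspace K M"
  "\<And>m a. m <: M ==> a <: A ==> lact M a m <: M"
  "\<And>m a b. m <: M ==> a <: A ==> b <: A ==>
   lact M (a \<oplus>\<^bsub>A\<^esub> b) m = lact M a m \<oplus>\<^bsub>M\<^esub> lact M b m"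
  "\<And>m m' a. m <: M ==> m' <: M ==> a <: A ==>
   lact M a (m \<oplus>\<^bsub>M\<^esub> m') = lact M a m \<oplus>\<^bsub>M\<^esub> lact M a m'"
  "\<And>c m a. c <: K ==> m <: M ==> a <: A ==>
   lact M (c \<odot>\<^bsub>A\<^esub> a) m = c \<odot>\<^bsub>M\<^esub> lact M a m"
  "\<And>c m a. c <: K ==> m <: M ==> a <: A ==>
   lact M a (c \<odot>\<^bsub>M\<^esub> m) = c \<odot>\<^bsub>M\<^esub> lact M a m"
  "\<And>m a b. m <: M ==> a <: A ==> b <: A ==>
   lact M a (lact M b m) = lact M (a \<otimes>\<^bsub>A\<^esub> b) m"
  "\<And>m. m <: M ==> lact M \<one>\<^bsub>A\<^esub> m = m"
proof -
 interpret M: left_module K A M by fact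
 show V: "vectorspace K M" by unfold_locales
qed (use assms in \<open>simp_all add: left_module.lact_closed left_module.lact_add left_module.add_lact
  left_module.lact_smult left_module.smult_lact left_module.lact_mult left_module.lact_one\<close>)

abbreviation rhom where "rhom M N \<equiv> right_hom K A M N"

lemma homI:
 assumes "h \<in> lin K M N"
  "\<And>m a. m <: M ==> a <: A ==> h (ract M m a) = ract N (h m) a"
 shows "h \<in> rhom M N"
 using assms by (auto simp: right_hom_def)

lemma homD:
 assumes "h \<in> rhom M N"
 shows "h \<in> lin K M N"
  "\<And>m a. m <: M ==> a <: A ==> h (ract M m a) = ract N (h m) a"
  "\<And>x. x <: M ==> h x <: N"
  "\<And>x y. x <: M ==> y <: M ==> h (x \<oplus>\<^bsub>M\<^esub> y) = h x \<oplus>\<^bsub>N\<^esub> h y"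
  "\<And>c x. c <: K ==> x <: M ==> h (c \<odot>\<^bsub>M\<^esub> x) = c \<odot>\<^bsub>N\<^esub> h x"
 using assms linD[of h M N] by (auto simp: right_hom_def)

lemma hom_comp: "f \<in> rhom L M ==> g \<in> rhom M N ==> (\<lambda>x. g (f x)) \<in> rhom L N"
 by (rule homI[OF lin_comp[OF homD(1) homD(1)]]) (auto simp: homD(2,3))

lemma hom_id: "(\<lambda>x. x) \<in> rhom M M"
 by (intro homI linI) auto

lemma hom_zero: "rmodule M ==> rmodule N ==> (\<lambda>x. \<zero>\<^bsub>N\<^esub>) \<in> rhom M N"
 by (intro homI linI) (auto simp: rmodD(1,9))

lemma hom_z:
 assumes "rmodule M" "rmodule N" "h \<in> rhom M N"
 shows "h \<zero>\<^bsub>M\<^esub> = \<zero>\<^bsub>N\<^esub>"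
 using lin_zero[OF rmodD(1) rmodD(1) homD(1)] assms by blast

lemma hom_add:
 assumes N: "rmodule N" and f: "f \<in> rhom M N" and g: "g \<in> rhom M N"
 shows "(\<lambda>x. f x \<oplus>\<^bsub>N\<^esub> g x) \<in> rhom M N"
 using homD[OF f] homD[OF g] rmodD[OF N]
 by (intro homI linI) (simp_all add: vs_ac vs_smult_add)

lemma hom_smult:
 assumes N: "rmodule N" and f: "f \<in> rhom M N" and c: "c <: K"
 shows "(\<lambda>x. c \<odot>\<^bsub>N\<^esub> f x) \<in> rhom M N"
 using homD[OF f] rmodD[OF N] c
 by (intro homI linI) (simp_all add: vs_smult_smult vs_smult_add m_comm)

lemma hom_sub:
 assumes N: "rmodule N" and f: "f \<in> rhom M N" and g: "g \<in> rhom M N"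
 shows "(\<lambda>x. f x \<oplus>\<^bsub>N\<^esub> (\<ominus> \<one>) \<odot>\<^bsub>N\<^esub> g x) \<in> rhom M N"
 by (rule hom_add[OF N f hom_smult[OF N g]]) simp

lemma hom_cong:
 assumes M: "rmodule M" and f: "f \<in> rhom M N" and e: "\<And>x. x <: M ==> g x = f x"
 shows "g \<in> rhom M N"
 using homD[OF f] rmodD[OF M] by (intro homI linI) (simp_all add: e)

lemma hom_space_eq: "hom_space K A M N = (lin_space M N)\<langle>rhom M N \<inter> extensional (carrier M)\<rangle>"
 by (simp add: hom_space_def lin_space_def fun_space_def)

lemma hom_space_simps [simp]:
 "carrier (hom_space K A M N) = rhom M N \<inter> extensional (carrier M)"
 "\<zero>\<^bsub>hom_space K A M N\<^esub> = (\<lambda>x\<in>carrier M. \<zero>\<^bsub>N\<^esub>)"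
 "f \<oplus>\<^bsub>hom_space K A M N\<^esub> g = (\<lambda>x\<in>carrier M. f x \<oplus>\<^bsub>N\<^esub> g x)"
 "c \<odot>\<^bsub>hom_space K A M N\<^esub> f = (\<lambda>x\<in>carrier M. c \<odot>\<^bsub>N\<^esub> f x)"
 by (simp_all add: hom_space_def)

lemma hom_restrict:
 assumes M: "rmodule M" and f: "f \<in> rhom M N"
 shows "restrict f (carrier M) <: (hom_space K A M N)"
 using hom_cong[OF M f, of "restrict f (carrier M)"] by simp

lemma hom_space_sub:
 assumes M: "rmodule M" and N: "rmodule N"
 shows "sspace K (rhom M N \<inter> extensional (carrier M)) (lin_space M N)"
proof (rule subI[OF lin_space_vs[OF rmodD(1)[OF M] rmodD(1)[OF N]]])
 show "rhom M N \<inter> extensional (carrier M) \<subseteq> carrier (lin_space M N)"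
  using homD(1) by (simp, blast)
 show "\<zero>\<^bsub>lin_space M N\<^esub> \<in> rhom M N \<inter> extensional (carrier M)"
  using hom_restrict[OF M hom_zero[OF M N]] by simp
 show "f \<oplus>\<^bsub>lin_space M N\<^esub> g \<in> rhom M N \<inter> extensional (carrier M)"
  if "f \<in> rhom M N \<inter> extensional (carrier M)" "g \<in> rhom M N \<inter> extensional (carrier M)" for f g
  using hom_restrict[OF M hom_add[OF N]] that by simp
 show "c \<odot>\<^bsub>lin_space M N\<^esub> f \<in> rhom M N \<inter> extensional (carrier M)"
  if "c <: K" "f \<in> rhom M N \<inter> extensional (carrier M)" for c f
  using hom_restrict[OF M hom_smult[OF N]] that by simp
qed

lemma hom_space_vs:
 assumes M: "rmodule M" and N: "rmodule N"
 shows "vectorspace K (hom_space K A M N)"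
 unfolding hom_space_eq by (rule sub_vs[OF hom_space_sub[OF assms]])

lemma hom_space_fin:
 assumes M: "rmodule M" and N: "rmodule N"
  and "findim M" "findim N"
 shows "findim (hom_space K A M N)"
 unfolding hom_space_eq
 by (rule sub_fin[OF hom_space_sub[OF M N] lin_space_dim(1)[OF rmodD(1)[OF M] rmodD(1)[OF N] assms(3,4)]])

subsection \<open>Submodules\<close>

definition submod :: "('k, 'm, 'a) rmod \<Rightarrow> 'm set \<Rightarrow> bool" where
 "submod M W \<longleftrightarrow> rmodule M \<and> sspace K W M \<and> (\<forall>w\<in>W. \<forall>a\<in>carrier A. ract M w a \<in> W)"

lemma submodD:
 assumes "submod M W"
 shows "rmodule M" "sspace K W M" "\<And>w a. w \<in> W ==> a <: A ==> ract M w a \<in> W"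
  "\<And>w. w \<in> W ==> w <: M"
 using assms subD(6) by (auto simp: submod_def)

lemma submod_rmod:
 assumes W: "submod M W"
 shows "rmodule (M\<langle>W\<rangle>)"
 using submodD[OF W] rmodD[OF submodD(1)[OF W]] sub_vs[OF submodD(2)[OF W]]
 by (intro rmodI) simp_all

lemma submod_incl: "submod M W ==> (\<lambda>x. x) \<in> rhom (M\<langle>W\<rangle>) M"
 by (intro homI linI) (auto simp: submodD(4))

lemma submod_ker:
 assumes M: "rmodule M" and N: "rmodule N" and h: "h \<in> rhom M N"
 shows "submod M {x \<in> carrier M. h x = \<zero>\<^bsub>N\<^esub>}"
 using lin_ker_sub[OF rmodD(1)[OF M] rmodD(1)[OF N] homD(1)[OF h]] M rmodD[OF M] rmodD(9)[OF N] homD(2)[OF h]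
 by (auto simp: submod_def)

lemma submod_im:
 assumes M: "rmodule M" and N: "rmodule N" and h: "h \<in> rhom M N"
 shows "submod N (h ` carrier M)"
 unfolding submod_def
proof (intro conjI ballI)
 show "sspace K (h ` carrier M) N"
  using lin_im_sub[OF rmodD(1)[OF M] rmodD(1)[OF N] homD(1)[OF h] sub_self[OF rmodD(1)[OF M]]] .
 fix w a assume "w \<in> h ` carrier M" "a <: A"
 then show "ract N w a \<in> h ` carrier M" using homD(2)[OF h] rmodD(2)[OF M] by (metis (no_types, lifting) image_iff)
qed (rule N)

lemma submod_zero: "rmodule M ==> submod M {\<zero>\<^bsub>M\<^esub>}"
 using sub_zero rmodD(1,9) by (auto simp: submod_def)

lemma hom_corestrict:
 assumes h: "h \<in> rhom M N" and i: "\<And>x. x <: M ==> h x \<in> W"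
 shows "h \<in> rhom M (N\<langle>W\<rangle>)"
 using homD[OF h] i by (intro homI linI) simp_all

lemma hom_dom:
 assumes h: "h \<in> rhom M N" and W: "submod M W"
 shows "h \<in> rhom (M\<langle>W\<rangle>) N"
 using homD[OF h] submodD[OF W] by (intro homI linI) simp_all

subsection \<open>Free and projective modules\<close>

lemma free_simps [simp]:
 "\<zero>\<^bsub>free_rmod A I\<^esub> = (\<lambda>i. \<zero>\<^bsub>A\<^esub>)" "f \<oplus>\<^bsub>free_rmod A I\<^esub> g = (\<lambda>i. f i \<oplus>\<^bsub>A\<^esub> g i)"
 "c \<odot>\<^bsub>free_rmod A I\<^esub> f = (\<lambda>i. c \<odot>\<^bsub>A\<^esub> f i)" "ract (free_rmod A I) f a = (\<lambda>i. f i \<otimes>\<^bsub>A\<^esub> a)"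
 by (simp_all add: free_rmod_def)

lemma free_fs: "fs_space (free_rmod A I) A I"
 by (simp add: fs_space_def free_rmod_def)

lemma free_mem: "f <: (free_rmod A I) \<longleftrightarrow>
  (\<forall>i. f i <: A) \<and> (\<forall>i. i \<notin> I \<longrightarrow> f i = \<zero>\<^bsub>A\<^esub>) \<and> finite {i. f i \<noteq> \<zero>\<^bsub>A\<^esub>}"
 by (simp add: free_rmod_def)

lemma free_rmod_module: "rmodule (free_rmod A I)"
proof (rule rmodI[OF fs_vs[OF alg_simps(1) free_fs]])
 show "ract (free_rmod A I) f a <: (free_rmod A I)"
  if f: "f <: (free_rmod A I)" and a: "a <: A" for f a
 proof -
  have "{i. f i \<otimes>\<^bsub>A\<^esub> a \<noteq> \<zero>\<^bsub>A\<^esub>} \<subseteq> {i. f i \<noteq> \<zero>\<^bsub>A\<^esub>}" using a by auto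
  then show ?thesis using f a by (auto simp: free_mem intro: finite_subset)
 qed
qed (auto simp: free_mem alg_rules)

lemma free_single: "i \<in> I ==> a <: A ==> single A i a <: (free_rmod A I)"
 using single_mem[OF alg_simps(1) free_fs] .

lemma single_ract:
 "a <: A ==> b <: A ==> ract (free_rmod A I) (single A i a) b = single A i (a \<otimes>\<^bsub>A\<^esub> b)"
 by (auto simp: single_def fun_eq_iff)

lemma free_hom:
 assumes X: "rmodule X" and x: "\<And>i. i \<in> I ==> x i <: X"
 obtains h where "h \<in> rhom (free_rmod A I) X"
  "\<And>i a. i \<in> I ==> a <: A ==> h (single A i a) = ract X (x i) a"
proof -
 note r = rmodD[OF X]
 have g: "(\<lambda>a. ract X (x i) a) \<in> lin K A X" if "i \<in> I" for i
  using r x[OF that] by (intro linI) simp_all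
 let ?h = "\<lambda>f. \<Oplus>\<^bsub>X\<^esub> i\<in>{i. f i \<noteq> \<zero>\<^bsub>A\<^esub>}. ract X (x i) (f i)"
 have l1: "?h \<in> lin K (free_rmod A I) X"
  by (rule fs_lift(1)[OF alg_simps(1) free_fs r(1) g])
 have l2: "?h (single A i a) = ract X (x i) a" if "i \<in> I" "a <: A" for i a
  by (rule fs_lift(2)[where g="\<lambda>i a. ract X (x i) a", OF alg_simps(1) free_fs r(1)]) (use g that in auto)
 have "?h \<in> rhom (free_rmod A I) X"
 proof (rule homI[OF l1])
  fix f b assume f: "f <: (free_rmod A I)" and b: "b <: A"
  let ?F = "free_rmod A I"
  have "(\<lambda>f. ract ?F f b) \<in> lin K ?F ?F"
   using rmodD[OF free_rmod_module[of I]] b by (intro linI) (simp_all del: free_simps)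
  from lin_comp[OF this l1] have 1: "(\<lambda>f. ?h (ract ?F f b)) \<in> lin K ?F X" .
  have "(\<lambda>y. ract X y b) \<in> lin K X X" using r b by (intro linI) simp_all
  from lin_comp[OF l1 this] have 2: "(\<lambda>f. ract X (?h f) b) \<in> lin K ?F X" .
  show "?h (ract ?F f b) = ract X (?h f) b"
  proof (rule fs_lin_eq[OF alg_simps(1) free_fs r(1) 1 2 _ f])
   fix i a assume i: "i \<in> I" and a: "a <: A"
   show "?h (ract ?F (single A i a) b) = ract X (?h (single A i a)) b"
    unfolding single_ract[OF a b] using l2[OF i a] l2[OF i, of "a \<otimes>\<^bsub>A\<^esub> b"] r(7) a b x[OF i] by simp
  qed
 qed
 then show thesis using l2 by (rule that)
qed

lemma free_hom_eq:
 assumes X: "rmodule X" and h: "h \<in> rhom (free_rmod A I) X" "h' \<in> rhom (free_rmod A I) X"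
  and e: "\<And>i. i \<in> I ==> h (single A i \<one>\<^bsub>A\<^esub>) = h' (single A i \<one>\<^bsub>A\<^esub>)" and f: "f <: (free_rmod A I)"
 shows "h f = h' f"
proof (rule fs_lin_eq[OF alg_simps(1) free_fs rmodD(1)[OF X] homD(1)[OF h(1)] homD(1)[OF h(2)] _ f])
 fix i a assume i: "i \<in> I" and a: "a <: A"
 have "single A i a = ract (free_rmod A I) (single A i \<one>\<^bsub>A\<^esub>) a" by (subst single_ract) (use a in simp_all)
 then show "h (single A i a) = h' (single A i a)"
  using homD(2)[OF h(1)] homD(2)[OF h(2)] free_single[OF i] a e[OF i] by (simp del: free_simps)
qed

text \<open>Projectivity tested on one pair of modules. A definition cannot quantify over the types
  of all X and Y, so lifting is passed around in instances. Asking for f to land in the image of g,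
  instead of g being onto, fits exact sequences; and modules that are not known to be
  \<open>projective_rmod\<close> can be shown to have the property, as in
  \<open>restricted_free_lifts\<close>.\<close>

definition lifts :: "('k, 'p, 'a) rmod \<Rightarrow> ('k, 'u, 'a) rmod \<Rightarrow> ('k, 'v, 'a) rmod \<Rightarrow> bool" where
 "lifts P X Y \<longleftrightarrow> (\<forall>g\<in>rhom X Y. \<forall>f\<in>rhom P Y. f ` carrier P \<subseteq> g ` carrier X \<longrightarrow>
   (\<exists>h\<in>rhom P X. \<forall>x\<in>carrier P. g (h x) = f x))"

lemma liftsD:
 assumes "lifts P X Y" "g \<in> rhom X Y" "f \<in> rhom P Y" "\<And>x. x <: P ==> f x \<in> g ` carrier X"
 obtains h where "h \<in> rhom P X" "\<And>x. x <: P ==> g (h x) = f x"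
 using assms unfolding lifts_def by blast

lemma free_lifts:
 assumes X: "rmodule X" and Y: "rmodule Y"
 shows "lifts (free_rmod A I) X Y"
 unfolding lifts_def
proof (intro ballI impI)
 fix g f assume g: "g \<in> rhom X Y" and f: "f \<in> rhom (free_rmod A I) Y"
  and im: "f ` carrier (free_rmod A I) \<subseteq> g ` carrier X"
 have "\<exists>y. y <: X \<and> g y = f (single A i \<one>\<^bsub>A\<^esub>)" if "i \<in> I" for i
 proof -
  have "f (single A i \<one>\<^bsub>A\<^esub>) \<in> g ` carrier X" using im free_single[OF that alg_simps(4)] by blast
  then show ?thesis by (metis imageE)
 qed
 then obtain x where x: "\<And>i. i \<in> I ==> x i <: X" "\<And>i. i \<in> I ==> g (x i) = f (single A i \<one>\<^bsub>A\<^esub>)"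
  by metis
 obtain h where h: "h \<in> rhom (free_rmod A I) X" "\<And>i a. i \<in> I ==> a <: A ==> h (single A i a) = ract X (x i) a"
  using free_hom[where x=x and I=I, OF X x(1)] by metis
 have "g (h z) = f z" if "z <: (free_rmod A I)" for z
  by (rule free_hom_eq[OF Y hom_comp[OF h(1) g] f _ that]) (use h x rmodD[OF X] in simp)
 then show "\<exists>h\<in>rhom (free_rmod A I) X. \<forall>x\<in>carrier (free_rmod A I). g (h x) = f x" using h(1) by blast
qed

lemma summand_lifts:
 assumes F: "lifts F X Y" and s: "s \<in> rhom P F" and r: "r \<in> rhom F P"
  and rs: "\<And>x. x <: P ==> r (s x) = x"
 shows "lifts P X Y"
 unfolding lifts_def
proof (intro ballI impI)
 fix g f assume g: "g \<in> rhom X Y" and f: "f \<in> rhom P Y" and im: "f ` carrier P \<subseteq> g ` carrier X"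
 have "(\<lambda>x. f (r x)) ` carrier F \<subseteq> g ` carrier X"
 proof (rule image_subsetI)
  fix x assume "x <: F"
  then have "f (r x) \<in> f ` carrier P" using homD(3)[OF r] by (intro imageI)
  then show "f (r x) \<in> g ` carrier X" using im by (rule rev_subsetD)
 qed
 then have "\<exists>h\<in>rhom F X. \<forall>x\<in>carrier F. g (h x) = f (r x)"
  using F[unfolded lifts_def, rule_format, OF g hom_comp[OF r f]] by simp
 then obtain h where h: "h \<in> rhom F X" "\<And>x. x <: F ==> g (h x) = f (r x)" by blast
 have "g (h (s x)) = f x" if "x <: P" for x using h(2)[OF homD(3)[OF s that]] rs[OF that] by simp
 then show "\<exists>h\<in>rhom P X. \<forall>x\<in>carrier P. g (h x) = f x"
  by (intro bexI[OF _ hom_comp[OF s h(1)]] ballI)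
qed

lemma projective_lifts:
 assumes P: "projective_rmod K A P" and X: "rmodule X" and Y: "rmodule Y"
 shows "lifts P X Y"
 using P summand_lifts[OF free_lifts[OF X Y]] unfolding projective_rmod_def by metis

lemma zero_ring_trivial:
 assumes "\<one>\<^bsub>A\<^esub> = \<zero>\<^bsub>A\<^esub>" and M: "rmodule M" and "x <: M"
 shows "x = \<zero>\<^bsub>M\<^esub>"
 using assms rmodD(8,10)[OF M] by metis

text \<open>Free modules are projective also in the sense of a definition that takes index sets from the
 type of elements of the module: index the basis by itself.\<close>

lemma free_projective: "projective_rmod K A (free_rmod A I)"
proof (cases "\<one>\<^bsub>A\<^esub> = \<zero>\<^bsub>A\<^esub>")
 \<comment> \<open>Over the zero ring all basis vectors coincide, so that they cannot index
   themselves; but every module is then zero and zero maps do.\<close>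
 case True
 note F = free_rmod_module
 show ?thesis unfolding projective_rmod_def
  using hom_zero[OF F F] zero_ring_trivial[OF True F] free_rmod_module by metis
next
 case False
 let ?e = "\<lambda>i. single A i \<one>\<^bsub>A\<^esub>"
 have inj: "inj ?e" using False by (auto simp: inj_def single_def fun_eq_iff split: if_splits)
 let ?I = "?e ` I"
 have m: "single A (?e i) \<one>\<^bsub>A\<^esub> <: (free_rmod A ?I)" if "i \<in> I" for i
  by (rule free_single) (use that in auto)
 obtain s where s: "s \<in> rhom (free_rmod A I) (free_rmod A ?I)"
  "\<And>i a. i \<in> I ==> a <: A ==> s (single A i a) = ract (free_rmod A ?I) (single A (?e i) \<one>\<^bsub>A\<^esub>) a"
  using free_hom[where x="\<lambda>i. single A (?e i) \<one>\<^bsub>A\<^esub>" and I=I, OF free_rmod_module[of ?I] m] by metis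
 have m': "x <: (free_rmod A I)" if "x \<in> ?I" for x
  using that free_single[OF _ alg_simps(4)] by auto
 obtain r where r: "r \<in> rhom (free_rmod A ?I) (free_rmod A I)"
  "\<And>i a. i \<in> ?I ==> a <: A ==> r (single A i a) = ract (free_rmod A I) i a"
  using free_hom[where x="\<lambda>i. i" and I="?I", OF free_rmod_module[of I] m'] by metis
 have rs: "r (s x) = x" if "x <: (free_rmod A I)" for x
 proof (rule free_hom_eq[OF free_rmod_module hom_comp[OF s(1) r(1)] hom_id _ that])
  fix i assume i: "i \<in> I"
  have "s (?e i) = single A (?e i) \<one>\<^bsub>A\<^esub>" using s(2) i single_ract[of "\<one>\<^bsub>A\<^esub>" "\<one>\<^bsub>A\<^esub>"] by simp
  then show "r (s (?e i)) = ?e i" using r(2) i rmodD(8)[OF free_rmod_module free_single[OF i]] by simp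
 qed
 show ?thesis unfolding projective_rmod_def
  by (intro conjI free_rmod_module exI[of _ ?I] bexI[OF _ s(1)] bexI[OF _ r(1)] ballI) (rule rs)
qed

subsection \<open>Comparison of resolutions\<close>

text \<open>A resolution without projectivity, which the comparison arguments receive separately
  through \<open>lifts\<close>. This makes them applicable to a resolution over A^e that is regarded
  as a complex of one-sided modules.\<close>

definition resolves :: "('k, 'm, 'a) rmod \<Rightarrow> (nat \<Rightarrow> ('k, 'p, 'a) rmod) \<Rightarrow> (nat \<Rightarrow> 'p \<Rightarrow> 'p) \<Rightarrow> ('p \<Rightarrow> 'm) \<Rightarrow> bool" where
 "resolves M P d \<epsilon> \<longleftrightarrow> (\<forall>l. rmodule (P l)) \<and>
   (\<forall>l. d l \<in> rhom (P (Suc l)) (P l)) \<and> \<epsilon> \<in> rhom (P 0) M \<and> \<epsilon> ` carrier (P 0) = carrier M \<and>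
   d 0 ` carrier (P 1) = {x \<in> carrier (P 0). \<epsilon> x = \<zero>\<^bsub>M\<^esub>} \<and>
   (\<forall>l. d (Suc l) ` carrier (P (Suc (Suc l))) = {x \<in> carrier (P (Suc l)). d l x = \<zero>\<^bsub>P l\<^esub>})"

lemma projective_resolves: "projective_resolution K A M P d \<epsilon> ==> resolves M P d \<epsilon>"
 by (simp add: projective_resolution_def resolves_def projective_rmod_def)

lemma resolvesD:
 assumes "resolves M P d \<epsilon>"
 shows "\<And>l. rmodule (P l)" "\<And>l. d l \<in> rhom (P (Suc l)) (P l)" "\<epsilon> \<in> rhom (P 0) M"
  "\<epsilon> ` carrier (P 0) = carrier M" "\<And>x. x <: (P 1) ==> \<epsilon> (d 0 x) = \<zero>\<^bsub>M\<^esub>"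
  "\<And>x. x <: (P 0) ==> \<epsilon> x = \<zero>\<^bsub>M\<^esub> ==> x \<in> d 0 ` carrier (P 1)"
  "\<And>l x. x <: (P (Suc (Suc l))) ==> d l (d (Suc l) x) = \<zero>\<^bsub>P l\<^esub>"
  "\<And>l x. x <: (P (Suc l)) ==> d l x = \<zero>\<^bsub>P l\<^esub> ==> x \<in> d (Suc l) ` carrier (P (Suc (Suc l)))"
 using assms unfolding resolves_def by blast+

lemma comparison:
 assumes P: "resolves M P d \<epsilon>" and Q: "resolves M Q d' \<epsilon>'"
  and l0: "lifts (P 0) (Q 0) M" and ls: "\<And>l. lifts (P (Suc l)) (Q (Suc l)) (Q l)"
 obtains F where "\<And>l. F l \<in> rhom (P l) (Q l)" "\<And>x. x <: (P 0) ==> \<epsilon>' (F 0 x) = \<epsilon> x"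
  "\<And>l x. x <: (P (Suc l)) ==> d' l (F (Suc l) x) = F l (d l x)"
proof -
 note p = resolvesD[OF P] and q = resolvesD[OF Q]
 \<comment> \<open>Besides being a homomorphism, \<phi> must send boundaries into the image of d';
   that is precisely the premise of the next lifting.\<close>
 let ?ok = "\<lambda>n \<phi>. \<phi> \<in> rhom (P n) (Q n) \<and> (\<forall>x\<in>carrier (P (Suc n)). \<phi> (d n x) \<in> d' n ` carrier (Q (Suc n)))
   \<and> (n = 0 \<longrightarrow> (\<forall>x\<in>carrier (P 0). \<epsilon>' (\<phi> x) = \<epsilon> x))"
 have "\<exists>F. \<forall>n. ?ok n (F n) \<and> (\<forall>x\<in>carrier (P (Suc n)). d' n (F (Suc n) x) = F n (d n x))"
 proof (rule dependent_nat_choice)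
  obtain \<phi> where \<phi>: "\<phi> \<in> rhom (P 0) (Q 0)" "\<And>x. x <: (P 0) ==> \<epsilon>' (\<phi> x) = \<epsilon> x"
   using liftsD[OF l0 q(3) p(3)] homD(3)[OF p(3)] q(4) by metis
  have "\<phi> (d 0 x) \<in> d' 0 ` carrier (Q 1)" if "x <: (P 1)" for x
   using that \<phi> p(5) homD(3)[OF p(2)[of 0]] homD(3)[OF \<phi>(1)] by (intro q(6)) auto
  then show "\<exists>\<phi>. ?ok 0 \<phi>" using \<phi> by auto
 next
  fix \<phi> n assume \<phi>: "?ok n \<phi>"
  obtain \<psi> where \<psi>: "\<psi> \<in> rhom (P (Suc n)) (Q (Suc n))" "\<And>x. x <: (P (Suc n)) ==> d' n (\<psi> x) = \<phi> (d n x)"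
   using liftsD[OF ls q(2) hom_comp[OF p(2)]] \<phi> by blast
  have "\<psi> (d (Suc n) x) \<in> d' (Suc n) ` carrier (Q (Suc (Suc n)))" if x: "x <: (P (Suc (Suc n)))" for x
  proof (rule q(8))
   have dx: "d (Suc n) x <: (P (Suc n))" using homD(3)[OF p(2)] x by blast
   then show "\<psi> (d (Suc n) x) <: (Q (Suc n))" using homD(3)[OF \<psi>(1)] by blast
   have "d' n (\<psi> (d (Suc n) x)) = \<phi> \<zero>\<^bsub>P n\<^esub>" using \<psi>(2)[OF dx] p(7)[OF x] by simp
   then show "d' n (\<psi> (d (Suc n) x)) = \<zero>\<^bsub>Q n\<^esub>" using hom_z[OF p(1) q(1)] \<phi> by metis
  qed
  then show "\<exists>\<psi>. ?ok (Suc n) \<psi> \<and> (\<forall>x\<in>carrier (P (Suc n)). d' n (\<psi> x) = \<phi> (d n x))" using \<psi> by auto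
 qed
 then obtain F where "\<And>n. ?ok n (F n)" "\<And>n x. x <: (P (Suc n)) ==> d' n (F (Suc n) x) = F n (d n x)"
  by metis
 then show thesis by (intro that[of F]) blast+
qed

text \<open>Since \<phi> lifts the identity of M, the difference of \<phi> and the identity is null
  homotopic. Only one complex occurs: \<phi> will be the composite of two comparison maps, and in
  \<open>contraction\<close> a map that is zero in positive degrees. The identities are solved for x
  so that no subtraction remains.\<close>

lemma homotopy:
 assumes P: "resolves M P d \<epsilon>" and ls: "\<And>l. lifts (P l) (P (Suc l)) (P l)"
  and \<phi>: "\<And>l. \<phi> l \<in> rhom (P l) (P l)" and \<phi>0: "\<And>x. x <: (P 0) ==> \<epsilon> (\<phi> 0 x) = \<epsilon> x"
  and \<phi>d: "\<And>l x. x <: (P (Suc l)) ==> d l (\<phi> (Suc l) x) = \<phi> l (d l x)"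
 obtains s where "\<And>l. s l \<in> rhom (P l) (P (Suc l))"
  "\<And>x. x <: (P 0) ==> x = \<phi> 0 x \<oplus>\<^bsub>P 0\<^esub> d 0 (s 0 x)"
  "\<And>l x. x <: (P (Suc l)) ==>
   x = \<phi> (Suc l) x \<oplus>\<^bsub>P (Suc l)\<^esub> (d (Suc l) (s (Suc l) x) \<oplus>\<^bsub>P (Suc l)\<^esub> s l (d l x))"
proof -
 note p = resolvesD[OF P]
 have V: "vectorspace K (P l)" for l using rmodD(1)[OF p(1)] .
 define t where "t l x = x \<oplus>\<^bsub>P l\<^esub> (\<ominus> \<one>) \<odot>\<^bsub>P l\<^esub> \<phi> l x" for l x
 have t: "t l \<in> rhom (P l) (P l)" for l
  unfolding t_def[abs_def] by (rule hom_sub[OF p(1) hom_id \<phi>])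
 have dt: "d l (t (Suc l) x) = t l (d l x)" if x: "x <: (P (Suc l))" for l x
 proof -
  have "d l (t (Suc l) x) = d l x \<oplus>\<^bsub>P l\<^esub> (\<ominus> \<one>) \<odot>\<^bsub>P l\<^esub> d l (\<phi> (Suc l) x)"
   unfolding t_def using homD(4,5)[OF p(2)] x homD(3)[OF \<phi>] V by simp
  then show ?thesis unfolding t_def using \<phi>d[OF x] by simp
 qed
 \<comment> \<open>\<open>u n s\<close> is what is left of id - \<phi> in degree n + 1 once s d is
   subtracted. Its values are cycles, hence boundaries, and a lift of it is the next component of
   the homotopy.\<close>
 define u where "u n s x = t (Suc n) x \<oplus>\<^bsub>P (Suc n)\<^esub> (\<ominus> \<one>) \<odot>\<^bsub>P (Suc n)\<^esub> s (d n x)" for n s x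
 have u: "u n s \<in> rhom (P (Suc n)) (P (Suc n))" if "s \<in> rhom (P n) (P (Suc n))" for n s
  unfolding u_def[abs_def] by (rule hom_sub[OF p(1) t hom_comp[OF p(2) that]])
 let ?ok = "\<lambda>n s. s \<in> rhom (P n) (P (Suc n)) \<and> (\<forall>x\<in>carrier (P (Suc n)). u n s x \<in> d (Suc n) ` carrier (P (Suc (Suc n))))
  \<and> (n = 0 \<longrightarrow> (\<forall>x\<in>carrier (P 0). d 0 (s x) = t 0 x))"
 have du: "d n (u n s x) = t n (d n x) \<oplus>\<^bsub>P n\<^esub> (\<ominus> \<one>) \<odot>\<^bsub>P n\<^esub> d n (s (d n x))"
  if s: "s \<in> rhom (P n) (P (Suc n))" and x: "x <: (P (Suc n))" for n s x
  unfolding u_def using homD(4,5)[OF p(2)] x homD(3)[OF t] homD(3)[OF s] homD(3)[OF p(2)] dt V by simp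
 have "\<exists>s. \<forall>n. ?ok n (s n) \<and> (\<forall>x\<in>carrier (P (Suc n)). d (Suc n) (s (Suc n) x) = u n (s n) x)"
 proof (rule dependent_nat_choice)
  have "t 0 x \<in> d 0 ` carrier (P (Suc 0))" if x: "x <: (P 0)" for x
  proof -
   have e: "\<epsilon> x <: M" using homD(3)[OF p(3)] x by blast
   obtain y where y: "y <: (P 0)" "\<epsilon> y = \<epsilon> x" using x by blast
   have "\<epsilon> (t 0 x) = \<epsilon> x \<oplus>\<^bsub>M\<^esub> (\<ominus> \<one>) \<odot>\<^bsub>M\<^esub> \<epsilon> x"
    unfolding t_def using homD(4,5)[OF p(3)] x homD(3)[OF \<phi>] \<phi>0 V by simp
   also have "\<dots> = \<epsilon> (x \<oplus>\<^bsub>P 0\<^esub> (\<ominus> \<one>) \<odot>\<^bsub>P 0\<^esub> x)"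
    using homD(4)[OF p(3) x vs_smult[OF V _ x]] homD(5)[OF p(3) _ x] by (simp del: vs_add_zero)
   \<comment> \<open>\<open>M\<close> is not assumed to be a module here, so its zero is reached as
     the value of \<epsilon> at a boundary.\<close>
   also have "\<dots> = \<epsilon> (d 0 \<zero>\<^bsub>P 1\<^esub>)" using x V hom_z[OF p(1) p(1) p(2), of 0] by simp
   also have "\<dots> = \<zero>\<^bsub>M\<^esub>" using p(5) V by simp
   finally show ?thesis using p(6)[OF homD(3)[OF t x]] by simp
  qed
  then obtain s where s: "s \<in> rhom (P 0) (P (Suc 0))" "\<And>x. x <: (P 0) ==> d 0 (s x) = t 0 x"
   using liftsD[OF ls p(2) t, of 0] by blast
  have "u 0 s x \<in> d (Suc 0) ` carrier (P (Suc (Suc 0)))" if x: "x <: (P (Suc 0))" for x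
  proof (rule p(8)[OF homD(3)[OF u[OF s(1)] x]])
   have "d 0 x <: (P 0)" using homD(3)[OF p(2)] x by blast
   then show "d 0 (u 0 s x) = \<zero>\<^bsub>P 0\<^esub>"
    using du[OF s(1) x] s(2)[of "d 0 x"] homD(3)[OF t, of "d 0 x" 0] V[of 0] by simp
  qed
  then show "\<exists>s. ?ok 0 s" using s by auto
 next
  fix s n assume s: "?ok n s"
  obtain s' where s': "s' \<in> rhom (P (Suc n)) (P (Suc (Suc n)))" "\<And>x. x <: (P (Suc n)) ==> d (Suc n) (s' x) = u n s x"
   using liftsD[OF ls p(2) u] s by blast
  have "u (Suc n) s' x \<in> d (Suc (Suc n)) ` carrier (P (Suc (Suc (Suc n))))" if x: "x <: (P (Suc (Suc n)))" for x
  proof (rule p(8)[OF homD(3)[OF u[OF s'(1)] x]])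
   have dx: "d (Suc n) x <: (P (Suc n))" using homD(3)[OF p(2)] x by blast
   have "u n s (d (Suc n) x) = t (Suc n) (d (Suc n) x)"
    unfolding u_def using p(7)[OF x] hom_z[OF p(1) p(1), of s n "Suc n"] s V homD(3)[OF t dx] by simp
   then show "d (Suc n) (u (Suc n) s' x) = \<zero>\<^bsub>P (Suc n)\<^esub>"
    using du[OF s'(1) x] s'(2)[OF dx] homD(3)[OF t dx] V[of "Suc n"] by simp
  qed
  then show "\<exists>s'. ?ok (Suc n) s' \<and> (\<forall>x\<in>carrier (P (Suc n)). d (Suc n) (s' x) = u n s x)" using s' by auto
 qed
 then obtain s where s: "\<And>n. ?ok n (s n)" and sd: "\<And>n x. x <: (P (Suc n)) ==> d (Suc n) (s (Suc n) x) = u n (s n) x"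
  by metis
 have sh: "s l \<in> rhom (P l) (P (Suc l))" for l using s by blast
 have tx: "x = \<phi> l x \<oplus>\<^bsub>P l\<^esub> t l x" if "x <: (P l)" for l x
 proof -
  have "\<phi> l x \<oplus>\<^bsub>P l\<^esub> t l x = x \<oplus>\<^bsub>P l\<^esub> (\<phi> l x \<oplus>\<^bsub>P l\<^esub> (\<ominus> \<one>) \<odot>\<^bsub>P l\<^esub> \<phi> l x)"
   unfolding t_def using that homD(3)[OF \<phi> that] V[of l] by (simp only: vs_lcomm vs_smult a_inv_closed one_closed)
  then show ?thesis using that homD(3)[OF \<phi> that] V[of l] by simp
 qed
 show thesis
 proof (rule that[OF sh])
  show "x = \<phi> 0 x \<oplus>\<^bsub>P 0\<^esub> d 0 (s 0 x)" if "x <: (P 0)" for x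
   using s[of 0] tx[OF that] that by simp
  show "x = \<phi> (Suc l) x \<oplus>\<^bsub>P (Suc l)\<^esub> (d (Suc l) (s (Suc l) x) \<oplus>\<^bsub>P (Suc l)\<^esub> s l (d l x))"
   if x: "x <: (P (Suc l))" for l x
  proof -
   have "s l (d l x) <: (P (Suc l))" using homD(3)[OF sh] homD(3)[OF p(2)] x by blast
   then have "d (Suc l) (s (Suc l) x) \<oplus>\<^bsub>P (Suc l)\<^esub> s l (d l x) = t (Suc l) x"
    unfolding sd[OF x] u_def using homD(3)[OF t x] V[of "Suc l"] by (simp add: vs_assoc)
   then show ?thesis using tx[OF x] by simp
  qed
 qed
qed

end

lemma (in base_field) lin_sub:
 assumes f: "f \<in> lin K V W" and Z: "sspace K Z V" and i: "\<And>x. x \<in> Z ==> f x \<in> Z'"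
 shows "f \<in> lin K (V\<langle>Z\<rangle>) (W\<langle>Z'\<rangle>)"
 using linD[OF f] subD(6)[OF Z] i by (intro linI) simp_all

context alg_over
begin

subsection \<open>Finite dimensional resolutions\<close>

text \<open>A vector space basis of X also generates X as a module. The elements of a free module
  are functions on a type fixed in advance, whose infinity supplies names for the
  generators.\<close>

lemma free_cover:
 assumes X: "rmodule X" and fin: "findim X" and inf: "infinite (UNIV :: 'i set)"
 obtains J :: "'i set" and h where "finite J" "h \<in> rhom (free_rmod A J) X" "h ` carrier (free_rmod A J) = carrier X"
proof -
 note V = rmodD(1)[OF X]
 obtain b c where B: "has_basis X {..<vdim X} b c" using basis_exists[OF V fin] by blast
 let ?I = "{..<vdim X}"
 note b = has_basisD[OF B]
 obtain \<iota> :: "nat \<Rightarrow> 'i" where \<iota>: "inj \<iota>" using infinite_countable_subset[OF inf] by blast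
 let ?J = "\<iota> ` ?I" and ?F = "free_rmod A (\<iota> ` ?I)"
 have x: "b (the_inv \<iota> j) <: X" if "j \<in> ?J" for j using that b(2) by (auto simp: the_inv_f_f[OF \<iota>])
 obtain h where h: "h \<in> rhom ?F X" "\<And>i a. i \<in> ?J ==> a <: A ==> h (single A i a) = ract X (b (the_inv \<iota> i)) a"
  using free_hom[where x="\<lambda>j. b (the_inv \<iota> j)" and I="?J", OF X x] by metis
 have Fv: "vectorspace K ?F" using rmodD(1)[OF free_rmod_module] .
 interpret F: vectorspace K ?F by (rule Fv)
 interpret X: vectorspace K X by (rule V)
 have "v \<in> h ` carrier ?F" if v: "v <: X" for v
 proof -
  let ?g = "\<lambda>i. c i v \<odot>\<^bsub>?F\<^esub> single A (\<iota> i) \<one>\<^bsub>A\<^esub>"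
  have g: "?g \<in> ?I \<rightarrow> carrier ?F"
   using b(6)[OF _ v] by (intro Pi_I vs_smult[OF Fv] free_single) auto
  have hg: "h (?g i) = c i v \<odot>\<^bsub>X\<^esub> b i" if i: "i \<in> ?I" for i
  proof -
   have m: "single A (\<iota> i) \<one>\<^bsub>A\<^esub> <: ?F" using i by (intro free_single) auto
   have "h (single A (\<iota> i) \<one>\<^bsub>A\<^esub>) = b i" using h(2)[of "\<iota> i" "\<one>\<^bsub>A\<^esub>"] i rmodD(8)[OF X b(2)[OF i]] by (simp add: the_inv_f_f[OF \<iota>])
   then show ?thesis using homD(5)[OF h(1) b(6)[OF i v] m] by simp
  qed
  have "h (\<Oplus>\<^bsub>?F\<^esub> i\<in>?I. ?g i) = (\<Oplus>\<^bsub>X\<^esub> i\<in>?I. h (?g i))" by (rule lin_finsum[OF Fv V homD(1)[OF h(1)] g])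
  also have "\<dots> = (\<Oplus>\<^bsub>X\<^esub> i\<in>?I. c i v \<odot>\<^bsub>X\<^esub> b i)"
   using hg b(2) b(6)[OF _ v] V by (intro X.M.finsum_cong') auto
  also have "\<dots> = v" by (rule b(4)[OF v])
  finally have "h (\<Oplus>\<^bsub>?F\<^esub> i\<in>?I. ?g i) = v" .
  then show ?thesis by (rule image_eqI[OF sym F.M.finsum_closed[OF g]])
 qed
 then have "h ` carrier ?F = carrier X" using homD(3)[OF h(1)] by blast
 then show thesis using that[of ?J h] h(1) by simp
qed

lemma free_fin:
 assumes "findim A" "finite J"
 shows "findim (free_rmod A J)"
 by (rule fs_fin[OF alg_simps(1) free_fs assms(2,1)])

lemma free_resolution:
 assumes M: "rmodule M" and fin: "findim M" and Afin: "findim A"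
  and inf: "infinite (UNIV :: 'i set)"
 obtains J :: "nat \<Rightarrow> 'i set" and d \<epsilon> where "\<And>l. finite (J l)" "resolves M (\<lambda>l. free_rmod A (J l)) d \<epsilon>"
proof -
 let ?F = "free_rmod A :: 'i set \<Rightarrow> _"
 obtain J0 :: "'i set" and \<epsilon> where J0: "finite J0" "\<epsilon> \<in> rhom (?F J0) M" "\<epsilon> ` carrier (?F J0) = carrier M"
  by (rule free_cover[OF M fin inf])
 \<comment> \<open>The state is an index set together with the submodule of its free module, a
   kernel, that the next term has to cover.\<close>
 let ?P = "\<lambda>n s. finite (fst s) \<and> submod (?F (fst s)) (snd s) \<and>
  (n = 0 \<longrightarrow> s = (J0, {x \<in> carrier (?F J0). \<epsilon> x = \<zero>\<^bsub>M\<^esub>}))"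
 let ?Q = "\<lambda>n s s'. \<exists>d. d \<in> rhom (?F (fst s')) (?F (fst s)) \<and> d ` carrier (?F (fst s')) = snd s \<and>
   snd s' = {x \<in> carrier (?F (fst s')). d x = \<zero>\<^bsub>?F (fst s)\<^esub>}"
 have "\<exists>s. \<forall>n::nat. ?P n (s n) \<and> ?Q n (s n) (s (Suc n))"
 proof (rule dependent_nat_choice)
  have "?P 0 (J0, {x \<in> carrier (?F J0). \<epsilon> x = \<zero>\<^bsub>M\<^esub>})"
   using J0(1) submod_ker[OF free_rmod_module M J0(2)] by simp
  then show "\<exists>s. ?P 0 s" ..
 next
  fix s :: "'i set \<times> ('i \<Rightarrow> 'a) set" and n :: nat assume s: "?P n s"
  let ?N = "(?F (fst s))\<langle>snd s\<rangle>"
  have sm: "submod (?F (fst s)) (snd s)" using s by blast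
  have N: "rmodule ?N" using submod_rmod[OF sm] .
  have Nf: "findim ?N" using sub_fin[OF submodD(2)[OF sm] free_fin[OF Afin]] s by blast
  obtain J :: "'i set" and h where J: "finite J" "h \<in> rhom (?F J) ?N" "h ` carrier (?F J) = carrier ?N"
   by (rule free_cover[OF N Nf inf])
  have h: "h \<in> rhom (?F J) (?F (fst s))" using hom_comp[OF J(2) submod_incl[OF sm]] by simp
  have "?P (Suc n) (J, {x \<in> carrier (?F J). h x = \<zero>\<^bsub>?F (fst s)\<^esub>})"
   using J(1) submod_ker[OF free_rmod_module free_rmod_module h] by simp
  moreover have "?Q n s (J, {x \<in> carrier (?F J). h x = \<zero>\<^bsub>?F (fst s)\<^esub>})"
   using h J(3) by (intro exI[of _ h]) simp
  ultimately show "\<exists>s'. ?P (Suc n) s' \<and> ?Q n s s'" by blast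
 qed
 then obtain s where sPQ: "\<forall>n. ?P n (s n) \<and> ?Q n (s n) (s (Suc n))" ..
 have s: "?P n (s n)" for n using sPQ by (rule allE) (rule conjunct1)
 have "\<forall>n. ?Q n (s n) (s (Suc n))" using sPQ by (intro allI) (erule allE, rule conjunct2)
 from choice[OF this] obtain d where "\<forall>n. d n \<in> rhom (?F (fst (s (Suc n)))) (?F (fst (s n))) \<and>
  d n ` carrier (?F (fst (s (Suc n)))) = snd (s n) \<and>
  snd (s (Suc n)) = {x \<in> carrier (?F (fst (s (Suc n)))). d n x = \<zero>\<^bsub>?F (fst (s n))\<^esub>}" ..
 then have d: "\<And>n. d n \<in> rhom (?F (fst (s (Suc n)))) (?F (fst (s n)))"
  "\<And>n. d n ` carrier (?F (fst (s (Suc n)))) = snd (s n)"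
  "\<And>n. snd (s (Suc n)) = {x \<in> carrier (?F (fst (s (Suc n)))). d n x = \<zero>\<^bsub>?F (fst (s n))\<^esub>}"
  by simp_all
 have s0: "s 0 = (J0, {x \<in> carrier (?F J0). \<epsilon> x = \<zero>\<^bsub>M\<^esub>})" using s[of 0] by blast
 have "resolves M (\<lambda>l. ?F (fst (s l))) d \<epsilon>"
  unfolding resolves_def
 proof (intro conjI allI free_rmod_module d(1))
  show "\<epsilon> \<in> rhom (?F (fst (s 0))) M" "\<epsilon> ` carrier (?F (fst (s 0))) = carrier M" using J0 s0 by simp_all
  show "d 0 ` carrier (?F (fst (s 1))) = {x \<in> carrier (?F (fst (s 0))). \<epsilon> x = \<zero>\<^bsub>M\<^esub>}"
   using d(2)[of 0] s0 by simp
  show "d (Suc l) ` carrier (?F (fst (s (Suc (Suc l))))) = {x \<in> carrier (?F (fst (s (Suc l)))). d l x = \<zero>\<^bsub>?F (fst (s l))\<^esub>}" for l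
   using d(2)[of "Suc l"] d(3)[of l] by simp
 qed
 then show thesis using that[of "\<lambda>l. fst (s l)" d \<epsilon>] s by blast
qed

lemma zero_projective:
 assumes Z: "rmodule Z" and z: "carrier Z = {\<zero>\<^bsub>Z\<^esub>}"
 shows "projective_rmod K A Z"
 unfolding projective_rmod_def
 by (intro conjI Z exI[of _ "{}"] bexI[OF _ hom_zero[OF Z free_rmod_module]]
   bexI[OF _ hom_zero[OF free_rmod_module Z]] ballI) (simp add: z)

definition fin_resolution where
 "fin_resolution M Q d \<epsilon> L \<longleftrightarrow> projective_resolution K A M Q d \<epsilon> \<and>
   (\<forall>l. findim (Q l)) \<and> (\<forall>l>L. carrier (Q l) = {\<zero>\<^bsub>Q l\<^esub>})"

lemma fin_resolutionD:
 assumes "fin_resolution M Q d \<epsilon> L"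
 shows "projective_resolution K A M Q d \<epsilon>" "resolves M Q d \<epsilon>" "\<And>l. rmodule (Q l)"
  "\<And>l. projective_rmod K A (Q l)"
  "\<And>l. findim (Q l)" "\<And>l. l > L ==> carrier (Q l) = {\<zero>\<^bsub>Q l\<^esub>}"
 using assms projective_resolves resolvesD(1)
 by (auto simp: fin_resolution_def projective_resolution_def projective_rmod_def)

text \<open>The section s exhibits the image of d b as a retract of the projective module F (Suc b).
  Being projective itself, the image can replace F in degree Suc b, with the inclusion as
  differential and zeros from then on; hence the length Suc b.\<close>

lemma truncate:
 assumes P: "resolves M F d \<epsilon>" and pr: "\<And>l. projective_rmod K A (F l)"
  and fin: "\<And>l. findim (F l)"
  and s: "s \<in> rhom ((F b)\<langle>d b ` carrier (F (Suc b))\<rangle>) (F (Suc b))"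
  and ds: "\<And>x. x \<in> d b ` carrier (F (Suc b)) ==> d b (s x) = x"
 shows "\<exists>(Q :: nat \<Rightarrow> ('k, 'p, 'a) rmod) d'. fin_resolution (M :: ('k, 'm, 'a) rmod) Q d' \<epsilon> (Suc b)"
proof -
 note p = resolvesD[OF P]
 let ?W = "d b ` carrier (F (Suc b))"
 \<comment> \<open>Both the last term and the zero terms are cut out of F b, which keeps the whole
   resolution in the type of F.\<close>
 let ?Y = "(F b)\<langle>?W\<rangle>" and ?Z = "(F b)\<langle>{\<zero>\<^bsub>F b\<^esub>}\<rangle>"
 have W: "submod (F b) ?W" by (rule submod_im[OF p(1) p(1) p(2)])
 have Y: "rmodule ?Y" by (rule submod_rmod[OF W])
 have Z: "rmodule ?Z" by (rule submod_rmod[OF submod_zero[OF p(1)]])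
 have dY: "d b \<in> rhom (F (Suc b)) ?Y" by (rule hom_corestrict[OF p(2)]) simp
 have Yp: "projective_rmod K A ?Y"
 proof -
  obtain I :: "'p set" and \<sigma> \<rho> where I: "\<sigma> \<in> rhom (F (Suc b)) (free_rmod A I)" "\<rho> \<in> rhom (free_rmod A I) (F (Suc b))"
   "\<And>x. x <: (F (Suc b)) ==> \<rho> (\<sigma> x) = x"
   using pr[of "Suc b"] unfolding projective_rmod_def by blast
  have "d b (\<rho> (\<sigma> (s x))) = x" if "x <: ?Y" for x
   using that I(3)[OF homD(3)[OF s that]] ds by simp
  then show ?thesis unfolding projective_rmod_def
   by (intro conjI Y exI[of _ I] bexI[OF _ hom_comp[OF s I(1)]] bexI[OF _ hom_comp[OF I(2) dY]] ballI)
 qed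
 define Q where "Q l = (if l \<le> b then F l else if l = Suc b then ?Y else ?Z)" for l
 define d' where "d' l = (if l < b then d l else if l = b then (\<lambda>x. x) else (\<lambda>x. \<zero>\<^bsub>F b\<^esub>))" for l
 have Qb: "Q l = F l" if "l \<le> b" for l using that by (simp add: Q_def)
 have QY: "Q (Suc b) = ?Y" and QZ: "\<And>l. l > Suc b ==> Q l = ?Z" by (simp_all add: Q_def)
 have Vb: "vectorspace K (F b)" using rmodD(1)[OF p(1)] .
 have WF: "x <: (F b)" if "x \<in> ?W" for x using submodD(4)[OF W that] .
 have Wz: "\<zero>\<^bsub>F b\<^esub> \<in> ?W" using subD(3)[OF submodD(2)[OF W]] .
 have Qm: "rmodule (Q l)" for l by (simp add: Q_def p(1) Y Z)
 have Qp: "projective_rmod K A (Q l)" for l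
  using pr Yp zero_projective[OF Z] by (simp add: Q_def)
 have Qf: "findim (Q l)" for l
  using fin sub_fin[OF submodD(2)[OF W] fin] dim_zero(1)[OF rmodD(1)[OF Z]] by (simp add: Q_def)
 have d'h: "d' l \<in> rhom (Q (Suc l)) (Q l)" for l
 proof -
  consider "l < b" | "l = b" | "l > b" by linarith
  then show ?thesis
  proof cases
   case 1
   then show ?thesis using p(2) by (simp add: Qb d'_def)
  next
   case 2
   then show ?thesis using submod_incl[OF W] by (simp add: Qb QY d'_def)
  next
   case 3
   then have "\<zero>\<^bsub>Q l\<^esub> = \<zero>\<^bsub>F b\<^esub>" by (simp add: Q_def)
   then show ?thesis using hom_zero[OF Qm[of "Suc l"] Qm[of l]] 3 by (simp add: d'_def)
  qed
 qed
 have "resolves M Q d' \<epsilon>"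
  unfolding resolves_def
 proof (intro conjI allI Qm d'h)
  show "\<epsilon> \<in> rhom (Q 0) M" "\<epsilon> ` carrier (Q 0) = carrier M" using p by (simp_all add: Qb)
  have e0: "d 0 ` carrier (F 1) = {x \<in> carrier (F 0). \<epsilon> x = \<zero>\<^bsub>M\<^esub>}" using P by (simp add: resolves_def)
  show "d' 0 ` carrier (Q 1) = {x \<in> carrier (Q 0). \<epsilon> x = \<zero>\<^bsub>M\<^esub>}"
   using e0 by (cases "b = 0") (simp_all add: Q_def d'_def)
  show "d' (Suc l) ` carrier (Q (Suc (Suc l))) = {x \<in> carrier (Q (Suc l)). d' l x = \<zero>\<^bsub>Q l\<^esub>}" for l
  proof -
   have e: "d (Suc l) ` carrier (F (Suc (Suc l))) = {x \<in> carrier (F (Suc l)). d l x = \<zero>\<^bsub>F l\<^esub>}"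
    using P by (simp add: resolves_def)
   consider "Suc l < b" | "Suc l = b" | "l = b" | "l > b" by linarith
   then show ?thesis
   proof cases
    case 1
    then show ?thesis using e by (simp add: Q_def d'_def)
   next
    case 2
    then show ?thesis using e by (auto simp: Q_def d'_def)
   next
    case 3
    then show ?thesis using Wz by (auto simp: Q_def d'_def)
   next
    case 4
    then show ?thesis by (auto simp: Q_def d'_def)
   qed
  qed
 qed
 then have "fin_resolution M Q d' \<epsilon> (Suc b)"
  using Qp Qf unfolding fin_resolution_def projective_resolution_def resolves_def by (simp add: QZ)
 then show ?thesis by blast
qed

text \<open>If some projective resolution vanishes beyond degree \<open>b\<close>, then the comparison homotopy splits
 every other resolution there.\<close>

lemma finite_from_comparison:
 assumes P: "resolves M P dP \<epsilon>P" and F: "resolves M F d \<epsilon>"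
  and lP: "\<And>l. lifts (P l) (F l) M" "\<And>l. lifts (P (Suc l)) (F (Suc l)) (F l)"
  and lF: "lifts (F 0) (P 0) M" "\<And>l. lifts (F (Suc l)) (P (Suc l)) (P l)"
  and lFF: "\<And>l. lifts (F l) (F (Suc l)) (F l)"
  and zP: "\<And>l. l > b ==> carrier (P l) = {\<zero>\<^bsub>P l\<^esub>}"
 obtains s where "\<And>l. s l \<in> rhom (F l) (F (Suc l))"
  "\<And>l x. l \<ge> b ==> x <: (F (Suc l)) ==>
   x = d (Suc l) (s (Suc l) x) \<oplus>\<^bsub>F (Suc l)\<^esub> s l (d l x)"
proof -
 note p = resolvesD[OF P] and f = resolvesD[OF F]
 obtain u where u: "\<And>l. u l \<in> rhom (F l) (P l)" "\<And>x. x <: (F 0) ==> \<epsilon>P (u 0 x) = \<epsilon> x"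
  "\<And>l x. x <: (F (Suc l)) ==> dP l (u (Suc l) x) = u l (d l x)"
  using comparison[OF F P lF] by metis
 obtain v where v: "\<And>l. v l \<in> rhom (P l) (F l)" "\<And>x. x <: (P 0) ==> \<epsilon> (v 0 x) = \<epsilon>P x"
  "\<And>l x. x <: (P (Suc l)) ==> d l (v (Suc l) x) = v l (dP l x)"
  using comparison[OF P F lP] by metis
 have vu: "(\<lambda>x. v l (u l x)) \<in> rhom (F l) (F l)" for l by (rule hom_comp[OF u(1) v(1)])
 have vu0: "\<epsilon> (v 0 (u 0 x)) = \<epsilon> x" if "x <: (F 0)" for x
  using v(2)[OF homD(3)[OF u(1) that]] u(2)[OF that] by simp
 have vud: "d l (v (Suc l) (u (Suc l) x)) = v l (u l (d l x))" if "x <: (F (Suc l))" for l x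
  using v(3)[OF homD(3)[OF u(1) that]] u(3)[OF that] by simp
 obtain s where s: "\<And>l. s l \<in> rhom (F l) (F (Suc l))"
  "\<And>l x. x <: (F (Suc l)) ==>
   x = v (Suc l) (u (Suc l) x) \<oplus>\<^bsub>F (Suc l)\<^esub> (d (Suc l) (s (Suc l) x) \<oplus>\<^bsub>F (Suc l)\<^esub> s l (d l x))"
  using homotopy[OF F lFF, of "\<lambda>l x. v l (u l x)", OF vu vu0 vud] by metis
 show thesis
 proof (rule that[OF s(1)])
  fix l x assume l: "l \<ge> b" and x: "x <: (F (Suc l))"
  have "u (Suc l) x = \<zero>\<^bsub>P (Suc l)\<^esub>" using homD(3)[OF u(1) x] zP[of "Suc l"] l by auto
  then have "v (Suc l) (u (Suc l) x) = \<zero>\<^bsub>F (Suc l)\<^esub>" using hom_z[OF p(1) f(1) v(1)] by simp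
  moreover have "d (Suc l) (s (Suc l) x) <: (F (Suc l))" "s l (d l x) <: (F (Suc l))"
   using homD(3)[OF f(2)] homD(3)[OF s(1)] x by blast+
  ultimately show "x = d (Suc l) (s (Suc l) x) \<oplus>\<^bsub>F (Suc l)\<^esub> s l (d l x)"
   using s(2)[OF x] rmodD(1)[OF f(1), of "Suc l"] by simp
 qed
qed

text \<open>The given resolution P serves only to bound the length: its terms may be infinite
  dimensional. A finite dimensional free resolution is homotopic to it, hence splits where P has
  stopped, and can be truncated there.\<close>

lemma fin_resolution_exists:
 assumes M: "rmodule (M :: ('k, 'm, 'a) rmod)" and fin: "findim M"
  and Afin: "findim A" and inf: "infinite (UNIV :: 'i set)"
  and P: "projective_resolution K A M P dP \<epsilon>P" and zP: "\<And>l. l > b ==> carrier (P l) = {\<zero>\<^bsub>P l\<^esub>}"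
 shows "\<exists>(Q :: nat \<Rightarrow> ('k, 'i \<Rightarrow> 'a, 'a) rmod) d \<epsilon>. fin_resolution M Q d \<epsilon> (Suc b)"
proof -
 obtain J :: "nat \<Rightarrow> 'i set" and d \<epsilon> where J: "\<And>l. finite (J l)" and F: "resolves M (\<lambda>l. free_rmod A (J l)) d \<epsilon>"
  using free_resolution[where 'i='i, OF M fin Afin inf] by metis
 let ?F = "\<lambda>l. free_rmod A (J l)"
 note f = resolvesD[OF F] and p = resolvesD[OF projective_resolves[OF P]]
 have Pp: "projective_rmod K A (P l)" for l using P by (simp add: projective_resolution_def)
 obtain s where s: "\<And>l. s l \<in> rhom (?F l) (?F (Suc l))"
  "\<And>l x. l \<ge> b ==> x <: (?F (Suc l)) ==> x = d (Suc l) (s (Suc l) x) \<oplus>\<^bsub>?F (Suc l)\<^esub> s l (d l x)"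
  using finite_from_comparison[OF projective_resolves[OF P] F projective_lifts[OF Pp f(1) M]
    projective_lifts[OF Pp f(1) f(1)] free_lifts[OF p(1) M] free_lifts[OF p(1) p(1)] free_lifts[OF f(1) f(1)] zP]
  by metis
 let ?W = "d b ` carrier (?F (Suc b))"
 have W: "submod (?F b) ?W" by (rule submod_im[OF f(1) f(1) f(2)])
 have "d b (s b x) = x" if "x \<in> ?W" for x
 proof -
  obtain y where y: "y <: (?F (Suc b))" "x = d b y" using \<open>x \<in> ?W\<close> by blast
  have s1: "s (Suc b) y <: (?F (Suc (Suc b)))" and s2: "s b x <: (?F (Suc b))"
   using homD(3)[OF s(1)] homD(3)[OF f(2)] y by blast+
  \<comment> \<open>This is the homotopy identity for a preimage y of x after applying d b: its
    first term dies, and what remains says that s is a section of d b on the image.\<close>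
  have "x = d b (d (Suc b) (s (Suc b) y) \<oplus>\<^bsub>?F (Suc b)\<^esub> s b x)" using s(2)[of b y] y by simp
  also have "\<dots> = d b (d (Suc b) (s (Suc b) y)) \<oplus>\<^bsub>?F b\<^esub> d b (s b x)"
   using homD(4)[OF f(2)[of b]] homD(3)[OF f(2) s1] s2 by blast
  also have "\<dots> = d b (s b x)"
   using f(7)[OF s1] homD(3)[OF f(2) s2] rmodD(1)[OF f(1)[of b]] by (simp del: free_simps)
  finally show ?thesis by simp
 qed
 from truncate[OF F free_projective free_fin[OF Afin J] hom_dom[OF s(1) W] this]
 show ?thesis by blast
qed

lemma some_resolution:
 assumes "\<exists>P d \<epsilon>. projective_resolution K A (M :: ('k, 'm, 'a) rmod) (P :: nat \<Rightarrow> ('k, 'm \<times> 'a list \<Rightarrow> 'a, 'a) rmod) d \<epsilon>"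
 obtains P d \<epsilon> where "some_resolution K A M = (P, d)" "projective_resolution K A M P d \<epsilon>"
proof -
 have "\<exists>Pd. case Pd of (P, d) \<Rightarrow> \<exists>\<epsilon>. projective_resolution K A M (P :: nat \<Rightarrow> ('k, 'm \<times> 'a list \<Rightarrow> 'a, 'a) rmod) d \<epsilon>"
  using assms by auto
 from someI_ex[OF this] show thesis
  using that unfolding some_resolution_def by (auto split: prod.splits)
qed

subsection \<open>Euler characteristics\<close>

text \<open>Here c l is the dimension of the complex in degree l, h l that of its homology and r l
  the rank of the map between degrees l and l + 1. The relation does not depend on the direction of
  that map, so it applies to Hom and to tensor complexes alike.\<close>

lemma euler_sums:
 fixes h r c :: "nat \<Rightarrow> nat"
 assumes e: "\<And>l. h l + r l + (case l of 0 \<Rightarrow> 0 | Suc i \<Rightarrow> r i) = c l" and z: "\<And>l. l > L ==> c l = 0"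
 shows "(\<lambda>l. (-1) ^ l * int (h l)) sums (\<Sum>l\<le>L. (-1) ^ l * int (c l))"
proof -
 \<comment> \<open>The ranks telescope except for the last one; at n = L it vanishes because the
   complex is zero in degree L + 1.\<close>
 have p: "(\<Sum>l\<le>n. (-1) ^ l * int (h l)) = (\<Sum>l\<le>n. (-1) ^ l * int (c l)) - (-1) ^ n * int (r n)" for n
 proof (induction n)
  case 0
  then show ?case using e[of 0] by simp
 next
  case (Suc n)
  have "int (c (Suc n)) = int (h (Suc n)) + int (r (Suc n)) + int (r n)" using e[of "Suc n"] by simp
  then show ?case using Suc by (simp add: algebra_simps)
 qed
 have "r L = 0" using e[of "Suc L"] z[of "Suc L"] by simp
 moreover have "h l = 0" if "l > L" for l using e[of l] z[OF that] by simp
 ultimately show ?thesis using sums_finite[of "{..L}" "\<lambda>l. (-1) ^ l * int (h l)"] p[of L] by simp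
qed

section \<open>The Hom complex and the independence of Ext from the resolution\<close>

definition extZ where
 "extZ P d N l = {f \<in> carrier (hom_space K A (P l) N).
   compose (carrier (P (Suc l))) f (d l) = \<zero>\<^bsub>hom_space K A (P (Suc l)) N\<^esub>}"

definition extB where
 "extB P d N l = (case l of 0 \<Rightarrow> {\<zero>\<^bsub>hom_space K A (P 0) N\<^esub>}
   | Suc i \<Rightarrow> (\<lambda>f. compose (carrier (P (Suc i))) f (d i)) ` carrier (hom_space K A (P i) N))"

lemma pullback_lin:
 assumes P: "rmodule P" and h: "h \<in> rhom P Q" and N: "rmodule N"
 shows "(\<lambda>f. compose (carrier P) f h) \<in> lin K (hom_space K A Q N) (hom_space K A P N)"
proof (rule linI)
 show "compose (carrier P) f h <: (hom_space K A P N)" if "f <: (hom_space K A Q N)" for f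
  using hom_restrict[OF P hom_comp[OF h, of f N]] that unfolding compose_def by simp
qed (use homD(3)[OF h] in \<open>auto simp: compose_def fun_eq_iff\<close>)

lemma extZ_iff:
 "f \<in> extZ P d N l \<longleftrightarrow> f <: (hom_space K A (P l) N) \<and> (\<forall>x\<in>carrier (P (Suc l)). f (d l x) = \<zero>\<^bsub>N\<^esub>)"
 by (auto simp: extZ_def compose_def fun_eq_iff)

lemma ext_sub:
 assumes P: "resolves M P d \<epsilon>" and N: "rmodule N"
 shows "sspace K (extZ P d N l) (hom_space K A (P l) N)" "sspace K (extB P d N l) (hom_space K A (P l) N)"
  "extB P d N l \<subseteq> extZ P d N l"
proof -
 note p = resolvesD[OF P]
 note H = hom_space_vs[OF p(1) N]
 show "sspace K (extZ P d N l) (hom_space K A (P l) N)"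
  unfolding extZ_def by (rule lin_ker_sub[OF H H pullback_lin[OF p(1) p(2) N]])
 show "sspace K (extB P d N l) (hom_space K A (P l) N)"
 proof (cases l)
  case 0
  then show ?thesis using sub_zero[OF H[of 0]] by (simp add: extB_def)
 next
  case (Suc i)
  then show ?thesis unfolding extB_def
   using lin_im_sub[OF H H pullback_lin[OF p(1) p(2) N] sub_self[OF H]] by simp
 qed
 show "extB P d N l \<subseteq> extZ P d N l"
 proof
  fix f assume f: "f \<in> extB P d N l"
  show "f \<in> extZ P d N l"
  proof (cases l)
   case 0
   then have "f = \<zero>\<^bsub>hom_space K A (P l) N\<^esub>" using f by (simp add: extB_def)
   then show ?thesis using subD(3)[OF \<open>sspace K (extZ P d N l) (hom_space K A (P l) N)\<close>] by simp
  next
   case (Suc i)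
   then obtain g where g: "g <: (hom_space K A (P i) N)" "f = compose (carrier (P (Suc i))) g (d i)"
    using f by (auto simp: extB_def)
   have "f (d l x) = \<zero>\<^bsub>N\<^esub>" if x: "x <: (P (Suc l))" for x
    using g x Suc p(7)[of x i] homD(3)[OF p(2), of x l] hom_z[OF p(1) N, of g i] by (simp add: compose_def)
   moreover have "f <: (hom_space K A (P l) N)"
    using linD(1)[OF pullback_lin[OF p(1) p(2) N] g(1)] g(2) Suc by simp
   ultimately show ?thesis by (simp only: extZ_iff) blast
  qed
 qed
qed

lemma ext_chain_map:
 assumes P: "resolves M P d \<epsilon>" and Q: "resolves M' Q d' \<epsilon>'" and N: "rmodule N"
  and u: "\<And>l. u l \<in> rhom (P l) (Q l)"
  and ud: "\<And>l x. x <: (P (Suc l)) ==> d' l (u (Suc l) x) = u l (d l x)"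
 shows "f \<in> extZ Q d' N l ==> compose (carrier (P l)) f (u l) \<in> extZ P d N l"
  and "f \<in> extB Q d' N l ==> compose (carrier (P l)) f (u l) \<in> extB P d N l"
proof -
 note p = resolvesD[OF P] and q = resolvesD[OF Q]
 have pb: "compose (carrier (P l)) f (u l) <: (hom_space K A (P l) N)"
  if "f <: (hom_space K A (Q l) N)" for f l
  by (rule linD(1)[OF pullback_lin[OF p(1) u N] that])
 show "compose (carrier (P l)) f (u l) \<in> extZ P d N l" if f: "f \<in> extZ Q d' N l"
 proof -
  have "f (u l (d l x)) = \<zero>\<^bsub>N\<^esub>" if x: "x <: (P (Suc l))" for x
   using f homD(3)[OF u x] ud[OF x, symmetric] by (simp add: extZ_iff)
  then show ?thesis using f pb homD(3)[OF p(2)] unfolding extZ_iff by (simp add: compose_def)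
 qed
 show "compose (carrier (P l)) f (u l) \<in> extB P d N l" if f: "f \<in> extB Q d' N l"
 proof (cases l)
  case 0
  then have "f = (\<lambda>x\<in>carrier (Q 0). \<zero>\<^bsub>N\<^esub>)" using f by (simp add: extB_def)
  then have "compose (carrier (P 0)) f (u 0) = (\<lambda>x\<in>carrier (P 0). \<zero>\<^bsub>N\<^esub>)"
   using homD(3)[OF u, of _ 0] by (auto simp: compose_def fun_eq_iff)
  then show ?thesis using 0 by (simp add: extB_def)
 next
  case (Suc i)
  then obtain g where g: "g <: (hom_space K A (Q i) N)" "f = compose (carrier (Q (Suc i))) g (d' i)"
   using f by (auto simp: extB_def)
  have "compose (carrier (P (Suc i))) f (u (Suc i)) = compose (carrier (P (Suc i))) (compose (carrier (P i)) g (u i)) (d i)"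
   using g(2) homD(3)[OF u] homD(3)[OF p(2)] ud by (auto simp: compose_def fun_eq_iff)
  then show ?thesis using Suc pb[OF g(1)] by (auto simp: extB_def)
 qed
qed

text \<open>Applying a cocycle z to the homotopy identity kills the term d s and leaves z = z v u +
  (z s) d, where the last term is a coboundary. In degree 0 there is no such term, and the
  coboundary is zero.\<close>

lemma ext_homotopy:
 assumes P: "resolves M P d \<epsilon>" and Q: "resolves M Q d' \<epsilon>'" and N: "rmodule N"
  and u: "\<And>l. u l \<in> rhom (P l) (Q l)" and v: "\<And>l. v l \<in> rhom (Q l) (P l)"
  and s: "\<And>l. s l \<in> rhom (P l) (P (Suc l))"
  and s0: "\<And>x. x <: (P 0) ==> x = v 0 (u 0 x) \<oplus>\<^bsub>P 0\<^esub> d 0 (s 0 x)"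
  and ss: "\<And>l x. x <: (P (Suc l)) ==>
   x = v (Suc l) (u (Suc l) x) \<oplus>\<^bsub>P (Suc l)\<^esub> (d (Suc l) (s (Suc l) x) \<oplus>\<^bsub>P (Suc l)\<^esub> s l (d l x))"
  and z: "z \<in> extZ P d N l"
 shows "\<exists>b\<in>extB P d N l. z = compose (carrier (P l)) (compose (carrier (Q l)) z (v l)) (u l) \<oplus>\<^bsub>hom_space K A (P l) N\<^esub> b"
proof -
 note p = resolvesD[OF P] and q = resolvesD[OF Q]
 have zh: "z \<in> rhom (P l) N" and ze: "z \<in> extensional (carrier (P l))"
  and zd: "\<And>x. x <: (P (Suc l)) ==> z (d l x) = \<zero>\<^bsub>N\<^esub>" using z by (auto simp: extZ_iff)
 note NV = rmodD(1)[OF N]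
 have uP: "u l x <: (Q l)" "v l (u l x) <: (P l)" "s l x <: (P (Suc l))"
  if "x <: (P l)" for x l
  using homD(3)[OF u that] homD(3)[OF v] homD(3)[OF s that] by auto
 show ?thesis
 proof (cases l)
  case 0
  have "z x = z (v 0 (u 0 x))" if x: "x <: (P 0)" for x
  proof -
   have "z x = z (v 0 (u 0 x) \<oplus>\<^bsub>P 0\<^esub> d 0 (s 0 x))" using s0[OF x] by simp
   also have "\<dots> = z (v 0 (u 0 x)) \<oplus>\<^bsub>N\<^esub> z (d 0 (s 0 x))"
    using homD(4)[OF zh] uP[OF x] homD(3)[OF p(2) uP(3)[OF x]] 0 by simp
   finally show ?thesis using zd[of "s 0 x"] uP[OF x] 0 NV homD(3)[OF zh, of "v 0 (u 0 x)"] by simp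
  qed
  moreover have "z (v 0 (u 0 x)) \<oplus>\<^bsub>N\<^esub> \<zero>\<^bsub>N\<^esub> = z (v 0 (u 0 x))" if x: "x <: (P 0)" for x
   using homD(3)[OF zh, of "v 0 (u 0 x)"] uP(2)[OF x] 0 NV by simp
  ultimately have "z = compose (carrier (P l)) (compose (carrier (Q l)) z (v l)) (u l) \<oplus>\<^bsub>hom_space K A (P l) N\<^esub> \<zero>\<^bsub>hom_space K A (P l) N\<^esub>"
   using uP ze 0 by (intro extensionalityI[where A="carrier (P l)"]) (simp_all add: compose_def)
  moreover have "\<zero>\<^bsub>hom_space K A (P l) N\<^esub> \<in> extB P d N l" using 0 by (simp add: extB_def)
  ultimately show ?thesis by blast
 next
  case (Suc i)
  let ?b = "compose (carrier (P (Suc i))) (compose (carrier (P i)) z (s i)) (d i)"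
  have "?b \<in> extB P d N l"
   using linD(1)[OF pullback_lin[OF p(1) s N], of z i] zh ze Suc by (auto simp: extB_def)
  moreover have eq: "z x = z (v l (u l x)) \<oplus>\<^bsub>N\<^esub> z (s i (d i x))" if x: "x <: (P l)" for x
  proof -
   have x': "x <: (P (Suc i))" using x Suc by simp
   have di: "d i x <: (P i)" using homD(3)[OF p(2) x'] .
   have si: "s i (d i x) <: (P l)" using uP(3)[OF di] Suc by simp
   have dsl: "d l (s l x) <: (P l)" using homD(3)[OF p(2) uP(3)[OF x]] .
   have V: "vectorspace K (P l)" using rmodD(1)[OF p(1)] .
   have "z x = z (v l (u l x) \<oplus>\<^bsub>P l\<^esub> (d l (s l x) \<oplus>\<^bsub>P l\<^esub> s i (d i x)))"
    using ss[OF x'] Suc by simp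
   also have "\<dots> = z (v l (u l x)) \<oplus>\<^bsub>N\<^esub> (z (d l (s l x)) \<oplus>\<^bsub>N\<^esub> z (s i (d i x)))"
    using homD(4)[OF zh] uP(2)[OF x] dsl si V by simp
   finally show ?thesis using zd[OF uP(3)[OF x]] NV homD(3)[OF zh si] by simp
  qed
  have "z = compose (carrier (P l)) (compose (carrier (Q l)) z (v l)) (u l) \<oplus>\<^bsub>hom_space K A (P l) N\<^esub> ?b"
  proof (rule extensionalityI[OF ze])
   fix x assume x: "x <: (P l)"
   then have "x <: (P (Suc i))" "d i x <: (P i)" using homD(3)[OF p(2)] Suc by auto
   then show "z x = (compose (carrier (P l)) (compose (carrier (Q l)) z (v l)) (u l) \<oplus>\<^bsub>hom_space K A (P l) N\<^esub> ?b) x"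
    using eq[OF x] uP(1)[OF x] x by (simp add: compose_def)
  qed simp
  ultimately show ?thesis by blast
 qed
qed

text \<open>One half of a homotopy equivalence: u is a chain map and v u is homotopic to the
  identity. That v is a chain map belongs to the other half, the same predicate with the roles
  exchanged.\<close>

definition chain_equiv where
 "chain_equiv P d Q d' u v s \<longleftrightarrow> (\<forall>l. u l \<in> rhom (P l) (Q l)) \<and> (\<forall>l. v l \<in> rhom (Q l) (P l)) \<and>
   (\<forall>l. s l \<in> rhom (P l) (P (Suc l))) \<and>
   (\<forall>l. \<forall>x\<in>carrier (P (Suc l)). d' l (u (Suc l) x) = u l (d l x)) \<and>
   (\<forall>x\<in>carrier (P 0). x = v 0 (u 0 x) \<oplus>\<^bsub>P 0\<^esub> d 0 (s 0 x)) \<and>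
   (\<forall>l. \<forall>x\<in>carrier (P (Suc l)).
    x = v (Suc l) (u (Suc l) x) \<oplus>\<^bsub>P (Suc l)\<^esub> (d (Suc l) (s (Suc l) x) \<oplus>\<^bsub>P (Suc l)\<^esub> s l (d l x)))"

lemma chain_equivD:
 assumes "chain_equiv P d Q d' u v s"
 shows "\<And>l. u l \<in> rhom (P l) (Q l)" "\<And>l. v l \<in> rhom (Q l) (P l)" "\<And>l. s l \<in> rhom (P l) (P (Suc l))"
  "\<And>l x. x <: (P (Suc l)) ==> d' l (u (Suc l) x) = u l (d l x)"
  "\<And>x. x <: (P 0) ==> x = v 0 (u 0 x) \<oplus>\<^bsub>P 0\<^esub> d 0 (s 0 x)"
  "\<And>l x. x <: (P (Suc l)) ==>
   x = v (Suc l) (u (Suc l) x) \<oplus>\<^bsub>P (Suc l)\<^esub> (d (Suc l) (s (Suc l) x) \<oplus>\<^bsub>P (Suc l)\<^esub> s l (d l x))"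
 using assms unfolding chain_equiv_def by blast+

lemma chain_equivalence:
 assumes P: "projective_resolution K A M P d \<epsilon>" and Q: "projective_resolution K A M Q d' \<epsilon>'"
  and M: "rmodule M"
 shows "\<exists>u v s t. chain_equiv P d Q d' u v s \<and> chain_equiv Q d' P d v u t"
proof -
 note rP = projective_resolves[OF P] and rQ = projective_resolves[OF Q]
 note p = resolvesD[OF rP] and q = resolvesD[OF rQ]
 have Pp: "projective_rmod K A (P l)" and Qp: "projective_rmod K A (Q l)" for l
  using P Q by (simp_all add: projective_resolution_def)
 obtain u where u: "\<And>l. u l \<in> rhom (P l) (Q l)" "\<And>x. x <: (P 0) ==> \<epsilon>' (u 0 x) = \<epsilon> x"
  "\<And>l x. x <: (P (Suc l)) ==> d' l (u (Suc l) x) = u l (d l x)"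
  using comparison[OF rP rQ projective_lifts[OF Pp q(1) M] projective_lifts[OF Pp q(1) q(1)]] by metis
 obtain v where v: "\<And>l. v l \<in> rhom (Q l) (P l)" "\<And>x. x <: (Q 0) ==> \<epsilon> (v 0 x) = \<epsilon>' x"
  "\<And>l x. x <: (Q (Suc l)) ==> d l (v (Suc l) x) = v l (d' l x)"
  using comparison[OF rQ rP projective_lifts[OF Qp p(1) M] projective_lifts[OF Qp p(1) p(1)]] by metis
 have vu0: "\<epsilon> (v 0 (u 0 x)) = \<epsilon> x" if "x <: (P 0)" for x
  using v(2)[OF homD(3)[OF u(1) that]] u(2)[OF that] by simp
 have vud: "d l (v (Suc l) (u (Suc l) x)) = v l (u l (d l x))" if "x <: (P (Suc l))" for l x
  using v(3)[OF homD(3)[OF u(1) that]] u(3)[OF that] by simp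
 have uv0: "\<epsilon>' (u 0 (v 0 x)) = \<epsilon>' x" if "x <: (Q 0)" for x
  using u(2)[OF homD(3)[OF v(1) that]] v(2)[OF that] by simp
 have uvd: "d' l (u (Suc l) (v (Suc l) x)) = u l (v l (d' l x))" if "x <: (Q (Suc l))" for l x
  using u(3)[OF homD(3)[OF v(1) that]] v(3)[OF that] by simp
 obtain s where s: "\<And>l. s l \<in> rhom (P l) (P (Suc l))"
  "\<And>x. x <: (P 0) ==> x = v 0 (u 0 x) \<oplus>\<^bsub>P 0\<^esub> d 0 (s 0 x)"
  "\<And>l x. x <: (P (Suc l)) ==>
   x = v (Suc l) (u (Suc l) x) \<oplus>\<^bsub>P (Suc l)\<^esub> (d (Suc l) (s (Suc l) x) \<oplus>\<^bsub>P (Suc l)\<^esub> s l (d l x))"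
  using homotopy[OF rP projective_lifts[OF Pp p(1) p(1)], of "\<lambda>l x. v l (u l x)", OF hom_comp[OF u(1) v(1)] vu0 vud] by metis
 obtain t where t: "\<And>l. t l \<in> rhom (Q l) (Q (Suc l))"
  "\<And>x. x <: (Q 0) ==> x = u 0 (v 0 x) \<oplus>\<^bsub>Q 0\<^esub> d' 0 (t 0 x)"
  "\<And>l x. x <: (Q (Suc l)) ==>
   x = u (Suc l) (v (Suc l) x) \<oplus>\<^bsub>Q (Suc l)\<^esub> (d' (Suc l) (t (Suc l) x) \<oplus>\<^bsub>Q (Suc l)\<^esub> t l (d' l x))"
  using homotopy[OF rQ projective_lifts[OF Qp q(1) q(1)], of "\<lambda>l x. u l (v l x)", OF hom_comp[OF v(1) u(1)] uv0 uvd] by metis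
 have "chain_equiv P d Q d' u v s"
  unfolding chain_equiv_def by (intro conjI allI ballI u(1,3) v(1) s)
 moreover have "chain_equiv Q d' P d v u t"
  unfolding chain_equiv_def by (intro conjI allI ballI u(1) v(1,3) t)
 ultimately show ?thesis by blast
qed

text \<open>\<open>Ext\<close> is built on an arbitrary choice, possibly of infinite length and
  dimension. Each of its spaces is moved to Q by \<open>subquotient_iso\<close>, and dimensions are
  counted there. The premise \<open>ex\<close> guarantees that the choice yields a resolution at
  all.\<close>

lemma ext_euler:
 assumes M: "rmodule (M :: ('k, 'm, 'a) rmod)" and N: "rmodule (N :: ('k, 'n, 'a) rmod)"
  and Nfin: "findim N"
  and Q: "fin_resolution M Q d' \<epsilon>' L"
  and ex: "\<exists>P d \<epsilon>. projective_resolution K A M (P :: nat \<Rightarrow> ('k, 'm \<times> 'a list \<Rightarrow> 'a, 'a) rmod) d \<epsilon>"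
 shows "has_euler_characteristic K (\<lambda>l. Ext K A M N l)
   (\<Sum>l\<le>L. (-1) ^ l * int (vdim (hom_space K A (Q l) N)))"
proof -
 obtain P d \<epsilon> where P: "some_resolution K A M = (P, d)" "projective_resolution K A M P d \<epsilon>"
  by (rule some_resolution[OF ex])
 note rP = projective_resolves[OF P(2)]
 note qq = fin_resolutionD[OF Q]
 note p = resolvesD[OF rP] and q = resolvesD[OF qq(2)]
 obtain u v s t where H: "chain_equiv P d Q d' u v s" "chain_equiv Q d' P d v u t"
  using chain_equivalence[OF P(2) qq(1) M] by blast
 note c = chain_equivD[OF H(1)] and c' = chain_equivD[OF H(2)]
 note u = c(1) and v = c(2) and s = c(3) and ud = c(4) and s0 = c(5) and ss = c(6)
  and t = c'(3) and vd = c'(4) and t0 = c'(5) and ts = c'(6)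
 let ?C = "\<lambda>l. hom_space K A (Q l) N"
 have E: "Ext K A M N l = subquotient (hom_space K A (P l) N) (extZ P d N l) (extB P d N l)" for l
  by (simp only: Ext_def P(1) extZ_def extB_def Let_def prod.case)
 have Cv: "vectorspace K (?C l)" for l by (rule hom_space_vs[OF q(1) N])
 have Cf: "findim (?C l)" for l by (rule hom_space_fin[OF q(1) N qq(5) Nfin])
 note sP = ext_sub[OF rP N] and sQ = ext_sub[OF qq(2) N]
 have vZ: "compose (carrier (Q l)) f (v l) \<in> extZ Q d' N l" if "f \<in> extZ P d N l" for f l
  by (rule ext_chain_map(1)[where u=v, OF qq(2) rP N v vd]) (assumption | rule that)+
 have uZ: "compose (carrier (P l)) f (u l) \<in> extZ P d N l" if "f \<in> extZ Q d' N l" for f l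
  by (rule ext_chain_map(1)[where u=u, OF rP qq(2) N u ud]) (assumption | rule that)+
 have vB: "compose (carrier (Q l)) f (v l) \<in> extB Q d' N l" if "f \<in> extB P d N l" for f l
  by (rule ext_chain_map(2)[where u=v, OF qq(2) rP N v vd]) (assumption | rule that)+
 have uB: "compose (carrier (P l)) f (u l) \<in> extB P d N l" if "f \<in> extB Q d' N l" for f l
  by (rule ext_chain_map(2)[where u=u, OF rP qq(2) N u ud]) (assumption | rule that)+
 have hP: "\<exists>b\<in>extB P d N l. z = compose (carrier (P l)) (compose (carrier (Q l)) z (v l)) (u l) \<oplus>\<^bsub>hom_space K A (P l) N\<^esub> b"
  if "z \<in> extZ P d N l" for z l
  by (rule ext_homotopy[where u=u and v=v and s=s, OF rP qq(2) N u v s s0 ss]) (assumption | rule that)+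
 have hQ: "\<exists>b\<in>extB Q d' N l. z = compose (carrier (Q l)) (compose (carrier (P l)) z (u l)) (v l) \<oplus>\<^bsub>hom_space K A (Q l) N\<^esub> b"
  if "z \<in> extZ Q d' N l" for z l
  by (rule ext_homotopy[where u=v and v=u and s=t, OF qq(2) rP N v u t t0 ts]) (assumption | rule that)+
 have pz: "(\<lambda>f. compose (carrier (Q l)) f (v l)) \<in> lin K ((hom_space K A (P l) N)\<langle>extZ P d N l\<rangle>) ((?C l)\<langle>extZ Q d' N l\<rangle>)" for l
  by (rule lin_sub[OF pullback_lin[OF q(1)[of l] v[of l] N] sP(1)[of l] vZ])
 have qz: "(\<lambda>f. compose (carrier (P l)) f (u l)) \<in> lin K ((?C l)\<langle>extZ Q d' N l\<rangle>) ((hom_space K A (P l) N)\<langle>extZ P d N l\<rangle>)" for l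
  by (rule lin_sub[OF pullback_lin[OF p(1)[of l] u[of l] N] sQ(1)[of l] uZ])
 have Zf: "findim ((?C l)\<langle>extZ Q d' N l\<rangle>)" for l
  by (rule sub_fin[OF sQ(1) Cf])
 have iso: "findim (subquotient (hom_space K A (P l) N) (extZ P d N l) (extB P d N l))"
  "vdim (subquotient (hom_space K A (P l) N) (extZ P d N l) (extB P d N l))
   + vdim ((?C l)\<langle>extB Q d' N l\<rangle>) = vdim ((?C l)\<langle>extZ Q d' N l\<rangle>)" for l
  by (rule subquotient_iso[OF sP(1-3)[of l] sQ(1-3)[of l] pz[of l] _ qz[of l] _ _ _ Zf[of l]];
    (rule vB uB hP hQ; assumption))+
 define r where "r l = vdim ((?C (Suc l))\<langle>(\<lambda>f. compose (carrier (Q (Suc l))) f (d' l)) ` carrier (?C l)\<rangle>)" for l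
 have rn: "vdim (?C l) = r l + vdim ((?C l)\<langle>extZ Q d' N l\<rangle>)" for l
  unfolding r_def extZ_def by (rule rank_nullity[OF Cv Cv pullback_lin[OF q(1) q(2) N] Cf])
 have rB: "vdim ((?C l)\<langle>extB Q d' N l\<rangle>) = (case l of 0 \<Rightarrow> 0 | Suc i \<Rightarrow> r i)" for l
 proof (cases l)
  case 0
  have "vdim ((?C 0)\<langle>{\<zero>\<^bsub>?C 0\<^esub>}\<rangle>) = 0"
   by (rule dim_zero(2)[OF sub_vs[OF sub_zero[OF Cv]]]) simp
  then show ?thesis using 0 by (simp add: extB_def)
 next
  case (Suc i)
  then show ?thesis by (simp add: extB_def r_def)
 qed
 have z: "vdim (?C l) = 0" if "l > L" for l
 proof (rule dim_zero(2)[OF Cv])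
  have "f = \<zero>\<^bsub>?C l\<^esub>" if f: "f <: (?C l)" for f
  proof (rule extensionalityI[of f "carrier (Q l)"])
   show "f x = \<zero>\<^bsub>?C l\<^esub> x" if "x <: (Q l)" for x
    using that qq(6)[OF \<open>l > L\<close>] hom_z[OF q(1) N, of f l] f by simp
  qed (use f in auto)
  then show "carrier (?C l) = {\<zero>\<^bsub>?C l\<^esub>}" using vs_zero[OF Cv] by blast
 qed
 show ?thesis
  unfolding has_euler_characteristic_def
 proof (intro conjI allI)
  show "findim (Ext K A M N l)" for l unfolding E by (rule iso(1))
  show "(\<lambda>l. (-1) ^ l * int (vdim (Ext K A M N l))) sums
    (\<Sum>l\<le>L. (-1) ^ l * int (vdim (hom_space K A (Q l) N)))"
  proof (rule euler_sums[where r=r, OF _ z])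
   show "vdim (Ext K A M N l) + r l + (case l of 0 \<Rightarrow> 0 | Suc i \<Rightarrow> r i) = vdim (?C l)" for l
    using rn[of l] iso(2)[of l] unfolding E rB by simp
  qed
 qed
qed

end

section \<open>Presented spaces and tensor products\<close>

context base_field
begin

lemma lin_id: "(\<lambda>x. x) \<in> lin K V V"
 by (rule linI) auto

lemma lin_add:
 assumes W: "vectorspace K W" and f: "f \<in> lin K V W" and g: "g \<in> lin K V W"
 shows "(\<lambda>x. f x \<oplus>\<^bsub>W\<^esub> g x) \<in> lin K V W"
 using linD[OF f] linD[OF g] W by (intro linI) (simp_all add: vs_ac vs_smult_add)

lemma sub_finsum:
 assumes W: "sspace K W V" and g: "g \<in> I \<rightarrow> W"
 shows "(\<Oplus>\<^bsub>V\<^esub> i\<in>I. g i) \<in> W"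
proof -
 interpret V: vectorspace K V using subD(1)[OF W] .
 show ?thesis
  using g
 proof (induction I rule: infinite_finite_induct)
  case (insert x F)
  then have "g \<in> F \<rightarrow> carrier V" "g x <: V" using subD(6)[OF W] by auto
  then show ?case using insert subD(4)[OF W] by (simp add: V.M.finsum_insert)
 qed (use subD(3)[OF W] in simp_all)
qed

lemma free_space_fs: "fs_space (free_space K X) scal X"
 by (simp add: fs_space_def free_space_def)

lemma unit_fun_single: "unit_fun K x = single scal x \<one>"
 by (simp add: unit_fun_def single_def fun_eq_iff)

lemma free_space_vs: "vectorspace K (free_space K X)"
 by (rule fs_vs[OF scal_vs free_space_fs])

lemma unit_fun_mem: "x \<in> X ==> unit_fun K x <: (free_space K X)"
 unfolding unit_fun_single by (rule single_mem[OF scal_vs free_space_fs]) auto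

lemma span_sub:
 assumes V: "vectorspace K V" and R: "R \<subseteq> carrier V"
 shows "sspace K (LinearCombinations.module.span K V R) V" "R \<subseteq> LinearCombinations.module.span K V R"
  "\<And>W. sspace K W V ==> R \<subseteq> W ==> LinearCombinations.module.span K V R \<subseteq> W"
proof -
 interpret V: vectorspace K V by (rule V)
 show "sspace K (V.span R) V" by (rule V.span_is_subspace[OF R])
 show "R \<subseteq> V.span R" by (rule V.in_own_span[OF R])
 show "V.span R \<subseteq> W" if "sspace K W V" "R \<subseteq> W" for W
  using V.span_is_subset[OF that(2)] that(1) by (simp add: VectorSpace.subspace_def)
qed

context
 fixes X :: "'i set" and R :: "('i \<Rightarrow> 'k) set"
 assumes R: "R \<subseteq> carrier (free_space K X)"
begin

lemma pres_vs: "vectorspace K (presented_space K X R)"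
 unfolding presented_space_def by (rule quotient_vs(1)[OF span_sub(1)[OF free_space_vs R]])

lemma pres_gen_mem: "x \<in> X ==> presented_gen K X R x <: (presented_space K X R)"
 unfolding presented_space_def presented_gen_def
 using linD(1)[OF quotient_vs(2)[OF span_sub(1)[OF free_space_vs R]] unit_fun_mem] .

lemma pres_lin_eq:
 assumes W: "vectorspace K W" and t: "t \<in> lin K (presented_space K X R) W" "t' \<in> lin K (presented_space K X R) W"
  and e: "\<And>x. x \<in> X ==> t (presented_gen K X R x) = t' (presented_gen K X R x)"
  and f: "f <: (presented_space K X R)"
 shows "t f = t' f"
proof -
 let ?F = "free_space K X" and ?S = "LinearCombinations.module.span K (free_space K X) R"
 note q = quotient_vs(2)[OF span_sub(1)[OF free_space_vs R]]
 obtain g where g: "g <: ?F" "f = ?S +>\<^bsub>?F\<^esub> g"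
  using f quotient_coset_simps(4)[OF span_sub(1)[OF free_space_vs R]] unfolding presented_space_def by auto
 have "t (?S +>\<^bsub>?F\<^esub> g) = t' (?S +>\<^bsub>?F\<^esub> g)"
 proof (rule fs_lin_eq[OF scal_vs free_space_fs W _ _ _ g(1)])
  show "(\<lambda>g. t (?S +>\<^bsub>?F\<^esub> g)) \<in> lin K ?F W" "(\<lambda>g. t' (?S +>\<^bsub>?F\<^esub> g)) \<in> lin K ?F W"
   using lin_comp[OF q] t unfolding presented_space_def by blast+
  fix x c assume x: "x \<in> X" and c: "c <: scal"
  have "single scal x c = c \<odot>\<^bsub>?F\<^esub> unit_fun K x"
   using c by (auto simp: single_def unit_fun_def free_space_def fun_eq_iff)
  then have s: "?S +>\<^bsub>?F\<^esub> single scal x c = c \<odot>\<^bsub>presented_space K X R\<^esub> presented_gen K X R x"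
   using linD(3)[OF q _ unit_fun_mem[OF x], of c] c unfolding presented_space_def presented_gen_def by simp
  show "t (?S +>\<^bsub>?F\<^esub> single scal x c) = t' (?S +>\<^bsub>?F\<^esub> single scal x c)"
   unfolding s using linD(3)[OF t(1) _ pres_gen_mem[OF x], of c] linD(3)[OF t(2) _ pres_gen_mem[OF x], of c] c e[OF x]
   by simp
 qed
 then show ?thesis using g by simp
qed

text \<open>The relations are checked on some linear map h with the right values on generators,
  which spares computing with the sum over the support in \<open>presented_lift\<close>; the two
  agree because they agree on generators.\<close>

lemma pres_lift:
 assumes V: "vectorspace K V" and g: "\<And>x. x \<in> X ==> g x <: V"
  and h: "h \<in> lin K (free_space K X) V" "\<And>x. x \<in> X ==> h (unit_fun K x) = g x"
  and r: "\<And>f. f \<in> R ==> h f = \<zero>\<^bsub>V\<^esub>"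
 shows "presented_lift K V g \<in> lin K (presented_space K X R) V"
  and "\<And>x. x \<in> X ==> presented_lift K V g (presented_gen K X R x) = g x"
proof -
 let ?F = "free_space K X" and ?S = "LinearCombinations.module.span K (free_space K X) R"
 let ?h = "\<lambda>f. \<Oplus>\<^bsub>V\<^esub> x\<in>{x. f x \<noteq> \<zero>}. f x \<odot>\<^bsub>V\<^esub> g x"
 note S = span_sub[OF free_space_vs R]
 have gl: "(\<lambda>c. c \<odot>\<^bsub>V\<^esub> g x) \<in> lin K scal V" if "x \<in> X" for x
  using V g[OF that] by (intro linI) (simp_all add: vs_add_smult vs_smult_smult)
 have l: "?h \<in> lin K ?F V"
  using fs_lift(1)[OF scal_vs free_space_fs V, of X "\<lambda>x c. c \<odot>\<^bsub>V\<^esub> g x"] gl by simp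
 have eq: "?h f = h f" if "f <: ?F" for f
 proof (rule fs_lin_eq[OF scal_vs free_space_fs V l h(1) _ that])
  fix x c assume x: "x \<in> X" and c: "c <: scal"
  have "single scal x c = c \<odot>\<^bsub>?F\<^esub> unit_fun K x"
   using c by (auto simp: single_def unit_fun_def free_space_def fun_eq_iff)
  then have "h (single scal x c) = c \<odot>\<^bsub>V\<^esub> g x" using linD(3)[OF h(1) _ unit_fun_mem[OF x], of c] h(2)[OF x] c by simp
  moreover have "?h (single scal x c) = c \<odot>\<^bsub>V\<^esub> g x"
   using fs_lift(2)[OF scal_vs free_space_fs V, of X "\<lambda>x c. c \<odot>\<^bsub>V\<^esub> g x" x c] gl x c by simp
  ultimately show "?h (single scal x c) = h (single scal x c)" by simp
 qed
 have "?S \<subseteq> {f \<in> carrier ?F. h f = \<zero>\<^bsub>V\<^esub>}"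
  by (rule S(3)[OF lin_ker_sub[OF free_space_vs V h(1)]]) (use R r in auto)
 then have k: "?h f = \<zero>\<^bsub>V\<^esub>" if "f \<in> ?S" for f using that eq by (simp add: subset_iff)
 show "presented_lift K V g \<in> lin K (presented_space K X R) V"
  unfolding presented_lift_def[abs_def] presented_space_def
  by (rule quotient_lift(1)[OF S(1) V l]) (erule k)
 show "presented_lift K V g (presented_gen K X R x) = g x" if x: "x \<in> X" for x
 proof -
  have "the_elem (?h ` (?S +>\<^bsub>?F\<^esub> unit_fun K x)) = ?h (unit_fun K x)"
   by (rule quotient_lift(2)[OF S(1) V l _ unit_fun_mem[OF x]]) (erule k)
  then show ?thesis
   using eq[OF unit_fun_mem[OF x]] h(2)[OF x] unfolding presented_lift_def presented_gen_def by simp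
 qed
qed

end

lemma free_ext:
 assumes V: "vectorspace K V" and g: "\<And>x. x \<in> X ==> g x <: V"
 obtains h where "h \<in> lin K (free_space K X) V" "\<And>x. x \<in> X ==> h (unit_fun K x) = g x"
proof -
 have gl: "(\<lambda>c. c \<odot>\<^bsub>V\<^esub> g x) \<in> lin K scal V" if "x \<in> X" for x
  using V g[OF that] by (intro linI) (simp_all add: vs_add_smult vs_smult_smult)
 let ?h = "\<lambda>f. \<Oplus>\<^bsub>V\<^esub> x\<in>{x. f x \<noteq> \<zero>}. f x \<odot>\<^bsub>V\<^esub> g x"
 have l: "?h \<in> lin K (free_space K X) V"
  using fs_lift(1)[OF scal_vs free_space_fs V, of X "\<lambda>x c. c \<odot>\<^bsub>V\<^esub> g x"] gl by simp
 have "?h (unit_fun K x) = g x" if x: "x \<in> X" for x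
  using fs_lift(2)[OF scal_vs free_space_fs V, of X "\<lambda>x c. c \<odot>\<^bsub>V\<^esub> g x" x \<one>] gl x V g[OF x]
  by (simp add: unit_fun_single)
 with l show thesis by (rule that)
qed

definition bil where
 "bil M N V g \<longleftrightarrow> (\<forall>n\<in>carrier N. (\<lambda>m. g m n) \<in> lin K M V) \<and> (\<forall>m\<in>carrier M. g m \<in> lin K N V)"

lemma bilI:
 assumes "\<And>n. n <: N ==> (\<lambda>m. g m n) \<in> lin K M V" "\<And>m. m <: M ==> (\<lambda>n. g m n) \<in> lin K N V"
 shows "bil M N V g"
 using assms by (simp add: bil_def)

lemma bilD:
 assumes "bil M N V g"
 shows "\<And>n. n <: N ==> (\<lambda>m. g m n) \<in> lin K M V" "\<And>m. m <: M ==> (\<lambda>n. g m n) \<in> lin K N V"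
  "\<And>m n. m <: M ==> n <: N ==> g m n <: V"
 using assms linD(1)[of _ N V] by (auto simp: bil_def)

text \<open>Both tensor products are presented by the bilinear relations together with a set \<open>S\<close> of
 further relations.\<close>

context
 fixes M :: "('k, 'm, 'y) module_scheme" and N :: "('k, 'n, 'z) module_scheme" and S R
 assumes M: "vectorspace K M" and N: "vectorspace K N"
  and S: "S \<subseteq> carrier (free_space K (carrier M \<times> carrier N))"
  and R: "R = bilinear_relations K M N \<union> S"
begin

lemma tens_rel: "R \<subseteq> carrier (free_space K (carrier M \<times> carrier N))"
proof -
 note F = free_space_vs[of "carrier M \<times> carrier N"]
 have "bilinear_relations K M N \<subseteq> carrier (free_space K (carrier M \<times> carrier N))"
  unfolding bilinear_relations_def Let_def
  by (intro Un_least subsetI; clarsimp; intro abelian_group.minus_closed[OF vs_addI(1)[OF F]] vs_add[OF F] vs_smult[OF F] unit_fun_mem)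
   (use M N in auto)
 then show ?thesis using S R by simp
qed

text \<open>The map on the free space is produced inside the proof, so the premise on the additional
  relations S has to speak about every linear h with the prescribed values.\<close>

lemma tens_lift:
 assumes V: "vectorspace K V" and g: "bil M N V g"
  and s: "\<And>h f. f \<in> S ==> h \<in> lin K (free_space K (carrier M \<times> carrier N)) V ==>
   (\<And>m n. m <: M ==> n <: N ==> h (unit_fun K (m, n)) = g m n) ==> h f = \<zero>\<^bsub>V\<^esub>"
 shows "presented_lift K V (\<lambda>(m, n). g m n) \<in> lin K (presented_space K (carrier M \<times> carrier N) R) V"
  and "\<And>m n. m <: M ==> n <: N ==>
   presented_lift K V (\<lambda>(m, n). g m n) (presented_gen K (carrier M \<times> carrier N) R (m, n)) = g m n"
proof -
 let ?X = "carrier M \<times> carrier N" and ?F = "free_space K (carrier M \<times> carrier N)"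
 note F = free_space_vs[of ?X]
 have gV: "(case x of (m, n) \<Rightarrow> g m n) <: V" if "x \<in> ?X" for x using that bilD(3)[OF g] by auto
 obtain h where h: "h \<in> lin K ?F V" "\<And>x. x \<in> ?X ==> h (unit_fun K x) = (case x of (m, n) \<Rightarrow> g m n)"
  using free_ext[where X="?X" and g="\<lambda>(m, n). g m n", OF V gV] by metis
 have hu: "h (unit_fun K (m, n)) = g m n" if "m <: M" "n <: N" for m n
  using h(2)[of "(m, n)"] that by simp
 have um: "unit_fun K (m, n) <: ?F" if "m <: M" "n <: N" for m n
  by (rule unit_fun_mem) (use that in simp)
 have "h f = \<zero>\<^bsub>V\<^esub>" if f: "f \<in> bilinear_relations K M N" for f
 proof -
  note l = linD[OF h(1)]
  note gl = linD(2,3)[OF bilD(1)[OF g]] linD(2,3)[OF bilD(2)[OF g]]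
  note V' = vs_sub_eq_zero[OF V]
  from f show ?thesis
   unfolding bilinear_relations_def Let_def using M N V F bilD(3)[OF g]
   by (elim UnE CollectE exE conjE) (simp_all add: l(2,3) um hu gl V')
 qed
 then have r: "h f = \<zero>\<^bsub>V\<^esub>" if "f \<in> R" for f using that R s[OF _ h(1) hu] by blast
 note pl = pres_lift[OF tens_rel V gV h r]
 show "presented_lift K V (\<lambda>(m, n). g m n) \<in> lin K (presented_space K ?X R) V" by (rule pl(1))
 show "presented_lift K V (\<lambda>(m, n). g m n) (presented_gen K ?X R (m, n)) = g m n"
  if "m <: M" "n <: N" for m n using pl(2)[of "(m, n)"] that by simp
qed

lemma tens_gen_eq:
 assumes "unit_fun K (m, n) \<ominus>\<^bsub>free_space K (carrier M \<times> carrier N)\<^esub> y \<in> R" "m <: M" "n <: N"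
  "y <: (free_space K (carrier M \<times> carrier N))"
 shows "presented_gen K (carrier M \<times> carrier N) R (m, n)
  = LinearCombinations.module.span K (free_space K (carrier M \<times> carrier N)) R +>\<^bsub>free_space K (carrier M \<times> carrier N)\<^esub> y"
proof -
 let ?F = "free_space K (carrier M \<times> carrier N)"
 note S' = span_sub[OF free_space_vs tens_rel]
 have u: "unit_fun K (m, n) <: ?F" using assms by (intro unit_fun_mem) simp
 have "unit_fun K (m, n) \<oplus>\<^bsub>?F\<^esub> (\<ominus> \<one>) \<odot>\<^bsub>?F\<^esub> y \<in> LinearCombinations.module.span K ?F R"
  using assms(1) S'(2) unfolding vs_minus[OF free_space_vs u assms(4)] by blast
 then show ?thesis unfolding presented_gen_def using quotient_coset_simps(1)[OF S'(1) u assms(4)] by blast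
qed

lemma tens_bil: "bil M N (presented_space K (carrier M \<times> carrier N) R) (\<lambda>m n. presented_gen K (carrier M \<times> carrier N) R (m, n))"
proof -
 let ?X = "carrier M \<times> carrier N" and ?F = "free_space K (carrier M \<times> carrier N)"
 let ?T = "presented_space K ?X R" and ?u = "\<lambda>m n. presented_gen K ?X R (m, n)"
 note S' = span_sub[OF free_space_vs tens_rel]
 note q = quotient_coset_simps(2,3)[OF S'(1)]
 note F = free_space_vs[of ?X]
 have um: "unit_fun K (m, n) <: ?F" if "m <: M" "n <: N" for m n
  by (rule unit_fun_mem) (use that in simp)
 have ut: "?u m n <: ?T" if "m <: M" "n <: N" for m n
  by (rule pres_gen_mem[OF tens_rel]) (use that in simp)
 have add: "(LinearCombinations.module.span K ?F R +>\<^bsub>?F\<^esub> unit_fun K (m, n)) \<oplus>\<^bsub>?T\<^esub> (LinearCombinations.module.span K ?F R +>\<^bsub>?F\<^esub> unit_fun K (m', n'))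
   = LinearCombinations.module.span K ?F R +>\<^bsub>?F\<^esub> (unit_fun K (m, n) \<oplus>\<^bsub>?F\<^esub> unit_fun K (m', n'))"
  if "m <: M" "n <: N" "m' <: M" "n' <: N" for m n m' n'
  using q(1)[OF um um] that unfolding presented_space_def by blast
 have sm: "c \<odot>\<^bsub>?T\<^esub> (LinearCombinations.module.span K ?F R +>\<^bsub>?F\<^esub> unit_fun K (m, n))
   = LinearCombinations.module.span K ?F R +>\<^bsub>?F\<^esub> (c \<odot>\<^bsub>?F\<^esub> unit_fun K (m, n))"
  if "m <: M" "n <: N" "c <: K" for m n c
  using q(2)[OF that(3) um] that unfolding presented_space_def by blast
 have r1: "unit_fun K (m \<oplus>\<^bsub>M\<^esub> m', n) \<ominus>\<^bsub>?F\<^esub> (unit_fun K (m, n) \<oplus>\<^bsub>?F\<^esub> unit_fun K (m', n)) \<in> R"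
  if "m <: M" "m' <: M" "n <: N" for m m' n
  unfolding R bilinear_relations_def Let_def using that by blast
 have r2: "unit_fun K (m, n \<oplus>\<^bsub>N\<^esub> n') \<ominus>\<^bsub>?F\<^esub> (unit_fun K (m, n) \<oplus>\<^bsub>?F\<^esub> unit_fun K (m, n')) \<in> R"
  if "m <: M" "n <: N" "n' <: N" for m n n'
  unfolding R bilinear_relations_def Let_def using that by blast
 have r3: "unit_fun K (c \<odot>\<^bsub>M\<^esub> m, n) \<ominus>\<^bsub>?F\<^esub> c \<odot>\<^bsub>?F\<^esub> unit_fun K (m, n) \<in> R"
  if "c <: K" "m <: M" "n <: N" for c m n
  unfolding R bilinear_relations_def Let_def using that by blast
 have r4: "unit_fun K (m, c \<odot>\<^bsub>N\<^esub> n) \<ominus>\<^bsub>?F\<^esub> c \<odot>\<^bsub>?F\<^esub> unit_fun K (m, n) \<in> R"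
  if "c <: K" "m <: M" "n <: N" for c m n
  unfolding R bilinear_relations_def Let_def using that by blast
 show ?thesis
 proof (rule bilI)
  show "(\<lambda>m. ?u m n) \<in> lin K M ?T" if n: "n <: N" for n
  proof (rule linI)
   show "?u (m \<oplus>\<^bsub>M\<^esub> m') n = ?u m n \<oplus>\<^bsub>?T\<^esub> ?u m' n" if "m <: M" "m' <: M" for m m'
    using tens_gen_eq[OF r1[OF that n]] add[OF that(1) n that(2) n] that n M F um
    unfolding presented_gen_def by simp
   show "?u (c \<odot>\<^bsub>M\<^esub> m) n = c \<odot>\<^bsub>?T\<^esub> ?u m n" if "c <: K" "m <: M" for c m
    using tens_gen_eq[OF r3[OF that n]] sm[OF that(2) n that(1)] that n M F um
    unfolding presented_gen_def by simp
  qed (use ut n in simp)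
  show "(\<lambda>n. ?u m n) \<in> lin K N ?T" if m: "m <: M" for m
  proof (rule linI)
   show "?u m (n \<oplus>\<^bsub>N\<^esub> n') = ?u m n \<oplus>\<^bsub>?T\<^esub> ?u m n'" if "n <: N" "n' <: N" for n n'
    using tens_gen_eq[OF r2[OF m that]] add[OF m that(1) m that(2)] that m N F um
    unfolding presented_gen_def by simp
   show "?u m (c \<odot>\<^bsub>N\<^esub> n) = c \<odot>\<^bsub>?T\<^esub> ?u m n" if "c <: K" "n <: N" for c n
    using tens_gen_eq[OF r4[OF that(1) m that(2)]] sm[OF m that(2,1)] that m N F um
    unfolding presented_gen_def by simp
  qed (use ut m in simp)
 qed
qed

lemma tens_eq:
 assumes W: "vectorspace K W" and t: "t \<in> lin K (presented_space K (carrier M \<times> carrier N) R) W"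
  "t' \<in> lin K (presented_space K (carrier M \<times> carrier N) R) W"
  and e: "\<And>m n. m <: M ==> n <: N ==> t (presented_gen K (carrier M \<times> carrier N) R (m, n))
   = t' (presented_gen K (carrier M \<times> carrier N) R (m, n))"
  and f: "f <: (presented_space K (carrier M \<times> carrier N) R)"
 shows "t f = t' f"
 by (rule pres_lin_eq[OF tens_rel W t _ f]) (use e in auto)

text \<open>The tensors of basis vectors span a subspace that contains all generators. The
  projection to the quotient by it kills every generator and is therefore zero, so the subspace is
  everything.\<close>

lemma tens_fin:
 assumes "findim M" "findim N"
 shows "findim (presented_space K (carrier M \<times> carrier N) R)"
proof -
 let ?X = "carrier M \<times> carrier N" let ?T = "presented_space K ?X R" and ?u = "\<lambda>m n. presented_gen K ?X R (m, n)"
 note T = pres_vs[OF tens_rel]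
 obtain b c b' c' where B: "has_basis M {..<vdim M} b c" and B': "has_basis N {..<vdim N} b' c'"
  using basis_exists[OF M assms(1)] basis_exists[OF N assms(2)] by blast
 let ?I = "{..<vdim M}" and ?J = "{..<vdim N}"
 note b = has_basisD[OF B] and b' = has_basisD[OF B']
 let ?G = "free_space K (?I \<times> ?J)"
 note G = free_space_vs[of "?I \<times> ?J"]
 have uT: "(case x of (i, j) \<Rightarrow> ?u (b i) (b' j)) <: ?T" if "x \<in> ?I \<times> ?J" for x
  using that bilD(3)[OF tens_bil] b(2) b'(2) by auto
 obtain h where h: "h \<in> lin K ?G ?T" "\<And>x. x \<in> ?I \<times> ?J ==> h (unit_fun K x) = (case x of (i, j) \<Rightarrow> ?u (b i) (b' j))"
  using free_ext[where X="?I \<times> ?J" and g="\<lambda>(i, j). ?u (b i) (b' j)", OF T uT] by metis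
 have im: "sspace K (h ` carrier ?G) ?T" by (rule lin_im_sub[OF G T h(1) sub_self[OF G]])
 have ub: "?u (b i) (b' j) \<in> h ` carrier ?G" if "i \<in> ?I" "j \<in> ?J" for i j
  using h(2)[of "(i, j)"] that unit_fun_mem[of "(i, j)" "?I \<times> ?J"] by (metis (no_types, lifting) SigmaI case_prod_conv image_eqI)
 have un: "?u (b i) n \<in> h ` carrier ?G" if i: "i \<in> ?I" and n: "n <: N" for i n
  unfolding lin_eq_on_basis[OF N T B' bilD(2)[OF tens_bil b(2)[OF i]] n]
  by (rule sub_finsum[OF im]) (use subD(5)[OF im] ub[OF i] b'(6)[OF _ n] in auto)
 have u: "?u m n \<in> h ` carrier ?G" if m: "m <: M" and n: "n <: N" for m n
  unfolding lin_eq_on_basis[OF M T B bilD(1)[OF tens_bil n] m]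
  by (rule sub_finsum[OF im]) (use subD(5)[OF im] un[OF _ n] b(6)[OF _ m] in auto)
 have "h ` carrier ?G = carrier ?T"
 proof -
  let ?Q = "quotient_space ?T (h ` carrier ?G)"
  note Q = quotient_vs[OF im]
  have zl: "(\<lambda>x. \<zero>\<^bsub>?Q\<^esub>) \<in> lin K ?T ?Q" using Q(1) by (intro linI) simp_all
  have "t \<in> h ` carrier ?G" if t: "t <: ?T" for t
  proof -
   have "(h ` carrier ?G) +>\<^bsub>?T\<^esub> t = \<zero>\<^bsub>?Q\<^esub>"
    by (rule tens_eq[OF Q(1) Q(2) zl _ t]) (use u bilD(3)[OF tens_bil] quotient_ker[OF im] in simp)
   then show ?thesis using quotient_ker[OF im t] by blast
  qed
  then show ?thesis using subD(2)[OF im] by blast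
 qed
 moreover have "findim ?G" by (rule fs_fin[OF scal_vs free_space_fs _ scal_dim(1)]) simp
 ultimately show ?thesis using fin_dim_surj[OF G T h(1)] by blast
qed

end

end

context alg_over
begin

context
 fixes M :: "('k, 'm, 'a) rmod" and N :: "('k, 'n, 'a) lmod"
 assumes M: "rmodule M" and N: "left_module K A N"
begin

lemma balanced_mem: "balanced_relations K A M N \<subseteq> carrier (free_space K (carrier M \<times> carrier N))"
proof -
 note F = free_space_vs[of "carrier M \<times> carrier N"]
 show ?thesis unfolding balanced_relations_def
  by (intro subsetI; clarsimp; intro abelian_group.minus_closed[OF vs_addI(1)[OF F]] unit_fun_mem)
   (use rmodD(2)[OF M] lmodD(2)[OF N] in auto)
qed

lemmas tensor_args = rmodD(1)[OF M] lmodD(1)[OF N] balanced_mem tensor_relations_def[of K A M N]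

abbreviation tgen where "tgen \<equiv> \<lambda>m n. presented_gen K (carrier M \<times> carrier N) (tensor_relations K A M N) (m, n)"

lemma tensor_vs: "vectorspace K (tensor K A M N)"
 unfolding tensor_def by (rule pres_vs[OF tens_rel[OF tensor_args]])

lemma tensor_bil: "bil M N (tensor K A M N) tgen"
 unfolding tensor_def by (rule tens_bil[OF tensor_args])

lemma tensor_eq:
 assumes "vectorspace K W" "t \<in> lin K (tensor K A M N) W" "t' \<in> lin K (tensor K A M N) W"
  "\<And>m n. m <: M ==> n <: N ==> t (tgen m n) = t' (tgen m n)"
  "f <: (tensor K A M N)"
 shows "t f = t' f"
 using assms unfolding tensor_def by (rule tens_eq[OF tensor_args])

lemma tensor_fin: "findim M ==> findim N ==> findim (tensor K A M N)"
 unfolding tensor_def by (rule tens_fin[OF tensor_args])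

lemma tensor_lift:
 assumes V: "vectorspace K V" and g: "bil M N V g"
  and b: "\<And>m a n. m <: M ==> a <: A ==> n <: N ==> g (ract M m a) n = g m (lact N a n)"
 shows "presented_lift K V (\<lambda>(m, n). g m n) \<in> lin K (tensor K A M N) V"
  and "\<And>m n. m <: M ==> n <: N ==> presented_lift K V (\<lambda>(m, n). g m n) (tgen m n) = g m n"
proof -
 have s: "h f = \<zero>\<^bsub>V\<^esub>" if f: "f \<in> balanced_relations K A M N" and h: "h \<in> lin K (free_space K (carrier M \<times> carrier N)) V"
  and hu: "\<And>m n. m <: M ==> n <: N ==> h (unit_fun K (m, n)) = g m n" for h f
 proof -
  obtain m a n where m: "m <: M" "a <: A" "n <: N"
   "f = unit_fun K (ract M m a, n) \<ominus>\<^bsub>free_space K (carrier M \<times> carrier N)\<^esub> unit_fun K (m, lact N a n)"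
   using f unfolding balanced_relations_def by blast
  have n: "ract M m a <: M" "lact N a n <: N" using m rmodD(2)[OF M] lmodD(2)[OF N] by auto
  have um: "unit_fun K (m, n) <: (free_space K (carrier M \<times> carrier N))" if "m <: M" "n <: N" for m n
   by (rule unit_fun_mem) (use that in simp)
  show ?thesis
   using m n V free_space_vs[of "carrier M \<times> carrier N"] linD[OF h] um hu bilD(3)[OF g] b vs_sub_eq_zero[OF V] by simp
 qed
 show "presented_lift K V (\<lambda>(m, n). g m n) \<in> lin K (tensor K A M N) V"
  unfolding tensor_def by (rule tens_lift(1)[OF tensor_args V g]) (rule s; simp)
 show "presented_lift K V (\<lambda>(m, n). g m n) (tgen m n) = g m n" if "m <: M" "n <: N" for m n
  by (rule tens_lift(2)[OF tensor_args V g _ that]) (rule s; simp)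
qed

lemma tensor_balanced:
 assumes "m <: M" "a <: A" "n <: N"
 shows "tgen (ract M m a) n = tgen m (lact N a n)"
 unfolding presented_gen_def[of K _ _ "(m, lact N a n)"]
 by (rule tens_gen_eq[OF tensor_args])
  (use assms rmodD(2)[OF M] lmodD(2)[OF N] in \<open>auto simp: tensor_relations_def balanced_relations_def intro!: unit_fun_mem\<close>)

end

end

section \<open>The tensor complex and the independence of Tor from the resolution\<close>

context alg_over
begin

text \<open>The map induced on tensor products, spelled exactly like the boundary map inside
  \<open>Tor\<close>, which then unfolds to \<open>torZ\<close> modulo \<open>torB\<close>.\<close>

definition tmap where
 "tmap N Q f = presented_lift K (tensor K A Q N)
   (\<lambda>(p, n). presented_gen K (carrier Q \<times> carrier N) (tensor_relations K A Q N) (f p, n))"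

lemma tmap:
 assumes P: "rmodule P" and Q: "rmodule Q" and N: "left_module K A N" and f: "f \<in> rhom P Q"
 shows "tmap N Q f \<in> lin K (tensor K A P N) (tensor K A Q N)"
  and "\<And>p n. p <: P ==> n <: N ==> tmap N Q f (tgen P N p n) = tgen Q N (f p) n"
proof -
 note b = tensor_bil[OF Q N]
 have g: "bil P N (tensor K A Q N) (\<lambda>p n. tgen Q N (f p) n)"
 proof (rule bilI)
  show "(\<lambda>p. tgen Q N (f p) n) \<in> lin K P (tensor K A Q N)" if "n <: N" for n
   by (rule lin_comp[OF homD(1)[OF f] bilD(1)[OF b that]])
  show "(\<lambda>n. tgen Q N (f p) n) \<in> lin K N (tensor K A Q N)" if "p <: P" for p
   by (rule bilD(2)[OF b homD(3)[OF f that]])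
 qed
 have bal: "tgen Q N (f (ract P p a)) n = tgen Q N (f p) (lact N a n)"
  if "p <: P" "a <: A" "n <: N" for p a n
  unfolding homD(2)[OF f that(1,2)] by (rule tensor_balanced[OF Q N homD(3)[OF f that(1)] that(2,3)])
 show "tmap N Q f \<in> lin K (tensor K A P N) (tensor K A Q N)"
  unfolding tmap_def by (rule tensor_lift(1)[OF P N tensor_vs[OF Q N] g bal])
 show "tmap N Q f (tgen P N p n) = tgen Q N (f p) n" if "p <: P" "n <: N" for p n
  unfolding tmap_def
  by (rule tensor_lift(2)[OF P N tensor_vs[OF Q N] g _ that]) (rule bal)
qed

definition torZ where
 "torZ P d N l = (case l of 0 \<Rightarrow> carrier (tensor K A (P 0) N)
   | Suc i \<Rightarrow> {t \<in> carrier (tensor K A (P (Suc i)) N). tmap N (P i) (d i) t = \<zero>\<^bsub>tensor K A (P i) N\<^esub>})"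

definition torB where
 "torB P d N l = tmap N (P l) (d l) ` carrier (tensor K A (P (Suc l)) N)"

lemma tmap_dd:
 assumes P: "resolves M P d \<epsilon>" and N: "left_module K A N" and t: "t <: (tensor K A (P (Suc (Suc l))) N)"
 shows "tmap N (P l) (d l) (tmap N (P (Suc l)) (d (Suc l)) t) = \<zero>\<^bsub>tensor K A (P l) N\<^esub>"
proof -
 note p = resolvesD[OF P]
 note tm = tmap[OF p(1) p(1) N p(2)]
 note T = tensor_vs[OF p(1) N]
 have z: "(\<lambda>x. \<zero>\<^bsub>tensor K A (P l) N\<^esub>) \<in> lin K (tensor K A (P (Suc (Suc l))) N) (tensor K A (P l) N)"
  using T[of l] by (intro linI) simp_all
 show ?thesis
 proof (rule tensor_eq[OF p(1) N T lin_comp[OF tm(1) tm(1)] z _ t])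
  fix x n assume x: "x <: (P (Suc (Suc l)))" and n: "n <: N"
  have dx: "d (Suc l) x <: (P (Suc l))" by (rule homD(3)[OF p(2) x])
  have "tmap N (P l) (d l) (tmap N (P (Suc l)) (d (Suc l)) (tgen (P (Suc (Suc l))) N x n)) = tgen (P l) N (d l (d (Suc l) x)) n"
   using tm(2)[OF x n] tm(2)[OF dx n] by simp
  also have "\<dots> = tgen (P l) N \<zero>\<^bsub>P l\<^esub> n" using p(7)[OF x] by simp
  also have "\<dots> = \<zero>\<^bsub>tensor K A (P l) N\<^esub>"
   by (rule lin_zero[OF rmodD(1)[OF p(1)] T bilD(1)[OF tensor_bil[OF p(1) N] n]])
  finally show "tmap N (P l) (d l) (tmap N (P (Suc l)) (d (Suc l)) (tgen (P (Suc (Suc l))) N x n)) = \<zero>\<^bsub>tensor K A (P l) N\<^esub>" .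
 qed
qed

lemma tor_sub:
 assumes P: "resolves M P d \<epsilon>" and N: "left_module K A N"
 shows "sspace K (torZ P d N l) (tensor K A (P l) N)" "sspace K (torB P d N l) (tensor K A (P l) N)"
  "torB P d N l \<subseteq> torZ P d N l"
proof -
 note p = resolvesD[OF P]
 note tm = tmap[OF p(1) p(1) N p(2)]
 note T = tensor_vs[OF p(1) N]
 show "sspace K (torZ P d N l) (tensor K A (P l) N)"
 proof (cases l)
  case 0
  then show ?thesis using sub_self[OF T[of 0]] by (simp add: torZ_def)
 next
  case (Suc i)
  then show ?thesis using lin_ker_sub[OF T T tm(1)[of i]] by (simp add: torZ_def)
 qed
 show "sspace K (torB P d N l) (tensor K A (P l) N)"
  unfolding torB_def by (rule lin_im_sub[OF T T tm(1) sub_self[OF T]])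
 show "torB P d N l \<subseteq> torZ P d N l"
  using linD(1)[OF tm(1)] tmap_dd[OF P N] by (cases l) (auto simp: torB_def torZ_def)
qed

lemma tor_chain_map:
 assumes P: "resolves M P d \<epsilon>" and Q: "resolves M' Q d' \<epsilon>'" and N: "left_module K A N"
  and u: "\<And>l. u l \<in> rhom (P l) (Q l)"
  and ud: "\<And>l x. x <: (P (Suc l)) ==> d' l (u (Suc l) x) = u l (d l x)"
 shows "t \<in> torZ P d N l ==> tmap N (Q l) (u l) t \<in> torZ Q d' N l"
  and "t \<in> torB P d N l ==> tmap N (Q l) (u l) t \<in> torB Q d' N l"
proof -
 note p = resolvesD[OF P] and q = resolvesD[OF Q]
 note tP = tmap[OF p(1) p(1) N p(2)] and tQ = tmap[OF q(1) q(1) N q(2)] and tu = tmap[OF p(1) q(1) N u]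
 note TP = tensor_vs[OF p(1) N] and TQ = tensor_vs[OF q(1) N]
 have comm: "tmap N (Q l) (d' l) (tmap N (Q (Suc l)) (u (Suc l)) t) = tmap N (Q l) (u l) (tmap N (P l) (d l) t)"
  if t: "t <: (tensor K A (P (Suc l)) N)" for t l
 proof (rule tensor_eq[OF p(1) N TQ lin_comp[OF tu(1) tQ(1)] lin_comp[OF tP(1) tu(1)] _ t])
  fix x n assume x: "x <: (P (Suc l))" and n: "n <: N"
  show "tmap N (Q l) (d' l) (tmap N (Q (Suc l)) (u (Suc l)) (tgen (P (Suc l)) N x n))
   = tmap N (Q l) (u l) (tmap N (P l) (d l) (tgen (P (Suc l)) N x n))"
   using tu(2)[OF x n] tQ(2)[OF homD(3)[OF u x] n] tP(2)[OF x n] tu(2)[OF homD(3)[OF p(2) x] n] ud[OF x] by simp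
 qed
 show "tmap N (Q l) (u l) t \<in> torZ Q d' N l" if t: "t \<in> torZ P d N l"
 proof (cases l)
  case 0
  then show ?thesis using t linD(1)[OF tu(1)[of 0]] by (simp add: torZ_def)
 next
  case (Suc i)
  then show ?thesis
   using t linD(1)[OF tu(1)[of l]] comm[of t i] lin_zero[OF TP TQ tu(1)[of i]] by (simp add: torZ_def)
 qed
 show "tmap N (Q l) (u l) t \<in> torB Q d' N l" if t: "t \<in> torB P d N l"
 proof -
  obtain y where y: "y <: (tensor K A (P (Suc l)) N)" "t = tmap N (P l) (d l) y" using t by (auto simp: torB_def)
  have "tmap N (Q l) (u l) t = tmap N (Q l) (d' l) (tmap N (Q (Suc l)) (u (Suc l)) y)" using comm[OF y(1)] y(2) by simp
  then show ?thesis using linD(1)[OF tu(1) y(1)] unfolding torB_def by blast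
 qed
qed

text \<open>The homotopy identity is tensored with N and checked on generators. On a cycle the term
  through d vanishes, and the remaining correction is a boundary.\<close>

lemma tor_homotopy:
 assumes P: "resolves M P d \<epsilon>" and Q: "resolves M Q d' \<epsilon>'" and N: "left_module K A N"
  and H: "chain_equiv P d Q d' u v s" and t: "t \<in> torZ P d N l"
 shows "\<exists>b\<in>torB P d N l. t = tmap N (P l) (v l) (tmap N (Q l) (u l) t) \<oplus>\<^bsub>tensor K A (P l) N\<^esub> b"
proof -
 note p = resolvesD[OF P] and q = resolvesD[OF Q] and h = chain_equivD[OF H]
 note td = tmap[OF p(1) p(1) N p(2)] and tu = tmap[OF p(1) q(1) N h(1)] and tv = tmap[OF q(1) p(1) N h(2)]
  and ts = tmap[OF p(1) p(1) N h(3)]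
 note T = tensor_vs[OF p(1) N]
 note vu = lin_comp[OF tu(1) tv(1)]
 have tT: "t <: (tensor K A (P l) N)" using subD(6)[OF tor_sub(1)[OF P N] t] .
 have sT: "tmap N (P (Suc l)) (s l) t <: (tensor K A (P (Suc l)) N)" by (rule linD(1)[OF ts(1) tT])
 have dsB: "tmap N (P l) (d l) (tmap N (P (Suc l)) (s l) t) \<in> torB P d N l" using sT unfolding torB_def by blast
 have vuT: "tmap N (P l) (v l) (tmap N (Q l) (u l) t) <: (tensor K A (P l) N)" by (rule linD(1)[OF vu tT])
 show ?thesis
 proof (cases l)
  case 0
  have "t = tmap N (P l) (v l) (tmap N (Q l) (u l) t) \<oplus>\<^bsub>tensor K A (P l) N\<^esub> tmap N (P l) (d l) (tmap N (P (Suc l)) (s l) t)"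
  proof (rule tensor_eq[OF p(1) N T lin_id lin_add[OF T vu lin_comp[OF ts(1) td(1)]] _ tT])
   fix x n assume x: "x <: (P l)" and n: "n <: N"
   have sx: "s l x <: (P (Suc l))" and ux: "u l x <: (Q l)" by (rule homD(3)[OF h(3) x], rule homD(3)[OF h(1) x])
   have vx: "v l (u l x) <: (P l)" and dx: "d l (s l x) <: (P l)"
    by (rule homD(3)[OF h(2) ux], rule homD(3)[OF p(2) sx])
   have "tgen (P l) N x n = tgen (P l) N (v l (u l x) \<oplus>\<^bsub>P l\<^esub> d l (s l x)) n" using h(5)[of x] x 0 by simp
   then show "tgen (P l) N x n = tmap N (P l) (v l) (tmap N (Q l) (u l) (tgen (P l) N x n)) \<oplus>\<^bsub>tensor K A (P l) N\<^esub>
     tmap N (P l) (d l) (tmap N (P (Suc l)) (s l) (tgen (P l) N x n))"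
    using linD(2)[OF bilD(1)[OF tensor_bil[OF p(1) N] n] vx dx] tu(2)[OF x n] tv(2)[OF ux n] ts(2)[OF x n] td(2)[OF sx n] by simp
  qed
  with dsB show ?thesis by blast
 next
  case (Suc i)
  have "t = tmap N (P l) (v l) (tmap N (Q l) (u l) t) \<oplus>\<^bsub>tensor K A (P l) N\<^esub>
   (tmap N (P l) (d l) (tmap N (P (Suc l)) (s l) t) \<oplus>\<^bsub>tensor K A (P l) N\<^esub> tmap N (P l) (s i) (tmap N (P i) (d i) t))"
  proof (rule tensor_eq[OF p(1) N T lin_id lin_add[OF T vu lin_add[OF T lin_comp[OF ts(1) td(1)] _]] _ tT])
   show "(\<lambda>t. tmap N (P l) (s i) (tmap N (P i) (d i) t)) \<in> lin K (tensor K A (P l) N) (tensor K A (P l) N)"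
    using lin_comp[OF td(1)[of i] ts(1)[of i]] Suc by simp
   fix x n assume x: "x <: (P l)" and n: "n <: N"
   have x': "x <: (P (Suc i))" using x Suc by simp
   have di: "d i x <: (P i)" by (rule homD(3)[OF p(2) x'])
   have si: "s i (d i x) <: (P l)" using homD(3)[OF h(3) di] Suc by simp
   have sx: "s l x <: (P (Suc l))" and ux: "u l x <: (Q l)" by (rule homD(3)[OF h(3) x], rule homD(3)[OF h(1) x])
   have vx: "v l (u l x) <: (P l)" and dx: "d l (s l x) <: (P l)"
    by (rule homD(3)[OF h(2) ux], rule homD(3)[OF p(2) sx])
   have ds: "d l (s l x) \<oplus>\<^bsub>P l\<^esub> s i (d i x) <: (P l)" using dx si rmodD(1)[OF p(1), of l] by simp
   note gl = linD(2)[OF bilD(1)[OF tensor_bil[OF p(1) N] n]]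
   have "tgen (P l) N x n = tgen (P l) N (v l (u l x) \<oplus>\<^bsub>P l\<^esub> (d l (s l x) \<oplus>\<^bsub>P l\<^esub> s i (d i x))) n" using h(6)[OF x'] Suc by simp
   also have "\<dots> = tgen (P l) N (v l (u l x)) n \<oplus>\<^bsub>tensor K A (P l) N\<^esub> (tgen (P l) N (d l (s l x)) n \<oplus>\<^bsub>tensor K A (P l) N\<^esub> tgen (P l) N (s i (d i x)) n)"
    using gl[OF vx ds] gl[OF dx si] by simp
   finally show "tgen (P l) N x n = tmap N (P l) (v l) (tmap N (Q l) (u l) (tgen (P l) N x n)) \<oplus>\<^bsub>tensor K A (P l) N\<^esub>
     (tmap N (P l) (d l) (tmap N (P (Suc l)) (s l) (tgen (P l) N x n)) \<oplus>\<^bsub>tensor K A (P l) N\<^esub>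
      tmap N (P l) (s i) (tmap N (P i) (d i) (tgen (P l) N x n)))"
    using tu(2)[OF x n] tv(2)[OF ux n] ts(2)[OF x n] td(2)[OF sx n] td(2)[OF x' n] ts(2)[OF di n] Suc by simp
  qed
  moreover have "tmap N (P l) (s i) (tmap N (P i) (d i) t) = \<zero>\<^bsub>tensor K A (P l) N\<^esub>"
  proof -
   have "tmap N (P i) (d i) t = \<zero>\<^bsub>tensor K A (P i) N\<^esub>" using t Suc by (simp add: torZ_def)
   then show ?thesis using lin_zero[OF T T ts(1)[of i]] Suc by simp
  qed
  ultimately show ?thesis using dsB subD(6)[OF tor_sub(2)[OF P N] dsB] T[of l] by (metis vs_r_zero)
 qed
qed

text \<open>Vanishing in degrees above L is left to the caller, who reads it off from a formula for
  dim(Q l \<otimes> N) in terms of Hom spaces.\<close>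

lemma tor_euler:
 assumes M: "rmodule (M :: ('k, 'm, 'a) rmod)" and N: "left_module K A (N :: ('k, 'n, 'a) lmod)"
  and Nfin: "findim N"
  and Q: "fin_resolution M Q d' \<epsilon>' L"
  and zero: "\<And>l. l > L ==> vdim (tensor K A (Q l) N) = 0"
  and ex: "\<exists>P d \<epsilon>. projective_resolution K A M (P :: nat \<Rightarrow> ('k, 'm \<times> 'a list \<Rightarrow> 'a, 'a) rmod) d \<epsilon>"
 shows "has_euler_characteristic K (\<lambda>l. Tor K A M N l)
   (\<Sum>l\<le>L. (-1) ^ l * int (vdim (tensor K A (Q l) N)))"
proof -
 obtain P d \<epsilon> where P: "some_resolution K A M = (P, d)" "projective_resolution K A M P d \<epsilon>"
  by (rule some_resolution[OF ex])
 note rP = projective_resolves[OF P(2)]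
 note qq = fin_resolutionD[OF Q]
 note p = resolvesD[OF rP] and q = resolvesD[OF qq(2)]
 obtain u v s t where H: "chain_equiv P d Q d' u v s" "chain_equiv Q d' P d v u t"
  using chain_equivalence[OF P(2) qq(1) M] by blast
 note c = chain_equivD[OF H(1)] and c' = chain_equivD[OF H(2)]
 let ?T = "\<lambda>l. tensor K A (P l) N" and ?U = "\<lambda>l. tensor K A (Q l) N"
 have E: "Tor K A M N l = subquotient (?T l) (torZ P d N l) (torB P d N l)" for l
  by (cases l) (simp_all only: Tor_def P(1) torZ_def torB_def tmap_def Let_def prod.case nat.case)
 note Tv = tensor_vs[OF p(1) N] and Uv = tensor_vs[OF q(1) N]
 have Uf: "findim (?U l)" for l by (rule tensor_fin[OF q(1) N qq(5) Nfin])
 note sP = tor_sub[OF rP N] and sQ = tor_sub[OF qq(2) N]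
 note tu = tmap[OF p(1) q(1) N c(1)] and tv = tmap[OF q(1) p(1) N c(2)] and td = tmap[OF q(1) q(1) N q(2)]
 have uZ: "tmap N (Q l) (u l) f \<in> torZ Q d' N l" if "f \<in> torZ P d N l" for f l
  by (rule tor_chain_map(1)[where u=u, OF rP qq(2) N c(1,4)]) (assumption | rule that)+
 have vZ: "tmap N (P l) (v l) f \<in> torZ P d N l" if "f \<in> torZ Q d' N l" for f l
  by (rule tor_chain_map(1)[where u=v, OF qq(2) rP N c'(1,4)]) (assumption | rule that)+
 have uB: "tmap N (Q l) (u l) f \<in> torB Q d' N l" if "f \<in> torB P d N l" for f l
  by (rule tor_chain_map(2)[where u=u, OF rP qq(2) N c(1,4)]) (assumption | rule that)+
 have vB: "tmap N (P l) (v l) f \<in> torB P d N l" if "f \<in> torB Q d' N l" for f l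
  by (rule tor_chain_map(2)[where u=v, OF qq(2) rP N c'(1,4)]) (assumption | rule that)+
 note hP = tor_homotopy[OF rP qq(2) N H(1)] and hQ = tor_homotopy[OF qq(2) rP N H(2)]
 have lu: "tmap N (Q l) (u l) \<in> lin K ((?T l)\<langle>torZ P d N l\<rangle>) ((?U l)\<langle>torZ Q d' N l\<rangle>)" for l
  by (rule lin_sub[OF tu(1)[of l] sP(1)[of l] uZ])
 have lv: "tmap N (P l) (v l) \<in> lin K ((?U l)\<langle>torZ Q d' N l\<rangle>) ((?T l)\<langle>torZ P d N l\<rangle>)" for l
  by (rule lin_sub[OF tv(1)[of l] sQ(1)[of l] vZ])
 have Zf: "findim ((?U l)\<langle>torZ Q d' N l\<rangle>)" for l
  by (rule sub_fin[OF sQ(1) Uf])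
 have iso: "findim (subquotient (?T l) (torZ P d N l) (torB P d N l))"
  "vdim (subquotient (?T l) (torZ P d N l) (torB P d N l))
   + vdim ((?U l)\<langle>torB Q d' N l\<rangle>) = vdim ((?U l)\<langle>torZ Q d' N l\<rangle>)" for l
  by (rule subquotient_iso[OF sP(1-3)[of l] sQ(1-3)[of l] lu[of l] _ lv[of l] _ _ _ Zf[of l]];
    (rule vB uB hP hQ; assumption))+
 define r where "r l = vdim ((?U l)\<langle>torB Q d' N l\<rangle>)" for l
 have rn: "vdim (?U (Suc l)) = r l + vdim ((?U (Suc l))\<langle>torZ Q d' N (Suc l)\<rangle>)" for l
  using rank_nullity[OF Uv Uv td(1)[of l] Uf] by (simp add: r_def torB_def torZ_def)
 have r0: "vdim (?U 0) = vdim ((?U 0)\<langle>torZ Q d' N 0\<rangle>)"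
  by (simp add: torZ_def)
 show ?thesis
  unfolding has_euler_characteristic_def
 proof (intro conjI allI)
  show "findim (Tor K A M N l)" for l unfolding E by (rule iso(1))
  show "(\<lambda>l. (-1) ^ l * int (vdim (Tor K A M N l))) sums
    (\<Sum>l\<le>L. (-1) ^ l * int (vdim (?U l)))"
  proof (rule euler_sums[where r=r, OF _ zero])
   show "vdim (Tor K A M N l) + r l + (case l of 0 \<Rightarrow> 0 | Suc i \<Rightarrow> r i) = vdim (?U l)" for l
    using iso(2)[of l] r0 rn unfolding E r_def[symmetric] by (cases l) simp_all
  qed
 qed
qed

subsection \<open>Dual modules\<close>

definition dual_rmod :: "('k, 'n, 'a) lmod \<Rightarrow> ('k, 'n \<Rightarrow> 'k, 'a) rmod" where
 "dual_rmod N = as_rmod (lin_space N scal) (\<lambda>\<phi> a. \<lambda>n\<in>carrier N. \<phi> (lact N a n))"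

lemma dual_simps [simp]:
 "carrier (dual_rmod N) = lin K N scal \<inter> extensional (carrier N)"
 "\<zero>\<^bsub>dual_rmod N\<^esub> = (\<lambda>x\<in>carrier N. \<zero>)"
 "f \<oplus>\<^bsub>dual_rmod N\<^esub> g = (\<lambda>x\<in>carrier N. f x \<oplus> g x)"
 "c \<odot>\<^bsub>dual_rmod N\<^esub> f = (\<lambda>x\<in>carrier N. c \<otimes> f x)"
 "ract (dual_rmod N) f a = (\<lambda>x\<in>carrier N. f (lact N a x))"
 by (simp_all add: dual_rmod_def)

lemma dual_vs:
 assumes "vectorspace K N"
 shows "vectorspace K (dual_rmod N)"
 by (rule vs_cong[OF lin_space_vs[OF assms scal_vs]]) (simp_all add: dual_rmod_def)

lemma dual_module:
 assumes N: "left_module K A N"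
 shows "rmodule (dual_rmod N)"
proof (rule rmodI[OF dual_vs[OF lmodD(1)[OF N]]])
 note n = lmodD[OF N]
 have lK: "f x <: K" if "f \<in> lin K N scal" "x <: N" for f x using linD(1)[OF that] by simp
 show "ract (dual_rmod N) f a <: (dual_rmod N)" if f: "f <: (dual_rmod N)" and a: "a <: A" for f a
 proof -
  have "(\<lambda>x. lact N a x) \<in> lin K N N" using n a by (intro linI) simp_all
  from lin_restrict[OF n(1) lin_comp[OF this, of f scal]] f show ?thesis by simp
 qed
 show "ract (dual_rmod N) f (a \<oplus>\<^bsub>A\<^esub> b) = ract (dual_rmod N) f a \<oplus>\<^bsub>dual_rmod N\<^esub> ract (dual_rmod N) f b"
  if "f <: (dual_rmod N)" "a <: A" "b <: A" for f a b
  using that n linD[of f N scal] by (auto simp: fun_eq_iff)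
 show "ract (dual_rmod N) f (c \<odot>\<^bsub>A\<^esub> a) = c \<odot>\<^bsub>dual_rmod N\<^esub> ract (dual_rmod N) f a"
  if "c <: K" "f <: (dual_rmod N)" "a <: A" for f a c
  using that n linD[of f N scal] by (auto simp: fun_eq_iff)
 show "ract (dual_rmod N) f (a \<otimes>\<^bsub>A\<^esub> b) = ract (dual_rmod N) (ract (dual_rmod N) f a) b"
  if "f <: (dual_rmod N)" "a <: A" "b <: A" for f a b
  using that n by (auto simp: fun_eq_iff)
 show "ract (dual_rmod N) f \<one>\<^bsub>A\<^esub> = f" if "f <: (dual_rmod N)" for f
  using that n by (auto simp: fun_eq_iff extensional_def)
qed (use lmodD[OF N] in \<open>auto simp: fun_eq_iff\<close>)

lemma dual_fin:
 assumes "vectorspace K N" "findim N"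
 shows "findim (dual_rmod N)" "vdim (dual_rmod N) = vdim N"
proof -
 note d = dual_dim[OF assms]
 have c: "findim (dual_rmod N) = findim (lin_space N scal)"
  "findim (lin_space N scal) ==> vdim (dual_rmod N) = vdim (lin_space N scal)"
  by (rule dim_cong[OF lin_space_vs[OF assms(1) scal_vs]], simp_all add: dual_rmod_def)+
 show "findim (dual_rmod N)" "vdim (dual_rmod N) = vdim N"
  using c d by simp_all
qed

text \<open>By the adjunction of tensor and Hom, the linear forms on Q \<otimes> N are the
  homomorphisms from Q to the dual of N; and a finite dimensional space has the dimension of its
  dual.\<close>

lemma tensor_dual_dim:
 assumes Q: "rmodule Q" and N: "left_module K A N"
  and fin: "findim Q" "findim N"
 shows "vdim (tensor K A Q N) = vdim (hom_space K A Q (dual_rmod N))"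
proof -
 let ?T = "tensor K A Q N" and ?H = "hom_space K A Q (dual_rmod N)"
 note T = tensor_vs[OF Q N] and D = dual_module[OF N] and b = tensor_bil[OF Q N]
 note H = hom_space_vs[OF Q D]
 note q = rmodD[OF Q] and n = lmodD[OF N]
 let ?\<Phi> = "\<lambda>\<tau>. \<lambda>q\<in>carrier Q. \<lambda>n\<in>carrier N. \<tau> (tgen Q N q n)"
 let ?\<Psi> = "\<lambda>h. restrict (presented_lift K scal (\<lambda>(q, n). h q n)) (carrier ?T)"
 have TK: "\<tau> (tgen Q N x y) <: K" if "\<tau> <: (lin_space ?T scal)" "x <: Q" "y <: N" for \<tau> x y
  using linD(1)[of \<tau> ?T scal] bilD(3)[OF b] that by simp
 have \<Phi>: "?\<Phi> \<tau> <: ?H" if \<tau>: "\<tau> <: (lin_space ?T scal)" for \<tau>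
 proof -
  have tl: "\<tau> \<in> lin K ?T scal" using \<tau> by simp
  have m: "(\<lambda>n\<in>carrier N. \<tau> (tgen Q N x n)) <: (dual_rmod N)" if "x <: Q" for x
   using lin_restrict[OF n(1) lin_comp[OF bilD(2)[OF b that] tl]] by simp
  have "?\<Phi> \<tau> \<in> rhom Q (dual_rmod N)"
  proof (intro homI linI)
   show "?\<Phi> \<tau> (x \<oplus>\<^bsub>Q\<^esub> y) = ?\<Phi> \<tau> x \<oplus>\<^bsub>dual_rmod N\<^esub> ?\<Phi> \<tau> y" if "x <: Q" "y <: Q" for x y
    using that q linD(2)[OF bilD(1)[OF b]] linD(2)[OF tl] bilD(3)[OF b] by (auto simp: fun_eq_iff)
   show "?\<Phi> \<tau> (c \<odot>\<^bsub>Q\<^esub> x) = c \<odot>\<^bsub>dual_rmod N\<^esub> ?\<Phi> \<tau> x" if "c <: K" "x <: Q" for c x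
    using that q linD(3)[OF bilD(1)[OF b]] linD(3)[OF tl] bilD(3)[OF b] by (auto simp: fun_eq_iff)
   show "?\<Phi> \<tau> (ract Q x a) = ract (dual_rmod N) (?\<Phi> \<tau> x) a" if "x <: Q" "a <: A" for x a
    using that q n tensor_balanced[OF Q N] by (auto simp: fun_eq_iff)
  qed (use m in simp)
  then show ?thesis by simp
 qed
 have bil: "bil Q N scal h" if h: "h <: ?H" for h
 proof (rule bilI)
  have hh: "h \<in> rhom Q (dual_rmod N)" using h by simp
  show "(\<lambda>x. h x y) \<in> lin K Q scal" if "y <: N" for y
   using homD[OF hh] that linD(1)[of "h _" N scal] by (intro linI) auto
  show "(\<lambda>y. h x y) \<in> lin K N scal" if "x <: Q" for x
   using homD(3)[OF hh that] by simp
 qed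
 have bal: "h (ract Q x a) y = h x (lact N a y)" if h: "h <: ?H" and "x <: Q" "a <: A" "y <: N" for h x a y
 proof -
  have hh: "h \<in> rhom Q (dual_rmod N)" using h by simp
  show ?thesis using homD(2)[OF hh that(2,3)] that by simp
 qed
 have \<Psi>l: "presented_lift K scal (\<lambda>(q, n). h q n) \<in> lin K ?T scal" if "h <: ?H" for h
  by (rule tensor_lift(1)[OF Q N scal_vs bil[OF that]]) (rule bal[OF that])
 have \<Psi>v: "presented_lift K scal (\<lambda>(q, n). h q n) (tgen Q N x y) = h x y"
  if "h <: ?H" "x <: Q" "y <: N" for h x y
  by (rule tensor_lift(2)[OF Q N scal_vs bil[OF that(1)] _ that(2,3)]) (rule bal[OF that(1)])
 have "vdim (lin_space ?T scal) = vdim ?H"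
 proof (rule lin_bij(3)[where f="?\<Phi>" and g="?\<Psi>", OF lin_space_vs[OF T scal_vs] H])
  show "?\<Phi> \<in> lin K (lin_space ?T scal) ?H"
   by (rule linI) (use \<Phi> bilD(3)[OF b] in \<open>auto simp: fun_eq_iff simp del: hom_space_simps(1)\<close>)
  show "?\<Psi> h <: (lin_space ?T scal)" if "h <: ?H" for h
   by (rule lin_restrict[OF T \<Psi>l[OF that]])
  show "?\<Psi> (?\<Phi> \<tau>) = \<tau>" if \<tau>: "\<tau> <: (lin_space ?T scal)" for \<tau>
  proof (rule extensionalityI[where A="carrier ?T"])
   fix t assume t: "t <: ?T"
   have "presented_lift K scal (\<lambda>(q, n). ?\<Phi> \<tau> q n) t = \<tau> t"
    by (rule tensor_eq[OF Q N scal_vs \<Psi>l[OF \<Phi>[OF \<tau>]] _ _ t]) (use \<tau> \<Psi>v[OF \<Phi>[OF \<tau>]] in simp_all)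
   then show "?\<Psi> (?\<Phi> \<tau>) t = \<tau> t" using t by simp
  qed (use \<tau> in simp_all)
  show "?\<Phi> (?\<Psi> h) = h" if h: "h <: ?H" for h
  proof (rule extensionalityI[where A="carrier Q"])
   fix x assume x: "x <: Q"
   have hx: "h x <: (dual_rmod N)" using homD(3)[of h Q "dual_rmod N"] h x by simp
   show "?\<Phi> (?\<Psi> h) x = h x"
   proof (rule extensionalityI[where A="carrier N"])
    show "?\<Phi> (?\<Psi> h) x y = h x y" if y: "y <: N" for y
     using x y \<Psi>v[OF h x y] bilD(3)[OF b x y] by simp
   qed (use hx x in simp_all)
  qed (use h in simp_all)
  show "findim (lin_space ?T scal) \<or> findim ?H"
   using dual_dim(1)[OF T tensor_fin[OF Q N fin]] by simp
 qed
 then show ?thesis using dual_dim(2)[OF T tensor_fin[OF Q N fin]] by simp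
qed

lemma idem_image:
 assumes M: "rmodule M" and e: "e <: A"
 shows "sspace K ((\<lambda>m. ract M m e) ` carrier M) M"
proof -
 have "(\<lambda>m. ract M m e) \<in> lin K M M" using rmodD[OF M] e by (intro linI) simp_all
 from lin_im_sub[OF rmodD(1)[OF M] rmodD(1)[OF M] this sub_self[OF rmodD(1)[OF M]]] show ?thesis .
qed

lemma idem_image_left:
 assumes N: "left_module K A N" and e: "e <: A"
 shows "sspace K ((\<lambda>m. lact N e m) ` carrier N) N"
proof -
 have "(\<lambda>m. lact N e m) \<in> lin K N N" using lmodD[OF N] e by (intro linI) simp_all
 from lin_im_sub[OF lmodD(1)[OF N] lmodD(1)[OF N] this sub_self[OF lmodD(1)[OF N]]] show ?thesis .
qed

text \<open>(D N) e is the dual of e N: restrict a form to e N, and conversely extend a form on e N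
  by composing it with the action of e.\<close>

lemma dual_idem_dim:
 assumes N: "left_module K A N" and fin: "findim N" and e: "e <: A" "e \<otimes>\<^bsub>A\<^esub> e = e"
 shows "vdim ((dual_rmod N)\<langle>(\<lambda>m. ract (dual_rmod N) m e) ` carrier (dual_rmod N)\<rangle>)
  = vdim (N\<langle>(\<lambda>m. lact N e m) ` carrier N\<rangle>)"
proof -
 note n = lmodD[OF N]
 note D = dual_module[OF N]
 let ?W = "(\<lambda>m. lact N e m) ` carrier N" and ?X = "(\<lambda>m. ract (dual_rmod N) m e) ` carrier (dual_rmod N)"
 let ?N = "N\<langle>?W\<rangle>" and ?D = "(dual_rmod N)\<langle>?X\<rangle>"
 note W = idem_image_left[OF N e(1)] and X = idem_image[OF D e(1)]
 note Wf = sub_fin[OF W fin]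
 have We: "lact N e y = y" if "y \<in> ?W" for y using that n(7)[OF _ e(1) e(1)] e(2) by auto
 have Xe: "f (lact N e y) = f y" if f: "f \<in> ?X" and "y <: N" for f y
 proof -
  obtain g where "f = (\<lambda>x\<in>carrier N. g (lact N e x))" using f by auto
  then show ?thesis using that(2) n(2)[OF that(2) e(1)] n(7)[OF that(2) e(1) e(1)] e(2) by simp
 qed
 have Xd: "f \<in> lin K N scal" "f \<in> extensional (carrier N)" if "f \<in> ?X" for f
  using subD(6)[OF X that] by simp_all
 have el: "(\<lambda>m. lact N e m) \<in> lin K N ?N" using n e by (intro linI) simp_all
 have "vdim ?D = vdim (lin_space ?N scal)"
 proof (rule lin_bij(3)[where f="\<lambda>f. restrict f ?W" and g="\<lambda>g. \<lambda>x\<in>carrier N. g (lact N e x)", OF sub_vs[OF X] lin_space_vs[OF sub_vs[OF W] scal_vs]])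
  show "(\<lambda>f. restrict f ?W) \<in> lin K ?D (lin_space ?N scal)"
  proof (rule linI)
   fix f g c assume f: "f <: ?D"
   have "f \<in> lin K ?N scal"
    using linD[OF Xd(1)[of f]] f subD(6)[OF W] by (intro linI) simp_all
   then show "restrict f ?W <: (lin_space ?N scal)" using lin_restrict[OF sub_vs[OF W]] by fastforce
  qed (use subD(6)[OF W] in \<open>auto simp: fun_eq_iff\<close>)
  show m: "(\<lambda>x\<in>carrier N. g (lact N e x)) <: ?D" if g: "g <: (lin_space ?N scal)" for g
  proof -
   have "g \<in> lin K ?N scal" using g by simp
   from lin_restrict[OF n(1) lin_comp[OF el this]]
   have d: "(\<lambda>x\<in>carrier N. g (lact N e x)) <: (dual_rmod N)" by simp
   have "(\<lambda>x\<in>carrier N. g (lact N e x)) = ract (dual_rmod N) (\<lambda>x\<in>carrier N. g (lact N e x)) e"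
    using n e by (auto simp: fun_eq_iff)
   with d show ?thesis by (simp del: dual_simps)
  qed
  show "(\<lambda>x\<in>carrier N. (restrict f ?W) (lact N e x)) = f" if f: "f <: ?D" for f
  proof (rule extensionalityI[where A="carrier N"])
   have fX: "f \<in> ?X" using f by simp
   show "f \<in> extensional (carrier N)" by (rule Xd(2)[OF fX])
   show "(\<lambda>x\<in>carrier N. (restrict f ?W) (lact N e x)) x = f x" if "x <: N" for x
    using Xe[OF fX that] that by simp
  qed simp
  show "restrict (\<lambda>x\<in>carrier N. g (lact N e x)) ?W = g" if g: "g <: (lin_space ?N scal)" for g
  proof (rule extensionalityI[where A="?W"])
   show "restrict (\<lambda>x\<in>carrier N. g (lact N e x)) ?W x = g x" if "x \<in> ?W" for x
    using We[OF that] subD(6)[OF W that] that by simp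
   show "restrict (\<lambda>x\<in>carrier N. g (lact N e x)) ?W \<in> extensional ?W" by (rule restrict_extensional)
  qed (use g in simp)
  show "findim ?D \<or> findim (lin_space ?N scal)"
   using dual_dim(1)[OF sub_vs[OF W] Wf] by simp
 qed
 then show ?thesis using dual_dim(2)[OF sub_vs[OF W] Wf] by simp
qed

definition left_principal :: "'a \<Rightarrow> ('k, 'a, 'a) lmod" where
 "left_principal e = as_lmod (A\<langle>(\<lambda>b. b \<otimes>\<^bsub>A\<^esub> e) ` carrier A\<rangle>) (monoid.mult A)"

lemma left_principal_simps [simp]:
 "carrier (left_principal e) = (\<lambda>b. b \<otimes>\<^bsub>A\<^esub> e) ` carrier A" "\<zero>\<^bsub>left_principal e\<^esub> = \<zero>\<^bsub>A\<^esub>"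
 "x \<oplus>\<^bsub>left_principal e\<^esub> y = x \<oplus>\<^bsub>A\<^esub> y" "c \<odot>\<^bsub>left_principal e\<^esub> y = c \<odot>\<^bsub>A\<^esub> y"
 "lact (left_principal e) a x = a \<otimes>\<^bsub>A\<^esub> x"
 by (simp_all add: left_principal_def)

lemma left_principal_module:
 assumes e: "e <: A"
 shows "left_module K A (left_principal e)" "findim A ==> findim (left_principal e)"
proof -
 have "(\<lambda>b. b \<otimes>\<^bsub>A\<^esub> e) \<in> lin K A A" using e by (intro linI) (simp_all add: alg_rules)
 note s = lin_im_sub[OF alg_simps(1) alg_simps(1) this sub_self[OF alg_simps(1)]]
 note v = sub_vs[OF s]
 have V: "vectorspace K (left_principal e)" by (rule vs_cong[OF v]) (simp_all add: left_principal_def)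
 show "left_module K A (left_principal e)"
 proof (rule lmodI[OF V])
  show "lact (left_principal e) a m <: (left_principal e)" if m: "m <: (left_principal e)" and a: "a <: A" for m a
  proof -
   obtain b where "b <: A" "m = b \<otimes>\<^bsub>A\<^esub> e" using m by auto
   then have "a \<otimes>\<^bsub>A\<^esub> m = (a \<otimes>\<^bsub>A\<^esub> b) \<otimes>\<^bsub>A\<^esub> e" "a \<otimes>\<^bsub>A\<^esub> b <: A" using a e by (simp_all add: alg_assoc)
   then show ?thesis by auto
  qed
 qed (use e in \<open>auto simp: alg_rules\<close>)
 have "findim (left_principal e) = findim (A\<langle>(\<lambda>b. b \<otimes>\<^bsub>A\<^esub> e) ` carrier A\<rangle>)"
  by (rule dim_cong(1)[OF v]) (simp_all add: left_principal_def)
 then show "findim A ==> findim (left_principal e)" using sub_fin[OF s] by simp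
qed

text \<open>Hom(Q, D(A e)) = D(Q \<otimes> A e) = D(Q e), written down directly: h corresponds to
  the form x \<mapsto> h x e on Q e, and a form \<psi> to the map with values \<psi>(x y) for y in A
  e.\<close>

lemma hom_dual_principal_dim:
 assumes Q: "rmodule Q" and fin: "findim Q" and e: "e <: A" "e \<otimes>\<^bsub>A\<^esub> e = e"
 shows "vdim (hom_space K A Q (dual_rmod (left_principal e)))
  = vdim (Q\<langle>(\<lambda>m. ract Q m e) ` carrier Q\<rangle>)"
proof -
 let ?L = "left_principal e" let ?W = "(\<lambda>m. ract Q m e) ` carrier Q"
 let ?Q = "Q\<langle>?W\<rangle>" and ?H = "hom_space K A Q (dual_rmod ?L)"
 note q = rmodD[OF Q]
 note L = left_principal_module(1)[OF e(1)]
 note D = dual_module[OF L]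
 note W = idem_image[OF Q e(1)]
 have eL: "e <: ?L" using e by force
 have LA: "y <: A" "y \<otimes>\<^bsub>A\<^esub> e = y" if "y <: ?L" for y
  using that e by (auto simp: alg_assoc)
 have qy: "ract Q x y \<in> ?W" if "x <: Q" "y <: ?L" for x y
 proof -
  have "ract Q x y = ract Q (ract Q x y) e" using q(7) that LA[OF that(2)] e by simp
  then show ?thesis using q(2) that LA by blast
 qed
 have Wx: "x <: Q" "ract Q x e = x" if "x \<in> ?W" for x
  using that q e by auto
 have hK: "h x y <: K" if "h <: ?H" "x <: Q" "y <: ?L" for h x y
  using homD(3)[of h Q "dual_rmod ?L" x] linD(1)[of "h x" ?L scal y] that by simp
 let ?\<Phi> = "\<lambda>h. \<lambda>x\<in>?W. h x e" and ?\<Psi> = "\<lambda>\<psi>. \<lambda>x\<in>carrier Q. \<lambda>y\<in>carrier ?L. \<psi> (ract Q x y)"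
 have "vdim ?H = vdim (lin_space ?Q scal)"
 proof (rule lin_bij(3)[where f="?\<Phi>" and g="?\<Psi>", OF hom_space_vs[OF Q D] lin_space_vs[OF sub_vs[OF W] scal_vs]])
  show "?\<Phi> \<in> lin K ?H (lin_space ?Q scal)"
  proof (rule linI)
   show "?\<Phi> h <: (lin_space ?Q scal)" if h: "h <: ?H" for h
   proof -
    have hh: "h \<in> rhom Q (dual_rmod ?L)" using h by simp
    have "(\<lambda>x. h x e) \<in> lin K ?Q scal"
     using homD(4,5)[OF hh] Wx(1) eL hK[OF h] by (intro linI) (simp_all del: left_principal_simps(1))
    then show ?thesis using lin_restrict[OF sub_vs[OF W]] by fastforce
   qed
  qed (use Wx(1) eL in \<open>auto simp: fun_eq_iff simp del: left_principal_simps(1)\<close>)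
  show "?\<Psi> \<psi> <: ?H" if \<psi>: "\<psi> <: (lin_space ?Q scal)" for \<psi>
  proof -
   have pl: "\<psi> \<in> lin K ?Q scal" using \<psi> by simp
   note p = linD[OF pl, simplified]
   have m: "(\<lambda>y\<in>carrier ?L. \<psi> (ract Q x y)) <: (dual_rmod ?L)" if x: "x <: Q" for x
   proof -
    have "(\<lambda>y. \<psi> (ract Q x y)) \<in> lin K ?L scal"
     using p qy[OF x] q x LA(1) by (intro linI) (simp_all del: left_principal_simps(1))
    from lin_restrict[OF lmodD(1)[OF L] this] show ?thesis by simp
   qed
   have "?\<Psi> \<psi> \<in> rhom Q (dual_rmod ?L)"
   proof (intro homI linI)
    show "?\<Psi> \<psi> (x \<oplus>\<^bsub>Q\<^esub> y) = ?\<Psi> \<psi> x \<oplus>\<^bsub>dual_rmod ?L\<^esub> ?\<Psi> \<psi> y" if "x <: Q" "y <: Q" for x y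
     using that q(1,4) LA(1) p(2) qy by (auto simp: fun_eq_iff simp del: left_principal_simps(1))
    show "?\<Psi> \<psi> (c \<odot>\<^bsub>Q\<^esub> x) = c \<odot>\<^bsub>dual_rmod ?L\<^esub> ?\<Psi> \<psi> x" if "c <: K" "x <: Q" for c x
     using that q(1,6) LA(1) p(3) qy by (auto simp: fun_eq_iff simp del: left_principal_simps(1))
    show "?\<Psi> \<psi> (ract Q x a) = ract (dual_rmod ?L) (?\<Psi> \<psi> x) a" if "x <: Q" "a <: A" for x a
     using that q(2,7) LA(1) lmodD(2)[OF L] by (auto simp: fun_eq_iff simp del: left_principal_simps(1))
   qed (use m in simp)
   then show ?thesis by simp
  qed
  show "?\<Psi> (?\<Phi> h) = h" if h: "h <: ?H" for h
  proof (rule extensionalityI[where A="carrier Q"])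
   fix x assume x: "x <: Q"
   have hh: "h \<in> rhom Q (dual_rmod ?L)" using h by simp
   have hx: "h x <: (dual_rmod ?L)" using homD(3)[OF hh x] .
   show "?\<Psi> (?\<Phi> h) x = h x"
   proof (rule extensionalityI[where A="carrier ?L"])
    show "?\<Psi> (?\<Phi> h) x y = h x y" if y: "y <: ?L" for y
     using x y qy[OF x y] homD(2)[OF hh x LA(1)[OF y]] LA(2)[OF y] eL by (simp del: left_principal_simps(1))
   qed (use hx x in simp_all)
  qed (use h in simp_all)
  show "?\<Phi> (?\<Psi> \<psi>) = \<psi>" if "\<psi> <: (lin_space ?Q scal)" for \<psi>
  proof (rule extensionalityI[where A="?W"])
   show "?\<Phi> (?\<Psi> \<psi>) x = \<psi> x" if "x \<in> ?W" for x
    using that Wx[OF that] eL by (simp del: left_principal_simps(1))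
  qed (use that in simp_all)
  show "findim ?H \<or> findim (lin_space ?Q scal)"
   using dual_dim(1)[OF sub_vs[OF W] sub_fin[OF W fin]] by simp
 qed
 then show ?thesis using dual_dim(2)[OF sub_vs[OF W] sub_fin[OF W fin]] by simp
qed

end

context alg_over
begin

subsection \<open>Corners and principal modules\<close>

definition corner :: "'a \<Rightarrow> 'a \<Rightarrow> nat" where
 "corner e f = vdim (A\<langle>(\<lambda>b. e \<otimes>\<^bsub>A\<^esub> (b \<otimes>\<^bsub>A\<^esub> f)) ` carrier A\<rangle>)"

lemma corner_sub:
 assumes "e <: A" "f <: A"
 shows "sspace K ((\<lambda>b. e \<otimes>\<^bsub>A\<^esub> (b \<otimes>\<^bsub>A\<^esub> f)) ` carrier A) A"
proof -
 have "(\<lambda>b. e \<otimes>\<^bsub>A\<^esub> (b \<otimes>\<^bsub>A\<^esub> f)) \<in> lin K A A" using assms by (intro linI) (simp_all add: alg_rules)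
 from lin_im_sub[OF alg_simps(1) alg_simps(1) this sub_self[OF alg_simps(1)]] show ?thesis .
qed

lemma corner_left:
 assumes "e <: A" "f <: A" "findim A"
 shows "vdim ((left_principal f)\<langle>(\<lambda>m. lact (left_principal f) e m) ` carrier (left_principal f)\<rangle>) = corner e f"
 unfolding corner_def
 by (rule dim_cong(2)[OF sub_vs[OF corner_sub[OF assms(1,2)]] _ _ _ _ sub_fin[OF corner_sub[OF assms(1,2)] assms(3)]])
  (simp_all add: left_principal_def image_image)

lemma principal_simps [simp]:
 "carrier (principal_rmod A e) = (\<lambda>a. e \<otimes>\<^bsub>A\<^esub> a) ` carrier A" "\<zero>\<^bsub>principal_rmod A e\<^esub> = \<zero>\<^bsub>A\<^esub>"
 "x \<oplus>\<^bsub>principal_rmod A e\<^esub> y = x \<oplus>\<^bsub>A\<^esub> y" "c \<odot>\<^bsub>principal_rmod A e\<^esub> x = c \<odot>\<^bsub>A\<^esub> x"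
 "ract (principal_rmod A e) x a = x \<otimes>\<^bsub>A\<^esub> a"
 by (simp_all add: principal_rmod_def)

lemma principal_module:
 assumes e: "e <: A"
 shows "rmodule (principal_rmod A e)" "findim A ==> findim (principal_rmod A e)"
proof -
 have "(\<lambda>b. e \<otimes>\<^bsub>A\<^esub> b) \<in> lin K A A" using e by (intro linI) (simp_all add: alg_rules)
 note s = lin_im_sub[OF alg_simps(1) alg_simps(1) this sub_self[OF alg_simps(1)]]
 note v = sub_vs[OF s]
 have V: "vectorspace K (principal_rmod A e)" by (rule vs_cong[OF v]) (simp_all add: principal_rmod_def)
 show "rmodule (principal_rmod A e)"
 proof (rule rmodI[OF V])
  show "ract (principal_rmod A e) m a <: (principal_rmod A e)" if m: "m <: (principal_rmod A e)" and a: "a <: A" for m a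
  proof -
   obtain b where "b <: A" "m = e \<otimes>\<^bsub>A\<^esub> b" using m by auto
   then have "m \<otimes>\<^bsub>A\<^esub> a = e \<otimes>\<^bsub>A\<^esub> (b \<otimes>\<^bsub>A\<^esub> a)" "b \<otimes>\<^bsub>A\<^esub> a <: A" using a e by (simp_all add: alg_assoc)
   then show ?thesis by auto
  qed
 qed (use e in \<open>auto simp: alg_rules\<close>)
 have "findim (principal_rmod A e) = findim (A\<langle>(\<lambda>b. e \<otimes>\<^bsub>A\<^esub> b) ` carrier A\<rangle>)"
  by (rule dim_cong(1)[OF v]) (simp_all add: principal_rmod_def)
 then show "findim A ==> findim (principal_rmod A e)" using sub_fin[OF s] by simp
qed

text \<open>A homomorphism on e A is determined by its value at e, which may be any element of N
  e.\<close>

lemma hom_principal_dim: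
 assumes N: "rmodule N" and fin: "findim N" and e: "e <: A" "e \<otimes>\<^bsub>A\<^esub> e = e"
 shows "vdim (hom_space K A (principal_rmod A e) N)
  = vdim (N\<langle>(\<lambda>m. ract N m e) ` carrier N\<rangle>)"
proof -
 let ?P = "principal_rmod A e" and ?W = "(\<lambda>m. ract N m e) ` carrier N"
 let ?H = "hom_space K A ?P N"
 note n = rmodD[OF N] and P = principal_module(1)[OF e(1)] and W = idem_image[OF N e(1)]
 have eP: "e <: ?P" using e by force
 have Pm: "y <: A" "e \<otimes>\<^bsub>A\<^esub> y = y" if "y <: ?P" for y
  using that e by (auto simp: alg_assoc[symmetric])
 show ?thesis
 proof (rule lin_bij(3)[where f="\<lambda>h. h e" and g="\<lambda>x. \<lambda>y\<in>carrier ?P. ract N x y", OF hom_space_vs[OF P N] sub_vs[OF W]])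
  have he: "h e \<in> ?W" if h: "h <: ?H" for h
  proof -
   have hh: "h \<in> rhom ?P N" using h by simp
   have "h e = ract N (h e) e" using homD(2)[OF hh eP e(1)] e by simp
   then show ?thesis using homD(3)[OF hh eP] by blast
  qed
  then show "(\<lambda>h. h e) \<in> lin K ?H (N\<langle>?W\<rangle>)"
   using eP by (intro linI) (simp_all del: principal_simps(1))
  show "(\<lambda>y\<in>carrier ?P. ract N x y) <: ?H" if x: "x <: (N\<langle>?W\<rangle>)" for x
  proof -
   have xN: "x <: N" using subD(6)[OF W] x by simp
   have "(\<lambda>y. ract N x y) \<in> rhom ?P N"
    using n xN Pm(1) by (intro homI linI) (simp_all del: principal_simps(1))
   from hom_restrict[OF P this] show ?thesis .
  qed
  show "(\<lambda>y\<in>carrier ?P. ract N (h e) y) = h" if h: "h <: ?H" for h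
  proof (rule extensionalityI[where A="carrier ?P"])
   have hh: "h \<in> rhom ?P N" using h by simp
   show "(\<lambda>y\<in>carrier ?P. ract N (h e) y) y = h y" if y: "y <: ?P" for y
    using homD(2)[OF hh eP Pm(1)[OF y]] Pm(2)[OF y] y by (simp del: principal_simps(1))
  qed (use h in simp_all)
  show "(\<lambda>y\<in>carrier ?P. ract N x y) e = x" if "x <: (N\<langle>?W\<rangle>)" for x
   using that eP n(7) e by (auto simp del: principal_simps(1))
  show "findim ?H \<or> findim (N\<langle>?W\<rangle>)" using sub_fin[OF W fin] by simp
 qed
qed

lemma corner_right:
 assumes "e <: A" "f <: A" "findim A"
 shows "vdim ((principal_rmod A e)\<langle>(\<lambda>m. ract (principal_rmod A e) m f) ` carrier (principal_rmod A e)\<rangle>) = corner e f"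
 unfolding corner_def
 by (rule dim_cong(2)[OF sub_vs[OF corner_sub[OF assms(1,2)]] _ _ _ _ sub_fin[OF corner_sub[OF assms(1,2)] assms(3)]])
  (use assms in \<open>simp_all add: principal_rmod_def image_image alg_assoc\<close>)

text \<open>The arguments change places because homomorphisms e A \<rightarrow> f A are left
  multiplications by elements of f A e.\<close>

lemma cartan_entry:
 assumes e: "e <: A" "e \<otimes>\<^bsub>A\<^esub> e = e" and f: "f <: A" and fin: "findim A"
 shows "vdim (hom_space K A (principal_rmod A e) (principal_rmod A f)) = corner f e"
 using hom_principal_dim[OF principal_module(1)[OF f] principal_module(2)[OF f fin] e] corner_right[OF f e(1) fin] by simp

text \<open>A proper submodule of greatest dimension above I is maximal.\<close>

lemma submod_maximal:
 assumes N: "rmodule N" and fin: "findim N" and I: "submod N I" "I \<noteq> carrier N"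
 obtains W where "submod N W" "I \<subseteq> W" "W \<noteq> carrier N"
  "\<And>W'. submod N W' ==> W \<subseteq> W' ==> W' = W \<or> W' = carrier N"
proof -
 let ?P = "\<lambda>W. submod N W \<and> I \<subseteq> W \<and> W \<noteq> carrier N" and ?d = "\<lambda>W. vdim (N\<langle>W\<rangle>)"
 have "\<forall>y. ?P y \<longrightarrow> ?d y < Suc (vdim N)"
  using sub_dim(1)[OF _ fin] submodD(2) le_imp_less_Suc by blast
 from ex_has_greatest_nat[of ?P I ?d, OF _ this] I obtain W where W: "?P W" "\<And>y. ?P y ==> ?d y \<le> ?d W" by blast
 have "W' = W \<or> W' = carrier N" if W': "submod N W'" "W \<subseteq> W'" for W'
 proof (rule ccontr)
  assume c: "\<not> (W' = W \<or> W' = carrier N)"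
  then have "?d W' \<le> ?d W" using W W' by blast
  moreover have s: "sspace K W (N\<langle>W'\<rangle>)"
   by (rule sub_trans[OF submodD(2)[OF W'(1)] submodD(2) W'(2)]) (use W in blast)
  moreover have f: "findim (N\<langle>W'\<rangle>)" using sub_fin[OF submodD(2)[OF W'(1)] fin] .
  ultimately have "W = carrier (N\<langle>W'\<rangle>)" using sub_dim[OF s f] by simp
  then show False using c by simp
 qed
 then show thesis using that W(1) by blast
qed

text \<open>The submodule W + n A. For maximal W and n outside W it is the whole module, which is
  how maximality is exploited.\<close>

lemma submod_add_cyclic:
 assumes W: "submod N W" and n: "n <: N"
 shows "submod N {w \<oplus>\<^bsub>N\<^esub> ract N n b | w b. w \<in> W \<and> b <: A}" (is "submod N ?X")
  and "W \<subseteq> {w \<oplus>\<^bsub>N\<^esub> ract N n b | w b. w \<in> W \<and> b <: A}"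
  and "n \<in> {w \<oplus>\<^bsub>N\<^esub> ract N n b | w b. w \<in> W \<and> b <: A}"
proof -
 note w = submodD[OF W] and s = subD[OF submodD(2)[OF W]]
 note r = rmodD[OF w(1)]
 note V = r(1)
 show "submod N ?X"
  unfolding submod_def
 proof (intro conjI ballI w(1) subI[OF V])
  show "?X \<subseteq> carrier N" using w(4) n r V by auto
  have "\<zero>\<^bsub>N\<^esub> = \<zero>\<^bsub>N\<^esub> \<oplus>\<^bsub>N\<^esub> ract N n \<zero>\<^bsub>A\<^esub>" using V n r by simp
  then show "\<zero>\<^bsub>N\<^esub> \<in> ?X" using s(3) vs_zero[OF alg_simps(1)] by blast
  show "x \<oplus>\<^bsub>N\<^esub> y \<in> ?X" if xy: "x \<in> ?X" "y \<in> ?X" for x y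
  proof -
   obtain w1 b1 w2 b2 where x: "x = w1 \<oplus>\<^bsub>N\<^esub> ract N n b1" "w1 \<in> W" "b1 <: A"
    and y: "y = w2 \<oplus>\<^bsub>N\<^esub> ract N n b2" "w2 \<in> W" "b2 <: A" using xy by blast
   have "x \<oplus>\<^bsub>N\<^esub> y = (w1 \<oplus>\<^bsub>N\<^esub> w2) \<oplus>\<^bsub>N\<^esub> ract N n (b1 \<oplus>\<^bsub>A\<^esub> b2)"
    using x y w(4) n r V by (simp add: vs_ac)
   then show ?thesis using s(4)[OF x(2) y(2)] vs_add[OF alg_simps(1) x(3) y(3)] by blast
  qed
  show "c \<odot>\<^bsub>N\<^esub> x \<in> ?X" if c: "c <: K" and x': "x \<in> ?X" for c x
  proof -
   obtain w1 b1 where x: "x = w1 \<oplus>\<^bsub>N\<^esub> ract N n b1" "w1 \<in> W" "b1 <: A" using x' by blast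
   have "c \<odot>\<^bsub>N\<^esub> x = c \<odot>\<^bsub>N\<^esub> w1 \<oplus>\<^bsub>N\<^esub> ract N n (c \<odot>\<^bsub>A\<^esub> b1)" using x w(4) n r V c by (simp add: vs_smult_add)
   then show ?thesis using s(5)[OF c x(2)] vs_smult[OF alg_simps(1) c x(3)] by blast
  qed
  show "ract N x a \<in> ?X" if x': "x \<in> ?X" and a: "a <: A" for x a
  proof -
   obtain w1 b1 where x: "x = w1 \<oplus>\<^bsub>N\<^esub> ract N n b1" "w1 \<in> W" "b1 <: A" using x' by blast
   have "ract N x a = ract N w1 a \<oplus>\<^bsub>N\<^esub> ract N n (b1 \<otimes>\<^bsub>A\<^esub> a)" using x w(4) n r V a by simp
   then show ?thesis using w(3)[OF x(2) a] alg_simps(3)[OF x(3) a] by blast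
  qed
 qed
 have "w = w \<oplus>\<^bsub>N\<^esub> ract N n \<zero>\<^bsub>A\<^esub>" if "w \<in> W" for w using that V n r w(4) by simp
 then show "W \<subseteq> ?X" using vs_zero[OF alg_simps(1)] by blast
 have "n = \<zero>\<^bsub>N\<^esub> \<oplus>\<^bsub>N\<^esub> ract N n \<one>\<^bsub>A\<^esub>" using V n r by simp
 then show "n \<in> ?X" using s(3) alg_simps(4) by blast
qed

end

section \<open>Algebras all of whose simple modules are one-dimensional\<close>

text \<open>The simple modules are given by characters \<open>\<chi> s\<close>, dual to idempotents \<open>e s\<close>. This covers
 both an elementary algebra and its enveloping algebra.\<close>

locale basic_algebra = alg_over K A for K :: "('k, 'x) ring_scheme" (structure) and A :: "('k, 'a) module" +
 fixes S :: "'s set" and e :: "'s \<Rightarrow> 'a" and \<chi> :: "'s \<Rightarrow> 'a \<Rightarrow> 'k"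
 assumes fin_A: "findim A" and fin_S: "finite S"
  and e_mem: "\<And>s. s \<in> S ==> e s <: A" and e_idem: "\<And>s. s \<in> S ==> e s \<otimes>\<^bsub>A\<^esub> e s = e s"
  and \<chi>_lin: "\<And>s. s \<in> S ==> \<chi> s \<in> lin K A scal"
  and \<chi>_mult: "\<And>s x y. s \<in> S ==> x <: A ==> y <: A ==> \<chi> s (x \<otimes>\<^bsub>A\<^esub> y) = \<chi> s x \<otimes> \<chi> s y"
  and \<chi>_one: "\<And>s. s \<in> S ==> \<chi> s \<one>\<^bsub>A\<^esub> = \<one>"
  and \<chi>_e: "\<And>s t. s \<in> S ==> t \<in> S ==> \<chi> s (e t) = (if s = t then \<one> else \<zero>)"
  and proper: "\<And>I. sspace K I A ==> (\<And>x a. x \<in> I ==> a <: A ==> x \<otimes>\<^bsub>A\<^esub> a \<in> I) ==> \<one>\<^bsub>A\<^esub> \<notin> I ==>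
   \<exists>s\<in>S. \<forall>x\<in>I. \<chi> s x = \<zero>"
begin

lemma \<chi>D:
 assumes "s \<in> S"
 shows "\<And>x. x <: A ==> \<chi> s x <: K"
  "\<And>x y. x <: A ==> y <: A ==> \<chi> s (x \<oplus>\<^bsub>A\<^esub> y) = \<chi> s x \<oplus> \<chi> s y"
  "\<And>c x. c <: K ==> x <: A ==> \<chi> s (c \<odot>\<^bsub>A\<^esub> x) = c \<otimes> \<chi> s x"
 using linD[OF \<chi>_lin[OF assms]] by simp_all

definition simple :: "'s \<Rightarrow> ('k, 'k, 'a) rmod" where
 "simple s = as_rmod scal (\<lambda>x a. x \<otimes> \<chi> s a)"

lemma simple_simps [simp]:
 "carrier (simple s) = carrier K" "\<zero>\<^bsub>simple s\<^esub> = \<zero>" "x \<oplus>\<^bsub>simple s\<^esub> y = x \<oplus> y"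
 "c \<odot>\<^bsub>simple s\<^esub> x = c \<otimes> x" "ract (simple s) x a = x \<otimes> \<chi> s a"
 by (simp_all add: simple_def)

lemma simple_module:
 assumes s: "s \<in> S"
 shows "rmodule (simple s)" "findim (simple s)"
proof -
 have V: "vectorspace K (simple s)" by (rule vs_cong[OF scal_vs]) (simp_all add: simple_def)
 show "rmodule (simple s)"
  by (rule rmodI[OF V]) (use \<chi>D[OF s] \<chi>_mult[OF s] \<chi>_one[OF s] in \<open>simp_all add: m_assoc l_distr r_distr m_lcomm\<close>)
 show "findim (simple s)"
  using dim_cong(1)[OF scal_vs, of "simple s"] scal_dim(1) by (simp add: simple_def)
qed

text \<open>For a maximal W above I and n outside W, the elements a with n a in W form a proper
  right ideal, which by \<open>proper\<close> lies in the kernel of some character. The two are in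
  fact equal, so that N/W is one-dimensional and A acts on it through that character.\<close>

lemma simple_quotient:
 assumes N: "rmodule N" and fin: "findim N" and I: "submod N I" "I \<noteq> carrier N"
 obtains s h n where "s \<in> S" "h \<in> rhom N (simple s)" "\<And>x. x \<in> I ==> h x = \<zero>" "n <: N" "h n = \<one>"
proof -
 obtain W where W: "submod N W" "I \<subseteq> W" "W \<noteq> carrier N"
  and mx: "\<And>W'. submod N W' ==> W \<subseteq> W' ==> W' = W \<or> W' = carrier N"
  by (rule submod_maximal[OF N fin I]) blast
 note w = submodD[OF W(1)] and ws = subD[OF submodD(2)[OF W(1)]]
 note r = rmodD[OF N] note V = r(1)
 obtain n where n: "n <: N" "n \<notin> W" using W w(4) by blast
 have cyc: "\<exists>w\<in>W. \<exists>b\<in>carrier A. x = w \<oplus>\<^bsub>N\<^esub> ract N m b" if m: "m <: N" "m \<notin> W" and x: "x <: N" for m x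
 proof -
  note c = submod_add_cyclic[OF W(1) m(1)]
  have "{w \<oplus>\<^bsub>N\<^esub> ract N m b | w b. w \<in> W \<and> b <: A} = carrier N"
   using mx[OF c(1,2)] c(3) m(2) by blast
  then show ?thesis using x by blast
 qed
 let ?ann = "{a \<in> carrier A. ract N n a \<in> W}"
 have ann: "sspace K ?ann A" using ws r n by (intro subI) simp_all
 have "\<exists>s\<in>S. \<forall>x\<in>?ann. \<chi> s x = \<zero>"
 proof (rule proper[OF ann])
  show "x \<otimes>\<^bsub>A\<^esub> a \<in> ?ann" if "x \<in> ?ann" "a <: A" for x a
   using that w(3)[of "ract N n x" a] r(7)[OF n(1), of x a] by simp
  show "\<one>\<^bsub>A\<^esub> \<notin> ?ann" using n r by simp
 qed
 then obtain s where s: "s \<in> S" "\<And>x. x <: A ==> ract N n x \<in> W ==> \<chi> s x = \<zero>" by blast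
 note xs = \<chi>D[OF s(1)]
 \<comment> \<open>If n j were outside W, then n = w' + n j b by maximality of W, so 1 - j b would
   send n into W; but the character has the value 1 there, since it kills j.\<close>
 have ker: "ract N n j \<in> W" if j: "j <: A" "\<chi> s j = \<zero>" for j
 proof (rule ccontr)
  assume nW: "ract N n j \<notin> W"
  obtain w' b where wb: "w' \<in> W" "b <: A" "n = w' \<oplus>\<^bsub>N\<^esub> ract N (ract N n j) b"
   using cyc[OF r(2)[OF n(1) j(1)] nW n(1)] by blast
  let ?y = "\<one>\<^bsub>A\<^esub> \<oplus>\<^bsub>A\<^esub> (\<ominus> \<one>) \<odot>\<^bsub>A\<^esub> (j \<otimes>\<^bsub>A\<^esub> b)"
  have jb: "j \<otimes>\<^bsub>A\<^esub> b <: A" "ract N n (j \<otimes>\<^bsub>A\<^esub> b) <: N" using j wb n r by simp_all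
  have "ract N n ?y = n \<oplus>\<^bsub>N\<^esub> (\<ominus> \<one>) \<odot>\<^bsub>N\<^esub> ract N n (j \<otimes>\<^bsub>A\<^esub> b)" using n r jb by simp
  also have "\<dots> = (w' \<oplus>\<^bsub>N\<^esub> ract N n (j \<otimes>\<^bsub>A\<^esub> b)) \<oplus>\<^bsub>N\<^esub> (\<ominus> \<one>) \<odot>\<^bsub>N\<^esub> ract N n (j \<otimes>\<^bsub>A\<^esub> b)"
   using wb(3) r(7)[OF n(1) j(1) wb(2)] by simp
  also have "\<dots> = w'" using w(4)[OF wb(1)] jb V by (simp add: vs_assoc)
  finally have "\<chi> s ?y = \<zero>" using s(2)[of ?y] wb jb by simp
  moreover have "\<chi> s ?y = \<one>" using xs jb j wb \<chi>_mult[OF s(1)] \<chi>_one[OF s(1)] by simp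
  ultimately show False by simp
 qed
 \<comment> \<open>Apply \<open>ker\<close> to b - \<chi>(b) 1.\<close>
 have act: "\<exists>w\<in>W. ract N n b = w \<oplus>\<^bsub>N\<^esub> \<chi> s b \<odot>\<^bsub>N\<^esub> n" if b: "b <: A" for b
 proof -
  let ?j = "b \<oplus>\<^bsub>A\<^esub> (\<ominus> \<one>) \<odot>\<^bsub>A\<^esub> (\<chi> s b \<odot>\<^bsub>A\<^esub> \<one>\<^bsub>A\<^esub>)"
  have "\<chi> s ?j = \<zero>" using xs b \<chi>_one[OF s(1)] by (simp add: r_neg l_minus)
  then have "ract N n ?j \<in> W" using ker b xs by simp
  moreover have "ract N n b = ract N n ?j \<oplus>\<^bsub>N\<^esub> \<chi> s b \<odot>\<^bsub>N\<^esub> n"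
   using n r xs b V by (simp add: vs_assoc)
  ultimately show ?thesis by blast
 qed
 have dec: "\<exists>w\<in>W. \<exists>c\<in>carrier K. x = w \<oplus>\<^bsub>N\<^esub> c \<odot>\<^bsub>N\<^esub> n" if x: "x <: N" for x
 proof -
  obtain w1 b where 1: "w1 \<in> W" "b <: A" "x = w1 \<oplus>\<^bsub>N\<^esub> ract N n b" using cyc[OF n x] by blast
  obtain w2 where 2: "w2 \<in> W" "ract N n b = w2 \<oplus>\<^bsub>N\<^esub> \<chi> s b \<odot>\<^bsub>N\<^esub> n" using act[OF 1(2)] by blast
  have "x = (w1 \<oplus>\<^bsub>N\<^esub> w2) \<oplus>\<^bsub>N\<^esub> \<chi> s b \<odot>\<^bsub>N\<^esub> n"
   using 1 2 w(4) n xs V by (simp add: vs_assoc)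
  then show ?thesis using ws(4)[OF 1(1) 2(1)] xs(1)[OF 1(2)] by blast
 qed
 have uniq: "c = c'" if "w1 \<in> W" "w2 \<in> W" "c <: K" "c' <: K"
  "w1 \<oplus>\<^bsub>N\<^esub> c \<odot>\<^bsub>N\<^esub> n = w2 \<oplus>\<^bsub>N\<^esub> c' \<odot>\<^bsub>N\<^esub> n" for w1 w2 c c'
 proof (rule ccontr)
  assume "c \<noteq> c'"
  let ?k = "c \<ominus> c'"
  have k: "?k <: K" "?k \<noteq> \<zero>" using that \<open>c \<noteq> c'\<close> vs_sub_eq_zero[OF scal_vs, of c c']
   by (simp_all add: a_minus_def l_minus)
  have "?k \<odot>\<^bsub>N\<^esub> n = w2 \<oplus>\<^bsub>N\<^esub> (\<ominus> \<one>) \<odot>\<^bsub>N\<^esub> w1"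
  proof -
   have "c \<odot>\<^bsub>N\<^esub> n = (\<ominus> \<one>) \<odot>\<^bsub>N\<^esub> w1 \<oplus>\<^bsub>N\<^esub> (w1 \<oplus>\<^bsub>N\<^esub> c \<odot>\<^bsub>N\<^esub> n)"
    using that(1-4) w(4) n V by (simp add: vs_assoc[symmetric])
   also have "\<dots> = (\<ominus> \<one>) \<odot>\<^bsub>N\<^esub> w1 \<oplus>\<^bsub>N\<^esub> (w2 \<oplus>\<^bsub>N\<^esub> c' \<odot>\<^bsub>N\<^esub> n)" using that by simp
   finally have 1: "c \<odot>\<^bsub>N\<^esub> n = (\<ominus> \<one>) \<odot>\<^bsub>N\<^esub> w1 \<oplus>\<^bsub>N\<^esub> (w2 \<oplus>\<^bsub>N\<^esub> c' \<odot>\<^bsub>N\<^esub> n)" .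
   have "?k \<odot>\<^bsub>N\<^esub> n = c \<odot>\<^bsub>N\<^esub> n \<oplus>\<^bsub>N\<^esub> (\<ominus> \<one>) \<odot>\<^bsub>N\<^esub> (c' \<odot>\<^bsub>N\<^esub> n)"
    using that n V by (simp add: a_minus_def vs_add_smult vs_smult_smult l_minus)
   also have "\<dots> = w2 \<oplus>\<^bsub>N\<^esub> (\<ominus> \<one>) \<odot>\<^bsub>N\<^esub> w1"
    unfolding 1 using that(1-4) w(4) n V by (simp add: vs_assoc vs_neg_add vs_comm[of N "(\<ominus> \<one>) \<odot>\<^bsub>N\<^esub> w1"])
   finally show ?thesis .
  qed
  then have "?k \<odot>\<^bsub>N\<^esub> n \<in> W" using ws(4,5) that by simp
  then have "inv ?k \<odot>\<^bsub>N\<^esub> (?k \<odot>\<^bsub>N\<^esub> n) \<in> W" using k by (rule_tac ws(5)) (simp_all add: field_Units)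
  moreover have "inv ?k \<odot>\<^bsub>N\<^esub> (?k \<odot>\<^bsub>N\<^esub> n) = n" using k n V by (simp add: vs_smult_smult field_Units)
  ultimately show False using n by simp
 qed
 \<comment> \<open>h reads off the coefficient of n in the decomposition of N into W and the line
   through n; \<open>dec\<close> and \<open>uniq\<close> justify the definite description.\<close>
 define h where "h x = (THE c. c <: K \<and> (\<exists>w\<in>W. x = w \<oplus>\<^bsub>N\<^esub> c \<odot>\<^bsub>N\<^esub> n))" for x
 have hI: "h x = c" if "w \<in> W" "c <: K" "x = w \<oplus>\<^bsub>N\<^esub> c \<odot>\<^bsub>N\<^esub> n" for x w c
  unfolding h_def by (rule the_equality) (use that uniq in blast)+
 have hdec: "h x <: K \<and> (\<exists>w\<in>W. x = w \<oplus>\<^bsub>N\<^esub> h x \<odot>\<^bsub>N\<^esub> n)" if "x <: N" for x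
  using dec[OF that] hI by metis
 have "h \<in> rhom N (simple s)"
 proof (intro homI linI)
  show "h x <: (simple s)" if "x <: N" for x using hdec[OF that] by simp
  show "h (x \<oplus>\<^bsub>N\<^esub> y) = h x \<oplus>\<^bsub>simple s\<^esub> h y" if xy: "x <: N" "y <: N" for x y
  proof -
   obtain w1 w2 where 1: "w1 \<in> W" "x = w1 \<oplus>\<^bsub>N\<^esub> h x \<odot>\<^bsub>N\<^esub> n" "w2 \<in> W" "y = w2 \<oplus>\<^bsub>N\<^esub> h y \<odot>\<^bsub>N\<^esub> n" "h x <: K" "h y <: K"
    using hdec xy by blast
   have "(w1 \<oplus>\<^bsub>N\<^esub> h x \<odot>\<^bsub>N\<^esub> n) \<oplus>\<^bsub>N\<^esub> (w2 \<oplus>\<^bsub>N\<^esub> h y \<odot>\<^bsub>N\<^esub> n) = (w1 \<oplus>\<^bsub>N\<^esub> w2) \<oplus>\<^bsub>N\<^esub> (h x \<oplus> h y) \<odot>\<^bsub>N\<^esub> n"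
    using 1(1,3,5,6) w(4) n V by (simp add: vs_add_smult vs_ac)
   then have xy': "x \<oplus>\<^bsub>N\<^esub> y = (w1 \<oplus>\<^bsub>N\<^esub> w2) \<oplus>\<^bsub>N\<^esub> (h x \<oplus> h y) \<odot>\<^bsub>N\<^esub> n" using 1(2,4) by simp
   show ?thesis using hI[OF ws(4)[OF 1(1,3)] _ xy'] 1(5,6) by simp
  qed
  show "h (c \<odot>\<^bsub>N\<^esub> x) = c \<odot>\<^bsub>simple s\<^esub> h x" if c: "c <: K" and x: "x <: N" for c x
  proof -
   obtain w1 where 1: "w1 \<in> W" "x = w1 \<oplus>\<^bsub>N\<^esub> h x \<odot>\<^bsub>N\<^esub> n" "h x <: K" using hdec x by blast
   have "c \<odot>\<^bsub>N\<^esub> (w1 \<oplus>\<^bsub>N\<^esub> h x \<odot>\<^bsub>N\<^esub> n) = c \<odot>\<^bsub>N\<^esub> w1 \<oplus>\<^bsub>N\<^esub> (c \<otimes> h x) \<odot>\<^bsub>N\<^esub> n"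
    using 1(1,3) w(4) n V c by (simp add: vs_smult_add vs_smult_smult)
   then have cx: "c \<odot>\<^bsub>N\<^esub> x = c \<odot>\<^bsub>N\<^esub> w1 \<oplus>\<^bsub>N\<^esub> (c \<otimes> h x) \<odot>\<^bsub>N\<^esub> n" using 1(2) by simp
   show ?thesis using hI[OF ws(5)[OF c 1(1)] _ cx] 1(3) c by simp
  qed
  show "h (ract N x a) = ract (simple s) (h x) a" if x: "x <: N" and a: "a <: A" for x a
  proof -
   obtain w1 where 1: "w1 \<in> W" "x = w1 \<oplus>\<^bsub>N\<^esub> h x \<odot>\<^bsub>N\<^esub> n" "h x <: K" using hdec x by blast
   obtain w2 where 2: "w2 \<in> W" "ract N n a = w2 \<oplus>\<^bsub>N\<^esub> \<chi> s a \<odot>\<^bsub>N\<^esub> n" using act[OF a] by blast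
   have "ract N (w1 \<oplus>\<^bsub>N\<^esub> h x \<odot>\<^bsub>N\<^esub> n) a = ract N w1 a \<oplus>\<^bsub>N\<^esub> h x \<odot>\<^bsub>N\<^esub> ract N n a"
    using 1(1,3) w(4) n V a r by simp
   also have "\<dots> = (ract N w1 a \<oplus>\<^bsub>N\<^esub> h x \<odot>\<^bsub>N\<^esub> w2) \<oplus>\<^bsub>N\<^esub> (h x \<otimes> \<chi> s a) \<odot>\<^bsub>N\<^esub> n"
    unfolding 2(2) using 1(1,3) 2(1) w(4) n V a r xs by (simp add: vs_smult_add vs_smult_smult vs_assoc)
   finally have e: "ract N x a = (ract N w1 a \<oplus>\<^bsub>N\<^esub> h x \<odot>\<^bsub>N\<^esub> w2) \<oplus>\<^bsub>N\<^esub> (h x \<otimes> \<chi> s a) \<odot>\<^bsub>N\<^esub> n" using 1(2) by simp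
   show ?thesis using hI[OF ws(4)[OF w(3)[OF 1(1) a] ws(5)[OF 1(3) 2(1)]] _ e] 1(3) xs(1)[OF a] by simp
  qed
 qed
 moreover have "h x = \<zero>" if x: "x \<in> I" for x
 proof -
  have "x \<in> W" using x W(2) by blast
  moreover have "x = x \<oplus>\<^bsub>N\<^esub> \<zero> \<odot>\<^bsub>N\<^esub> n" using w(4)[OF \<open>x \<in> W\<close>] n V by simp
  ultimately show ?thesis using hI[of x \<zero> x] by simp
 qed
 moreover have "h n = \<one>" using hI[OF ws(3), of \<one> n] n V by simp
 ultimately show thesis using that s(1) n(1) by blast
qed

text \<open>Induction along a composition series, taking simple quotients off the top. Passing to
  the kernel keeps the type of N fixed, which passing to a quotient would not.\<close>

lemma fd_induct [consumes 2, case_names zero step]: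
 assumes N: "rmodule N" and fin: "findim N"
  and z: "\<And>N. rmodule N ==> findim N ==> carrier N = {\<zero>\<^bsub>N\<^esub>} ==> P N"
  and st: "\<And>N s h n. rmodule N ==> findim N ==> s \<in> S ==> h \<in> rhom N (simple s) ==>
   n <: N ==> h n = \<one> ==> rmodule (N\<langle>{x \<in> carrier N. h x = \<zero>}\<rangle>) ==>
   findim (N\<langle>{x \<in> carrier N. h x = \<zero>}\<rangle>) ==>
   P (N\<langle>{x \<in> carrier N. h x = \<zero>}\<rangle>) ==> P N"
 shows "P N"
 using N fin
proof (induction "vdim N" arbitrary: N rule: less_induct)
 case less
 note V = rmodD(1)[OF less.prems(1)]
 show ?case
 proof (cases "carrier N = {\<zero>\<^bsub>N\<^esub>}")
  case True
  then show ?thesis using z less.prems by blast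
 next
  case False
  then obtain s h n where h: "s \<in> S" "h \<in> rhom N (simple s)" "n <: N" "h n = \<one>"
   using simple_quotient[OF less.prems submod_zero[OF less.prems(1)]] by metis
  have W: "submod N {x \<in> carrier N. h x = \<zero>}"
   using submod_ker[OF less.prems(1) simple_module(1)[OF h(1)] h(2)] by simp
  note s = submodD(2)[OF W]
  have "{x \<in> carrier N. h x = \<zero>} \<noteq> carrier N"
   using h(3,4) one_not_zero by (metis (mono_tags, lifting) mem_Collect_eq)
  then have "vdim (N\<langle>{x \<in> carrier N. h x = \<zero>}\<rangle>) < vdim N"
   using sub_dim[OF s less.prems(2)] by linarith
  from less.hyps[OF this submod_rmod[OF W] sub_fin[OF s less.prems(2)]]
  show ?thesis using st[OF less.prems h submod_rmod[OF W] sub_fin[OF s less.prems(2)]] by blast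
 qed
qed

lemma simple_surj:
 assumes s: "s \<in> S" and h: "h \<in> rhom N (simple s)" and n: "n <: N" "h n = \<one>" and c: "c <: K"
  and N: "rmodule N"
 shows "c \<odot>\<^bsub>N\<^esub> n <: N" "h (c \<odot>\<^bsub>N\<^esub> n) = c"
 using homD(5)[OF h c n(1)] n c rmodD(1)[OF N] by simp_all

text \<open>N \<mapsto> N e_t is exact, and S_s e_t is the field or zero according to whether s = t.
  The proof is rank-nullity for h on N e_t.\<close>

lemma idem_dim_step:
 assumes N: "rmodule N" and fin: "findim N" and s: "s \<in> S" and t: "t \<in> S"
  and h: "h \<in> rhom N (simple s)" and n: "n <: N" "h n = \<one>"
 defines "N' \<equiv> N\<langle>{x \<in> carrier N. h x = \<zero>}\<rangle>"
 shows "vdim (N\<langle>(\<lambda>m. ract N m (e t)) ` carrier N\<rangle>)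
  = vdim (N'\<langle>(\<lambda>m. ract N' m (e t)) ` carrier N'\<rangle>) + (if s = t then 1 else 0)"
proof -
 note r = rmodD[OF N] and et = e_mem[OF t] e_idem[OF t]
 let ?W = "(\<lambda>m. ract N m (e t)) ` carrier N"
 let ?E = "N\<langle>?W\<rangle>"
 note W = idem_image[OF N et(1)]
 have We: "ract N y (e t) = y" "y <: N" if "y \<in> ?W" for y using that r(2,7) et by auto
 have hl: "h \<in> lin K ?E scal"
  using homD(3-5)[OF h] We(2) by (intro linI) simp_all
 have hx: "h (ract N x (e t)) = (if s = t then h x else \<zero>)" if "x <: N" for x
  using homD(2)[OF h that et(1)] \<chi>_e[OF s t] homD(3)[OF h that] by simp
 have k: "{x \<in> carrier ?E. h x = \<zero>\<^bsub>scal\<^esub>} = (\<lambda>m. ract N' m (e t)) ` carrier N'"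
 proof (rule Set.set_eqI, rule iffI)
  fix y assume y: "y \<in> {x \<in> carrier ?E. h x = \<zero>\<^bsub>scal\<^esub>}"
  then have "y = ract N' y (e t)" "y <: N'" using We[of y] by (simp_all add: N'_def)
  then show "y \<in> (\<lambda>m. ract N' m (e t)) ` carrier N'" by blast
 next
  fix y assume "y \<in> (\<lambda>m. ract N' m (e t)) ` carrier N'"
  then obtain x where "x <: N" "h x = \<zero>" "y = ract N x (e t)" by (auto simp: N'_def)
  then show "y \<in> {x \<in> carrier ?E. h x = \<zero>\<^bsub>scal\<^esub>}" using hx[of x] by simp
 qed
 have i: "vdim (scal\<langle>h ` carrier ?E\<rangle>) = (if s = t then 1 else 0)"
 proof (cases "s = t")
  case True
  have "c \<in> h ` ?W" if c: "c <: K" for c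
   using simple_surj[OF s h n c N] hx[of "c \<odot>\<^bsub>N\<^esub> n"] True by (metis (no_types, lifting) image_eqI)
  then have "h ` carrier ?E = carrier scal" using linD(1)[OF hl] by auto
  then have "scal\<langle>h ` carrier ?E\<rangle> = scal" by simp
  then show ?thesis using True scal_dim(2) by simp
 next
  case False
  have "h ` carrier ?E = (\<lambda>m. \<zero>) ` carrier N"
   using hx False by (simp add: image_image cong: image_cong_simp)
  then have "h ` carrier ?E = {\<zero>}" using n(1) by auto
  then have "vdim (scal\<langle>h ` carrier ?E\<rangle>) = 0"
   using dim_zero(2)[OF sub_vs[OF sub_zero[OF scal_vs]]] by simp
  then show ?thesis using False by simp
 qed
 have "vdim ?E = vdim (scal\<langle>h ` carrier ?E\<rangle>) + vdim (?E\<langle>{x \<in> carrier ?E. h x = \<zero>\<^bsub>scal\<^esub>}\<rangle>)"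
  by (rule rank_nullity[OF sub_vs[OF W] scal_vs hl sub_fin[OF W fin]])
 moreover have "?E\<langle>{x \<in> carrier ?E. h x = \<zero>\<^bsub>scal\<^esub>}\<rangle> = N'\<langle>(\<lambda>m. ract N' m (e t)) ` carrier N'\<rangle>"
  unfolding k by (simp add: N'_def)
 ultimately show ?thesis using i by simp
qed

text \<open>Hom(Q, -) is exact because Q is projective: the sequence ker h \<rightarrow> N
  \<rightarrow> S_s yields a short exact sequence of Hom spaces.\<close>

lemma hom_dim_step:
 assumes Q: "projective_rmod K A Q" and Qfin: "findim Q"
  and N: "rmodule N" and fin: "findim N" and s: "s \<in> S"
  and h: "h \<in> rhom N (simple s)" and n: "n <: N" "h n = \<one>"
 shows "vdim (hom_space K A Q N)
  = vdim (hom_space K A Q (simple s)) + vdim (hom_space K A Q (N\<langle>{x \<in> carrier N. h x = \<zero>}\<rangle>))"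
proof -
 let ?N = "N\<langle>{x \<in> carrier N. h x = \<zero>}\<rangle>"
 have Qm: "rmodule Q" using Q by (simp add: projective_rmod_def)
 note sm = simple_module[OF s] and r = rmodD[OF N]
 let ?H = "hom_space K A Q N" and ?G = "hom_space K A Q (simple s)" and ?p = "\<lambda>f. \<lambda>x\<in>carrier Q. h (f x)"
 note H = hom_space_vs[OF Qm N] and G = hom_space_vs[OF Qm sm(1)]
 have pl: "?p \<in> lin K ?H ?G"
 proof (rule linI)
  show "?p f <: ?G" if "f <: ?H" for f using hom_restrict[OF Qm hom_comp[OF _ h]] that by simp
  show "?p (f \<oplus>\<^bsub>?H\<^esub> g) = ?p f \<oplus>\<^bsub>?G\<^esub> ?p g" if "f <: ?H" "g <: ?H" for f g
   using that homD(3)[of f Q N] homD(3)[of g Q N] homD(4)[OF h] by (auto simp: fun_eq_iff)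
  show "?p (c \<odot>\<^bsub>?H\<^esub> f) = c \<odot>\<^bsub>?G\<^esub> ?p f" if "c <: K" "f <: ?H" for c f
   using that homD(3)[of f Q N] homD(5)[OF h] by (auto simp: fun_eq_iff)
 qed
 have "g \<in> ?p ` carrier ?H" if g: "g <: ?G" for g
 proof -
  have gh: "g \<in> rhom Q (simple s)" and ge: "g \<in> extensional (carrier Q)" using g by simp_all
  have gi: "g x \<in> h ` carrier N" if "x <: Q" for x
   using simple_surj[OF s h n _ N, of "g x"] homD(3)[OF gh that] by (metis image_eqI simple_simps(1))
  obtain f where f: "f \<in> rhom Q N" "\<And>x. x <: Q ==> h (f x) = g x"
   using liftsD[OF projective_lifts[OF Q N sm(1)] h gh gi] by metis
  have "?p (restrict f (carrier Q)) = g"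
   by (rule extensionalityI[where A="carrier Q"]) (use ge f(2) in simp_all)
  then show ?thesis using hom_restrict[OF Qm f(1)] by blast
 qed
 then have im: "?p ` carrier ?H = carrier ?G" using linD(1)[OF pl] by blast
 have "f <: (hom_space K A Q ?N) \<longleftrightarrow> f <: ?H \<and> ?p f = \<zero>\<^bsub>?G\<^esub>" for f
 proof
  assume f: "f <: (hom_space K A Q ?N)"
  then have fh: "f \<in> rhom Q ?N" by simp
  have "f \<in> rhom Q N" using homD[OF fh] by (intro homI linI) simp_all
  then show "f <: ?H \<and> ?p f = \<zero>\<^bsub>?G\<^esub>" using f homD(3)[OF fh] by (auto simp: fun_eq_iff)
 next
  assume f: "f <: ?H \<and> ?p f = \<zero>\<^bsub>?G\<^esub>"
  then have fh: "f \<in> rhom Q N" and "\<And>x. x <: Q ==> h (f x) = \<zero>" by (auto simp: fun_eq_iff split: if_splits)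
  then have "f \<in> rhom Q ?N" using homD(3)[OF fh] by (intro hom_corestrict[OF fh]) simp
  then show "f <: (hom_space K A Q ?N)" using f by simp
 qed
 then have c: "carrier (hom_space K A Q ?N) = {f \<in> carrier ?H. ?p f = \<zero>\<^bsub>?G\<^esub>}" by blast
 have "hom_space K A Q ?N = ?H\<langle>{f \<in> carrier ?H. ?p f = \<zero>\<^bsub>?G\<^esub>}\<rangle>"
  using c by (simp add: hom_space_def)
 moreover have "?G\<langle>?p ` carrier ?H\<rangle> = ?G" unfolding im by (simp del: hom_space_simps)
 ultimately show ?thesis
  using rank_nullity[OF H G pl hom_space_fin[OF Qm N Qfin fin]] by (simp only:)
qed

lemma hom_dim:
 assumes Q: "projective_rmod K A Q" and Qfin: "findim Q"
  and N: "rmodule N" and fin: "findim N"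
 shows "vdim (hom_space K A Q N) = (\<Sum>s\<in>S. vdim (hom_space K A Q (simple s)) *
  vdim (N\<langle>(\<lambda>m. ract N m (e s)) ` carrier N\<rangle>))"
 using N fin
proof (induction rule: fd_induct)
 case (zero N)
 have Qm: "rmodule Q" using Q by (simp add: projective_rmod_def)
 note r = rmodD[OF zero(1)]
 have "f = \<zero>\<^bsub>hom_space K A Q N\<^esub>" if f: "f <: (hom_space K A Q N)" for f
  by (rule extensionalityI[where A="carrier Q"]) (use f homD(3)[of f Q N] zero(3) in auto)
 then have "carrier (hom_space K A Q N) = {\<zero>\<^bsub>hom_space K A Q N\<^esub>}" using vs_zero[OF hom_space_vs[OF Qm zero(1)]] by blast
 then have 1: "vdim (hom_space K A Q N) = 0" by (rule dim_zero(2)[OF hom_space_vs[OF Qm zero(1)]])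
 have 2: "vdim (N\<langle>(\<lambda>m. ract N m (e s)) ` carrier N\<rangle>) = 0" if "s \<in> S" for s
 proof -
  have "(\<lambda>m. ract N m (e s)) ` carrier N = {\<zero>\<^bsub>N\<^esub>}" using zero(3) r(9)[OF e_mem[OF that]] by simp
  then show ?thesis using dim_zero(2)[OF sub_vs[OF sub_zero[OF r(1)]]] by simp
 qed
 show ?case using 1 2 by simp
next
 case (step N s h n)
 let ?N = "N\<langle>{x \<in> carrier N. h x = \<zero>}\<rangle>"
 let ?q = "\<lambda>s. vdim (hom_space K A Q (simple s))"
 let ?d = "\<lambda>t. vdim (?N\<langle>(\<lambda>m. ract ?N m (e t)) ` carrier ?N\<rangle>)"
 have "(\<Sum>t\<in>S. ?q t * vdim (N\<langle>(\<lambda>m. ract N m (e t)) ` carrier N\<rangle>))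
  = (\<Sum>t\<in>S. ?q t * ?d t + (if s = t then ?q t else 0))"
  by (rule sum.cong[OF refl]) (simp only: idem_dim_step[OF step(1-3) _ step(4-6)], simp add: algebra_simps)
 also have "\<dots> = (\<Sum>t\<in>S. ?q t * ?d t) + ?q s" using fin_S step(3) by (simp add: sum.distrib)
 finally show ?case using hom_dim_step[OF Q Qfin step(1-6)] step(9) by simp
qed

text \<open>This is \<open>hom_dim\<close> for the test module N = D(A e_t): its left side is dim Q
  e_t, and dim N e_s = dim e_s A e_t by duality.\<close>

lemma projective_idem_dim:
 assumes Q: "projective_rmod K A Q" and Qfin: "findim Q" and t: "t \<in> S"
 shows "vdim (Q\<langle>(\<lambda>m. ract Q m (e t)) ` carrier Q\<rangle>)
  = (\<Sum>s\<in>S. vdim (hom_space K A Q (simple s)) * corner (e s) (e t))"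
proof -
 have Qm: "rmodule Q" using Q by (simp add: projective_rmod_def)
 note et = e_mem[OF t] e_idem[OF t]
 note L = left_principal_module(1)[OF et(1)] left_principal_module(2)[OF et(1) fin_A]
 have "vdim (Q\<langle>(\<lambda>m. ract Q m (e t)) ` carrier Q\<rangle>)
  = vdim (hom_space K A Q (dual_rmod (left_principal (e t))))"
  using hom_dual_principal_dim[OF Qm Qfin et] by simp
 also have "\<dots> = (\<Sum>s\<in>S. vdim (hom_space K A Q (simple s)) *
  vdim ((dual_rmod (left_principal (e t)))\<langle>(\<lambda>m. ract (dual_rmod (left_principal (e t))) m (e s)) ` carrier (dual_rmod (left_principal (e t)))\<rangle>))"
  by (rule hom_dim[OF Q Qfin dual_module[OF L(1)] dual_fin(1)[OF lmodD(1)[OF L(1)] L(2)]])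
 also have "\<dots> = (\<Sum>s\<in>S. vdim (hom_space K A Q (simple s)) * corner (e s) (e t))"
  by (rule sum.cong[OF refl]) (simp only: dual_idem_dim[OF L e_mem e_idem] corner_left[OF e_mem et(1) fin_A])
 finally show ?thesis .
qed

text \<open>The number x_s of the overview: the multiplicity of e_s A in the alternating sum of the
  terms of Q.\<close>

definition mult :: "(nat \<Rightarrow> ('k, 'p, 'a) rmod) \<Rightarrow> nat \<Rightarrow> 's \<Rightarrow> int" where
 "mult Q L s = (\<Sum>l\<le>L. (-1) ^ l * int (vdim (hom_space K A (Q l) (simple s))))"

lemma mult_sum:
 "(\<Sum>l\<le>L. (-1) ^ l * int (\<Sum>s\<in>S. vdim (hom_space K A (Q l) (simple s)) * d s)) = (\<Sum>s\<in>S. mult Q L s * int (d s))"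
 unfolding mult_def of_nat_sum of_nat_mult sum_distrib_left sum_distrib_right mult.assoc[symmetric]
 by (rule sum.swap)

lemma ext_euler_mult:
 assumes M: "rmodule (M :: ('k, 'm, 'a) rmod)" and N: "rmodule (N :: ('k, 'n, 'a) rmod)"
  and Nfin: "findim N" and Q: "fin_resolution M Q d' \<epsilon>' L"
  and ex: "\<exists>P d \<epsilon>. projective_resolution K A M (P :: nat \<Rightarrow> ('k, 'm \<times> 'a list \<Rightarrow> 'a, 'a) rmod) d \<epsilon>"
 shows "has_euler_characteristic K (\<lambda>l. Ext K A M N l)
   (\<Sum>s\<in>S. mult Q L s * int (vdim (N\<langle>(\<lambda>m. ract N m (e s)) ` carrier N\<rangle>)))"
 using ext_euler[OF M N Nfin Q ex]
 unfolding hom_dim[OF fin_resolutionD(4,5)[OF Q] N Nfin] mult_sum .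

text \<open>\<open>hom_dim\<close> is applied to the dual of N, where multiplication by e_s turns
  back into e_s N. The resulting formula also shows that the tensor products vanish above L, as the
  Hom spaces do.\<close>

lemma tor_euler_mult:
 assumes M: "rmodule (M :: ('k, 'm, 'a) rmod)" and N: "left_module K A (N :: ('k, 'n, 'a) lmod)"
  and Nfin: "findim N" and Q: "fin_resolution M Q d' \<epsilon>' L"
  and ex: "\<exists>P d \<epsilon>. projective_resolution K A M (P :: nat \<Rightarrow> ('k, 'm \<times> 'a list \<Rightarrow> 'a, 'a) rmod) d \<epsilon>"
 shows "has_euler_characteristic K (\<lambda>l. Tor K A M N l)
   (\<Sum>s\<in>S. mult Q L s * int (vdim (N\<langle>(\<lambda>m. lact N (e s) m) ` carrier N\<rangle>)))"
proof -
 note qq = fin_resolutionD[OF Q]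
 note D = dual_module[OF N] dual_fin(1)[OF lmodD(1)[OF N] Nfin]
 have t: "vdim (tensor K A (Q l) N) = (\<Sum>s\<in>S. vdim (hom_space K A (Q l) (simple s)) *
   vdim (N\<langle>(\<lambda>m. lact N (e s) m) ` carrier N\<rangle>))" for l
  unfolding tensor_dual_dim[OF qq(3) N qq(5) Nfin] hom_dim[OF qq(4,5) D]
  by (rule sum.cong[OF refl]) (simp only: dual_idem_dim[OF N Nfin e_mem e_idem])
 have z: "vdim (tensor K A (Q l) N) = 0" if l: "l > L" for l
  unfolding t
 proof (rule sum.neutral, rule ballI)
  fix s assume s: "s \<in> S"
  note H = hom_space_vs[OF qq(3) simple_module(1)[OF s]]
  have "f = \<zero>\<^bsub>hom_space K A (Q l) (simple s)\<^esub>" if f: "f <: (hom_space K A (Q l) (simple s))" for f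
   by (rule extensionalityI[where A="carrier (Q l)"])
    (use f hom_z[OF qq(3) simple_module(1)[OF s], of f l] qq(6)[OF l] in auto)
  then have "carrier (hom_space K A (Q l) (simple s)) = {\<zero>\<^bsub>hom_space K A (Q l) (simple s)\<^esub>}" using vs_zero[OF H] by blast
  from dim_zero(2)[OF H this]
  show "vdim (hom_space K A (Q l) (simple s)) *
   vdim (N\<langle>(\<lambda>m. lact N (e s) m) ` carrier N\<rangle>) = 0" by simp
 qed
 show ?thesis using tor_euler[OF M N Nfin Q z ex] unfolding t mult_sum .
qed

text \<open>Multiplying the resolution by e_t from the right keeps it exact, so it is a complex of
  finite dimensional spaces whose homology is M e_t in degree 0. Counting dimensions gives dim M e_t
  as the alternating sum of the dim Q_l e_t, which \<open>projective_idem_dim\<close>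
  evaluates.\<close>

lemma dim_mult:
 assumes M: "rmodule M" and Mfin: "findim M" and Q: "fin_resolution M Q d \<epsilon> L" and t: "t \<in> S"
 shows "int (vdim (M\<langle>(\<lambda>m. ract M m (e t)) ` carrier M\<rangle>))
  = (\<Sum>s\<in>S. mult Q L s * int (corner (e s) (e t)))"
proof -
 note qq = fin_resolutionD[OF Q] note q = resolvesD[OF qq(2)]
 note et = e_mem[OF t] e_idem[OF t]
 let ?i = "\<lambda>X. (\<lambda>m. ract X m (e t)) ` carrier X"
 have stab: "y \<in> ?i X \<longleftrightarrow> y <: X \<and> ract X y (e t) = y" if "rmodule X" for X :: "('k, 'u, 'a) rmod" and y
  using rmodD(2,7)[OF that] et by (auto intro: image_eqI[where x=y])
 have rl: "f \<in> lin K (X\<langle>?i X\<rangle>) (Y\<langle>?i Y\<rangle>)" if X: "rmodule X" and f: "f \<in> rhom X Y"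
  for X :: "('k, 'u, 'a) rmod" and Y :: "('k, 'v, 'a) rmod" and f
  by (rule lin_sub[OF homD(1)[OF f] idem_image[OF X et(1)]]) (use homD(2,3)[OF f] et in auto)
 \<comment> \<open>Exactness of X \<mapsto> X e: an element of the image that e fixes has a fixed
   preimage, namely x e for an arbitrary preimage x.\<close>
 have im: "f ` ?i X = {y \<in> carrier Y. ract Y y (e t) = y \<and> y \<in> f ` carrier X}"
  if X: "rmodule X" and Y: "rmodule Y" and f: "f \<in> rhom X Y"
  for X :: "('k, 'u, 'a) rmod" and Y :: "('k, 'v, 'a) rmod" and f
 proof (rule Set.set_eqI, rule iffI)
  fix y assume "y \<in> f ` ?i X"
  then obtain x where x: "x <: X" "ract X x (e t) = x" "y = f x" using stab[OF X] by auto
  then show "y \<in> {y \<in> carrier Y. ract Y y (e t) = y \<and> y \<in> f ` carrier X}"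
   using homD(2)[OF f x(1) et(1)] homD(3)[OF f x(1)] by auto
 next
  fix y assume "y \<in> {y \<in> carrier Y. ract Y y (e t) = y \<and> y \<in> f ` carrier X}"
  then obtain x where x: "x <: X" "y = f x" "ract Y y (e t) = y" by auto
  then have "y = f (ract X x (e t))" using homD(2)[OF f x(1) et(1)] by simp
  then show "y \<in> f ` ?i X" using x(1) by blast
 qed
 let ?c = "\<lambda>l. vdim ((Q l)\<langle>?i (Q l)\<rangle>)"
 define r where "r l = vdim ((Q l)\<langle>d l ` ?i (Q (Suc l))\<rangle>)" for l
 have V: "vectorspace K ((Q l)\<langle>?i (Q l)\<rangle>)" and F: "findim ((Q l)\<langle>?i (Q l)\<rangle>)" for l
  using sub_vs[OF idem_image[OF q(1) et(1)]] sub_fin[OF idem_image[OF q(1) et(1)] qq(5)] by auto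
 have MV: "vectorspace K (M\<langle>?i M\<rangle>)" using sub_vs[OF idem_image[OF M et(1)]] .
 have c0: "?c 0 = vdim (M\<langle>?i M\<rangle>) + r 0"
 proof -
  have "\<epsilon> ` ?i (Q 0) = ?i M" unfolding im[OF q(1) M q(3)] using stab[OF M] q(4) by auto
  moreover have "{x \<in> ?i (Q 0). \<epsilon> x = \<zero>\<^bsub>M\<^esub>} = d 0 ` ?i (Q (Suc 0))"
   unfolding im[OF q(1) q(1) q(2)] using stab[OF q(1), of _ 0] q(5,6) by auto
  ultimately show ?thesis using rank_nullity[OF V MV rl[OF q(1) q(3)] F] by (simp add: r_def)
 qed
 have cS: "?c (Suc l) = r l + r (Suc l)" for l
 proof -
  have "{x \<in> ?i (Q (Suc l)). d l x = \<zero>\<^bsub>Q l\<^esub>} = d (Suc l) ` ?i (Q (Suc (Suc l)))"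
   unfolding im[OF q(1) q(1) q(2)] using stab[OF q(1), of _ "Suc l"] q(7,8) by auto
  then show ?thesis using rank_nullity[OF V[of "Suc l"] V[of l] rl[OF q(1) q(2)] F[of "Suc l"]] by (simp add: r_def)
 qed
 \<comment> \<open>The homology of the complex Q e_t, concentrated in degree 0.\<close>
 define h where "h l = (if l = 0 then vdim (M\<langle>?i M\<rangle>) else 0)" for l :: nat
 have z: "?c l = 0" if l: "l > L" for l
 proof -
  have "?i (Q l) = {\<zero>\<^bsub>Q l\<^esub>}" using qq(6)[OF l] rmodD(9)[OF q(1) et(1)] by simp
  then show ?thesis using dim_zero(2)[OF sub_vs[OF sub_zero[OF rmodD(1)[OF q(1)]]]] by simp
 qed
 have "(\<lambda>l. (-1) ^ l * int (h l)) sums (\<Sum>l\<le>L. (-1) ^ l * int (?c l))"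
  by (rule euler_sums[where r=r, OF _ z]) (auto simp: h_def c0 cS split: nat.splits)
 moreover have "(\<lambda>l. (-1) ^ l * int (h l)) sums int (h 0)"
  using sums_finite[of "{0::nat}" "\<lambda>l. (-1) ^ l * int (h l)"] by (simp add: h_def)
 ultimately have "int (h 0) = (\<Sum>l\<le>L. (-1) ^ l * int (?c l))" by (rule sums_unique2[symmetric])
 then show ?thesis unfolding projective_idem_dim[OF qq(4,5) t] mult_sum by (simp add: h_def)
qed

end

section \<open>Elementary algebras\<close>

text \<open>\<open>RDirProd_list\<close> is built recursively from binary products; induction on m
  through \<open>RDirProd_list_hom1\<close> brings its operations down to the components.\<close>

lemma dir_prod_list:
 fixes K :: "('k, 'x) ring_scheme"
 defines "D m \<equiv> RDirProd_list (replicate m K)"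
 shows "xs <: (D m) \<longleftrightarrow> length xs = m \<and> (\<forall>t<m. xs ! t <: K)"
  and "xs <: (D m) ==> ys <: (D m) ==> t < m ==> (xs \<otimes>\<^bsub>D m\<^esub> ys) ! t = xs ! t \<otimes>\<^bsub>K\<^esub> ys ! t"
  and "xs <: (D m) ==> ys <: (D m) ==> t < m ==> (xs \<oplus>\<^bsub>D m\<^esub> ys) ! t = xs ! t \<oplus>\<^bsub>K\<^esub> ys ! t"
  and "t < m ==> \<one>\<^bsub>D m\<^esub> ! t = \<one>\<^bsub>K\<^esub>" "\<zero>\<^bsub>D m\<^esub> = replicate m \<zero>\<^bsub>K\<^esub>"
proof -
 show c: "xs <: (D m) \<longleftrightarrow> length xs = m \<and> (\<forall>t<m. xs ! t <: K)" for xs m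
  unfolding D_def using RDirProd_list_carrier_mem[of xs "replicate m K"] RDirProd_list_carrier_memI[of xs "replicate m K"] by auto
 note h = RDirProd_list_hom1[of K "replicate m K" for m, folded replicate_Suc, folded D_def]
 have cons: "(a, as) <: (RDirProd K (D m))" if "a # as <: (D (Suc m))" for a as m
 proof -
  have l: "length as = m" and k: "\<And>t. t < Suc m ==> (a # as) ! t <: K" using that c by auto
  have "a <: K" "as ! t <: K" if "t < m" for t using k[of 0] k[of "Suc t"] that by auto
  then show ?thesis using l c[of as m] k[of 0] by (simp add: RDirProd_carrier)
 qed
 have cs: "as <: (D m)" if "a # as <: (D (Suc m))" for a as m
  using cons[OF that] by (simp add: RDirProd_carrier)
 show "(xs \<otimes>\<^bsub>D m\<^esub> ys) ! t = xs ! t \<otimes>\<^bsub>K\<^esub> ys ! t" if "xs <: (D m)" "ys <: (D m)" "t < m" for xs ys t m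
  using that
 proof (induction m arbitrary: xs ys t)
  case (Suc m)
  obtain a as b bs where e: "xs = a # as" "ys = b # bs" using Suc.prems c by (metis length_Suc_conv)
  have "(a # as) \<otimes>\<^bsub>D (Suc m)\<^esub> (b # bs) = (a \<otimes>\<^bsub>K\<^esub> b) # (as \<otimes>\<^bsub>D m\<^esub> bs)"
   using ring_hom_mult[OF h cons cons] Suc.prems(1,2) unfolding e by (auto simp: RDirProd_def DirProd_def monoid.defs)
  then show ?case using Suc.IH[OF cs cs, of a as b bs "t - 1"] Suc.prems unfolding e by (cases t) auto
 qed simp
 show "(xs \<oplus>\<^bsub>D m\<^esub> ys) ! t = xs ! t \<oplus>\<^bsub>K\<^esub> ys ! t" if "xs <: (D m)" "ys <: (D m)" "t < m" for xs ys t m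
  using that
 proof (induction m arbitrary: xs ys t)
  case (Suc m)
  obtain a as b bs where e: "xs = a # as" "ys = b # bs" using Suc.prems c by (metis length_Suc_conv)
  have "(a # as) \<oplus>\<^bsub>D (Suc m)\<^esub> (b # bs) = (a \<oplus>\<^bsub>K\<^esub> b) # (as \<oplus>\<^bsub>D m\<^esub> bs)"
   using ring_hom_add[OF h cons cons] Suc.prems(1,2) unfolding e by (auto simp: RDirProd_def DirProd_def monoid.defs)
  then show ?case using Suc.IH[OF cs cs, of a as b bs "t - 1"] Suc.prems unfolding e by (cases t) auto
 qed simp
 show "\<zero>\<^bsub>D m\<^esub> = replicate m \<zero>\<^bsub>K\<^esub>" unfolding D_def RDirProd_list_zero by (induction m) auto
 have "\<one>\<^bsub>D m\<^esub> = replicate m \<one>\<^bsub>K\<^esub>" unfolding D_def RDirProd_list_one by (induction m) auto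
 then show "t < m ==> \<one>\<^bsub>D m\<^esub> ! t = \<one>\<^bsub>K\<^esub>" by simp
qed

context alg_over
begin

text \<open>Right ideals as subspaces, that is, as submodules of the regular module, so that
  dimension arguments apply. \<open>right_ideal_iff\<close> identifies them with the ring theoretic
  notion.\<close>

definition rideal :: "'a set \<Rightarrow> bool" where
 "rideal I \<longleftrightarrow> sspace K I A \<and> (\<forall>x\<in>I. \<forall>a\<in>carrier A. x \<otimes>\<^bsub>A\<^esub> a \<in> I)"

lemma regular_module: "rmodule (as_rmod A (monoid.mult A))"
 by (rule rmodI[OF vs_cong[OF alg_simps(1)]]) (simp_all add: alg_rules)

lemma rideal_submod: "rideal I \<longleftrightarrow> submod (as_rmod A (monoid.mult A)) I"
proof -
 have "sspace K I (as_rmod A (monoid.mult A))" if I: "sspace K I A"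
  using subD(2-5)[OF I] by (intro subI[OF rmodD(1)[OF regular_module]]) simp_all
 moreover have "sspace K I A" if I: "sspace K I (as_rmod A (monoid.mult A))"
  using subD(2-5)[OF I] by (intro subI[OF alg_simps(1)]) simp_all
 ultimately have "sspace K I A \<longleftrightarrow> sspace K I (as_rmod A (monoid.mult A))" by blast
 then show ?thesis by (simp add: rideal_def submod_def regular_module)
qed

text \<open>Closure under scalars is automatic, as c x = x (c 1).\<close>

lemma right_ideal_iff: "right_ideal A I \<longleftrightarrow> rideal I"
proof
 interpret R: ring A by (rule alg_simps)
 assume r: "right_ideal A I"
 then interpret I: additive_subgroup I A by (simp add: right_ideal_def)
 have m: "x \<otimes>\<^bsub>A\<^esub> a \<in> I" if "x \<in> I" "a <: A" for x a using r that by (simp add: right_ideal_def)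
 have "c \<odot>\<^bsub>A\<^esub> x \<in> I" if "c <: K" "x \<in> I" for c x
  using m[OF that(2), of "c \<odot>\<^bsub>A\<^esub> \<one>\<^bsub>A\<^esub>"] that I.a_subset by auto
 then show "rideal I" unfolding rideal_def using m I.a_subset I.zero_closed I.a_closed
  by (auto intro!: subI[OF alg_simps(1)])
next
 interpret R: ring A by (rule alg_simps)
 assume r: "rideal I"
 then have s: "sspace K I A" by (simp add: rideal_def)
 have "\<ominus>\<^bsub>A\<^esub> x \<in> I" if "x \<in> I" for x
  using subD(5)[OF s _ that, of "\<ominus> \<one>"] subD(6)[OF s that] vs_minus[OF alg_simps(1)] by simp
 then have "additive_subgroup I A"
  using subD[OF s] by (intro additive_subgroup.intro R.add.subgroupI) (auto simp: a_inv_def)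
 then show "right_ideal A I" using r by (simp add: right_ideal_def rideal_def)
qed

lemma rideal_annihilator:
 assumes I: "rideal I" and a: "a <: A"
 shows "rideal {y \<in> carrier A. a \<otimes>\<^bsub>A\<^esub> y \<in> I}"
proof -
 have s: "sspace K I A" "\<And>x b. x \<in> I ==> b <: A ==> x \<otimes>\<^bsub>A\<^esub> b \<in> I" using I by (auto simp: rideal_def)
 have "sspace K {y \<in> carrier A. a \<otimes>\<^bsub>A\<^esub> y \<in> I} A"
  using subD(3-5)[OF s(1)] a by (intro subI[OF alg_simps(1)]) (simp_all add: alg_r_distr)
 then show ?thesis unfolding rideal_def using s(2) a by (simp add: alg_assoc[symmetric])
qed

lemma maximal_contains:
 assumes I: "rideal I" "\<one>\<^bsub>A\<^esub> \<notin> I" and fin: "findim A"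
 obtains W where "maximal_right_ideal A W" "I \<subseteq> W"
proof -
 let ?R = "as_rmod A (monoid.mult A)"
 have f: "findim ?R" using dim_cong(1)[OF alg_simps(1), of ?R] fin by simp
 have "I \<noteq> carrier ?R" using I(2) by auto
 from submod_maximal[OF regular_module f I(1)[unfolded rideal_submod] this] obtain W where
  "submod ?R W" "I \<subseteq> W" "W \<noteq> carrier ?R" "\<And>W'. submod ?R W' ==> W \<subseteq> W' ==> W' = W \<or> W' = carrier ?R" by metis
 then show thesis using that[of W] by (auto simp: maximal_right_ideal_def right_ideal_iff rideal_submod)
qed

text \<open>The radical is defined through right ideals; the point is closure under left
  multiplication by a. If a x lay outside a maximal right ideal I, the right ideal of all y with a y
  in I would again be maximal, because A modulo it embeds into the simple module A/I, and so it
  would contain x.\<close>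

lemma jacobson_ideal: "ideal (jacobson_radical A) A"
proof -
 interpret R: ring A by (rule alg_simps)
 let ?R = "as_rmod A (monoid.mult A)"
 have mx: "rideal I" "I \<noteq> carrier A" "\<And>J. rideal J ==> I \<subseteq> J ==> J = I \<or> J = carrier A"
  if "maximal_right_ideal A I" for I
  using that by (auto simp: maximal_right_ideal_def right_ideal_iff)
 have Js: "sspace K (jacobson_radical A) A"
 proof (intro subI[OF alg_simps(1)])
  have I: "sspace K I A" if "maximal_right_ideal A I" for I using mx(1)[OF that] by (simp add: rideal_def)
  show "\<zero>\<^bsub>A\<^esub> \<in> jacobson_radical A" using subD(3)[OF I] by (simp add: jacobson_radical_def)
  show "x \<oplus>\<^bsub>A\<^esub> y \<in> jacobson_radical A" if "x \<in> jacobson_radical A" "y \<in> jacobson_radical A" for x y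
   using that subD(4)[OF I] by (simp add: jacobson_radical_def)
  show "c \<odot>\<^bsub>A\<^esub> x \<in> jacobson_radical A" if "c <: K" "x \<in> jacobson_radical A" for c x
   using that subD(5)[OF I] by (simp add: jacobson_radical_def)
 qed (auto simp: jacobson_radical_def)
 have J: "rideal (jacobson_radical A)"
  unfolding rideal_def using Js mx(1) by (auto simp: jacobson_radical_def rideal_def)
 have left: "a \<otimes>\<^bsub>A\<^esub> x \<in> jacobson_radical A" if x: "x \<in> jacobson_radical A" and a: "a <: A" for x a
 proof -
  have xA: "x <: A" using subD(6)[OF Js x] .
  have "a \<otimes>\<^bsub>A\<^esub> x \<in> I" if I: "maximal_right_ideal A I" for I
  proof (rule ccontr)
   assume n: "a \<otimes>\<^bsub>A\<^esub> x \<notin> I"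
   let ?Ia = "{y \<in> carrier A. a \<otimes>\<^bsub>A\<^esub> y \<in> I}"
   note Ia = rideal_annihilator[OF mx(1)[OF I] a]
   have "J = ?Ia \<or> J = carrier A" if J: "rideal J" "?Ia \<subseteq> J" for J
   proof (rule ccontr)
    assume c: "\<not> (J = ?Ia \<or> J = carrier A)"
    have Js: "sspace K J A" using J by (simp add: rideal_def)
    \<comment> \<open>Since I + a z A is everything, a y = w + a z b for any y, with w in I; then y
      - z b lies in the smaller ideal, which J contains, and z b lies in J.\<close>
    obtain z where z: "z \<in> J" "z <: A" "a \<otimes>\<^bsub>A\<^esub> z \<notin> I" using c J(2) subD(6)[OF Js] by blast
    have az: "a \<otimes>\<^bsub>A\<^esub> z <: ?R" using a z by simp
    note cy = submod_add_cyclic[OF mx(1)[OF I, unfolded rideal_submod] az]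
    have full: "{w \<oplus>\<^bsub>?R\<^esub> ract ?R (a \<otimes>\<^bsub>A\<^esub> z) b | w b. w \<in> I \<and> b <: A} = carrier A"
     using mx(3)[OF I cy(1)[folded rideal_submod] cy(2)] cy(3) z(3) by blast
    have "y \<in> J" if y: "y <: A" for y
    proof -
     have "a \<otimes>\<^bsub>A\<^esub> y <: A" using a y by simp
     then obtain w b where wb: "w \<in> I" "b <: A" "a \<otimes>\<^bsub>A\<^esub> y = w \<oplus>\<^bsub>A\<^esub> a \<otimes>\<^bsub>A\<^esub> z \<otimes>\<^bsub>A\<^esub> b"
      using full by fastforce
     have wA: "w <: A" using wb(1) mx(1)[OF I] subD(6) by (auto simp: rideal_def)
     have "a \<otimes>\<^bsub>A\<^esub> (y \<ominus>\<^bsub>A\<^esub> z \<otimes>\<^bsub>A\<^esub> b) = a \<otimes>\<^bsub>A\<^esub> y \<ominus>\<^bsub>A\<^esub> a \<otimes>\<^bsub>A\<^esub> z \<otimes>\<^bsub>A\<^esub> b"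
      using a y z wb(2) by (simp add: R.m_assoc R.r_distr R.minus_eq R.r_minus)
     also have "\<dots> = w" unfolding wb(3) using wA a z wb(2)
      by (simp add: R.minus_eq R.add.m_assoc R.r_neg)
     finally have "y \<ominus>\<^bsub>A\<^esub> z \<otimes>\<^bsub>A\<^esub> b \<in> J" using J(2) wb(1,2) y z by auto
     moreover have "z \<otimes>\<^bsub>A\<^esub> b \<in> J" using J(1) z wb(2) by (auto simp: rideal_def)
     ultimately have "(y \<ominus>\<^bsub>A\<^esub> z \<otimes>\<^bsub>A\<^esub> b) \<oplus>\<^bsub>A\<^esub> z \<otimes>\<^bsub>A\<^esub> b \<in> J" using subD(4)[OF Js] by blast
     then show ?thesis using y z wb(2) by (simp add: R.minus_eq R.add.m_assoc R.l_neg)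
    qed
    then show False using c subD(6)[OF Js] by blast
   qed
   moreover have "?Ia \<noteq> carrier A" using n xA by blast
   ultimately have "maximal_right_ideal A ?Ia" using Ia by (simp add: maximal_right_ideal_def right_ideal_iff)
   then show False using x n by (auto simp: jacobson_radical_def)
  qed
  then show ?thesis using a xA by (auto simp: jacobson_radical_def)
 qed
 have "additive_subgroup (jacobson_radical A) A" using J[folded right_ideal_iff] by (simp add: right_ideal_def)
 then show ?thesis
  using left J by (intro idealI[OF alg_simps(2)]) (auto simp: rideal_def additive_subgroup_def)
qed

text \<open>The characters are the coordinates of A \<rightarrow> A/rad \<rightarrow> k^m. For the
  last property, suppose that no character kills I: elements of I can then be combined into a z in I
  at which all characters are 1. So 1 - z lies in the radical, and 1 lies in every maximal right
  ideal above I.\<close>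

lemma elementary_characters:
 assumes el: "elementary K A" and fin: "findim A"
 obtains m :: nat and \<chi> :: "nat \<Rightarrow> 'a \<Rightarrow> 'k" where "\<And>t. t < m ==> \<chi> t \<in> lin K A scal"
  "\<And>t x y. t < m ==> x <: A ==> y <: A ==> \<chi> t (x \<otimes>\<^bsub>A\<^esub> y) = \<chi> t x \<otimes> \<chi> t y"
  "\<And>t. t < m ==> \<chi> t \<one>\<^bsub>A\<^esub> = \<one>"
  "\<And>t. t < m ==> \<exists>u\<in>carrier A. \<forall>s<m. \<chi> s u = (if s = t then \<one> else \<zero>)"
  "\<And>I. rideal I ==> \<one>\<^bsub>A\<^esub> \<notin> I ==> \<exists>t<m. \<forall>x\<in>I. \<chi> t x = \<zero>"
proof -
 interpret R: ring A by (rule alg_simps)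
 interpret J: ideal "jacobson_radical A" A by (rule jacobson_ideal)
 let ?J = "jacobson_radical A" and ?D = "\<lambda>m. RDirProd_list (replicate m K)"
 obtain m \<phi> where \<phi>: "\<phi> \<in> ring_iso (A Quot ?J) (?D m)"
  and \<phi>s: "\<And>c x. c <: K ==> x <: A ==> \<phi> (?J +>\<^bsub>A\<^esub> (c \<odot>\<^bsub>A\<^esub> x)) = map (\<lambda>y. c \<otimes> y) (\<phi> (?J +>\<^bsub>A\<^esub> x))"
  using el unfolding elementary_def by blast
 define \<psi> where "\<psi> x = \<phi> (?J +>\<^bsub>A\<^esub> x)" for x
 have h: "\<psi> \<in> Ring.ring_hom A (?D m)"
  using ring_hom_trans[OF J.rcos_ring_hom, of \<phi> "?D m"] \<phi> by (simp add: ring_iso_def comp_def \<psi>_def[abs_def])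
 note D = dir_prod_list[where K=K]
 have \<psi>c: "\<psi> x <: (?D m)" if "x <: A" for x using ring_hom_closed[OF h that] .
 have \<psi>l: "length (\<psi> x) = m" "t < m ==> \<psi> x ! t <: K" if "x <: A" for x t
  using \<psi>c[OF that] D(1) by auto
 have lin: "(\<lambda>x. \<psi> x ! t) \<in> lin K A scal" if t: "t < m" for t
 proof (rule linI)
  show "\<psi> (x \<oplus>\<^bsub>A\<^esub> y) ! t = \<psi> x ! t \<oplus>\<^bsub>scal\<^esub> \<psi> y ! t" if "x <: A" "y <: A" for x y
   using D(3)[OF \<psi>c \<psi>c t] ring_hom_add[OF h] that by simp
  show "\<psi> (c \<odot>\<^bsub>A\<^esub> x) ! t = c \<odot>\<^bsub>scal\<^esub> \<psi> x ! t" if "x <: A" "c <: K" for x c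
   using \<phi>s that t \<psi>l(1) by (simp add: \<psi>_def)
 qed (use \<psi>l t in simp_all)
 have mult: "\<psi> (x \<otimes>\<^bsub>A\<^esub> y) ! t = \<psi> x ! t \<otimes> \<psi> y ! t" if "t < m" "x <: A" "y <: A" for t x y
  using D(2)[OF \<psi>c \<psi>c that(1)] ring_hom_mult[OF h] that by simp
 have one: "\<psi> \<one>\<^bsub>A\<^esub> ! t = \<one>" if "t < m" for t
  using D(4)[OF that] ring_hom_one[OF h] by simp
 have surj: "\<exists>u\<in>carrier A. \<forall>s<m. \<psi> u ! s = (if s = t then \<one> else \<zero>)" for t
 proof -
  let ?y = "map (\<lambda>s. if s = t then \<one> else \<zero>) [0..<m]"
  have "?y <: (?D m)" using D(1) by auto
  moreover have "\<phi> ` carrier (A Quot ?J) = carrier (?D m)" using \<phi> by (simp add: ring_iso_def bij_betw_def)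
  ultimately obtain X where X: "X <: (A Quot ?J)" "\<phi> X = ?y" by (metis (no_types, lifting) imageE)
  then obtain u where "u <: A" "X = ?J +>\<^bsub>A\<^esub> u" by (auto simp: FactRing_def A_RCOSETS_def')
  then show ?thesis using X(2) by (auto simp: \<psi>_def intro!: bexI[of _ u])
 qed
 have ker: "x \<in> ?J" if x: "x <: A" "\<And>t. t < m ==> \<psi> x ! t = \<zero>" for x
 proof -
  have "\<psi> x = \<psi> \<zero>\<^bsub>A\<^esub>"
  proof (rule nth_equalityI)
   show "\<psi> x ! t = \<psi> \<zero>\<^bsub>A\<^esub> ! t" if "t < length (\<psi> x)" for t
    using that x \<psi>l(1)[OF x(1)] lin_zero[OF alg_simps(1) scal_vs lin[of t]] by simp
  qed (use \<psi>l(1) x in simp)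
  then have "?J +>\<^bsub>A\<^esub> x = ?J +>\<^bsub>A\<^esub> \<zero>\<^bsub>A\<^esub>"
   using \<phi> x(1) unfolding \<psi>_def ring_iso_def bij_betw_def inj_on_def by (auto simp: FactRing_def A_RCOSETS_def')
  then show ?thesis using J.a_rcos_self[OF x(1)] J.a_subset by (simp add: R.a_coset_add_zero)
 qed
 show thesis
 proof (rule that[of m "\<lambda>t x. \<psi> x ! t"])
  fix I assume I: "rideal I" "\<one>\<^bsub>A\<^esub> \<notin> I"
  have Is: "sspace K I A" and Im: "\<And>x b. x \<in> I ==> b <: A ==> x \<otimes>\<^bsub>A\<^esub> b \<in> I" using I by (auto simp: rideal_def)
  show "\<exists>t<m. \<forall>x\<in>I. \<psi> x ! t = \<zero>"
  proof (rule ccontr)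
   assume "\<not> ?thesis"
   then have "\<forall>t. \<exists>x. t < m \<longrightarrow> x \<in> I \<and> \<psi> x ! t \<noteq> \<zero>" by blast
   then obtain a where a: "\<And>t. t < m ==> a t \<in> I" "\<And>t. t < m ==> \<psi> (a t) ! t \<noteq> \<zero>" by metis
   from surj obtain u where u: "\<And>t. u t <: A" "\<And>s t. s < m ==> \<psi> (u t) ! s = (if s = t then \<one> else \<zero>)" by metis
   have aA: "a t <: A" if "t < m" for t using subD(6)[OF Is a(1)[OF that]] .
   \<comment> \<open>The summand for t has value 1 under the t-th character and 0 under the others:
     u t separates the characters, and the inverse normalises the value at a t.\<close>
   let ?z = "\<Oplus>\<^bsub>A\<^esub> t\<in>{..<m}. inv (\<psi> (a t) ! t) \<odot>\<^bsub>A\<^esub> (a t \<otimes>\<^bsub>A\<^esub> u t)"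
   have k: "\<psi> (a t) ! t \<in> carrier K - {\<zero>}" if "t < m" for t using a(2) \<psi>l(2)[OF aA] that by simp
   have zI: "?z \<in> I"
    using Im a(1) u(1) k subD(5)[OF Is] by (intro sub_finsum[OF Is]) (auto simp: field_Units)
   have "\<psi> ?z ! s = \<one>" if s: "s < m" for s
   proof -
    have "\<psi> ?z ! s = (\<Oplus>\<^bsub>scal\<^esub> t\<in>{..<m}. \<psi> (inv (\<psi> (a t) ! t) \<odot>\<^bsub>A\<^esub> (a t \<otimes>\<^bsub>A\<^esub> u t)) ! s)"
     using aA u(1) k by (intro lin_finsum[OF alg_simps(1) scal_vs lin[OF s]]) (auto simp: field_Units)
    also have "\<dots> = (\<Oplus>\<^bsub>scal\<^esub> t\<in>{..<m}. (if s = t then \<one> else \<zero>) \<odot>\<^bsub>scal\<^esub> \<one>)"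
    proof (intro vs_finsum_cong[OF scal_vs] funcsetI)
     fix t assume "t \<in> {..<m}"
     then have t: "t < m" by simp
     have i: "inv (\<psi> (a t) ! t) <: K" using k[OF t] by (simp add: field_Units)
     show "\<psi> (inv (\<psi> (a t) ! t) \<odot>\<^bsub>A\<^esub> (a t \<otimes>\<^bsub>A\<^esub> u t)) ! s = (if s = t then \<one> else \<zero>) \<odot>\<^bsub>scal\<^esub> \<one>"
      using linD(3)[OF lin[OF s] i, of "a t \<otimes>\<^bsub>A\<^esub> u t"] aA[OF t] u(1) u(2)[OF s] mult[OF s aA[OF t] u(1)] k[OF t] i
      by (cases "s = t") (simp_all add: field_Units \<psi>l(2)[OF _ s])
    qed simp_all
    also have "\<dots> = \<one>" by (rule finsum_delta(2)[OF scal_vs]) (use s in simp_all)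
    finally show ?thesis .
   qed
   then have d: "\<one>\<^bsub>A\<^esub> \<ominus>\<^bsub>A\<^esub> ?z \<in> ?J"
    using subD(6)[OF Is zI] one linD(2,3)[OF lin] vs_minus[OF alg_simps(1)]
    by (intro ker) (simp_all add: a_minus_def r_neg l_minus)
   obtain W where W: "maximal_right_ideal A W" "I \<subseteq> W" by (rule maximal_contains[OF I fin])
   have Ws: "sspace K W A" using W(1) by (simp add: maximal_right_ideal_def right_ideal_iff rideal_def)
   have "?J \<subseteq> W" using W(1) by (auto simp: jacobson_radical_def)
   then have "(\<one>\<^bsub>A\<^esub> \<ominus>\<^bsub>A\<^esub> ?z) \<oplus>\<^bsub>A\<^esub> ?z \<in> W"
    using subD(4)[OF Ws subsetD[OF _ d] subsetD[OF W(2) zI]] by blast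
   then have one: "\<one>\<^bsub>A\<^esub> \<in> W" using subD(6)[OF Is zI] by (simp add: R.minus_eq R.add.m_assoc R.l_neg)
   have "W = carrier A"
   proof
    show "carrier A \<subseteq> W"
    proof
     fix x assume "x <: A"
     then show "x \<in> W" using one W(1) by (auto simp: maximal_right_ideal_def right_ideal_def dest: bspec[of _ _ "\<one>\<^bsub>A\<^esub>"])
    qed
   qed (use subD(2)[OF Ws] in simp)
   then show False using W(1) by (simp add: maximal_right_ideal_def)
  qed
 qed (use lin mult one surj in simp_all)
qed

lemma surj_inj:
 assumes V: "vectorspace K V" and f: "f \<in> lin K V V" and fin: "findim V"
  and s: "f ` carrier V = carrier V"
 shows "inj_on f (carrier V)"
proof (rule lin_inj[OF V V f])
 fix x assume x: "x <: V" "f x = \<zero>\<^bsub>V\<^esub>"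
 let ?k = "{x \<in> carrier V. f x = \<zero>\<^bsub>V\<^esub>}"
 note k = lin_ker_sub[OF V V f]
 have "vdim (V\<langle>?k\<rangle>) = 0" using rank_nullity[OF V V f fin] s by simp
 moreover have "vdim ((V\<langle>?k\<rangle>)\<langle>{\<zero>\<^bsub>V\<^esub>}\<rangle>) = 0"
  by (rule dim_zero(2)) (use sub_vs[OF sub_zero[OF V]] in simp_all)
 ultimately have "{\<zero>\<^bsub>V\<^esub>} = ?k"
  using sub_dim(2)[OF sub_trans[OF k sub_zero[OF V]] sub_fin[OF k fin]] lin_zero[OF V V f] V by simp
 then show "x = \<zero>\<^bsub>V\<^esub>" using x by blast
qed

section \<open>Matching the characters with the given primitive idempotents\<close>

context
 fixes m :: nat and \<chi> :: "nat \<Rightarrow> 'a \<Rightarrow> 'k"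
 assumes \<chi>_lin: "\<And>t. t < m ==> \<chi> t \<in> lin K A scal"
  and \<chi>_mult: "\<And>t x y. t < m ==> x <: A ==> y <: A ==> \<chi> t (x \<otimes>\<^bsub>A\<^esub> y) = \<chi> t x \<otimes> \<chi> t y"
  and \<chi>_one: "\<And>t. t < m ==> \<chi> t \<one>\<^bsub>A\<^esub> = \<one>"
  and \<chi>_surj: "\<And>t. t < m ==> \<exists>u\<in>carrier A. \<forall>s<m. \<chi> s u = (if s = t then \<one> else \<zero>)"
  and \<chi>_proper: "\<And>I. rideal I ==> \<one>\<^bsub>A\<^esub> \<notin> I ==> \<exists>t<m. \<forall>x\<in>I. \<chi> t x = \<zero>"
  and fin: "findim A"
begin

text \<open>The elements x with e x = 0 form a right ideal that contains 1 - e but not 1. A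
  character that kills it takes equal values at e and at 1.\<close>

lemma idempotent_character:
 assumes e: "e <: A" "e \<otimes>\<^bsub>A\<^esub> e = e" "e \<noteq> \<zero>\<^bsub>A\<^esub>"
 shows "\<exists>t<m. \<chi> t e = \<one>"
proof -
 interpret R: ring A by (rule alg_simps)
 let ?I = "{x \<in> carrier A. e \<otimes>\<^bsub>A\<^esub> x \<in> {\<zero>\<^bsub>A\<^esub>}}"
 have "rideal {\<zero>\<^bsub>A\<^esub>}" using sub_zero[OF alg_simps(1)] by (simp add: rideal_def)
 then obtain t where t: "t < m" "\<And>x. x \<in> ?I ==> \<chi> t x = \<zero>"
  using \<chi>_proper[OF rideal_annihilator[OF _ e(1)], of "{\<zero>\<^bsub>A\<^esub>}"] e by auto
 have "\<one>\<^bsub>A\<^esub> \<ominus>\<^bsub>A\<^esub> e \<in> ?I" using e by (simp add: R.minus_eq R.r_distr R.r_minus R.r_neg)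
 from t(2)[OF this] have "\<one> \<ominus> \<chi> t e = \<zero>"
  using linD[OF \<chi>_lin[OF t(1)]] e \<chi>_one[OF t(1)] by (simp add: vs_minus[OF alg_simps(1)] a_minus_def l_minus)
 then show ?thesis using t(1) linD(1)[OF \<chi>_lin[OF t(1)] e(1)] by auto
qed

text \<open>If two characters were nonzero on a primitive idempotent, a Fitting decomposition would split it.\<close>

lemma primitive_character_unique:
 assumes e: "primitive_idempotent A e" and t: "t < m" "t' < m" "t \<noteq> t'" "\<chi> t e = \<one>"
 shows "\<chi> t' e \<noteq> \<one>"
proof
 assume t': "\<chi> t' e = \<one>"
 interpret R: ring A by (rule alg_simps)
 have eA: "e <: A" "e \<otimes>\<^bsub>A\<^esub> e = e" using e by (auto simp: primitive_idempotent_def)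
 \<comment> \<open>Elements of e A e that separate the two characters; e u e is one. Instead of the
   chain of powers in Fitting's lemma, an x with x A of least dimension is taken. As x x has the
   same properties, x x A = x A.\<close>
 let ?P = "\<lambda>x. x <: A \<and> e \<otimes>\<^bsub>A\<^esub> x = x \<and> x \<otimes>\<^bsub>A\<^esub> e = x \<and> \<chi> t x = \<one> \<and> \<chi> t' x = \<zero>"
 let ?W = "\<lambda>x. (\<lambda>b. x \<otimes>\<^bsub>A\<^esub> b) ` carrier A"
 let ?D = "\<lambda>x. vdim (A\<langle>?W x\<rangle>)"
 obtain u where u: "u <: A" "\<And>s. s < m ==> \<chi> s u = (if s = t then \<one> else \<zero>)" using \<chi>_surj[OF t(1)] by blast
 have "?P (e \<otimes>\<^bsub>A\<^esub> u \<otimes>\<^bsub>A\<^esub> e)"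
  using eA u t t' by (simp add: alg_assoc alg_assoc[symmetric, of e e] \<chi>_mult)
 from ex_has_least_nat[of ?P _ ?D, OF this] obtain x where x: "?P x" and mn: "\<And>y. ?P y ==> ?D x \<le> ?D y" by blast
 have xA: "x <: A" using x by blast
 have l: "(\<lambda>b. a \<otimes>\<^bsub>A\<^esub> b) \<in> lin K A A" if "a <: A" for a using that by (intro linI) (simp_all add: alg_rules)
 have Ws: "sspace K (?W a) A" if "a <: A" for a
  using lin_im_sub[OF alg_simps(1) alg_simps(1) l[OF that] sub_self[OF alg_simps(1)]] .
 note W = Ws[OF xA] and Wv = sub_vs[OF Ws[OF xA]] and Wf = sub_fin[OF Ws[OF xA] fin]
 have xx: "x \<otimes>\<^bsub>A\<^esub> x <: A" using xA by simp
 have sub: "?W (x \<otimes>\<^bsub>A\<^esub> x) \<subseteq> ?W x" using xA by (auto simp: alg_assoc)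
 have ex: "e \<otimes>\<^bsub>A\<^esub> (x \<otimes>\<^bsub>A\<^esub> x) = x \<otimes>\<^bsub>A\<^esub> x" using x eA by (simp add: alg_assoc[symmetric])
 have xe: "x \<otimes>\<^bsub>A\<^esub> x \<otimes>\<^bsub>A\<^esub> e = x \<otimes>\<^bsub>A\<^esub> x" using x eA by (simp add: alg_assoc)
 have "?P (x \<otimes>\<^bsub>A\<^esub> x)" using x ex xe t by (simp add: \<chi>_mult)
 then have le: "?D x \<le> ?D (x \<otimes>\<^bsub>A\<^esub> x)" by (rule mn)
 have "?W (x \<otimes>\<^bsub>A\<^esub> x) = ?W x"
  using sub_dim[OF sub_trans[OF W Ws[OF xx] sub] Wf] le by simp
 moreover have "(\<lambda>b. x \<otimes>\<^bsub>A\<^esub> b) ` ?W x = ?W (x \<otimes>\<^bsub>A\<^esub> x)" using xA by (auto simp: image_image alg_assoc)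
 moreover have "(\<lambda>b. x \<otimes>\<^bsub>A\<^esub> b) \<in> lin K (A\<langle>?W x\<rangle>) (A\<langle>?W x\<rangle>)"
  using xA by (intro linI) (auto simp: alg_rules intro!: imageI)
 ultimately have inj: "inj_on (\<lambda>b. x \<otimes>\<^bsub>A\<^esub> b) (?W x)" and surj: "(\<lambda>b. x \<otimes>\<^bsub>A\<^esub> b) ` ?W x = ?W x"
  using surj_inj[OF Wv _ Wf, of "\<lambda>b. x \<otimes>\<^bsub>A\<^esub> b"] by auto
 have "x \<in> ?W x" using xA by (intro image_eqI[of _ _ "\<one>\<^bsub>A\<^esub>"]) simp_all
 \<comment> \<open>Left multiplication by x is bijective on x A, and w is the preimage of x. By
   injectivity w w = w and w e = w, since x carries both sides of each equation to x.\<close>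
 then obtain w where w: "w \<in> ?W x" "x \<otimes>\<^bsub>A\<^esub> w = x" using surj by (metis (no_types, lifting) imageE)
 then obtain c where c: "c <: A" "w = x \<otimes>\<^bsub>A\<^esub> c" by blast
 have wA: "w <: A" using c xA by simp
 have Wm: "w \<otimes>\<^bsub>A\<^esub> b \<in> ?W x" if "b <: A" for b using c that xA by (auto simp: alg_assoc)
 have ww: "w \<otimes>\<^bsub>A\<^esub> w = w"
  by (rule inj_onD[OF inj _ Wm[OF wA] w(1)]) (use w xA wA in \<open>simp add: alg_assoc[symmetric]\<close>)
 have we: "w \<otimes>\<^bsub>A\<^esub> e = w"
  by (rule inj_onD[OF inj _ Wm[OF eA(1)] w(1)]) (use w xA wA eA x in \<open>simp add: alg_assoc[symmetric]\<close>)
 have ew: "e \<otimes>\<^bsub>A\<^esub> w = w" using x xA eA c by (simp add: alg_assoc[symmetric])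
 have k: "\<chi> s a <: K" if "s < m" "a <: A" for s a using linD(1)[OF \<chi>_lin[OF that(1)] that(2)] by simp
 \<comment> \<open>x w = x forces the value 1 at the first character, and w, being a right multiple
   of x, has value 0 at the second. Hence neither w nor e - w is zero, against primitivity.\<close>
 have c1: "\<chi> t w = \<one>" using \<chi>_mult[OF t(1) xA wA] w(2) x k[OF t(1) wA] by simp
 have c2: "\<chi> t' w = \<zero>" using \<chi>_mult[OF t(2) xA c(1)] c x k[OF t(2) c(1)] by simp
 let ?g = "e \<ominus>\<^bsub>A\<^esub> w"
 have gA: "?g <: A" using eA wA by simp
 have g: "?g \<otimes>\<^bsub>A\<^esub> ?g = ?g" "w \<otimes>\<^bsub>A\<^esub> ?g = \<zero>\<^bsub>A\<^esub>" "?g \<otimes>\<^bsub>A\<^esub> w = \<zero>\<^bsub>A\<^esub>" "e = w \<oplus>\<^bsub>A\<^esub> ?g"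
  using eA wA ww we ew
  by (simp_all add: R.minus_eq R.l_distr R.r_distr R.l_minus R.r_minus R.r_neg R.l_neg R.add.m_comm R.add.m_lcomm R.minus_add)
 have "w = \<zero>\<^bsub>A\<^esub> \<or> ?g = \<zero>\<^bsub>A\<^esub>"
  using e wA gA ww g unfolding primitive_idempotent_def by blast
 moreover have "w \<noteq> \<zero>\<^bsub>A\<^esub>"
  using c1 lin_zero[OF alg_simps(1) scal_vs \<chi>_lin[OF t(1)]] one_not_zero by auto
 moreover have "?g \<noteq> \<zero>\<^bsub>A\<^esub>"
 proof
  assume "?g = \<zero>\<^bsub>A\<^esub>"
  then have "e = w" using g(4) wA by simp
  then show False using c2 t' one_not_zero by simp
 qed
 ultimately show False by blast
qed

text \<open>\<open>\<tau> i\<close> is a character with value 1 at e i; by orthogonality it vanishes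
  at the other idempotents. Primitivity and completeness together show that \<open>\<tau>\<close>
  reaches every character, which carries \<open>\<chi>_proper\<close> over to the new index
  set.\<close>

lemma complete_idempotents_basic:
 assumes ce: "complete_primitive_idempotents A n e"
 shows "\<exists>\<chi>'. basic_algebra K A {..<n} e \<chi>'"
proof -
 have p: "primitive_idempotent A (e i)" if "i < n" for i using ce that by (simp add: complete_primitive_idempotents_def)
 have e: "e i <: A" "e i \<otimes>\<^bsub>A\<^esub> e i = e i" "e i \<noteq> \<zero>\<^bsub>A\<^esub>" if "i < n" for i
  using p[OF that] by (auto simp: primitive_idempotent_def)
 have o: "e i \<otimes>\<^bsub>A\<^esub> e j = \<zero>\<^bsub>A\<^esub>" if "i < n" "j < n" "i \<noteq> j" for i j
  using ce that by (simp add: complete_primitive_idempotents_def)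
 have k: "\<chi> s a <: K" if "s < m" "a <: A" for s a using linD(1)[OF \<chi>_lin[OF that(1)] that(2)] by simp
 have z: "\<chi> s \<zero>\<^bsub>A\<^esub> = \<zero>" if "s < m" for s using lin_zero[OF alg_simps(1) scal_vs \<chi>_lin[OF that]] by simp
 have v: "\<chi> t (e i) = \<one> \<or> \<chi> t (e i) = \<zero>" if "t < m" "i < n" for t i
 proof -
  have "\<chi> t (e i) \<otimes> \<chi> t (e i) = \<chi> t (e i)" using \<chi>_mult[OF that(1), of "e i" "e i"] e[OF that(2)] by simp
  then show ?thesis using k[OF that(1) e(1)[OF that(2)]]
   by (metis m_rcancel one_closed l_one)
 qed
 have "\<forall>i. \<exists>t. i < n \<longrightarrow> t < m \<and> \<chi> t (e i) = \<one>" using idempotent_character e by blast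
 then obtain \<tau> where \<tau>: "\<And>i. i < n ==> \<tau> i < m" "\<And>i. i < n ==> \<chi> (\<tau> i) (e i) = \<one>" by metis
 have d: "\<chi> (\<tau> i) (e j) = \<zero>" if "i < n" "j < n" "i \<noteq> j" for i j
  using \<chi>_mult[OF \<tau>(1)[OF that(1)] e(1)[OF that(1)] e(1)[OF that(2)]] o[OF that] z[OF \<tau>(1)[OF that(1)]] \<tau>(2)[OF that(1)]
   k[OF \<tau>(1)[OF that(1)] e(1)[OF that(2)]] by simp
 \<comment> \<open>A character outside the range of \<open>\<tau>\<close> would vanish at each e i,
   by uniqueness, and therefore at their sum 1.\<close>
 have sur: "\<exists>i<n. t = \<tau> i" if t: "t < m" for t
 proof (rule ccontr)
  assume c: "\<not> ?thesis"
  have "\<chi> t (e i) = \<zero>" if i: "i < n" for i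
   using primitive_character_unique[OF p[OF i] \<tau>(1)[OF i] t _ \<tau>(2)[OF i]] v[OF t i] c i by auto
  then have "(\<Oplus>\<^bsub>scal\<^esub> i\<in>{..<n}. \<chi> t (e i)) = (\<Oplus>\<^bsub>scal\<^esub> i\<in>{..<n}. \<zero>\<^bsub>scal\<^esub>)"
   by (intro vs_finsum_cong[OF scal_vs]) auto
  also have "\<dots> = \<zero>" using abelian_monoid.finsum_zero[OF abelian_group.axioms(1)[OF vs_addI(1)[OF scal_vs]]] by simp
  finally have "\<chi> t (\<Oplus>\<^bsub>A\<^esub> i\<in>{..<n}. e i) = \<zero>"
   using lin_finsum[OF alg_simps(1) scal_vs \<chi>_lin[OF t], of e "{..<n}"] e(1) by auto
  then show False using ce \<chi>_one[OF t] one_not_zero by (simp add: complete_primitive_idempotents_def)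
 qed
 have "basic_algebra K A {..<n} e (\<lambda>i. \<chi> (\<tau> i))"
 proof (intro basic_algebra.intro basic_algebra_axioms.intro alg_over_axioms fin)
  show "\<chi> (\<tau> s) (e t) = (if s = t then \<one> else \<zero>)" if "s \<in> {..<n}" "t \<in> {..<n}" for s t
   using that \<tau>(2) d by auto
  show "\<exists>s\<in>{..<n}. \<forall>x\<in>I. \<chi> (\<tau> s) x = \<zero>" if I: "sspace K I A" "\<And>x a. x \<in> I ==> a <: A ==> x \<otimes>\<^bsub>A\<^esub> a \<in> I" "\<one>\<^bsub>A\<^esub> \<notin> I" for I
  proof -
   have "rideal I" using I(1,2) by (simp add: rideal_def)
   then obtain t where "t < m" "\<forall>x\<in>I. \<chi> t x = \<zero>" using \<chi>_proper I(3) by blast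
   then show ?thesis using sur by blast
  qed
 qed (use e \<tau>(1) \<chi>_lin \<chi>_mult \<chi>_one in simp_all)
 then show ?thesis by blast
qed

end

lemma elementary_basic:
 assumes "elementary K A" "findim A" "complete_primitive_idempotents A n e"
 shows "\<exists>\<chi>. basic_algebra K A {..<n} e \<chi>"
proof (rule elementary_characters[OF assms(1,2)])
 fix m :: nat and \<chi> :: "nat \<Rightarrow> 'a \<Rightarrow> 'k"
 assume c: "\<And>t. t < m ==> \<chi> t \<in> lin K A scal"
  "\<And>t x y. t < m ==> x <: A ==> y <: A ==> \<chi> t (x \<otimes>\<^bsub>A\<^esub> y) = \<chi> t x \<otimes> \<chi> t y"
  "\<And>t. t < m ==> \<chi> t \<one>\<^bsub>A\<^esub> = \<one>"
  "\<And>t. t < m ==> \<exists>u\<in>carrier A. \<forall>s<m. \<chi> s u = (if s = t then \<one> else \<zero>)"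
  "\<And>I. rideal I ==> \<one>\<^bsub>A\<^esub> \<notin> I ==> \<exists>t<m. \<forall>x\<in>I. \<chi> t x = \<zero>"
 show ?thesis by (rule complete_idempotents_basic[of m \<chi>]) (fact c assms)+
qed

subsection \<open>Finite global dimension\<close>

text \<open>\<open>finite_global_dimension\<close> speaks only about modules with elements in one
  type. Coordinates with respect to a basis copy any finite dimensional module into that
  type.\<close>

lemma transport_module:
 assumes M: "rmodule (M :: ('k, 'm, 'a) rmod)" and fin: "findim M"
 obtains N :: "('k, nat \<Rightarrow> 'k, 'a) rmod" and g where "rmodule N" "g \<in> rhom N M" "bij_betw g (carrier N) (carrier M)"
proof -
 note r = rmodD[OF M]
 obtain b c where B: "has_basis M {..<vdim M} b c" using basis_exists[OF r(1) fin] by blast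
 let ?I = "{..<vdim M}"
 note B' = has_basisD[OF B]
 define f where "f x = (\<lambda>i\<in>?I. c i x)" for x
 have inj: "inj_on f (carrier M)"
 proof (rule inj_onI)
  fix x y assume x: "x <: M" and y: "y <: M" and e: "f x = f y"
  have "c i x = c i y" if "i \<in> ?I" for i using fun_cong[OF e, of i] that by (simp add: f_def)
  then have "(\<Oplus>\<^bsub>M\<^esub> i\<in>?I. c i x \<odot>\<^bsub>M\<^esub> b i) = (\<Oplus>\<^bsub>M\<^esub> i\<in>?I. c i y \<odot>\<^bsub>M\<^esub> b i)"
   using B'(2,6) y r(1) by (intro vs_finsum_cong[OF r(1)]) auto
  then show "x = y" using B'(4) x y by simp
 qed
 define g where "g = the_inv_into (carrier M) f"
 have gf: "g (f x) = x" if "x <: M" for x using that inj by (simp add: g_def the_inv_into_f_f)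
 define N :: "('k, nat \<Rightarrow> 'k, 'a) rmod" where "N = \<lparr>carrier = f ` carrier M, monoid.mult = undefined, monoid.one = undefined,
  ring.zero = f \<zero>\<^bsub>M\<^esub>, add = (\<lambda>v w. f (g v \<oplus>\<^bsub>M\<^esub> g w)), smult = (\<lambda>c v. f (c \<odot>\<^bsub>M\<^esub> g v)), ract = (\<lambda>v a. f (ract M (g v) a))\<rparr>"
 have ng: "g v <: M" "f (g v) = v" if "v <: N" for v using that gf by (auto simp: N_def)
 have V: "vectorspace K N"
 proof (rule vs_embed[OF r(1), where f=g])
  show "inj_on g (carrier N)" by (rule inj_on_inverseI[of _ f]) (rule ng(2))
 qed (use ng(1) r(1) in \<open>simp_all add: N_def gf\<close>)
 have "rmodule N"
  by (rule rmodI[OF V]) (use ng r in \<open>simp_all add: N_def gf\<close>)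
 moreover have "g \<in> rhom N M" using ng(1) r by (intro homI linI) (simp_all add: N_def gf)
 moreover have "bij_betw g (carrier N) (carrier M)"
  by (rule bij_betw_byWitness[of _ f]) (use ng gf in \<open>auto simp: N_def\<close>)
 ultimately show thesis by (rule that)
qed

text \<open>A resolution of the transported copy, followed by the isomorphism, bounds the length for
  M itself. The bound is uniform in M, as is needed when all simple modules are treated at once; it
  is Suc b because \<open>truncate\<close> keeps an image in one further degree.\<close>

lemma global_resolution:
 assumes gd: "finite_global_dimension K A" and Afin: "findim A"
 obtains L where "\<And>M :: ('k, 'm, 'a) rmod. rmodule M ==> findim M ==>
  \<exists>(Q :: nat \<Rightarrow> ('k, 'm \<times> 'a list \<Rightarrow> 'a, 'a) rmod) d \<epsilon>. fin_resolution M Q d \<epsilon> L"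
proof -
 obtain b where b: "\<And>M :: ('k, nat \<Rightarrow> 'k, 'a) rmod. rmodule M ==> proj_dim_le K A M b"
  using gd unfolding finite_global_dimension_def by blast
 have "\<exists>(Q :: nat \<Rightarrow> ('k, 'm \<times> 'a list \<Rightarrow> 'a, 'a) rmod) d \<epsilon>. fin_resolution M Q d \<epsilon> (Suc b)"
  if M: "rmodule M" and fin: "findim M" for M :: "('k, 'm, 'a) rmod"
 proof -
  obtain N :: "('k, nat \<Rightarrow> 'k, 'a) rmod" and g where N: "rmodule N" and g: "g \<in> rhom N M" and bij: "bij_betw g (carrier N) (carrier M)"
   by (rule transport_module[OF M fin])
  obtain P :: "nat \<Rightarrow> ('k, (nat \<Rightarrow> 'k) \<times> 'a list \<Rightarrow> 'a, 'a) rmod" and d \<epsilon>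
   where P: "projective_resolution K A N P d \<epsilon>" and z: "\<And>l. l > b ==> carrier (P l) = {\<zero>\<^bsub>P l\<^esub>}"
   using b[OF N] unfolding proj_dim_le_def by blast
  have \<epsilon>: "\<epsilon> \<in> rhom (P 0) N" "\<epsilon> ` carrier (P 0) = carrier N" using P by (simp_all add: projective_resolution_def)
  have gz: "g y = \<zero>\<^bsub>M\<^esub> \<longleftrightarrow> y = \<zero>\<^bsub>N\<^esub>" if "y <: N" for y
   using inj_onD[of g "carrier N" y "\<zero>\<^bsub>N\<^esub>"] hom_z[OF N M g] that bij rmodD(1)[OF N] by (auto simp: bij_betw_def)
  have "{x \<in> carrier (P 0). g (\<epsilon> x) = \<zero>\<^bsub>M\<^esub>} = {x \<in> carrier (P 0). \<epsilon> x = \<zero>\<^bsub>N\<^esub>}" using gz \<epsilon>(2) by blast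
  moreover have "(\<lambda>x. g (\<epsilon> x)) ` carrier (P 0) = carrier M"
   using \<epsilon>(2) bij by (simp add: bij_betw_def image_image[symmetric])
  ultimately have P': "projective_resolution K A M P d (\<lambda>x. g (\<epsilon> x))"
   using P hom_comp[OF \<epsilon>(1) g] by (simp add: projective_resolution_def)
  have inf: "infinite (UNIV :: ('m \<times> 'a list) set)"
   by (simp add: finite_prod infinite_UNIV_listI)
  show ?thesis by (rule fin_resolution_exists[OF M fin Afin inf P']) (rule z)
 qed
 then show thesis by (rule that)
qed

end

section \<open>The enveloping algebra\<close>

context base_field
begin

text \<open>The elementary tensor m \<otimes> n in \<open>field_tensor K M N\<close>.\<close>

definition pure :: "('k, 'm, 'y) module_scheme \<Rightarrow> ('k, 'n, 'z) module_scheme \<Rightarrow> 'm \<Rightarrow> 'n \<Rightarrow> ('m \<times> 'n \<Rightarrow> 'k) set" where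
 "pure M N m n = presented_gen K (carrier M \<times> carrier N) (bilinear_relations K M N) (m, n)"

context
 fixes M :: "('k, 'm, 'y) module_scheme" and N :: "('k, 'n, 'z) module_scheme"
 assumes M: "vectorspace K M" and N: "vectorspace K N"
begin

lemmas field_tensor_args = M N empty_subsetI Un_empty_right[symmetric]

lemma field_tensor_vs: "vectorspace K (field_tensor K M N)"
 unfolding field_tensor_def by (rule pres_vs[OF tens_rel[OF field_tensor_args]])

lemma field_tensor_bil: "bil M N (field_tensor K M N) (pure M N)"
 unfolding field_tensor_def pure_def[abs_def] by (rule tens_bil[OF field_tensor_args])

lemma field_tensor_eq:
 assumes "vectorspace K W" "t \<in> lin K (field_tensor K M N) W" "t' \<in> lin K (field_tensor K M N) W"
  "\<And>m n. m <: M ==> n <: N ==> t (pure M N m n) = t' (pure M N m n)"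
  "f <: (field_tensor K M N)"
 shows "t f = t' f"
 using assms unfolding field_tensor_def pure_def by (rule tens_eq[OF field_tensor_args])

lemma field_tensor_fin: "findim M ==> findim N ==> findim (field_tensor K M N)"
 unfolding field_tensor_def by (rule tens_fin[OF field_tensor_args])

lemma field_tensor_lift:
 assumes V: "vectorspace K V" and g: "bil M N V g"
 shows "presented_lift K V (\<lambda>(m, n). g m n) \<in> lin K (field_tensor K M N) V"
  and "\<And>m n. m <: M ==> n <: N ==> presented_lift K V (\<lambda>(m, n). g m n) (pure M N m n) = g m n"
 unfolding field_tensor_def pure_def
 using tens_lift[OF field_tensor_args V g] by simp_all

text \<open>A basis b of the image of Q turns P \<otimes> Q into coordinates:
  \<open>\<kappa> j\<close> sends m \<otimes> n to c_j(Q n) P m. With idempotents P and Q this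
  computes corners of the enveloping algebra (\<open>field_tensor_proj_dim\<close>); with identities
  it shows that A^e is free over one of its factors (\<open>restricted_free_lifts\<close>).\<close>

lemma field_tensor_coord:
 assumes P: "P \<in> lin K M M" and Q: "Q \<in> lin K N N"
  and B: "has_basis (N\<langle>Q ` carrier N\<rangle>) J b c"
 obtains \<kappa> where "\<And>j. j \<in> J ==> \<kappa> j \<in> lin K (field_tensor K M N) M"
  "\<And>j m n. j \<in> J ==> m <: M ==> n <: N ==> \<kappa> j (pure M N m n) = c j (Q n) \<odot>\<^bsub>M\<^esub> P m"
  "\<And>\<Phi> t. \<Phi> \<in> lin K (field_tensor K M N) (field_tensor K M N) ==>
   (\<And>m n. m <: M ==> n <: N ==> \<Phi> (pure M N m n) = pure M N (P m) (Q n)) ==>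
   t <: (field_tensor K M N) ==> (\<Oplus>\<^bsub>field_tensor K M N\<^esub> j\<in>J. pure M N (\<kappa> j t) (b j)) = \<Phi> t"
proof -
 let ?T = "field_tensor K M N" and ?W = "N\<langle>Q ` carrier N\<rangle>"
 note T = field_tensor_vs and bt = bilD[OF field_tensor_bil] and B' = has_basisD[OF B]
 have s: "sspace K (Q ` carrier N) N" by (rule lin_im_sub[OF N N Q sub_self[OF N]])
 have bN: "b j <: N" if "j \<in> J" for j using subD(6)[OF s] B'(2)[OF that] by simp
 have cQ: "(\<lambda>n. c j (Q n)) \<in> lin K N scal" if "j \<in> J" for j
  by (rule lin_comp[of _ _ ?W, OF _ B'(3)[OF that]]) (use linD[OF Q] in \<open>auto intro!: linI\<close>)
 have cK: "c j (Q n) <: K" if "j \<in> J" "n <: N" for j n using linD(1)[OF cQ] that by simp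
 have bl: "bil M N M (\<lambda>m n. c j (Q n) \<odot>\<^bsub>M\<^esub> P m)" if j: "j \<in> J" for j
  by (intro bilI linI) (use M linD[OF P] linD[OF cQ[OF j]] cK[OF j] in
   \<open>simp_all add: vs_smult_add vs_smult_smult vs_add_smult m_comm\<close>)
 define \<kappa> where "\<kappa> j = presented_lift K M (\<lambda>(m, n). c j (Q n) \<odot>\<^bsub>M\<^esub> P m)" for j
 note k = field_tensor_lift[OF M bl, folded \<kappa>_def]
 have sumN: "(\<Oplus>\<^bsub>N\<^esub> j\<in>J. c j v \<odot>\<^bsub>N\<^esub> b j) = v" if v: "v \<in> Q ` carrier N" for v
 proof -
  have "(\<lambda>x. x) \<in> lin K ?W N" using subD(6)[OF s] by (intro linI) simp_all
  from lin_finsum[OF sub_vs[OF s] N this, of "\<lambda>j. c j v \<odot>\<^bsub>?W\<^esub> b j" J] B'(4)[of v] v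
  show ?thesis using B'(2,6) subD(5)[OF s] by (auto simp: Pi_def)
 qed
 have sum: "(\<Oplus>\<^bsub>?T\<^esub> j\<in>J. pure M N (\<kappa> j t) (b j)) = \<Phi> t" if \<Phi>: "\<Phi> \<in> lin K ?T ?T"
  "\<And>m n. m <: M ==> n <: N ==> \<Phi> (pure M N m n) = pure M N (P m) (Q n)" and t: "t <: ?T" for \<Phi> t
 proof (rule field_tensor_eq[OF T _ \<Phi>(1) _ t])
  show "(\<lambda>t. \<Oplus>\<^bsub>?T\<^esub> j\<in>J. pure M N (\<kappa> j t) (b j)) \<in> lin K ?T ?T"
   by (rule lin_sum[OF T]) (rule lin_comp[OF k(1) bt(1)[OF bN]]; assumption)
  show "(\<Oplus>\<^bsub>?T\<^esub> j\<in>J. pure M N (\<kappa> j (pure M N m n)) (b j)) = \<Phi> (pure M N m n)" if m: "m <: M" and n: "n <: N" for m n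
  proof -
   have Pm: "P m <: M" using linD(1)[OF P m] .
   have "pure M N (\<kappa> j (pure M N m n)) (b j) = pure M N (P m) (c j (Q n) \<odot>\<^bsub>N\<^esub> b j)" if j: "j \<in> J" for j
    using k(2)[OF j m n] linD(3)[OF bt(1)[OF bN[OF j]] cK[OF j n] Pm] linD(3)[OF bt(2)[OF Pm] cK[OF j n] bN[OF j]] by simp
   then have "(\<Oplus>\<^bsub>?T\<^esub> j\<in>J. pure M N (\<kappa> j (pure M N m n)) (b j)) = (\<Oplus>\<^bsub>?T\<^esub> j\<in>J. pure M N (P m) (c j (Q n) \<odot>\<^bsub>N\<^esub> b j))"
    using bt(3)[OF Pm] cK[OF _ n] bN N
    by (intro vs_finsum_cong[OF T]) auto
   also have "\<dots> = pure M N (P m) (\<Oplus>\<^bsub>N\<^esub> j\<in>J. c j (Q n) \<odot>\<^bsub>N\<^esub> b j)"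
    using cK[OF _ n] bN N by (intro lin_finsum[OF N T bt(2)[OF Pm], symmetric]) auto
   also have "\<dots> = \<Phi> (pure M N m n)" using sumN n \<Phi>(2)[OF m n] by simp
   finally show ?thesis .
  qed
 qed
 show thesis by (rule that[of \<kappa>]) (use k sum in auto)
qed

text \<open>The image of P \<otimes> Q is identified, by the coordinates \<open>\<kappa>\<close>,
  with the functions from a basis of the image of Q to the image of P. This counts the dimension
  without first identifying that image with a tensor product of the two images.\<close>

lemma field_tensor_proj_dim:
 assumes fM: "findim M" and fN: "findim N"
  and P: "P \<in> lin K M M" "\<And>m. m <: M ==> P (P m) = P m"
  and Q: "Q \<in> lin K N N" "\<And>n. n <: N ==> Q (Q n) = Q n"
  and \<Phi>: "\<Phi> \<in> lin K (field_tensor K M N) (field_tensor K M N)"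
   "\<And>m n. m <: M ==> n <: N ==> \<Phi> (pure M N m n) = pure M N (P m) (Q n)"
 shows "vdim ((field_tensor K M N)\<langle>\<Phi> ` carrier (field_tensor K M N)\<rangle>)
  = vdim (M\<langle>P ` carrier M\<rangle>) * vdim (N\<langle>Q ` carrier N\<rangle>)"
proof -
 let ?T = "field_tensor K M N" and ?V = "M\<langle>P ` carrier M\<rangle>" and ?W = "N\<langle>Q ` carrier N\<rangle>"
 let ?I = "\<Phi> ` carrier ?T"
 note T = field_tensor_vs and bt = bilD[OF field_tensor_bil]
 have sP: "sspace K (P ` carrier M) M" by (rule lin_im_sub[OF M M P(1) sub_self[OF M]])
 have sQ: "sspace K (Q ` carrier N) N" by (rule lin_im_sub[OF N N Q(1) sub_self[OF N]])
 have sI: "sspace K ?I ?T" by (rule lin_im_sub[OF T T \<Phi>(1) sub_self[OF T]])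
 obtain b c where B: "has_basis ?W {..<vdim ?W} b c" using basis_exists[OF sub_vs[OF sQ] sub_fin[OF sQ fN]] by blast
 let ?J = "{..<vdim ?W}"
 note B' = has_basisD[OF B]
 obtain \<kappa> where k: "\<And>j. j \<in> ?J ==> \<kappa> j \<in> lin K ?T M"
  "\<And>j m n. j \<in> ?J ==> m <: M ==> n <: N ==> \<kappa> j (pure M N m n) = c j (Q n) \<odot>\<^bsub>M\<^esub> P m"
  "\<And>\<Phi> t. \<Phi> \<in> lin K ?T ?T ==>
   (\<And>m n. m <: M ==> n <: N ==> \<Phi> (pure M N m n) = pure M N (P m) (Q n)) ==>
   t <: ?T ==> (\<Oplus>\<^bsub>?T\<^esub> j\<in>?J. pure M N (\<kappa> j t) (b j)) = \<Phi> t"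
  by (rule field_tensor_coord[OF P(1) Q(1) B]) blast
 have bN: "b j <: N" "Q (b j) = b j" if j: "j \<in> ?J" for j using subD(6)[OF sQ] B'(2)[OF j] Q(2) by auto
 have \<Phi>\<Phi>: "\<Phi> (\<Phi> t) = \<Phi> t" if "t <: ?T" for t
  by (rule field_tensor_eq[OF T lin_comp[OF \<Phi>(1) \<Phi>(1)] \<Phi>(1) _ that])
   (use \<Phi>(2) linD(1)[OF P(1)] linD(1)[OF Q(1)] P(2) Q(2) in simp)
 have kP: "\<kappa> j t \<in> P ` carrier M" if j: "j \<in> ?J" and t: "t <: ?T" for j t
 proof -
  have "\<kappa> j t = P (\<kappa> j t)"
  proof (rule field_tensor_eq[OF M k(1)[OF j] lin_comp[OF k(1)[OF j] P(1)] _ t])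
   fix m n assume m: "m <: M" "n <: N"
   have "c j (Q n) <: K" using B'(6)[OF j, of "Q n"] m by simp
   then show "\<kappa> j (pure M N m n) = P (\<kappa> j (pure M N m n))"
    using k(2)[OF j m] linD[OF P(1)] P(2) m by simp
  qed
  then show ?thesis using linD(1)[OF k(1)[OF j] t] by (rule image_eqI)
 qed
 have PP: "P x = x" "x <: M" if "x \<in> P ` carrier M" for x using that P(2) linD(1)[OF P(1)] by auto
 let ?F = "\<lparr>carrier = {f. (\<forall>i. f i <: ?V) \<and> (\<forall>i. i \<notin> ?J \<longrightarrow> f i = \<zero>\<^bsub>?V\<^esub>) \<and> finite {i. f i \<noteq> \<zero>\<^bsub>?V\<^esub>}},
  monoid.mult = undefined, monoid.one = undefined, ring.zero = (\<lambda>i. \<zero>\<^bsub>?V\<^esub>), add = (\<lambda>f g i. f i \<oplus>\<^bsub>?V\<^esub> g i),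
  smult = (\<lambda>c f i. c \<odot>\<^bsub>?V\<^esub> f i)\<rparr>"
 have fs: "fs_space ?F ?V ?J" by (simp add: fs_space_def)
 note Fv = fs_vs[OF sub_vs[OF sP] fs]
 obtain b' c' where B2: "has_basis ?V {..<vdim ?V} b' c'" using basis_exists[OF sub_vs[OF sP] sub_fin[OF sP fM]] by blast
 have dF: "vdim ?F = vdim ?V * vdim ?W"
  using basis_dim(2)[OF Fv fs_basis[OF sub_vs[OF sP] fs _ B2]] by (simp add: card_cartesian_product)
 let ?f = "\<lambda>t j. if j \<in> ?J then \<kappa> j t else \<zero>\<^bsub>M\<^esub>" and ?g = "\<lambda>\<phi>. \<Oplus>\<^bsub>?T\<^esub> j\<in>?J. pure M N (\<phi> j) (b j)"
 have It: "t <: ?T" if "t \<in> ?I" for t using subD(6)[OF sI that] .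
 have "vdim (?T\<langle>?I\<rangle>) = vdim ?F"
 proof (rule lin_bij(3)[where f="?f" and g="?g", OF sub_vs[OF sI] Fv])
  show "?f \<in> lin K (?T\<langle>?I\<rangle>) ?F"
  proof (intro linI)
   show "?f t <: ?F" if t: "t <: (?T\<langle>?I\<rangle>)" for t
   proof -
    have "\<forall>i. ?f t i \<in> P ` carrier M" using kP It t subD(3)[OF sP] by auto
    moreover have "finite {i. ?f t i \<noteq> \<zero>\<^bsub>M\<^esub>}" by (rule finite_subset[of _ ?J]) auto
    ultimately show ?thesis by simp
   qed
  qed (use It linD[OF k(1)] M in \<open>auto simp: fun_eq_iff\<close>)
  show "?g \<phi> <: (?T\<langle>?I\<rangle>)" if \<phi>: "\<phi> <: ?F" for \<phi>
  proof -
   have "pure M N (\<phi> j) (b j) \<in> ?I" if j: "j \<in> ?J" for j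
   proof -
    have "\<phi> j \<in> P ` carrier M" using \<phi> by simp
    note m = PP[OF this]
    show ?thesis
     by (rule image_eqI[of _ _ "pure M N (\<phi> j) (b j)"]) (simp_all add: \<Phi>(2) m bN[OF j] bt(3))
   qed
   then show ?thesis using sub_finsum[OF sI, of "\<lambda>j. pure M N (\<phi> j) (b j)" ?J] by auto
  qed
  show "?g (?f t) = t" if t: "t <: (?T\<langle>?I\<rangle>)" for t
  proof -
   have t': "t <: ?T" using It t by simp
   have "?g (?f t) = (\<Oplus>\<^bsub>?T\<^esub> j\<in>?J. pure M N (\<kappa> j t) (b j))"
    using bt(3) bN linD(1)[OF k(1) t']
    by (intro vs_finsum_cong[OF T]) auto
   also have "\<dots> = \<Phi> t" by (rule k(3)[OF \<Phi> t'])
   also have "\<dots> = t" using t \<Phi>\<Phi> by auto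
   finally show ?thesis .
  qed
  show "?f (?g \<phi>) = \<phi>" if \<phi>: "\<phi> <: ?F" for \<phi>
  proof
   fix i
   have "\<phi> j \<in> P ` carrier M" for j using \<phi> by simp
   note \<phi>M = PP[OF this]
   show "?f (?g \<phi>) i = \<phi> i"
   proof (cases "i \<in> ?J")
    case True
    have "\<kappa> i (?g \<phi>) = (\<Oplus>\<^bsub>M\<^esub> j\<in>?J. \<kappa> i (pure M N (\<phi> j) (b j)))"
     using bt(3) bN \<phi>M by (intro lin_finsum[OF T M k(1)[OF True]]) auto
    also have "\<dots> = (\<Oplus>\<^bsub>M\<^esub> j\<in>?J. (if i = j then \<one> else \<zero>) \<odot>\<^bsub>M\<^esub> \<phi> j)"
     using k(2)[OF True] \<phi>M bN B'(5)[OF True] M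
     by (intro vs_finsum_cong[OF M]) auto
    also have "\<dots> = \<phi> i" by (rule finsum_delta(2)[OF M]) (use True \<phi>M in auto)
    finally show ?thesis using True by simp
   qed (use \<phi> in auto)
  qed
  show "findim (?T\<langle>?I\<rangle>) \<or> findim ?F"
   using sub_fin[OF sI field_tensor_fin[OF fM fN]] by simp
 qed
 then show ?thesis using dF by simp
qed

end

end

context base_field
begin

lemma lin_smult:
 assumes W: "vectorspace K W" and f: "f \<in> lin K V W" and c: "c <: K"
 shows "(\<lambda>x. c \<odot>\<^bsub>W\<^esub> f x) \<in> lin K V W"
 by (rule linI) (use W c linD[OF f] in \<open>simp_all add: vs_smult_add vs_smult_smult m_comm\<close>)

lemma k_algebraI:
 fixes A :: "('k, 'a) module"
 assumes V: "vectorspace K A"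
  and "\<And>x y. x <: A ==> y <: A ==> x \<otimes>\<^bsub>A\<^esub> y <: A" "\<one>\<^bsub>A\<^esub> <: A"
  and "\<And>x y z. x <: A ==> y <: A ==> z <: A ==> x \<otimes>\<^bsub>A\<^esub> y \<otimes>\<^bsub>A\<^esub> z = x \<otimes>\<^bsub>A\<^esub> (y \<otimes>\<^bsub>A\<^esub> z)"
  and "\<And>x. x <: A ==> \<one>\<^bsub>A\<^esub> \<otimes>\<^bsub>A\<^esub> x = x" "\<And>x. x <: A ==> x \<otimes>\<^bsub>A\<^esub> \<one>\<^bsub>A\<^esub> = x"
  and l: "\<And>y. y <: A ==> (\<lambda>x. x \<otimes>\<^bsub>A\<^esub> y) \<in> lin K A A" and r: "\<And>x. x <: A ==> (\<lambda>y. x \<otimes>\<^bsub>A\<^esub> y) \<in> lin K A A"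
 shows "k_algebra K A"
proof (intro k_algebra.intro k_algebra_axioms.intro V)
 show "ring A"
  by (intro ringI monoidI vs_addI(1)[OF V] assms(2-6)) (use linD(2)[OF l] linD(2)[OF r] in simp_all)
qed (use linD(3)[OF l] linD(3)[OF r] in simp_all)

end

context alg_over
begin

abbreviation "Aop \<equiv> opposite_algebra A"
abbreviation "Env \<equiv> enveloping_algebra K A"
abbreviation "u \<equiv> pure Aop A"

lemma opposite_simps [simp]:
 "carrier Aop = carrier A" "\<zero>\<^bsub>Aop\<^esub> = \<zero>\<^bsub>A\<^esub>" "add Aop = add A" "smult Aop = smult A" "\<one>\<^bsub>Aop\<^esub> = \<one>\<^bsub>A\<^esub>"
 "x \<otimes>\<^bsub>Aop\<^esub> y = y \<otimes>\<^bsub>A\<^esub> x"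
 by (simp_all add: opposite_algebra_def)

lemma opposite_vs: "vectorspace K Aop"
 by (rule vs_cong[OF alg_simps(1)]) simp_all

lemma opposite_algebra: "k_algebra K Aop"
 by (rule k_algebraI[OF opposite_vs]) (auto simp: alg_rules intro!: linI)

lemma opposite_lin: "lin K Aop W = lin K A W"
 by (simp add: module_hom_defs)

lemma opposite_bil: "bil Aop A W g \<longleftrightarrow> bil A A W g"
 by (simp add: bil_def opposite_lin)

abbreviation (input) "Tens \<equiv> field_tensor K Aop A"

lemma env_simps:
 "carrier Env = carrier Tens" "\<zero>\<^bsub>Env\<^esub> = \<zero>\<^bsub>Tens\<^esub>" "add Env = add Tens" "smult Env = smult Tens"
 "\<one>\<^bsub>Env\<^esub> = u \<one>\<^bsub>A\<^esub> \<one>\<^bsub>A\<^esub>"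
 "s \<otimes>\<^bsub>Env\<^esub> t = presented_lift K Tens (\<lambda>(a, b). presented_lift K Tens (\<lambda>(a', b'). u (a' \<otimes>\<^bsub>A\<^esub> a) (b \<otimes>\<^bsub>A\<^esub> b')) t) s"
 by (simp_all add: enveloping_algebra_def tensor_algebra_def Let_def pure_def)

lemma env_vs [simp]: "vectorspace K Env"
 by (rule vs_cong[OF field_tensor_vs[OF opposite_vs alg_simps(1)]]) (simp_all add: env_simps)

lemma env_lin: "lin K Env W = lin K Tens W" "lin K W Env = lin K W Tens"
 by (simp_all add: module_hom_defs env_simps)

lemma env_bil: "bil A A Env u"
 using field_tensor_bil[OF opposite_vs alg_simps(1)] by (simp add: bil_def opposite_lin env_lin)

lemma u_mem [simp]: "a <: A ==> b <: A ==> u a b <: Env"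
 using bilD(3)[OF env_bil] .

lemma env_eq:
 assumes "vectorspace K W" "t \<in> lin K Env W" "t' \<in> lin K Env W"
  "\<And>a b. a <: A ==> b <: A ==> t (u a b) = t' (u a b)" "f <: Env"
 shows "t f = t' f"
 by (rule field_tensor_eq[OF opposite_vs alg_simps(1) assms(1)]) (use assms in \<open>simp_all add: env_simps env_lin\<close>)

lemma env_lift:
 assumes V: "vectorspace K V" and g: "bil A A V g"
 shows "presented_lift K V (\<lambda>(a, b). g a b) \<in> lin K Env V"
  and "\<And>a b. a <: A ==> b <: A ==> presented_lift K V (\<lambda>(a, b). g a b) (u a b) = g a b"
 using field_tensor_lift[OF opposite_vs alg_simps(1) V, of g] g by (simp_all add: opposite_bil env_lin)

lemma env_fin: "findim A ==> findim Env"
 using field_tensor_fin[OF opposite_vs alg_simps(1)] dim_cong(1)[OF alg_simps(1), of Aop]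
  dim_cong(1)[OF field_tensor_vs[OF opposite_vs alg_simps(1)], of Env] by (simp add: env_simps)

lemma mult_lin: "a <: A ==> (\<lambda>x. a \<otimes>\<^bsub>A\<^esub> x) \<in> lin K A A" "a <: A ==> (\<lambda>x. x \<otimes>\<^bsub>A\<^esub> a) \<in> lin K A A"
 by (intro linI; simp add: alg_rules)+

text \<open>The product is a lift inside a lift: the inner one has to be shown bilinear in the first
  pair of arguments before the outer one is known to be linear. The first components multiply in
  reverse order.\<close>

lemma env_mult:
 shows "\<And>t. t <: Env ==> (\<lambda>s. s \<otimes>\<^bsub>Env\<^esub> t) \<in> lin K Env Env"
  and "\<And>s. s <: Env ==> (\<lambda>t. s \<otimes>\<^bsub>Env\<^esub> t) \<in> lin K Env Env"
  and "\<And>a b a' b'. a <: A ==> b <: A ==> a' <: A ==> b' <: A ==>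
   u a b \<otimes>\<^bsub>Env\<^esub> u a' b' = u (a' \<otimes>\<^bsub>A\<^esub> a) (b \<otimes>\<^bsub>A\<^esub> b')"
proof -
 define g where "g a b t = presented_lift K Env (\<lambda>(a', b'). u (a' \<otimes>\<^bsub>A\<^esub> a) (b \<otimes>\<^bsub>A\<^esub> b')) t" for a b t
 \<comment> \<open>\<open>Env\<close> and \<open>Tens\<close> differ only in product and unit, on
   which finite sums do not depend.\<close>
 have pl: "presented_lift K Tens = presented_lift K Env"
  by (simp add: presented_lift_def[abs_def] finsum_def finprod_def env_simps)
 have st: "s \<otimes>\<^bsub>Env\<^esub> t = presented_lift K Env (\<lambda>(a, b). g a b t) s" for s t
  by (simp add: env_simps(6) g_def pl)
 have b1: "bil A A Env (\<lambda>a' b'. u (a' \<otimes>\<^bsub>A\<^esub> a) (b \<otimes>\<^bsub>A\<^esub> b'))" if "a <: A" "b <: A" for a b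
 proof (rule bilI)
  show "(\<lambda>a'. u (a' \<otimes>\<^bsub>A\<^esub> a) (b \<otimes>\<^bsub>A\<^esub> n)) \<in> lin K A Env" if n: "n <: A" for n
   by (rule lin_comp[OF mult_lin(2)[OF \<open>a \<in> _\<close>] bilD(1)[OF env_bil]]) (use n \<open>b \<in> _\<close> in simp)
  show "(\<lambda>b'. u (m \<otimes>\<^bsub>A\<^esub> a) (b \<otimes>\<^bsub>A\<^esub> b')) \<in> lin K A Env" if m: "m <: A" for m
   by (rule lin_comp[OF mult_lin(1)[OF \<open>b \<in> _\<close>] bilD(2)[OF env_bil]]) (use m \<open>a \<in> _\<close> in simp)
 qed
 have g: "g a b \<in> lin K Env Env" "a' <: A ==> b' <: A ==> g a b (u a' b') = u (a' \<otimes>\<^bsub>A\<^esub> a) (b \<otimes>\<^bsub>A\<^esub> b')"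
  if "a <: A" "b <: A" for a b a' b'
  using env_lift[OF env_vs b1[OF that]] by (simp_all add: g_def[abs_def])
 have b2: "bil A A Env (\<lambda>a b. g a b t)" if t: "t <: Env" for t
 proof (intro bilI linI)
  show "g a n t <: Env" if "a <: A" "n <: A" for a n using linD(1)[OF g(1)[OF that] t] .
  then show "g n a t <: Env" if "a <: A" "n <: A" for a n using that by simp
  note ub = bilD[OF env_bil]
  show "g (a \<oplus>\<^bsub>A\<^esub> a2) n t = g a n t \<oplus>\<^bsub>Env\<^esub> g a2 n t" if "a <: A" "a2 <: A" "n <: A" for a a2 n
   by (rule env_eq[OF env_vs g(1) lin_add[OF env_vs g(1) g(1)] _ t]) (use that linD(2)[OF ub(1)] in \<open>simp_all add: g(2) alg_rules\<close>)
  show "g n (a \<oplus>\<^bsub>A\<^esub> a2) t = g n a t \<oplus>\<^bsub>Env\<^esub> g n a2 t" if "a <: A" "a2 <: A" "n <: A" for a a2 n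
   by (rule env_eq[OF env_vs g(1) lin_add[OF env_vs g(1) g(1)] _ t]) (use that linD(2)[OF ub(2)] in \<open>simp_all add: g(2) alg_rules\<close>)
  show "g (c \<odot>\<^bsub>A\<^esub> a) n t = c \<odot>\<^bsub>Env\<^esub> g a n t" if "c <: K" "a <: A" "n <: A" for c a n
   by (rule env_eq[OF env_vs g(1) lin_smult[OF env_vs g(1)] _ t]) (use that linD(3)[OF ub(1)] in \<open>simp_all add: g(2) alg_rules\<close>)
  show "g n (c \<odot>\<^bsub>A\<^esub> a) t = c \<odot>\<^bsub>Env\<^esub> g n a t" if "c <: K" "a <: A" "n <: A" for c a n
   by (rule env_eq[OF env_vs g(1) lin_smult[OF env_vs g(1)] _ t]) (use that linD(3)[OF ub(2)] in \<open>simp_all add: g(2) alg_rules\<close>)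
 qed
 have m: "(\<lambda>s. s \<otimes>\<^bsub>Env\<^esub> t) \<in> lin K Env Env" "a <: A ==> b <: A ==> u a b \<otimes>\<^bsub>Env\<^esub> t = g a b t"
  if "t <: Env" for t a b
  using env_lift[OF env_vs b2[OF that]] by (simp_all add: st)
 show "(\<lambda>s. s \<otimes>\<^bsub>Env\<^esub> t) \<in> lin K Env Env" if "t <: Env" for t by (rule m(1)[OF that])
 show "u a b \<otimes>\<^bsub>Env\<^esub> u a' b' = u (a' \<otimes>\<^bsub>A\<^esub> a) (b \<otimes>\<^bsub>A\<^esub> b')"
  if "a <: A" "b <: A" "a' <: A" "b' <: A" for a b a' b'
  using that m(2) g(2) by simp
 show "(\<lambda>t. s \<otimes>\<^bsub>Env\<^esub> t) \<in> lin K Env Env" if s: "s <: Env" for s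
 proof (rule linI)
  show "s \<otimes>\<^bsub>Env\<^esub> t <: Env" if "t <: Env" for t using linD(1)[OF m(1)[OF that] s] .
  show "s \<otimes>\<^bsub>Env\<^esub> (t \<oplus>\<^bsub>Env\<^esub> t') = s \<otimes>\<^bsub>Env\<^esub> t \<oplus>\<^bsub>Env\<^esub> s \<otimes>\<^bsub>Env\<^esub> t'" if t: "t <: Env" "t' <: Env" for t t'
   by (rule env_eq[OF env_vs m(1) lin_add[OF env_vs m(1) m(1)] _ s]) (use t linD(2)[OF g(1)] in \<open>simp_all add: m(2)\<close>)
  show "s \<otimes>\<^bsub>Env\<^esub> (c \<odot>\<^bsub>Env\<^esub> t) = c \<odot>\<^bsub>Env\<^esub> (s \<otimes>\<^bsub>Env\<^esub> t)" if t: "c <: K" "t <: Env" for c t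
   by (rule env_eq[OF env_vs m(1) lin_smult[OF env_vs m(1)] _ s]) (use t linD(3)[OF g(1)] in \<open>simp_all add: m(2)\<close>)
 qed
qed

lemma env_closed [simp]: "s <: Env ==> t <: Env ==> s \<otimes>\<^bsub>Env\<^esub> t <: Env"
 using linD(1)[OF env_mult(1)] .

lemma env_one: "\<one>\<^bsub>Env\<^esub> = u \<one>\<^bsub>A\<^esub> \<one>\<^bsub>A\<^esub>" by (rule env_simps(5))

lemma env_algebra: "k_algebra K Env"
proof (rule k_algebraI[OF env_vs env_closed _ _ _ _ env_mult(1,2)])
 show "\<one>\<^bsub>Env\<^esub> <: Env" by (simp add: env_one)
 show "\<one>\<^bsub>Env\<^esub> \<otimes>\<^bsub>Env\<^esub> x = x" if "x <: Env" for x
  by (rule env_eq[OF env_vs env_mult(2) lin_id _ that]) (simp_all add: env_one env_mult(3))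
 show "x \<otimes>\<^bsub>Env\<^esub> \<one>\<^bsub>Env\<^esub> = x" if "x <: Env" for x
  by (rule env_eq[OF env_vs env_mult(1) lin_id _ that]) (simp_all add: env_one env_mult(3))
 show "x \<otimes>\<^bsub>Env\<^esub> y \<otimes>\<^bsub>Env\<^esub> z = x \<otimes>\<^bsub>Env\<^esub> (y \<otimes>\<^bsub>Env\<^esub> z)" if x: "x <: Env" and y: "y <: Env" and z: "z <: Env" for x y z
 proof (rule env_eq[OF env_vs lin_comp[OF env_mult(1)[OF y] env_mult(1)[OF z]] env_mult(1) _ x])
  fix a b assume 1: "a <: A" "b <: A"
  show "u a b \<otimes>\<^bsub>Env\<^esub> y \<otimes>\<^bsub>Env\<^esub> z = u a b \<otimes>\<^bsub>Env\<^esub> (y \<otimes>\<^bsub>Env\<^esub> z)"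
  proof (rule env_eq[OF env_vs lin_comp[OF env_mult(2) env_mult(1)[OF z]] lin_comp[OF env_mult(1)[OF z] env_mult(2)] _ y])
   fix a' b' assume 2: "a' <: A" "b' <: A"
   show "u a b \<otimes>\<^bsub>Env\<^esub> u a' b' \<otimes>\<^bsub>Env\<^esub> z = u a b \<otimes>\<^bsub>Env\<^esub> (u a' b' \<otimes>\<^bsub>Env\<^esub> z)"
    by (rule env_eq[OF env_vs env_mult(2) lin_comp[OF env_mult(2) env_mult(2)] _ z]) (use 1 2 in \<open>simp_all add: env_mult(3) alg_assoc\<close>)
  qed (use 1 in simp_all)
 qed (use y z in simp_all)
qed

subsection \<open>Bimodules\<close>

lemma bimoduleD:
 assumes M: "bimodule K A M"
 shows "left_module K A M" "rmodule (as_rmod M (bract M))"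
  "\<And>m a b. m <: M ==> a <: A ==> b <: A ==> bract M (lact M a m) b = lact M a (bract M m b)"
 using M by (auto simp: bimodule_def bimodule_axioms_def)

text \<open>Both actions are lifted from elementary tensors. Linearity in the module element and the
  action law are therefore verified on elementary tensors, where they reduce to the two commuting
  actions on M.\<close>

lemma env_modules:
 assumes M: "bimodule K A (M :: ('k, 'm, 'a) bimod)"
 shows "right_module K Env (env_rmod K M)" "left_module K Env (env_lmod K M)"
  and "\<And>m a b. m <: M ==> a <: A ==> b <: A ==> ract (env_rmod K M) m (u a b) = bract M (lact M a m) b"
  and "\<And>m a b. m <: M ==> a <: A ==> b <: A ==> lact (env_lmod K M) (u a b) m = lact M b (bract M m a)"
proof -
 interpret E: alg_over K Env by (intro alg_over.intro base_field_axioms alg_over_axioms.intro env_algebra)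
 note l = lmodD[OF bimoduleD(1)[OF M]] and r = rmodD[OF bimoduleD(2)[OF M], simplified] and c = bimoduleD(3)[OF M]
 note V = l(1)
 define f where "f m = presented_lift K M (\<lambda>(a, b). bract M (lact M a m) b)" for m
 define g where "g m = presented_lift K M (\<lambda>(a, b). lact M b (bract M m a))" for m
 have b1: "bil A A M (\<lambda>a b. bract M (lact M a m) b)" if "m <: M" for m
  using that by (intro bilI linI) (simp_all add: l r)
 have b2: "bil A A M (\<lambda>a b. lact M b (bract M m a))" if "m <: M" for m
  using that by (intro bilI linI) (simp_all add: l r)
 note f = env_lift[OF V b1, folded f_def] and g = env_lift[OF V b2, folded g_def]
 have rs: "carrier (env_rmod K M) = carrier M" "\<zero>\<^bsub>env_rmod K M\<^esub> = \<zero>\<^bsub>M\<^esub>" "add (env_rmod K M) = add M" "smult (env_rmod K M) = smult M" "ract (env_rmod K M) = f"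
  "carrier (env_lmod K M) = carrier M" "\<zero>\<^bsub>env_lmod K M\<^esub> = \<zero>\<^bsub>M\<^esub>" "add (env_lmod K M) = add M" "smult (env_lmod K M) = smult M" "lact (env_lmod K M) = (\<lambda>t m. g m t)"
  by (simp_all add: env_rmod_def env_lmod_def f_def[abs_def] g_def[abs_def])
 have fc: "f m t <: M" "g m t <: M" if "m <: M" "t <: Env" for m t
  using linD(1)[OF f(1)] linD(1)[OF g(1)] that by simp_all
 have fl: "(\<lambda>m. f m t) \<in> lin K M M" if t: "t <: Env" for t
 proof (rule linI)
  show "f m t <: M" if "m <: M" for m using fc(1)[OF that t] .
  show "f (m \<oplus>\<^bsub>M\<^esub> m') t = f m t \<oplus>\<^bsub>M\<^esub> f m' t" if m: "m <: M" "m' <: M" for m m'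
   by (rule env_eq[OF V f(1) lin_add[OF V f(1) f(1)] _ t]) (use m in \<open>simp_all add: f(2) l r V\<close>)
  show "f (c \<odot>\<^bsub>M\<^esub> m) t = c \<odot>\<^bsub>M\<^esub> f m t" if m: "c <: K" "m <: M" for c m
   by (rule env_eq[OF V f(1) lin_smult[OF V f(1)] _ t]) (use m in \<open>simp_all add: f(2) l r V\<close>)
 qed
 have gl: "(\<lambda>m. g m t) \<in> lin K M M" if t: "t <: Env" for t
 proof (rule linI)
  show "g m t <: M" if "m <: M" for m using fc(2)[OF that t] .
  show "g (m \<oplus>\<^bsub>M\<^esub> m') t = g m t \<oplus>\<^bsub>M\<^esub> g m' t" if m: "m <: M" "m' <: M" for m m'
   by (rule env_eq[OF V g(1) lin_add[OF V g(1) g(1)] _ t]) (use m in \<open>simp_all add: g(2) l r V\<close>)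
  show "g (c \<odot>\<^bsub>M\<^esub> m) t = c \<odot>\<^bsub>M\<^esub> g m t" if m: "c <: K" "m <: M" for c m
   by (rule env_eq[OF V g(1) lin_smult[OF V g(1)] _ t]) (use m in \<open>simp_all add: g(2) l r V\<close>)
 qed
 have fm: "f m (s \<otimes>\<^bsub>Env\<^esub> t) = f (f m s) t" if m: "m <: M" and s: "s <: Env" and t: "t <: Env" for m s t
 proof (rule env_eq[OF V lin_comp[OF env_mult(1)[OF t] f(1)[OF m]] lin_comp[OF f(1)[OF m] fl[OF t]] _ s])
  fix a b assume 1: "a <: A" "b <: A"
  have m1: "bract M (lact M a m) b <: M" using 1 m by (simp add: l r)
  have "f m (u a b \<otimes>\<^bsub>Env\<^esub> t) = f (bract M (lact M a m) b) t"
   by (rule env_eq[OF V lin_comp[OF env_mult(2) f(1)[OF m]] f(1)[OF m1] _ t]) (use 1 m m1 in \<open>simp_all add: env_mult(3) f(2) l r c\<close>)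
  then show "f m (u a b \<otimes>\<^bsub>Env\<^esub> t) = f (f m (u a b)) t" using 1 m by (simp add: f(2))
 qed
 have gm: "g m (s \<otimes>\<^bsub>Env\<^esub> t) = g (g m t) s" if m: "m <: M" and s: "s <: Env" and t: "t <: Env" for m s t
 proof (rule env_eq[OF V lin_comp[OF env_mult(2)[OF s] g(1)[OF m]] lin_comp[OF g(1)[OF m] gl[OF s]] _ t])
  fix a b assume 1: "a <: A" "b <: A"
  have m1: "lact M b (bract M m a) <: M" using 1 m by (simp add: l r)
  have "g m (s \<otimes>\<^bsub>Env\<^esub> u a b) = g (lact M b (bract M m a)) s"
   by (rule env_eq[OF V lin_comp[OF env_mult(1) g(1)[OF m]] g(1)[OF m1] _ s]) (use 1 m m1 in \<open>simp_all add: env_mult(3) g(2) l r c\<close>)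
  then show "g m (s \<otimes>\<^bsub>Env\<^esub> u a b) = g (g m (u a b)) s" using 1 m by (simp add: g(2))
 qed
 have "vectorspace K (env_rmod K M)" by (rule vs_cong[OF V]) (simp_all add: rs)
 then show "right_module K Env (env_rmod K M)"
  by (rule E.rmodI) (use fc fm linD[OF f(1)] linD[OF fl] in \<open>simp_all add: rs env_one f(2) l r\<close>)
 have "vectorspace K (env_lmod K M)" by (rule vs_cong[OF V]) (simp_all add: rs)
 then show "left_module K Env (env_lmod K M)"
  by (rule E.lmodI) (use fc gm linD[OF g(1)] linD[OF gl] in \<open>simp_all add: rs env_one g(2) l r\<close>)
 show "ract (env_rmod K M) m (u a b) = bract M (lact M a m) b" "lact (env_lmod K M) (u a b) m = lact M b (bract M m a)"
  if "m <: M" "a <: A" "b <: A" for m a b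
  using that by (simp_all add: rs f(2) g(2))
qed

lemma env_mod_simps [simp]:
 "carrier (env_rmod K M) = carrier M" "\<zero>\<^bsub>env_rmod K M\<^esub> = \<zero>\<^bsub>M\<^esub>" "add (env_rmod K M) = add M"
 "smult (env_rmod K M) = smult M" "carrier (env_lmod K M) = carrier M" "\<zero>\<^bsub>env_lmod K M\<^esub> = \<zero>\<^bsub>M\<^esub>"
 "add (env_lmod K M) = add M" "smult (env_lmod K M) = smult M"
 by (simp_all add: env_rmod_def env_lmod_def)

lemma regular_bimodule:
 shows "bimodule K A (regular_bimodule A)"
  and "carrier (regular_bimodule A) = carrier A" "\<zero>\<^bsub>regular_bimodule A\<^esub> = \<zero>\<^bsub>A\<^esub>" "add (regular_bimodule A) = add A"
  "smult (regular_bimodule A) = smult A" "lact (regular_bimodule A) = monoid.mult A" "bract (regular_bimodule A) = monoid.mult A"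
proof -
 show s: "carrier (regular_bimodule A) = carrier A" "\<zero>\<^bsub>regular_bimodule A\<^esub> = \<zero>\<^bsub>A\<^esub>" "add (regular_bimodule A) = add A"
  "smult (regular_bimodule A) = smult A" "lact (regular_bimodule A) = monoid.mult A" "bract (regular_bimodule A) = monoid.mult A"
  by (simp_all add: regular_bimodule_def as_lmod_def module.defs lmod.defs bimod.defs)
 have V: "vectorspace K (regular_bimodule A)" by (rule vs_cong[OF alg_simps(1)]) (simp_all add: s)
 have "left_module K A (regular_bimodule A)" by (rule lmodI[OF V]) (simp_all add: s alg_rules)
 moreover have "rmodule (as_rmod (regular_bimodule A) (bract (regular_bimodule A)))"
  by (rule rmodI[OF vs_cong[OF V]]) (simp_all add: s alg_rules)
 ultimately show "bimodule K A (regular_bimodule A)"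
  by (simp add: bimodule_def bimodule_axioms_def s alg_assoc)
qed

end

section \<open>The simple modules of the enveloping algebra\<close>

context alg_over
begin

definition right_restriction :: "('k, 'm, ('a \<times> 'a \<Rightarrow> 'k) set) rmod \<Rightarrow> ('k, 'm, 'a) rmod" where
 "right_restriction X = as_rmod X (\<lambda>x a. ract X x (u \<one>\<^bsub>A\<^esub> a))"

lemma env_alg_over: "alg_over K Env"
 by (intro alg_over.intro base_field_axioms alg_over_axioms.intro env_algebra)

lemma right_restriction_module:
 assumes X: "right_module K Env X"
 shows "rmodule (right_restriction X)"
proof -
 note r = alg_over.rmodD[OF env_alg_over X] and b = linD[OF bilD(2)[OF env_bil]]
 show ?thesis
  by (rule rmodI[OF vs_cong[OF r(1)]])
   (simp_all add: right_restriction_def r b env_mult(3) r(8)[unfolded env_one])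
qed

end

context basic_algebra
begin

text \<open>A nonzero module contains a common eigenvector: descend the composition series to its
  last nonzero term, where h is injective, so that n itself is an eigenvector.\<close>

lemma socle:
 assumes N: "rmodule (N :: ('k, 'm, 'a) rmod)" and fin: "findim N" and nz: "carrier N \<noteq> {\<zero>\<^bsub>N\<^esub>}"
 shows "\<exists>p\<in>S. \<exists>v\<in>carrier N. v \<noteq> \<zero>\<^bsub>N\<^esub> \<and> (\<forall>a\<in>carrier A. ract N v a = \<chi> p a \<odot>\<^bsub>N\<^esub> v)"
 using N fin nz
proof (induction rule: fd_induct)
 case (step N s h n)
 let ?N' = "N\<langle>{x \<in> carrier N. h x = \<zero>}\<rangle>"
 note r = rmodD[OF step(1)]
 show ?case
 proof (cases "carrier ?N' = {\<zero>\<^bsub>?N'\<^esub>}")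
  case True
  have "ract N n a = \<chi> s a \<odot>\<^bsub>N\<^esub> n" if a: "a <: A" for a
  proof -
   have m: "ract N n a <: N" "\<chi> s a \<odot>\<^bsub>N\<^esub> n <: N" using r step(5) \<chi>D(1)[OF step(3)] a by simp_all
   have "h (ract N n a) = h (\<chi> s a \<odot>\<^bsub>N\<^esub> n)"
    using homD(2)[OF step(4,5) a] homD(5)[OF step(4) _ step(5)] step(6) \<chi>D(1)[OF step(3) a] by simp
   moreover have "inj_on h (carrier N)"
    by (rule lin_inj[OF r(1) rmodD(1)[OF simple_module(1)[OF step(3)]] homD(1)[OF step(4)]]) (use True in auto)
   ultimately show ?thesis using m by (auto dest: inj_onD)
  qed
  moreover have "n \<noteq> \<zero>\<^bsub>N\<^esub>" using hom_z[OF step(1) simple_module(1)[OF step(3)] step(4)] step(6) one_not_zero by auto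
  ultimately show ?thesis using step(3,5) by blast
 next
  case False
  from step(9)[OF this] show ?thesis by auto
 qed
qed simp

definition env_char :: "'s \<times> 's \<Rightarrow> ('a \<times> 'a \<Rightarrow> 'k) set \<Rightarrow> 'k" where
 "env_char = (\<lambda>(p, q). presented_lift K scal (\<lambda>(a, b). \<chi> p a \<otimes> \<chi> q b))"

lemma env_char:
 assumes p: "p \<in> S" and q: "q \<in> S"
 shows "env_char (p, q) \<in> lin K Env scal"
  and "\<And>a b. a <: A ==> b <: A ==> env_char (p, q) (u a b) = \<chi> p a \<otimes> \<chi> q b"
  and "\<And>s t. s <: Env ==> t <: Env ==> env_char (p, q) (s \<otimes>\<^bsub>Env\<^esub> t) = env_char (p, q) s \<otimes> env_char (p, q) t"
proof -
 have "bil A A scal (\<lambda>a b. \<chi> p a \<otimes> \<chi> q b)"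
  by (intro bilI linI) (use \<chi>D[OF p] \<chi>D[OF q] in \<open>simp_all add: l_distr r_distr m_assoc m_lcomm\<close>)
 note l = env_lift[OF scal_vs this]
 show e: "env_char (p, q) \<in> lin K Env scal" "\<And>a b. a <: A ==> b <: A ==> env_char (p, q) (u a b) = \<chi> p a \<otimes> \<chi> q b"
  using l by (simp_all add: env_char_def)
 have k: "env_char (p, q) x <: K" if "x <: Env" for x using linD(1)[OF e(1) that] by simp
 have m: "(\<lambda>x. c \<otimes> f x) \<in> lin K Env scal" "(\<lambda>x. f x \<otimes> c) \<in> lin K Env scal" if "f \<in> lin K Env scal" "c <: K" for f c
  using that linD[OF that(1)] by (auto intro!: linI simp: l_distr r_distr m_assoc m_lcomm)
 show "env_char (p, q) (s \<otimes>\<^bsub>Env\<^esub> t) = env_char (p, q) s \<otimes> env_char (p, q) t" if s: "s <: Env" and t: "t <: Env" for s t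
 proof (rule env_eq[OF scal_vs lin_comp[OF env_mult(1)[OF t] e(1)] m(2)[OF e(1) k[OF t]] _ s])
  fix a b assume 1: "a <: A" "b <: A"
  show "env_char (p, q) (u a b \<otimes>\<^bsub>Env\<^esub> t) = env_char (p, q) (u a b) \<otimes> env_char (p, q) t"
  proof (rule env_eq[OF scal_vs lin_comp[OF env_mult(2) e(1)] m(1)[OF e(1) k] _ t])
   show "env_char (p, q) (u a b \<otimes>\<^bsub>Env\<^esub> u a' b') = env_char (p, q) (u a b) \<otimes> env_char (p, q) (u a' b')"
    if "a' <: A" "b' <: A" for a' b'
    using that 1 \<chi>D(1)[OF p] \<chi>D(1)[OF q] by (simp add: env_mult(3) e(2) \<chi>_mult[OF p] \<chi>_mult[OF q] m_ac)
  qed (use 1 in simp_all)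
 qed
qed

text \<open>The two factors are diagonalised one after the other. Over the second factor, A^e/I has
  a simple quotient, which is a linear form on A^e that kills I and transforms by some \<chi> q. All
  such forms make up a nonzero module over the first factor, and an eigenvector in it, with
  character \<chi> p, must be a multiple of \<chi> p \<otimes> \<chi> q.\<close>

lemma env_proper:
 assumes I: "sspace K I Env" "\<And>x t. x \<in> I ==> t <: Env ==> x \<otimes>\<^bsub>Env\<^esub> t \<in> I" "\<one>\<^bsub>Env\<^esub> \<notin> I"
 shows "\<exists>p\<in>S. \<exists>q\<in>S. \<forall>x\<in>I. env_char (p, q) x = \<zero>"
proof -
 let ?N = "right_restriction (as_rmod Env (monoid.mult Env))"
 \<comment> \<open>Right multiplication by a \<otimes> 1 is a left action of A because the first
   factor is the opposite algebra; its dual is then a right module.\<close>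
 let ?L = "as_lmod Env (\<lambda>a x. x \<otimes>\<^bsub>Env\<^esub> u a \<one>\<^bsub>A\<^esub>)"
 let ?D = "dual_rmod ?L"
 note es = alg_over.alg_simps[OF env_alg_over] and ea = alg_over.alg_rules[OF env_alg_over]
 have ns: "carrier ?N = carrier Env" "\<zero>\<^bsub>?N\<^esub> = \<zero>\<^bsub>Env\<^esub>" "add ?N = add Env" "smult ?N = smult Env"
  "ract ?N x a = x \<otimes>\<^bsub>Env\<^esub> u \<one>\<^bsub>A\<^esub> a" for x a by (simp_all add: right_restriction_def)
 have N: "rmodule ?N" by (rule right_restriction_module[OF alg_over.regular_module[OF env_alg_over]])
 have fN: "findim ?N" using dim_cong(1)[OF env_vs, of ?N] env_fin[OF fin_A] by (simp add: ns)
 have "sspace K I ?N" using subD(2-5)[OF I(1)] by (intro subI[OF rmodD(1)[OF N]]) (simp_all add: ns)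
 then have "submod ?N I" using N I(2) by (simp add: submod_def ns)
 moreover have "I \<noteq> carrier ?N" using I(3) es(4) by (auto simp: ns)
 ultimately obtain q h n where q: "q \<in> S" and h: "h \<in> rhom ?N (simple q)" "\<And>x. x \<in> I ==> h x = \<zero>" and n: "n <: ?N" "h n = \<one>"
  by (rule simple_quotient[OF N fN]) blast
 have hl: "h \<in> lin K Env scal" using homD(3-5)[OF h(1)] by (intro linI) (simp_all add: ns)
 have ha: "h (x \<otimes>\<^bsub>Env\<^esub> u \<one>\<^bsub>A\<^esub> a) = h x \<otimes> \<chi> q a" if "x <: Env" "a <: A" for x a
  using homD(2)[OF h(1), of x a] that by (simp add: ns)
 note ub = linD[OF bilD(1)[OF env_bil]]
 have L: "left_module K A ?L"
  by (rule lmodI[OF vs_cong[OF env_vs]]) (simp_all add: ub es ea env_mult(3) env_one[symmetric])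
 have fL: "findim ?L" using dim_cong(1)[OF env_vs, of ?L] env_fin[OF fin_A] by simp
 note D = dual_module[OF L] and fD = dual_fin(1)[OF lmodD(1)[OF L] fL]
 \<comment> \<open>The forms that kill I and transform by \<chi> q under the second factor; a
   submodule, since the two factors commute.\<close>
 let ?\<Lambda> = "{f \<in> carrier ?D. (\<forall>x\<in>I. f x = \<zero>) \<and> (\<forall>x\<in>carrier Env. \<forall>a\<in>carrier A. f (x \<otimes>\<^bsub>Env\<^esub> u \<one>\<^bsub>A\<^esub> a) = f x \<otimes> \<chi> q a)}"
 have IE: "x <: Env" if "x \<in> I" for x using subD(6)[OF I(1) that] .
 have fK: "f x <: K" if "f <: ?D" "x <: Env" for f x
  using that linD(1)[of f ?L scal x] by simp
 have "submod ?D ?\<Lambda>"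
  unfolding submod_def
 proof (intro conjI ballI D subI[OF rmodD(1)[OF D]])
  show "\<zero>\<^bsub>?D\<^esub> \<in> ?\<Lambda>" using vs_zero[OF rmodD(1)[OF D]] IE \<chi>D(1)[OF q] by simp
  show "f \<oplus>\<^bsub>?D\<^esub> g \<in> ?\<Lambda>" if "f \<in> ?\<Lambda>" "g \<in> ?\<Lambda>" for f g
   using that vs_add[OF rmodD(1)[OF D], of f g] fK IE \<chi>D(1)[OF q] by (simp add: l_distr)
  show "c \<odot>\<^bsub>?D\<^esub> f \<in> ?\<Lambda>" if "c <: K" "f \<in> ?\<Lambda>" for c f
   using that vs_smult[OF rmodD(1)[OF D], of c f] fK IE \<chi>D(1)[OF q] by (simp add: m_assoc)
  show "ract ?D f a \<in> ?\<Lambda>" if f: "f \<in> ?\<Lambda>" and a: "a <: A" for f a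
  proof -
   have "x \<otimes>\<^bsub>Env\<^esub> u \<one>\<^bsub>A\<^esub> b \<otimes>\<^bsub>Env\<^esub> u a \<one>\<^bsub>A\<^esub> = x \<otimes>\<^bsub>Env\<^esub> u a \<one>\<^bsub>A\<^esub> \<otimes>\<^bsub>Env\<^esub> u \<one>\<^bsub>A\<^esub> b" if "x <: Env" "b <: A" for x b
    using that a by (simp add: ea env_mult(3))
   then show ?thesis using f rmodD(2)[OF D _ a, of f] I(2) IE a by simp
  qed
 qed auto
 note \<Lambda> = submod_rmod[OF this] and sub = submodD(2)[OF this]
 have hr: "restrict h (carrier Env) \<in> ?\<Lambda>"
  using hl h(2) IE ha by (auto simp: module_hom_defs)
 moreover have "restrict h (carrier Env) \<noteq> \<zero>\<^bsub>?D\<^esub>"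
 proof
  assume "restrict h (carrier Env) = \<zero>\<^bsub>?D\<^esub>"
  from fun_cong[OF this, of n] show False using n one_not_zero by (simp add: ns)
 qed
 ultimately have "carrier (?D\<langle>?\<Lambda>\<rangle>) \<noteq> {\<zero>\<^bsub>?D\<langle>?\<Lambda>\<rangle>\<^esub>}" by auto
 from socle[OF \<Lambda> sub_fin[OF sub fD] this] obtain p v where p: "p \<in> S" and v: "v \<in> ?\<Lambda>" "v \<noteq> \<zero>\<^bsub>?D\<^esub>"
  and va: "\<And>a. a <: A ==> ract ?D v a = \<chi> p a \<odot>\<^bsub>?D\<^esub> v" by auto
 have vD: "v <: ?D" and vI: "\<And>x. x \<in> I ==> v x = \<zero>"
  and vq: "\<And>x a. x <: Env ==> a <: A ==> v (x \<otimes>\<^bsub>Env\<^esub> u \<one>\<^bsub>A\<^esub> a) = v x \<otimes> \<chi> q a" using v(1) by auto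
 have vp: "v (x \<otimes>\<^bsub>Env\<^esub> u a \<one>\<^bsub>A\<^esub>) = \<chi> p a \<otimes> v x" if x: "x <: Env" "a <: A" for x a
  using fun_cong[OF va[OF x(2)], of x] x by simp
 have vl: "v \<in> lin K Env scal" using vD by (simp add: module_hom_defs)
 note k1 = fK[OF vD es(4)]
 \<comment> \<open>u a b is obtained from the unit by acting with 1 \<otimes> b and then with a
   \<otimes> 1, so the two eigenvalue equations determine v up to its value at the unit.\<close>
 have eq: "v x = v \<one>\<^bsub>Env\<^esub> \<otimes> env_char (p, q) x" if x: "x <: Env" for x
 proof (rule env_eq[OF scal_vs vl _ _ x])
  show "(\<lambda>x. v \<one>\<^bsub>Env\<^esub> \<otimes> env_char (p, q) x) \<in> lin K Env scal"
   using lin_smult[OF scal_vs env_char(1)[OF p q] k1] by simp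
  fix a b assume ab: "a <: A" "b <: A"
  have "u a b = \<one>\<^bsub>Env\<^esub> \<otimes>\<^bsub>Env\<^esub> u \<one>\<^bsub>A\<^esub> b \<otimes>\<^bsub>Env\<^esub> u a \<one>\<^bsub>A\<^esub>" using ab by (simp add: env_mult(3) env_one)
  then have "v (u a b) = \<chi> p a \<otimes> (v \<one>\<^bsub>Env\<^esub> \<otimes> \<chi> q b)" using ab vp vq es(4) by simp
  then show "v (u a b) = v \<one>\<^bsub>Env\<^esub> \<otimes> env_char (p, q) (u a b)"
   using ab k1 \<chi>D(1)[OF p] \<chi>D(1)[OF q] by (simp add: env_char(2)[OF p q] m_lcomm)
 qed
 have "v \<one>\<^bsub>Env\<^esub> \<noteq> \<zero>"
 proof
  assume z: "v \<one>\<^bsub>Env\<^esub> = \<zero>"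
  have "v = \<zero>\<^bsub>?D\<^esub>"
  proof (rule extensionalityI[where A="carrier Env"])
   show "v x = \<zero>\<^bsub>?D\<^esub> x" if "x <: Env" for x
    using eq[OF that] z that linD(1)[OF env_char(1)[OF p q] that] by simp
  qed (use vD in simp_all)
  then show False using v(2) by simp
 qed
 moreover have "v \<one>\<^bsub>Env\<^esub> \<otimes> env_char (p, q) x = \<zero>" if "x \<in> I" for x using eq[OF IE[OF that]] vI[OF that] by simp
 ultimately have "env_char (p, q) x = \<zero>" if "x \<in> I" for x
  using that k1 linD(1)[OF env_char(1)[OF p q] IE[OF that]] integral by auto
 then show ?thesis using p q by blast
qed

lemma env_basic: "basic_algebra K Env (S \<times> S) (\<lambda>(p, q). u (e p) (e q)) env_char"
proof (intro basic_algebra.intro basic_algebra_axioms.intro env_alg_over env_fin fin_A finite_cartesian_product fin_S)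
 fix I assume "sspace K I Env" "\<And>x t. x \<in> I ==> t <: Env ==> x \<otimes>\<^bsub>Env\<^esub> t \<in> I" "\<one>\<^bsub>Env\<^esub> \<notin> I"
 then show "\<exists>s\<in>S \<times> S. \<forall>x\<in>I. env_char s x = \<zero>" using env_proper[of I] by blast
qed (use env_char \<chi>_one \<chi>_e e_mem e_idem in \<open>auto simp: env_mult(3) env_one split: if_splits\<close>)

text \<open>The corner is the image of x \<otimes> y \<mapsto> e_i x e_p \<otimes> e_q y e_j, a
  tensor product of two idempotent maps; in the first factor the idempotents change sides.\<close>

lemma env_corner:
 assumes "p \<in> S" "q \<in> S" "i \<in> S" "j \<in> S"
 shows "alg_over.corner K Env (u (e p) (e q)) (u (e i) (e j)) = corner (e i) (e p) * corner (e q) (e j)"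
proof -
 note a = e_mem[OF assms(1)] e_mem[OF assms(2)] e_mem[OF assms(3)] e_mem[OF assms(4)]
 note d = e_idem[OF assms(1)] e_idem[OF assms(2)] e_idem[OF assms(3)] e_idem[OF assms(4)]
 let ?P = "\<lambda>x. e i \<otimes>\<^bsub>A\<^esub> (x \<otimes>\<^bsub>A\<^esub> e p)" and ?Q = "\<lambda>x. e q \<otimes>\<^bsub>A\<^esub> (x \<otimes>\<^bsub>A\<^esub> e j)"
 let ?F = "\<lambda>b. u (e p) (e q) \<otimes>\<^bsub>Env\<^esub> (b \<otimes>\<^bsub>Env\<^esub> u (e i) (e j))"
 have l: "(\<lambda>x. f \<otimes>\<^bsub>A\<^esub> (x \<otimes>\<^bsub>A\<^esub> g)) \<in> lin K A A" if "f <: A" "g <: A" for f g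
  using that by (intro linI) (simp_all add: alg_rules)
 have id: "f \<otimes>\<^bsub>A\<^esub> ((f \<otimes>\<^bsub>A\<^esub> (x \<otimes>\<^bsub>A\<^esub> g)) \<otimes>\<^bsub>A\<^esub> g) = f \<otimes>\<^bsub>A\<^esub> (x \<otimes>\<^bsub>A\<^esub> g)"
  if "f <: A" "g <: A" "x <: A" "f \<otimes>\<^bsub>A\<^esub> f = f" "g \<otimes>\<^bsub>A\<^esub> g = g" for f g x
 proof -
  have "f \<otimes>\<^bsub>A\<^esub> ((f \<otimes>\<^bsub>A\<^esub> (x \<otimes>\<^bsub>A\<^esub> g)) \<otimes>\<^bsub>A\<^esub> g) = (f \<otimes>\<^bsub>A\<^esub> f) \<otimes>\<^bsub>A\<^esub> (x \<otimes>\<^bsub>A\<^esub> (g \<otimes>\<^bsub>A\<^esub> g))" using that(1-3) by (simp add: alg_assoc)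
  then show ?thesis using that by simp
 qed
 have F: "?F \<in> lin K Tens Tens"
  using lin_comp[OF env_mult(1) env_mult(2), of "u (e i) (e j)" "u (e p) (e q)"] a by (simp add: env_lin)
 have "vdim (Tens\<langle>?F ` carrier Tens\<rangle>) = vdim (Aop\<langle>?P ` carrier Aop\<rangle>) * vdim (A\<langle>?Q ` carrier A\<rangle>)"
  by (rule field_tensor_proj_dim[OF opposite_vs alg_simps(1) _ fin_A _ _ l _ F])
   (use a d l id dim_cong(1)[OF alg_simps(1), of Aop] fin_A in \<open>simp_all add: opposite_lin env_mult(3) alg_assoc module_hom_defs\<close>)
 moreover have "vdim (Aop\<langle>?P ` carrier Aop\<rangle>) = corner (e i) (e p)"
  unfolding corner_def by (rule dim_cong(2)[OF sub_vs[OF corner_sub]]) (use a sub_fin[OF corner_sub fin_A] in simp_all)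
 moreover have "vdim (Tens\<langle>?F ` carrier Tens\<rangle>) = alg_over.corner K Env (u (e p) (e q)) (u (e i) (e j))"
 proof -
  note c = alg_over.corner_sub[OF env_alg_over u_mem u_mem, OF a(1,2,3,4)]
  show ?thesis unfolding alg_over.corner_def[OF env_alg_over]
   by (rule dim_cong(2)[OF sub_vs[OF c]]) (use sub_fin[OF c env_fin[OF fin_A]] in \<open>simp_all add: env_simps(1-4)\<close>)
 qed
 ultimately show ?thesis by (simp add: corner_def)
qed

end

section \<open>A finite resolution of the regular bimodule\<close>

context alg_over
begin

declare regular_bimodule(2-7) [simp]

text \<open>The left A-module underlying a bimodule, in the guise of a right module over
  \<open>Aop\<close>, so that everything proved for right modules applies to it.\<close>

definition left_restriction :: "('k, 'm, ('a \<times> 'a \<Rightarrow> 'k) set) rmod \<Rightarrow> ('k, 'm, 'a) rmod" where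
 "left_restriction X = as_rmod X (\<lambda>x a. ract X x (u a \<one>\<^bsub>A\<^esub>))"

lemma left_restriction_simps [simp]:
 "carrier (left_restriction X) = carrier X" "\<zero>\<^bsub>left_restriction X\<^esub> = \<zero>\<^bsub>X\<^esub>" "add (left_restriction X) = add X"
 "smult (left_restriction X) = smult X" "ract (left_restriction X) x a = ract X x (u a \<one>\<^bsub>A\<^esub>)"
 by (simp_all add: left_restriction_def)

lemma opposite_over: "alg_over K Aop"
 by (intro alg_over.intro base_field_axioms alg_over_axioms.intro opposite_algebra)

lemma left_restriction_module:
 assumes X: "right_module K Env X"
 shows "right_module K Aop (left_restriction X)"
proof -
 note r = alg_over.rmodD[OF env_alg_over X] and b = linD[OF bilD(1)[OF env_bil]]
 show ?thesis
  by (rule alg_over.rmodI[OF opposite_over vs_cong[OF r(1)]])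
   (simp_all add: r b env_mult(3) r(8)[unfolded env_one])
qed

lemma left_restriction_hom:
 "f \<in> right_hom K Env X Y ==> f \<in> right_hom K Aop (left_restriction X) (left_restriction Y)"
 by (auto simp: right_hom_def module_hom_defs)

text \<open>\<open>A\<^sup>e\<close> is free as a left \<open>A\<close>-module, on a basis of the second tensor factor.\<close>

lemma restricted_free_lifts:
 assumes fin: "findim A" and X: "right_module K Aop X" and Y: "right_module K Aop Y"
 shows "alg_over.lifts K Aop (left_restriction (free_rmod Env J)) X Y"
 unfolding alg_over.lifts_def[OF opposite_over]
proof (intro ballI impI)
 let ?F = "free_rmod Env J"
 fix g f assume g: "g \<in> right_hom K Aop X Y" and f: "f \<in> right_hom K Aop (left_restriction ?F) Y"
  and sub: "f ` carrier (left_restriction ?F) \<subseteq> g ` carrier X"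
 interpret O: alg_over K Aop by (rule opposite_over)
 interpret E: alg_over K Env by (rule env_alg_over)
 note x = O.rmodD[OF X] and y = O.rmodD[OF Y] and f' = O.homD[OF f] and g' = O.homD[OF g]
 obtain b c where B: "has_basis A {..<vdim A} b c" using basis_exists[OF alg_simps(1) fin] by blast
 let ?I = "{..<vdim A}"
 note bA = has_basisD(2)[OF B] and cK = has_basisD(6)[OF B]
 have B': "has_basis (A\<langle>(\<lambda>x. x) ` carrier A\<rangle>) ?I b c" using B by simp
 \<comment> \<open>\<open>\<kappa> j\<close> is the coefficient at 1 \<otimes> b j. It intertwines
   the action of a \<otimes> 1 with multiplication by a (\<open>ka\<close>), so the elements 1
   \<otimes> b j form a basis over the first factor.\<close>
 obtain \<kappa> where k0: "\<And>j. j \<in> ?I ==> \<kappa> j \<in> lin K Tens Aop"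
  "\<And>j a b. j \<in> ?I ==> a <: Aop ==> b <: A ==> \<kappa> j (u a b) = c j b \<odot>\<^bsub>Aop\<^esub> a"
  "\<And>\<Phi> t. \<Phi> \<in> lin K Tens Tens ==> (\<And>m n. m <: Aop ==> n <: A ==> \<Phi> (u m n) = u m n) ==>
   t <: Tens ==> (\<Oplus>\<^bsub>Tens\<^esub> j\<in>?I. u (\<kappa> j t) (b j)) = \<Phi> t"
  by (rule field_tensor_coord[OF opposite_vs alg_simps(1) lin_id lin_id B']) blast
 note k = k0(1) k0(2)[simplified] k0(3)[OF lin_id refl]
 have kl: "\<kappa> j \<in> lin K Env A" if "j \<in> ?I" for j
  using k(1)[OF that] by (simp add: module_hom_defs env_simps(1-4))
 have kA: "\<kappa> j t <: A" if "j \<in> ?I" "t <: Env" for j t using linD(1)[OF kl that(2)] that(1) .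
 have sum: "(\<Oplus>\<^bsub>Env\<^esub> j\<in>?I. u (\<kappa> j t) (b j)) = t" if t: "t <: Env" for t
  using k(3) t by (simp add: env_simps(1-4) finsum_def finprod_def)
 have ka: "\<kappa> j (t \<otimes>\<^bsub>Env\<^esub> u a \<one>\<^bsub>A\<^esub>) = a \<otimes>\<^bsub>A\<^esub> \<kappa> j t" if j: "j \<in> ?I" and t: "t <: Env" and a: "a <: A" for j t a
  by (rule env_eq[OF alg_simps(1) lin_comp[OF env_mult(1) kl[OF j]] lin_comp[OF kl[OF j] mult_lin(1)[OF a]] _ t])
   (use a j cK in \<open>simp_all add: env_mult(3) k(2)\<close>)
 have s: "single Env i t <: ?F" if "i \<in> J" "t <: Env" for i t using E.free_single that .
 have "\<exists>v. i \<in> J \<longrightarrow> k \<in> ?I \<longrightarrow> v <: X \<and> g v = f (single Env i (u \<one>\<^bsub>A\<^esub> (b k)))" for i k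
 proof (cases "i \<in> J \<and> k \<in> ?I")
  case True
  then have "f (single Env i (u \<one>\<^bsub>A\<^esub> (b k))) \<in> g ` carrier X"
   using sub s[of i "u \<one>\<^bsub>A\<^esub> (b k)"] bA[of k] by (auto simp del: E.free_simps)
  then show ?thesis by (metis imageE)
 qed blast
 \<comment> \<open>v i k lifts the value of f at the basis element 1 \<otimes> b k of the i-th
   summand; these values determine h.\<close>
 then obtain v where v: "\<And>i k. i \<in> J ==> k \<in> ?I ==> v i k <: X"
  "\<And>i k. i \<in> J ==> k \<in> ?I ==> g (v i k) = f (single Env i (u \<one>\<^bsub>A\<^esub> (b k)))" by metis
 define h' where "h' i t = (\<Oplus>\<^bsub>X\<^esub> k\<in>?I. ract X (v i k) (\<kappa> k t))" for i t
 have hm: "ract X (v i k) (\<kappa> k t) <: X" if "i \<in> J" "k \<in> ?I" "t <: Env" for i k t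
  using x(2) v(1) kA that by simp
 have h'l: "h' i \<in> lin K Env X" if i: "i \<in> J" for i
  unfolding h'_def
 proof (rule lin_sum[OF x(1)])
  fix k assume k: "k \<in> ?I"
  have "(\<lambda>a. ract X (v i k) a) \<in> lin K A X" using v(1)[OF i k] x by (intro linI) simp_all
  then show "(\<lambda>t. ract X (v i k) (\<kappa> k t)) \<in> lin K Env X" by (rule lin_comp[OF kl[OF k]])
 qed
 define h where "h f = (\<Oplus>\<^bsub>X\<^esub> i\<in>{i. f i \<noteq> \<zero>\<^bsub>Env\<^esub>}. h' i (f i))" for f
 have h: "h \<in> lin K ?F X" "\<And>i t. i \<in> J ==> t <: Env ==> h (single Env i t) = h' i t"
  using fs_lift[OF env_vs E.free_fs x(1) h'l] by (simp_all add: h_def[abs_def])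
 have "h \<in> right_hom K Aop (left_restriction ?F) X"
 proof (rule O.homI)
  show "h \<in> lin K (left_restriction ?F) X" using h(1) by (simp add: module_hom_defs)
  fix m a assume m: "m <: (left_restriction ?F)" and a: "a <: Aop"
  have r: "(\<lambda>m. ract ?F m (u a \<one>\<^bsub>A\<^esub>)) \<in> lin K ?F ?F" "(\<lambda>m. ract X m a) \<in> lin K X X"
   using E.rmodD[OF E.free_rmod_module[of J]] x a by (auto intro!: linI simp del: E.free_simps)
  have "h (ract ?F m (u a \<one>\<^bsub>A\<^esub>)) = ract X (h m) a"
  proof (rule fs_lin_eq[OF env_vs E.free_fs x(1) lin_comp[OF r(1) h(1)] lin_comp[OF h(1) r(2)]])
   fix i t assume i: "i \<in> J" and t: "t <: Env"
   have "h (ract ?F (single Env i t) (u a \<one>\<^bsub>A\<^esub>)) = h' i (t \<otimes>\<^bsub>Env\<^esub> u a \<one>\<^bsub>A\<^esub>)"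
    using E.single_ract[OF t, of "u a \<one>\<^bsub>A\<^esub>" J i] h(2)[OF i] t a by (simp del: E.free_simps)
   also have "\<dots> = (\<Oplus>\<^bsub>X\<^esub> k\<in>?I. ract X (ract X (v i k) (\<kappa> k t)) a)"
    unfolding h'_def
   proof (intro vs_finsum_cong[OF x(1)] refl funcsetI)
    fix k assume k: "k \<in> ?I"
    show "ract X (ract X (v i k) (\<kappa> k t)) a <: X" using x(2)[OF hm[OF i k t] a] .
    show "ract X (v i k) (\<kappa> k (t \<otimes>\<^bsub>Env\<^esub> u a \<one>\<^bsub>A\<^esub>)) = ract X (ract X (v i k) (\<kappa> k t)) a"
     using x(7)[OF v(1)[OF i k], of "\<kappa> k t" a] kA[OF k t] ka[OF k t] a by simp
   qed
   also have "\<dots> = ract X (h' i t) a"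
    unfolding h'_def using hm[OF i _ t] by (intro lin_finsum[OF x(1) x(1) r(2), symmetric]) auto
   finally show "h (ract ?F (single Env i t) (u a \<one>\<^bsub>A\<^esub>)) = ract X (h (single Env i t)) a" using h(2)[OF i t] by simp
  qed (use m in simp)
  then show "h (ract (left_restriction ?F) m a) = ract X (h m) a" by simp
 qed
 moreover have "g (h m) = f m" if m: "m <: ?F" for m
 proof (rule fs_lin_eq[OF env_vs E.free_fs y(1) lin_comp[OF h(1) g'(1)] _ _ m])
  show fl: "f \<in> lin K ?F Y" using f'(1) by (simp add: module_hom_defs)
  fix i t assume i: "i \<in> J" and t: "t <: Env"
  have "g (h (single Env i t)) = (\<Oplus>\<^bsub>Y\<^esub> k\<in>?I. g (ract X (v i k) (\<kappa> k t)))"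
   unfolding h(2)[OF i t] h'_def using hm[OF i _ t] by (intro lin_finsum[OF x(1) y(1) g'(1)]) auto
  also have "\<dots> = (\<Oplus>\<^bsub>Y\<^esub> k\<in>?I. f (single Env i (u (\<kappa> k t) (b k))))"
  proof (intro vs_finsum_cong[OF y(1)] refl funcsetI)
   fix k assume k: "k \<in> ?I"
   have b1: "u \<one>\<^bsub>A\<^esub> (b k) <: Env" using bA[OF k] by simp
   have "f (ract ?F (single Env i (u \<one>\<^bsub>A\<^esub> (b k))) (u (\<kappa> k t) \<one>\<^bsub>A\<^esub>)) = ract Y (f (single Env i (u \<one>\<^bsub>A\<^esub> (b k)))) (\<kappa> k t)"
    using f'(2)[of "single Env i (u \<one>\<^bsub>A\<^esub> (b k))" "\<kappa> k t"] s[OF i b1] kA[OF k t] by simp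
   then show "g (ract X (v i k) (\<kappa> k t)) = f (single Env i (u (\<kappa> k t) (b k)))"
    using g'(2)[OF v(1)[OF i k], of "\<kappa> k t"] kA[OF k t] v(2)[OF i k] E.single_ract[OF b1, of "u (\<kappa> k t) \<one>\<^bsub>A\<^esub>" J i] bA[OF k]
    by (simp add: env_mult(3) del: E.free_simps)
   show "f (single Env i (u (\<kappa> k t) (b k))) <: Y" using linD(1)[OF fl] s[OF i] kA[OF k t] bA[OF k] by simp
  qed
  also have "\<dots> = f (single Env i (\<Oplus>\<^bsub>Env\<^esub> k\<in>?I. u (\<kappa> k t) (b k)))"
   using kA[OF _ t] bA by (intro lin_finsum[OF env_vs y(1) lin_comp[OF single_lin[OF env_vs E.free_fs i] fl], symmetric]) auto
  finally show "g (h (single Env i t)) = f (single Env i t)" using sum[OF t] by simp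
 qed
 ultimately show "\<exists>h\<in>right_hom K Aop (left_restriction ?F) X. \<forall>x\<in>carrier (left_restriction ?F). g (h x) = f x"
  by auto
qed

abbreviation (input) "Reg \<equiv> env_rmod K (regular_bimodule A)"

lemma regular_env:
 shows "right_module K Env Reg" "carrier Reg = carrier A" "\<zero>\<^bsub>Reg\<^esub> = \<zero>\<^bsub>A\<^esub>" "add Reg = add A" "smult Reg = smult A"
  and "\<And>m a b. m <: A ==> a <: A ==> b <: A ==> ract Reg m (u a b) = a \<otimes>\<^bsub>A\<^esub> m \<otimes>\<^bsub>A\<^esub> b"
 using env_modules(1,3)[OF regular_bimodule(1)] by (simp_all add: regular_bimodule(2-7))

text \<open>As a left module, A is free on 1, so \<epsilon> splits: with \<epsilon> x0 = 1, the map
  x \<mapsto> x0 (\<epsilon> x \<otimes> 1) in degree 0, extended by zero, lifts the identity of A.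
  The terms of F still have the lifting property over the first factor, so \<open>homotopy\<close>
  compares this map with the identity of F.\<close>

lemma contraction:
 assumes fin: "findim A" and F: "alg_over.resolves K Env Reg (\<lambda>l. free_rmod Env (J l)) d \<epsilon>"
 obtains \<sigma> x0 where "x0 <: (free_rmod Env (J 0))"
  "\<And>l. \<sigma> l \<in> right_hom K Aop (left_restriction (free_rmod Env (J l))) (left_restriction (free_rmod Env (J (Suc l))))"
  "\<And>x. x <: (free_rmod Env (J 0)) ==> x = ract (free_rmod Env (J 0)) x0 (u (\<epsilon> x) \<one>\<^bsub>A\<^esub>) \<oplus>\<^bsub>free_rmod Env (J 0)\<^esub> d 0 (\<sigma> 0 x)"
  "\<And>l x. x <: (free_rmod Env (J (Suc l))) ==>
   x = d (Suc l) (\<sigma> (Suc l) x) \<oplus>\<^bsub>free_rmod Env (J (Suc l))\<^esub> \<sigma> l (d l x)"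
proof -
 interpret O: alg_over K Aop by (rule opposite_over)
 interpret E: alg_over K Env by (rule env_alg_over)
 let ?F = "\<lambda>l. free_rmod Env (J l)" and ?R = "\<lambda>l. left_restriction (free_rmod Env (J l))"
 note f = E.resolvesD[OF F] and fr = E.rmodD[OF E.resolvesD(1)[OF F]] and R = left_restriction_module[OF E.resolvesD(1)[OF F]]
 have R': "O.resolves (left_restriction Reg) ?R d \<epsilon>"
  unfolding O.resolves_def
  using F[unfolded E.resolves_def] left_restriction_hom[OF f(2)] left_restriction_hom[OF f(3)] R by (simp del: E.free_simps)
 have "\<one>\<^bsub>A\<^esub> \<in> \<epsilon> ` carrier (?F 0)" unfolding f(4) regular_env(2) by simp
 then obtain x0 where x0: "x0 <: (?F 0)" "\<epsilon> x0 = \<one>\<^bsub>A\<^esub>" by auto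
 have \<epsilon>A: "\<epsilon> x <: A" if "x <: (?F 0)" for x using E.homD(3)[OF f(3) that] by (simp add: regular_env)
 have \<epsilon>l: "\<epsilon> \<in> lin K (?F 0) A" using E.homD(1)[OF f(3)] by (simp add: module_hom_defs regular_env)
 \<comment> \<open>A chain map: in degree 0 it annihilates boundaries, because \<epsilon>
   does.\<close>
 define \<phi> where "\<phi> l = (if l = (0::nat) then (\<lambda>x. ract (?F 0) x0 (u (\<epsilon> x) \<one>\<^bsub>A\<^esub>)) else (\<lambda>x. \<zero>\<^bsub>?F l\<^esub>))" for l
 have xl: "(\<lambda>t. ract (?F 0) x0 t) \<in> lin K Env (?F 0)" using fr x0(1) by (intro linI) (simp_all del: E.free_simps)
 have \<phi>0: "\<phi> 0 \<in> right_hom K Aop (?R 0) (?R 0)"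
 proof (rule O.homI)
  have "(\<lambda>x. ract (?F 0) x0 (u (\<epsilon> x) \<one>\<^bsub>A\<^esub>)) \<in> lin K (?F 0) (?F 0)"
   by (rule lin_comp[OF \<epsilon>l lin_comp[OF bilD(1)[OF env_bil] xl]]) simp
  then show "\<phi> 0 \<in> lin K (?R 0) (?R 0)" by (simp add: \<phi>_def module_hom_defs del: E.free_simps)
  show "\<phi> 0 (ract (?R 0) m a) = ract (?R 0) (\<phi> 0 m) a" if m: "m <: (?R 0)" and a: "a <: Aop" for m a
  proof -
   have m': "m <: (?F 0)" using m by simp
   have "\<epsilon> (ract (?F 0) m (u a \<one>\<^bsub>A\<^esub>)) = a \<otimes>\<^bsub>A\<^esub> \<epsilon> m"
    using E.homD(2)[OF f(3) m', of "u a \<one>\<^bsub>A\<^esub>"] \<epsilon>A[OF m'] a by (simp add: regular_env del: E.free_simps)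
   moreover have "ract (?F 0) (ract (?F 0) x0 (u (\<epsilon> m) \<one>\<^bsub>A\<^esub>)) (u a \<one>\<^bsub>A\<^esub>) = ract (?F 0) x0 (u (a \<otimes>\<^bsub>A\<^esub> \<epsilon> m) \<one>\<^bsub>A\<^esub>)"
    using fr(7)[OF x0(1), of "u (\<epsilon> m) \<one>\<^bsub>A\<^esub>" "u a \<one>\<^bsub>A\<^esub>"] \<epsilon>A[OF m'] a by (simp add: env_mult(3) del: E.free_simps)
   ultimately show ?thesis by (simp add: \<phi>_def del: E.free_simps)
  qed
 qed
 have \<phi>h: "\<phi> l \<in> right_hom K Aop (?R l) (?R l)" for l
  using \<phi>0 O.hom_zero[OF R R] by (cases l) (simp_all add: \<phi>_def del: E.free_simps)
 have l: "O.lifts (?R l) (?R (Suc l)) (?R l)" for l by (rule restricted_free_lifts[OF fin R R])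
 obtain \<sigma> where \<sigma>: "\<And>l. \<sigma> l \<in> right_hom K Aop (?R l) (?R (Suc l))"
  "\<And>x. x <: (?R 0) ==> x = \<phi> 0 x \<oplus>\<^bsub>?R 0\<^esub> d 0 (\<sigma> 0 x)"
  "\<And>l x. x <: (?R (Suc l)) ==> x = \<phi> (Suc l) x \<oplus>\<^bsub>?R (Suc l)\<^esub> (d (Suc l) (\<sigma> (Suc l) x) \<oplus>\<^bsub>?R (Suc l)\<^esub> \<sigma> l (d l x))"
 proof (rule O.homotopy[OF R' l \<phi>h])
  show "\<epsilon> (\<phi> 0 x) = \<epsilon> x" if "x <: (?R 0)" for x
  proof -
   have x: "x <: (?F 0)" using that by simp
   show ?thesis using E.homD(2)[OF f(3) x0(1), of "u (\<epsilon> x) \<one>\<^bsub>A\<^esub>"] x0(2) \<epsilon>A[OF x] by (simp add: \<phi>_def regular_env del: E.free_simps)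
  qed
  show "d l (\<phi> (Suc l) x) = \<phi> l (d l x)" if "x <: (?R (Suc l))" for l x
  proof -
   have x: "x <: (?F (Suc l))" using that by simp
   have z: "d l \<zero>\<^bsub>?F (Suc l)\<^esub> = \<zero>\<^bsub>?F l\<^esub>" by (rule E.hom_z[OF f(1,1,2)])
   show ?thesis
   proof (cases l)
    case 0
    have "\<epsilon> (d 0 x) = \<zero>\<^bsub>A\<^esub>" using f(5) x 0 by (simp add: regular_env del: E.free_simps)
    moreover have "ract (?F 0) x0 (u \<zero>\<^bsub>A\<^esub> \<one>\<^bsub>A\<^esub>) = \<zero>\<^bsub>?F 0\<^esub>"
     using lin_zero[OF alg_simps(1) fr(1) lin_comp[OF bilD(1)[OF env_bil alg_simps(4)] xl]] .
    ultimately show ?thesis using z 0 by (simp add: \<phi>_def del: E.free_simps)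
   qed (use z in \<open>simp add: \<phi>_def del: E.free_simps\<close>)
  qed
 qed blast
 show thesis
 proof (rule that[OF x0(1) \<sigma>(1)])
  show "x = ract (?F 0) x0 (u (\<epsilon> x) \<one>\<^bsub>A\<^esub>) \<oplus>\<^bsub>?F 0\<^esub> d 0 (\<sigma> 0 x)" if "x <: (?F 0)" for x
   using \<sigma>(2)[of x] that by (simp add: \<phi>_def del: E.free_simps)
  show "x = d (Suc l) (\<sigma> (Suc l) x) \<oplus>\<^bsub>?F (Suc l)\<^esub> \<sigma> l (d l x)" if x: "x <: (?F (Suc l))" for l x
  proof -
   have c: "d (Suc l) (\<sigma> (Suc l) x) <: (?F (Suc l))" "\<sigma> l (d l x) <: (?F (Suc l))"
    using x E.homD(3)[OF f(2)] O.homD(3)[OF \<sigma>(1)] by (simp_all del: E.free_simps)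
   have "x = \<zero>\<^bsub>?F (Suc l)\<^esub> \<oplus>\<^bsub>?F (Suc l)\<^esub> (d (Suc l) (\<sigma> (Suc l) x) \<oplus>\<^bsub>?F (Suc l)\<^esub> \<sigma> l (d l x))"
    using \<sigma>(3)[of x l] x by (simp add: \<phi>_def del: E.free_simps)
   then show ?thesis using c vs_l_zero[OF fr(1)] vs_add[OF fr(1) c] by metis
  qed
 qed
qed

end

section \<open>Reduction of free bimodules along a character of the first factor\<close>

context basic_algebra
begin

text \<open>The canonical map from A^e to its reduction, the simple module S_p tensored over A with
  the left module A^e; this reduction is A, as a right module.\<close>

definition contract :: "'s \<Rightarrow> ('a \<times> 'a \<Rightarrow> 'k) set \<Rightarrow> 'a" where
 "contract p = presented_lift K A (\<lambda>(a, b). \<chi> p a \<odot>\<^bsub>A\<^esub> b)"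

lemma contract:
 assumes p: "p \<in> S"
 shows "contract p \<in> lin K Env A"
  and "\<And>a b. a <: A ==> b <: A ==> contract p (u a b) = \<chi> p a \<odot>\<^bsub>A\<^esub> b"
  and "\<And>x a b. x <: Env ==> a <: A ==> b <: A ==>
   contract p (x \<otimes>\<^bsub>Env\<^esub> u a b) = \<chi> p a \<odot>\<^bsub>A\<^esub> (contract p x \<otimes>\<^bsub>A\<^esub> b)"
proof -
 have "bil A A A (\<lambda>a b. \<chi> p a \<odot>\<^bsub>A\<^esub> b)"
  by (intro bilI linI) (use \<chi>D[OF p] in \<open>simp_all add: vs_add_smult vs_smult_add vs_smult_smult m_comm\<close>)
 note l = env_lift[OF alg_simps(1) this, folded contract_def]
 show c: "contract p \<in> lin K Env A"
  and e: "\<And>a b. a <: A ==> b <: A ==> contract p (u a b) = \<chi> p a \<odot>\<^bsub>A\<^esub> b" using l by auto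
 show "contract p (x \<otimes>\<^bsub>Env\<^esub> u a b) = \<chi> p a \<odot>\<^bsub>A\<^esub> (contract p x \<otimes>\<^bsub>A\<^esub> b)"
  if x: "x <: Env" and a: "a <: A" and b: "b <: A" for x a b
  by (rule env_eq[OF alg_simps(1) lin_comp[OF env_mult(1) c] lin_smult[OF alg_simps(1) lin_comp[OF c mult_lin(2)[OF b]] \<chi>D(1)[OF p a]] _ x])
   (use a b \<chi>D(1)[OF p] \<chi>_mult[OF p] in \<open>simp_all add: env_mult(3) e vs_smult_smult\<close>)
qed

definition proj :: "'s \<Rightarrow> ('i \<Rightarrow> ('a \<times> 'a \<Rightarrow> 'k) set) \<Rightarrow> 'i \<Rightarrow> 'a" where
 "proj p f = (\<lambda>j. contract p (f j))"

text \<open>A common section of all \<open>proj p\<close>. It respects the right action only, so a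
  map on the reduced module is defined as proj, after the original map, after incl.\<close>

definition incl :: "('i \<Rightarrow> 'a) \<Rightarrow> 'i \<Rightarrow> ('a \<times> 'a \<Rightarrow> 'k) set" where
 "incl g = (\<lambda>j. u \<one>\<^bsub>A\<^esub> (g j))"

lemma env_free_simps:
 "\<zero>\<^bsub>free_rmod Env I\<^esub> = (\<lambda>i. \<zero>\<^bsub>Env\<^esub>)" "f \<oplus>\<^bsub>free_rmod Env I\<^esub> g = (\<lambda>i. f i \<oplus>\<^bsub>Env\<^esub> g i)"
 "c \<odot>\<^bsub>free_rmod Env I\<^esub> f = (\<lambda>i. c \<odot>\<^bsub>Env\<^esub> f i)" "ract (free_rmod Env I) f a = (\<lambda>i. f i \<otimes>\<^bsub>Env\<^esub> a)"
 by (simp_all add: free_rmod_def)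

lemmas env_free_mem = alg_over.free_mem[OF env_alg_over]

lemma proj:
 assumes p: "p \<in> S"
 shows "proj p \<in> lin K (free_rmod Env J) (free_rmod A J)"
  and "\<And>f a b. f <: (free_rmod Env J) ==> a <: A ==> b <: A ==>
   proj p (ract (free_rmod Env J) f (u a b)) = \<chi> p a \<odot>\<^bsub>free_rmod A J\<^esub> ract (free_rmod A J) (proj p f) b"
proof -
 note c = linD[OF contract(1)[OF p]] and z = lin_zero[OF env_vs alg_simps(1) contract(1)[OF p]]
 show "proj p \<in> lin K (free_rmod Env J) (free_rmod A J)"
 proof (rule linI)
  show "proj p f <: (free_rmod A J)" if f: "f <: (free_rmod Env J)" for f
  proof -
   have "{i. contract p (f i) \<noteq> \<zero>\<^bsub>A\<^esub>} \<subseteq> {i. f i \<noteq> \<zero>\<^bsub>Env\<^esub>}" using z by auto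
   then show ?thesis using f c(1) z by (auto simp: free_mem env_free_mem proj_def intro: finite_subset)
  qed
 qed (use c in \<open>auto simp: proj_def env_free_simps env_free_mem\<close>)
qed (simp add: proj_def env_free_simps env_free_mem contract(3)[OF p])

lemma incl:
 shows "incl \<in> lin K (free_rmod A J) (free_rmod Env J)"
  and "\<And>g b. g <: (free_rmod A J) ==> b <: A ==>
   incl (ract (free_rmod A J) g b) = ract (free_rmod Env J) (incl g) (u \<one>\<^bsub>A\<^esub> b)"
  and "\<And>p g. p \<in> S ==> g <: (free_rmod A J) ==> proj p (incl g) = g"
proof -
 note b = bilD(2)[OF env_bil alg_simps(4)]
 note c = linD[OF b] and z = lin_zero[OF alg_simps(1) env_vs b]
 show "incl \<in> lin K (free_rmod A J) (free_rmod Env J)"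
 proof (rule linI)
  show "incl g <: (free_rmod Env J)" if g: "g <: (free_rmod A J)" for g
  proof -
   have "finite {i. u \<one>\<^bsub>A\<^esub> (g i) \<noteq> \<zero>\<^bsub>Env\<^esub>}"
    by (rule finite_subset[of _ "{i. g i \<noteq> \<zero>\<^bsub>A\<^esub>}"]) (use g z in \<open>auto simp: free_mem\<close>)
   then show ?thesis using g c(1) z unfolding env_free_mem free_mem incl_def by simp
  qed
 qed (simp_all add: incl_def env_free_simps free_mem c(2,3))
 show "incl (ract (free_rmod A J) g b) = ract (free_rmod Env J) (incl g) (u \<one>\<^bsub>A\<^esub> b)"
  if "g <: (free_rmod A J)" "b <: A" for g b
  using that by (simp add: incl_def env_free_simps free_mem env_mult(3))
 show "proj p (incl g) = g" if "p \<in> S" "g <: (free_rmod A J)" for p g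
  using that by (simp add: incl_def proj_def free_mem contract(2) \<chi>_one)
qed

text \<open>A map on which a \<otimes> 1 acts through \<chi> p is a map out of the reduction, so it
  cannot tell x from the representative incl (proj p x). It is enough to compare values at
  elementary tensors, since u a b equals (1 \<otimes> b)(a \<otimes> 1).\<close>

lemma twisted_factor:
 assumes p: "p \<in> S" and W: "vectorspace K W" and t: "t \<in> lin K (free_rmod Env J) W"
  and tw: "\<And>x a. x <: (free_rmod Env J) ==> a <: A ==>
   t (ract (free_rmod Env J) x (u a \<one>\<^bsub>A\<^esub>)) = \<chi> p a \<odot>\<^bsub>W\<^esub> t x"
  and x: "x <: (free_rmod Env J)"
 shows "t (incl (proj p x)) = t x"
proof (rule fs_lin_eq[OF env_vs alg_over.free_fs[OF env_alg_over] W lin_comp[OF lin_comp[OF proj(1)[OF p] incl(1)] t] t _ x])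
 fix i s assume i: "i \<in> J" and s: "s <: Env"
 note sl = single_lin[OF env_vs alg_over.free_fs[OF env_alg_over] i]
 show "t (incl (proj p (single Env i s))) = t (single Env i s)"
 proof (rule env_eq[OF W lin_comp[OF sl lin_comp[OF lin_comp[OF proj(1)[OF p] incl(1)] t]] lin_comp[OF sl t] _ s])
  fix a b assume a: "a <: A" and b: "b <: A"
  have z: "contract p \<zero>\<^bsub>Env\<^esub> = \<zero>\<^bsub>A\<^esub>" "u \<one>\<^bsub>A\<^esub> \<zero>\<^bsub>A\<^esub> = \<zero>\<^bsub>Env\<^esub>"
   using lin_zero[OF env_vs alg_simps(1) contract(1)[OF p]] lin_zero[OF alg_simps(1) env_vs bilD(2)[OF env_bil alg_simps(4)]] by auto
  have "incl (proj p (single Env i (u a b))) = \<chi> p a \<odot>\<^bsub>free_rmod Env J\<^esub> single Env i (u \<one>\<^bsub>A\<^esub> b)"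
   using a b z \<chi>D(1)[OF p a] linD(3)[OF bilD(2)[OF env_bil alg_simps(4)]] contract(2)[OF p]
   by (auto simp: incl_def proj_def single_def env_free_simps fun_eq_iff)
  then have "t (incl (proj p (single Env i (u a b)))) = \<chi> p a \<odot>\<^bsub>W\<^esub> t (single Env i (u \<one>\<^bsub>A\<^esub> b))"
   using linD(3)[OF t \<chi>D(1)[OF p a]] linD(1)[OF sl] b by simp
  also have "\<dots> = t (ract (free_rmod Env J) (single Env i (u \<one>\<^bsub>A\<^esub> b)) (u a \<one>\<^bsub>A\<^esub>))"
   using tw[OF linD(1)[OF sl]] a b by simp
  also have "ract (free_rmod Env J) (single Env i (u \<one>\<^bsub>A\<^esub> b)) (u a \<one>\<^bsub>A\<^esub>) = single Env i (u a b)"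
   using alg_over.single_ract[OF env_alg_over, of "u \<one>\<^bsub>A\<^esub> b" "u a \<one>\<^bsub>A\<^esub>" J i] a b by (simp add: env_mult(3) env_free_simps)
  finally show "t (incl (proj p (single Env i (u a b)))) = t (single Env i (u a b))" .
 qed
qed

text \<open>Reducing a free resolution of \<open>A\<close> over \<open>A\<^sup>e\<close> along \<open>\<chi> p\<close> in the first factor gives a free
 resolution of the simple module of \<open>p\<close> over \<open>A\<close>: exactness survives since the resolution is
 contractible as a complex of left modules.\<close>

lemma reduced_resolution:
 fixes J :: "nat \<Rightarrow> 'i set"
 assumes p: "p \<in> S" and F: "alg_over.resolves K Env Reg (\<lambda>l. free_rmod Env (J l)) d \<epsilon>"
 shows "resolves (simple p) (\<lambda>l. free_rmod A (J l)) (\<lambda>l g. proj p (d l (incl g))) (\<lambda>g. \<chi> p (\<epsilon> (incl g)))"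
  and "\<And>l x. x <: (free_rmod Env (J (Suc l))) ==> proj p (d l x) = proj p (d l (incl (proj p x)))"
proof -
 let ?F = "\<lambda>l. free_rmod Env (J l)" and ?G = "\<lambda>l. free_rmod A (J l)"
 note f = alg_over.resolvesD[OF env_alg_over F] and fv = alg_over.rmodD(1)[OF env_alg_over alg_over.resolvesD(1)[OF env_alg_over F]]
 have G: "rmodule (?G l)" for l by (rule free_rmod_module)
 note gv = rmodD(1)[OF G] and Gr = rmodD[OF G]
 note hD = alg_over.homD[OF env_alg_over]
 note P = proj[OF p] and I = incl(1,2) incl(3)[OF p] and D = hD[OF f(2)] and x = \<chi>D[OF p]
 have Gc: "proj p y <: (?G l)" if "y <: (?F l)" for y l using linD(1)[OF P(1) that] .
 have Ic: "incl y <: (?F l)" if "y <: (?G l)" for y l using linD(1)[OF I(1) that] .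
 have P1: "proj p (ract (?F l) y (u a \<one>\<^bsub>A\<^esub>)) = \<chi> p a \<odot>\<^bsub>?G l\<^esub> proj p y" if "y <: (?F l)" "a <: A" for y a l
  using P(2)[OF that alg_simps(4)] Gr(8)[OF Gc[OF that(1)]] by (simp del: free_simps)
 \<comment> \<open>x \<mapsto> proj p (d l x) is twisted by \<chi> p, because d l commutes with a
   \<otimes> 1. The same argument serves for \<epsilon> in \<open>comm0\<close> and for the
   contraction in \<open>\<sigma>t\<close>.\<close>
 show comm: "proj p (d l y) = proj p (d l (incl (proj p y)))" if y: "y <: (?F (Suc l))" for l y
  by (rule twisted_factor[OF p gv lin_comp[OF D(1) P(1)] _ y, symmetric]) (use D(2,3) P1 in \<open>simp del: free_simps\<close>)
 have \<epsilon>A: "\<epsilon> y <: A" if "y <: (?F 0)" for y using hD(3)[OF f(3) that] by simp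
 have \<epsilon>l: "\<epsilon> \<in> lin K (?F 0) A" using hD(1)[OF f(3)] by (simp add: module_hom_defs)
 have \<epsilon>u: "\<epsilon> (ract (?F 0) y (u a b)) = a \<otimes>\<^bsub>A\<^esub> \<epsilon> y \<otimes>\<^bsub>A\<^esub> b" if "y <: (?F 0)" "a <: A" "b <: A" for y a b
  using hD(2)[OF f(3) that(1), of "u a b"] regular_env(6)[OF \<epsilon>A[OF that(1)]] that by simp
 have comm0: "\<chi> p (\<epsilon> y) = \<chi> p (\<epsilon> (incl (proj p y)))" if y: "y <: (?F 0)" for y
  by (rule twisted_factor[OF p scal_vs lin_comp[OF \<epsilon>l \<chi>_lin[OF p]] _ y, symmetric])
   (use \<epsilon>u \<epsilon>A \<chi>_mult[OF p] in simp)
 obtain \<sigma> x0 where x0: "x0 <: (?F 0)"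
  and \<sigma>: "\<And>l. \<sigma> l \<in> right_hom K Aop (left_restriction (?F l)) (left_restriction (?F (Suc l)))"
  and \<sigma>0: "\<And>x. x <: (?F 0) ==> x = ract (?F 0) x0 (u (\<epsilon> x) \<one>\<^bsub>A\<^esub>) \<oplus>\<^bsub>?F 0\<^esub> d 0 (\<sigma> 0 x)"
  and \<sigma>d: "\<And>l x. x <: (?F (Suc l)) ==> x = d (Suc l) (\<sigma> (Suc l) x) \<oplus>\<^bsub>?F (Suc l)\<^esub> \<sigma> l (d l x)"
  by (rule contraction[OF fin_A F]) blast
 note oD = alg_over.homD[OF opposite_over \<sigma>]
 have \<sigma>l: "\<sigma> l \<in> lin K (?F l) (?F (Suc l))" for l using oD(1)[of l] by (simp add: module_hom_defs)
 have \<sigma>t: "proj p (\<sigma> l (incl (proj p y))) = proj p (\<sigma> l y)" if y: "y <: (?F l)" for l y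
  by (rule twisted_factor[OF p gv lin_comp[OF \<sigma>l P(1)] _ y]) (use oD(2) linD(1)[OF \<sigma>l] P1 in \<open>simp del: free_simps\<close>)
 let ?d = "\<lambda>l g. proj p (d l (incl g))" and ?e = "\<lambda>g. \<chi> p (\<epsilon> (incl g))"
 have dh: "?d l \<in> rhom (?G (Suc l)) (?G l)" for l
 proof (rule homI[OF lin_comp[OF I(1) lin_comp[OF D(1) P(1)]]])
  show "?d l (ract (?G (Suc l)) m a) = ract (?G l) (?d l m) a" if m: "m <: (?G (Suc l))" and a: "a <: A" for m a
   using I(2)[OF m a] D(2)[OF Ic[OF m], of "u \<one>\<^bsub>A\<^esub> a"] P(2)[OF D(3)[OF Ic[OF m]] alg_simps(4) a] a
    \<chi>_one[OF p] Gr(2)[OF Gc[OF D(3)[OF Ic[OF m]]] a] gv by (simp del: free_simps)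
 qed
 have eh: "?e \<in> rhom (?G 0) (simple p)"
 proof (rule homI)
  show "?e \<in> lin K (?G 0) (simple p)"
   using lin_comp[OF I(1) lin_comp[OF \<epsilon>l \<chi>_lin[OF p]]] by (simp add: module_hom_defs)
  show "?e (ract (?G 0) m a) = ract (simple p) (?e m) a" if m: "m <: (?G 0)" and a: "a <: A" for m a
   using I(2)[OF m a] \<epsilon>u[OF Ic[OF m], of "\<one>\<^bsub>A\<^esub>" a] \<epsilon>A[OF Ic[OF m]] a \<chi>_mult[OF p] by (simp del: free_simps)
 qed
 have ed: "?e (?d 0 g) = \<zero>" if g: "g <: (?G (Suc 0))" for g
  using comm0[OF D(3)[OF Ic[OF g]]] f(5) Ic[OF g] lin_zero[OF alg_simps(1) scal_vs \<chi>_lin[OF p]] by simp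
 have dd: "?d l (?d (Suc l) g) = \<zero>\<^bsub>?G l\<^esub>" if g: "g <: (?G (Suc (Suc l)))" for l g
  using comm[OF D(3)[OF Ic[OF g]]] f(7)[OF Ic[OF g]] lin_zero[OF fv gv P(1)] by (simp del: free_simps)
 have ex0: "g \<in> ?d 0 ` carrier (?G (Suc 0))" if g: "g <: (?G 0)" "?e g = \<zero>" for g
 proof (rule image_eqI)
  let ?i = "incl g"
  note i = Ic[OF g(1)]
  have c: "ract (?F 0) x0 (u (\<epsilon> ?i) \<one>\<^bsub>A\<^esub>) <: (?F 0)" "\<sigma> 0 ?i <: (?F (Suc 0))"
   using alg_over.rmodD(2)[OF env_alg_over f(1) x0] \<epsilon>A[OF i] linD(1)[OF \<sigma>l i] by simp_all
  \<comment> \<open>The contraction writes incl g as x0 (\<epsilon> \<otimes> 1) plus a boundary.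
    Reduction turns the first summand into the multiple of proj p x0 by \<chi> p (\<epsilon> (incl
    g)), which is zero.\<close>
  have "g = proj p (ract (?F 0) x0 (u (\<epsilon> ?i) \<one>\<^bsub>A\<^esub>) \<oplus>\<^bsub>?F 0\<^esub> d 0 (\<sigma> 0 ?i))" using I(3)[OF g(1)] \<sigma>0[OF i] by simp
  also have "\<dots> = proj p (d 0 (\<sigma> 0 ?i))"
   using linD(2)[OF P(1) c(1) D(3)[OF c(2)]] P1[OF x0 \<epsilon>A[OF i]] g(2) gv Gc[OF x0] Gc[OF D(3)[OF c(2)]] by (simp del: free_simps)
  also have "\<dots> = ?d 0 (proj p (\<sigma> 0 ?i))" by (rule comm[OF c(2)])
  finally show "g = ?d 0 (proj p (\<sigma> 0 ?i))" .
  show "proj p (\<sigma> 0 ?i) <: (?G (Suc 0))" using Gc[OF c(2)] .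
 qed
 have exS: "g \<in> ?d (Suc l) ` carrier (?G (Suc (Suc l)))" if g: "g <: (?G (Suc l))" "?d l g = \<zero>\<^bsub>?G l\<^esub>" for l g
 proof (rule image_eqI)
  let ?i = "incl g"
  note i = Ic[OF g(1)]
  have c: "\<sigma> (Suc l) ?i <: (?F (Suc (Suc l)))" "\<sigma> l (d l ?i) <: (?F (Suc l))"
   using linD(1)[OF \<sigma>l i] linD(1)[OF \<sigma>l D(3)[OF i]] by simp_all
  \<comment> \<open>d l (incl g) itself need not vanish, only its reduction does; since \<sigma>
    respects the left action, the reduction of its value depends on nothing more.\<close>
  have "proj p (\<sigma> l (d l ?i)) = proj p (\<sigma> l (incl \<zero>\<^bsub>?G l\<^esub>))" using \<sigma>t[OF D(3)[OF i]] g(2) by simp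
  also have "\<dots> = \<zero>\<^bsub>?G (Suc l)\<^esub>" using lin_zero[OF gv gv lin_comp[OF I(1) lin_comp[OF \<sigma>l P(1)]]] .
  finally have z: "proj p (\<sigma> l (d l ?i)) = \<zero>\<^bsub>?G (Suc l)\<^esub>" .
  have "g = proj p (d (Suc l) (\<sigma> (Suc l) ?i) \<oplus>\<^bsub>?F (Suc l)\<^esub> \<sigma> l (d l ?i))" using I(3)[OF g(1)] \<sigma>d[OF i] by simp
  also have "\<dots> = proj p (d (Suc l) (\<sigma> (Suc l) ?i))"
   using linD(2)[OF P(1) D(3)[OF c(1)] c(2)] z gv Gc[OF D(3)[OF c(1)]] by (simp del: free_simps)
  also have "\<dots> = ?d (Suc l) (proj p (\<sigma> (Suc l) ?i))" by (rule comm[OF c(1)])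
  finally show "g = ?d (Suc l) (proj p (\<sigma> (Suc l) ?i))" .
  show "proj p (\<sigma> (Suc l) ?i) <: (?G (Suc (Suc l)))" using Gc[OF c(1)] .
 qed
 have surj: "?e ` carrier (?G 0) = carrier (simple p)"
 proof
  have "\<one>\<^bsub>A\<^esub> \<in> \<epsilon> ` carrier (?F 0)" unfolding f(4) by simp
  then obtain y where y: "y <: (?F 0)" "\<epsilon> y = \<one>\<^bsub>A\<^esub>" by auto
  have y1: "?e (proj p y) = \<one>" using comm0[OF y(1)] y(2) \<chi>_one[OF p] by simp
  show "carrier (simple p) \<subseteq> ?e ` carrier (?G 0)"
  proof
   fix c assume c: "c <: (simple p)"
   then have c': "c <: K" by simp
   note ss = simple_surj[OF p eh Gc[OF y(1)] y1 c' G]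
   show "c \<in> ?e ` carrier (?G 0)" by (rule image_eqI) (rule ss(2)[symmetric], rule ss(1))
  qed
 qed (use homD(3)[OF eh] in blast)
 have e0: "?d 0 ` carrier (?G (Suc 0)) = {g \<in> carrier (?G 0). ?e g = \<zero>}"
  using ed ex0 homD(3)[OF dh] by blast
 have eS: "?d (Suc l) ` carrier (?G (Suc (Suc l))) = {g \<in> carrier (?G (Suc l)). ?d l g = \<zero>\<^bsub>?G l\<^esub>}" for l
  using dd exS homD(3)[OF dh] by blast
 show "resolves (simple p) ?G ?d ?e"
  unfolding resolves_def using G dh eh surj e0 eS by (simp del: free_simps)
qed

text \<open>Extend the composite h \<eta> from Z to the free module, lift the extension through h,
  and subtract the lift from \<eta>. The difference takes values in ker h, where the induction
  hypothesis extends it.\<close>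

lemma hom_extension:
 assumes Z: "submod (free_rmod A I) Z"
  and ex: "\<And>s \<eta>. s \<in> S ==> \<eta> \<in> rhom ((free_rmod A I)\<langle>Z\<rangle>) (simple s) ==>
   \<exists>\<xi>\<in>rhom (free_rmod A I) (simple s). \<forall>z\<in>Z. \<xi> z = \<eta> z"
  and N: "rmodule (N :: ('k, 'm, 'a) rmod)" and fin: "findim N"
  and \<eta>: "\<eta> \<in> rhom ((free_rmod A I)\<langle>Z\<rangle>) N"
 shows "\<exists>\<xi>\<in>rhom (free_rmod A I) N. \<forall>z\<in>Z. \<xi> z = \<eta> z"
 using N fin \<eta>
proof (induction arbitrary: \<eta> rule: fd_induct)
 case (zero N)
 have "\<eta> z = \<zero>\<^bsub>N\<^esub>" if "z \<in> Z" for z using homD(3)[OF zero(4), of z] that zero(3) by simp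
 then show ?case by (intro bexI[OF _ hom_zero[OF free_rmod_module zero(1)]]) simp
next
 case (step N s h n)
 let ?F = "free_rmod A I" and ?N = "N\<langle>{x \<in> carrier N. h x = \<zero>}\<rangle>"
 note F = free_rmod_module[of I] and V = rmodD(1)[OF step(1)] and Zm = submod_rmod[OF Z]
 obtain \<psi> where \<psi>: "\<psi> \<in> rhom ?F (simple s)" "\<And>z. z \<in> Z ==> \<psi> z = h (\<eta> z)"
  using ex[OF step(3) hom_comp[OF step(10,4)]] by blast
 have "\<psi> x \<in> h ` carrier N" if x: "x <: ?F" for x
 proof -
  have "\<psi> x <: K" using homD(3)[OF \<psi>(1) x] by simp
  note ss = simple_surj[OF step(3,4,5,6) this step(1)]
  show ?thesis by (rule image_eqI) (rule ss(2)[symmetric], rule ss(1))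
 qed
 then obtain \<psi>' where \<psi>': "\<psi>' \<in> rhom ?F N" "\<And>x. x <: ?F ==> h (\<psi>' x) = \<psi> x"
  using liftsD[OF free_lifts[OF step(1) simple_module(1)[OF step(3)]] step(4) \<psi>(1)] by metis
 have ZF: "z <: ?F" if "z \<in> Z" for z using submodD(4)[OF Z that] .
 let ?\<delta> = "\<lambda>z. \<eta> z \<oplus>\<^bsub>N\<^esub> (\<ominus> \<one>) \<odot>\<^bsub>N\<^esub> \<psi>' z"
 have \<psi>Z: "\<psi>' \<in> rhom (?F\<langle>Z\<rangle>) N" using hom_comp[OF submod_incl[OF Z] \<psi>'(1)] .
 have \<delta>: "?\<delta> \<in> rhom (?F\<langle>Z\<rangle>) N"
  by (rule hom_sub[OF step(1,10) \<psi>Z])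
 have h\<delta>: "h (?\<delta> z) = \<zero>" if z: "z \<in> Z" for z
 proof -
  have c: "\<eta> z <: N" "\<psi>' z <: N" using homD(3)[OF step(10), of z] homD(3)[OF \<psi>'(1) ZF[OF z]] z by simp_all
  have "h (?\<delta> z) = h (\<eta> z) \<oplus> (\<ominus> \<one>) \<otimes> h (\<psi>' z)"
   using homD(4)[OF step(4) c(1), of "(\<ominus> \<one>) \<odot>\<^bsub>N\<^esub> \<psi>' z"] homD(5)[OF step(4) _ c(2), of "\<ominus> \<one>"] c V by simp
  then show ?thesis using \<psi>(2)[OF z] \<psi>'(2)[OF ZF[OF z]] homD(3)[OF step(4) c(1)] by (simp add: r_neg l_minus)
 qed
 have "?\<delta> \<in> rhom (?F\<langle>Z\<rangle>) ?N"
  by (rule hom_corestrict[OF \<delta>]) (use homD(3)[OF \<delta>] h\<delta> in simp)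
 from step(9)[OF this] obtain \<rho> where \<rho>: "\<rho> \<in> rhom ?F ?N" "\<And>z. z \<in> Z ==> \<rho> z = ?\<delta> z" by blast
 have \<rho>': "\<rho> \<in> rhom ?F N" using homD[OF \<rho>(1)] by (intro homI linI) (simp_all del: free_simps)
 have "\<rho> z \<oplus>\<^bsub>N\<^esub> \<psi>' z = \<eta> z" if z: "z \<in> Z" for z
 proof -
  have c: "\<eta> z <: N" "\<psi>' z <: N" using homD(3)[OF step(10), of z] homD(3)[OF \<psi>'(1) ZF[OF z]] z by simp_all
  then show ?thesis using \<rho>(2)[OF z] V by (simp add: vs_assoc)
 qed
 then show ?case by (intro bexI[OF _ hom_add[OF step(1) \<rho>' \<psi>'(1)]]) simp
qed

text \<open>A single L serves for all simple A-modules, so one syzygy Z in F L allows the extension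
  of maps to every simple A^e-module. Truncation there accounts for Suc L.\<close>

lemma regular_resolution:
 assumes L: "\<And>s. s \<in> S ==> \<exists>(Q :: nat \<Rightarrow> ('k, 'q, 'a) rmod) d \<epsilon>. fin_resolution (simple s) Q d \<epsilon> L"
  and inf: "infinite (UNIV :: 'i set)"
 shows "\<exists>(Q :: nat \<Rightarrow> ('k, 'i \<Rightarrow> ('a \<times> 'a \<Rightarrow> 'k) set, ('a \<times> 'a \<Rightarrow> 'k) set) rmod) d \<epsilon>.
  alg_over.fin_resolution K Env Reg Q d \<epsilon> (Suc L)"
proof -
 interpret B: basic_algebra K Env "S \<times> S" "\<lambda>(p, q). u (e p) (e q)" env_char by (rule env_basic)
 have fR: "findim Reg" using dim_cong(1)[OF alg_simps(1), of Reg] fin_A by simp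
 obtain J :: "nat \<Rightarrow> 'i set" and d \<epsilon> where J: "\<And>l. finite (J l)" and F: "B.resolves Reg (\<lambda>l. free_rmod Env (J l)) d \<epsilon>"
  by (rule B.free_resolution[OF regular_env(1) fR B.fin_A inf]) blast
 let ?F = "\<lambda>l. free_rmod Env (J l)" and ?G = "\<lambda>l. free_rmod A (J l)"
 note f = B.resolvesD[OF F] and D = B.homD[OF B.resolvesD(2)[OF F]]
 have fF: "findim (?F l)" for l by (rule B.free_fin[OF B.fin_A J])
 let ?Z = "d L ` carrier (?F (Suc L))"
 have Z: "B.submod (?F L) ?Z" using B.submod_im[OF f(1,1,2)] by (simp del: B.free_simps)
 let ?M = "(?F L)\<langle>?Z\<rangle>"
 have ZF: "z <: (?F L)" if "z \<in> ?Z" for z using B.submodD(4)[OF Z that] .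
 have ext: "\<exists>\<xi>\<in>B.rhom (?F L) (B.simple s). \<forall>z\<in>?Z. \<xi> z = \<eta> z"
  if s: "s \<in> S \<times> S" and \<eta>: "\<eta> \<in> B.rhom ?M (B.simple s)" for s \<eta>
 proof -
  obtain p q where pq: "s = (p, q)" "p \<in> S" "q \<in> S" using s by auto
  note ec = env_char[OF pq(2,3)]
  obtain Q dQ \<epsilon>Q where Q: "fin_resolution (simple p) (Q :: nat \<Rightarrow> ('k, 'q, 'a) rmod) dQ \<epsilon>Q L" using L[OF pq(2)] by blast
  note Q' = fin_resolutionD[OF Q]
  note G = reduced_resolution(1)[OF pq(2) F] and comm = reduced_resolution(2)[OF pq(2) F]
  let ?d = "\<lambda>l g. proj p (d l (incl g))"
  have GR: "rmodule (?G l)" for l by (rule free_rmod_module)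
  note gv = rmodD(1)[OF GR] and Sm = simple_module(1)[OF pq(2)]
  obtain r where r: "\<And>l. r l \<in> rhom (?G l) (?G (Suc l))"
   "\<And>l x. l \<ge> L ==> x <: (?G (Suc l)) ==> x = ?d (Suc l) (r (Suc l) x) \<oplus>\<^bsub>?G (Suc l)\<^esub> r l (?d l x)"
  proof (rule finite_from_comparison[OF Q'(2) G])
   show "lifts (Q l) (?G l) (simple p)" "lifts (Q (Suc l)) (?G (Suc l)) (?G l)" for l
    by (rule projective_lifts[OF Q'(4)] GR Sm)+
   show "lifts (?G 0) (Q 0) (simple p)" "lifts (?G (Suc l)) (Q (Suc l)) (Q l)" "lifts (?G l) (?G (Suc l)) (?G l)" for l
    by (rule free_lifts Q'(3) GR Sm)+
   show "carrier (Q l) = {\<zero>\<^bsub>Q l\<^esub>}" if "l > L" for l using Q'(6) that .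
  qed blast
  have \<eta>Z: "\<eta> \<in> lin K ?M scal" using B.homD(1)[OF \<eta>] by (simp add: module_hom_defs del: B.free_simps)
  have dZ: "d L \<in> lin K (?F (Suc L)) ?M" using D(3-5) by (intro linI) (simp_all del: B.free_simps)
  note t = lin_comp[OF dZ \<eta>Z] and P = proj[OF pq(2)] and I = incl(1,2) incl(3)[OF pq(2)]
  have Gc: "proj p y <: (?G l)" if "y <: (?F l)" for y l using linD(1)[OF P(1) that] .
  have Ic: "incl y <: (?F l)" if "y <: (?G l)" for y l using linD(1)[OF I(1) that] .
  have \<eta>u: "\<eta> (d L (ract (?F (Suc L)) y (u a b))) = (\<chi> p a \<otimes> \<chi> q b) \<otimes> \<eta> (d L y)"
   if "y <: (?F (Suc L))" "a <: A" "b <: A" for y a b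
   using D(2)[OF that(1), of "u a b"] B.homD(2)[OF \<eta>, of "d L y" "u a b"] linD(1)[OF t that(1)]
    \<chi>D(1)[OF pq(2) that(2)] \<chi>D(1)[OF pq(3) that(3)] that
   by (simp add: pq(1) ec(2) m_comm del: B.free_simps)
  have tf: "\<eta> (d L (incl (proj p y))) = \<eta> (d L y)" if "y <: (?F (Suc L))" for y
   by (rule twisted_factor[OF pq(2) scal_vs t _ that]) (use \<eta>u \<chi>_one[OF pq(3)] \<chi>D(1)[OF pq(2)] in simp)
  \<comment> \<open>\<eta> d L is twisted by \<chi> p and so lives on the reduced module. There r
    splits the complex from degree L on, and composing with r L extends the map from the boundaries
    to all of F L.\<close>
  let ?\<xi> = "\<lambda>x. \<eta> (d L (incl (r L (proj p x))))"
  note rl = homD(1)[OF r(1)]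
  have eq: "?\<xi> (d L y) = \<eta> (d L y)" if y: "y <: (?F (Suc L))" for y
  proof -
   have py: "proj p y <: (?G (Suc L))" using Gc[OF y] .
   have r1: "incl (r (Suc L) (proj p y)) <: (?F (Suc (Suc L)))" using Ic linD(1)[OF rl py] by blast
   have c: "?d (Suc L) (r (Suc L) (proj p y)) <: (?G (Suc L))" "r L (?d L (proj p y)) <: (?G (Suc L))"
    using Gc[OF D(3)[OF r1]] linD(1)[OF rl Gc[OF D(3)[OF Ic[OF py]]]] by blast+
   have tl: "(\<lambda>g. \<eta> (d L (incl g))) \<in> lin K (?G (Suc L)) scal" by (rule lin_comp[OF I(1) t])
   \<comment> \<open>By \<open>tf\<close> the reduced boundary may be replaced by an honest
     boundary, on which d L vanishes.\<close>
   have z: "\<eta> (d L (incl (?d (Suc L) (r (Suc L) (proj p y))))) = \<zero>"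
    using tf[OF D(3)[OF r1]] f(7)[OF r1] lin_zero[OF rmodD(1)[OF GR] scal_vs]
     lin_zero[OF B.rmodD(1)[OF B.submod_rmod[OF Z]] scal_vs \<eta>Z] by (simp del: B.free_simps)
   have "\<eta> (d L y) = \<eta> (d L (incl (proj p y)))" using tf[OF y] by simp
   also have "\<dots> = \<eta> (d L (incl (?d (Suc L) (r (Suc L) (proj p y)) \<oplus>\<^bsub>?G (Suc L)\<^esub> r L (?d L (proj p y)))))"
    using r(2)[OF order_refl py] by simp
   also have "\<dots> = \<eta> (d L (incl (r L (?d L (proj p y)))))"
    using linD(2)[OF tl c] z linD(1)[OF tl c(2)] by simp
   also have "?d L (proj p y) = proj p (d L y)" using comm[OF y] by simp
   finally show ?thesis by simp
  qed
  have "?\<xi> \<in> B.rhom (?F L) (B.simple s)"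
  proof (rule B.homI)
   show "?\<xi> \<in> lin K (?F L) (B.simple s)"
    using lin_comp[OF P(1) lin_comp[OF rl lin_comp[OF I(1) t]]] by (simp add: module_hom_defs)
   fix m b assume m: "m <: (?F L)" and b: "b <: Env"
   have pm: "proj p m <: (?G L)" using Gc[OF m] .
   have l: "(\<lambda>b. ract (?F L) m b) \<in> lin K Env (?F L)"
    using B.rmodD[OF f(1)[of L]] m by (intro linI) (simp_all del: B.free_simps)
   have xl: "?\<xi> \<in> lin K (?F L) scal" by (rule lin_comp[OF P(1) lin_comp[OF rl lin_comp[OF I(1) t]]])
   have k: "?\<xi> m <: K" using linD(1)[OF xl m] by simp
   have "?\<xi> (ract (?F L) m b) = ?\<xi> m \<otimes> env_char (p, q) b"
   proof (rule env_eq[OF scal_vs lin_comp[OF l xl] _ _ b])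
    show "(\<lambda>b. ?\<xi> m \<otimes> env_char (p, q) b) \<in> lin K Env scal" using lin_smult[OF scal_vs ec(1) k] by simp
    fix a b assume a: "a <: A" and b: "b <: A"
    have g: "r L (proj p m) <: (?G (Suc L))" using linD(1)[OF rl pm] .
    have "r L (proj p (ract (?F L) m (u a b))) = \<chi> p a \<odot>\<^bsub>?G (Suc L)\<^esub> ract (?G (Suc L)) (r L (proj p m)) b"
     using P(2)[OF m a b] homD(5)[OF r(1) \<chi>D(1)[OF pq(2) a] rmodD(2)[OF GR pm b]] homD(2)[OF r(1) pm b] by simp
    then have "?\<xi> (ract (?F L) m (u a b)) = \<chi> p a \<otimes> \<eta> (d L (incl (ract (?G (Suc L)) (r L (proj p m)) b)))"
     using linD(3)[OF lin_comp[OF I(1) t] \<chi>D(1)[OF pq(2) a] rmodD(2)[OF GR g b]] by simp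
    also have "\<dots> = \<chi> p a \<otimes> (\<chi> q b \<otimes> ?\<xi> m)"
     using I(2)[OF g b] \<eta>u[OF Ic[OF g] alg_simps(4) b] \<chi>_one[OF pq(2)] \<chi>D(1)[OF pq(3) b] by simp
    finally show "?\<xi> (ract (?F L) m (u a b)) = ?\<xi> m \<otimes> env_char (p, q) (u a b)"
     using k \<chi>D(1)[OF pq(2) a] \<chi>D(1)[OF pq(3) b] ec(2)[OF a b] by (simp add: m_ac)
   qed
   then show "?\<xi> (ract (?F L) m b) = ract (B.simple s) (?\<xi> m) b" by (simp add: pq(1) del: B.free_simps)
  qed
  then show ?thesis using eq by (intro bexI) auto
 qed
 have Zm: "right_module K Env ?M" "findim ?M"
  using B.submod_rmod[OF Z] sub_fin[OF B.submodD(2)[OF Z] fF] by auto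
 \<comment> \<open>Extending the identity of Z makes Z a retract of F L. Lifting the retraction
   through d L produces the section that \<open>truncate\<close> asks for.\<close>
 obtain \<rho> where \<rho>: "\<rho> \<in> B.rhom (?F L) ?M" "\<And>z. z \<in> ?Z ==> \<rho> z = z"
  using B.hom_extension[OF Z ext Zm B.hom_id] by blast
 have dM: "d L \<in> B.rhom (?F (Suc L)) ?M"
  using f(2)[of L] by (auto simp: right_hom_def module_hom_defs)
 have im: "\<rho> x \<in> d L ` carrier (?F (Suc L))" if "x <: (?F L)" for x using B.homD(3)[OF \<rho>(1) that] by simp
 obtain \<rho>' where \<rho>': "\<rho>' \<in> B.rhom (?F L) (?F (Suc L))" "\<And>x. x <: (?F L) ==> d L (\<rho>' x) = \<rho> x"
  by (rule B.liftsD[OF B.free_lifts[OF f(1) Zm(1)] dM \<rho>(1) im]) blast+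
 have "\<exists>(Q :: nat \<Rightarrow> ('k, 'i \<Rightarrow> ('a \<times> 'a \<Rightarrow> 'k) set, ('a \<times> 'a \<Rightarrow> 'k) set) rmod) d'. B.fin_resolution Reg Q d' \<epsilon> (Suc L)"
 proof (rule B.truncate[OF F B.free_projective fF])
  show "\<rho>' \<in> B.rhom ?M (?F (Suc L))" using B.hom_comp[OF B.submod_incl[OF Z] \<rho>'(1)] .
  show "d L (\<rho>' x) = x" if "x \<in> ?Z" for x using \<rho>'(2)[OF ZF[OF that]] \<rho>(2)[OF that] by simp
 qed
 then show ?thesis by blast
qed

end

section \<open>Inverse Cartan matrix and Euler characteristics\<close>

text \<open>Over the rationals a one-sided inverse of a square matrix is two-sided, and the
  embedding of the integers is injective.\<close>

lemma int_mat_left_inverse: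
 fixes C D :: "int mat"
 assumes C: "C \<in> carrier_mat n n" and D: "D \<in> carrier_mat n n" and CD: "C * D = 1\<^sub>m n"
 shows "D * C = 1\<^sub>m n"
proof -
 have one: "map_mat rat_of_int (1\<^sub>m n) = 1\<^sub>m n" by (rule of_int_hom.mat_hom_one)
 have "map_mat rat_of_int C * map_mat rat_of_int D = 1\<^sub>m n" using of_int_hom.mat_hom_mult[OF C D] CD one by metis
 then have "map_mat rat_of_int D * map_mat rat_of_int C = 1\<^sub>m n"
  using mat_mult_left_right_inverse[of "map_mat rat_of_int C" n "map_mat rat_of_int D"] C D by simp
 then have "map_mat rat_of_int (D * C) = map_mat rat_of_int (1\<^sub>m n)" using of_int_hom.mat_hom_mult[OF D C] one by metis
 then show ?thesis by (rule of_int_hom.mat_hom_inj)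
qed

lemma inverse_matrix_eq:
 assumes C: "C \<in> carrier_mat n n" and D: "D \<in> carrier_mat n n" and CD: "C * D = 1\<^sub>m n"
 shows "inverse_matrix C = D" "invertible_mat C"
proof -
 note DC = int_mat_left_inverse[OF C D CD]
 have i: "inverts_mat C D" "inverts_mat D C" using C D CD DC by (auto simp: inverts_mat_def)
 then show "invertible_mat C" using C by (auto simp: invertible_mat_def)
 show "inverse_matrix C = D"
  unfolding inverse_matrix_def
 proof (rule the_equality)
  fix E assume E: "inverts_mat C E \<and> inverts_mat E C"
  have "dim_col E = n" using E C by (metis carrier_matD(1) index_mult_mat(3) index_one_mat(3) inverts_mat_def)
  moreover have "dim_row E = n" using E C by (metis carrier_matD(2) index_mult_mat(3) index_one_mat(3) inverts_mat_def)
  ultimately have Ec: "E \<in> carrier_mat n n" by auto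
  have "E = E * (C * D)" using CD Ec by simp
  also have "\<dots> = (E * C) * D" using assoc_mult_mat[OF Ec C D] by simp
  also have "\<dots> = D" using E Ec D by (simp add: inverts_mat_def)
  finally show "E = D" .
 qed (use i in blast)
qed

lemma mat_vec_entry: "C \<in> carrier_mat n n ==> v \<in> carrier_vec n ==> i < n ==> (C *\<^sub>v v) $ i = (\<Sum>j<n. C $$ (i, j) * v $ j)"
 by (simp add: scalar_prod_def atLeast0LessThan row_def)

lemma mat_mult_entry: "C \<in> carrier_mat n n ==> D \<in> carrier_mat n n ==> i < n ==> j < n ==>
  (C * D) $$ (i, j) = (\<Sum>k<n. C $$ (i, k) * D $$ (k, j))"
 by (simp add: scalar_prod_def atLeast0LessThan row_def col_def)

lemma matrix_trace_mult:
 "C \<in> carrier_mat n n ==> D \<in> carrier_mat n n ==> matrix_trace (C * D) = (\<Sum>i<n. \<Sum>k<n. C $$ (i, k) * D $$ (k, i))"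
 by (simp add: matrix_trace_def scalar_prod_def atLeast0LessThan row_def col_def)

locale basic_cartan = basic_algebra K A "{..<n}" e \<chi>
 for K :: "('k, 'x) ring_scheme" (structure) and A :: "('k, 'a) module" and n :: nat and e \<chi> +
 assumes finite_gd: "finite_global_dimension K A"
begin

abbreviation "C \<equiv> cartan_matrix K A n e"

lemma C_carrier: "C \<in> carrier_mat n n" by (simp add: cartan_matrix_def)

lemma C_entry: "i < n ==> j < n ==> C $$ (i, j) = int (corner (e j) (e i))"
 using cartan_entry[OF e_mem e_idem e_mem fin_A] by (simp add: cartan_matrix_def)

lemma simple_dim:
 assumes s: "s < n" "t < n"
 shows "vdim ((simple s)\<langle>(\<lambda>m. ract (simple s) m (e t)) ` carrier (simple s)\<rangle>) = (if s = t then 1 else 0)"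
proof -
 have s': "s \<in> {..<n}" "t \<in> {..<n}" using s by auto
 let ?W = "(\<lambda>m. ract (simple s) m (e t)) ` carrier (simple s)"
 note W = idem_image[OF simple_module(1)[OF s'(1)] e_mem[OF s'(2)]]
 show ?thesis
 proof (cases "s = t")
  case True
  then have "?W = carrier K" using \<chi>_e[OF s'] by (auto simp: image_def intro!: bexI)
  then show ?thesis using True dim_cong(2)[OF scal_vs, of "(simple s)\<langle>?W\<rangle>"] scal_dim by (simp add: simple_def)
 next
  case False
  then have "?W = {\<zero>}" using \<chi>_e[OF s'] by (auto simp: image_def intro!: bexI[of _ \<zero>])
  then show ?thesis using False dim_zero(2)[OF sub_vs[OF W]] by simp
 qed
qed

lemma cartan_inverse:
 obtains D where "D \<in> carrier_mat n n" "C * D = 1\<^sub>m n" "D * C = 1\<^sub>m n" "inverse_matrix C = D" "invertible_mat C"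
proof -
 obtain L where L: "\<And>M :: ('k, 'k, 'a) rmod. rmodule M ==> findim M ==>
  \<exists>(Q :: nat \<Rightarrow> ('k, 'k \<times> 'a list \<Rightarrow> 'a, 'a) rmod) d \<epsilon>. fin_resolution M Q d \<epsilon> L"
  by (rule global_resolution[OF finite_gd fin_A]) blast
 \<comment> \<open>X is the vector of multiplicities in a resolution of the simple module s, and
   becomes column s of the inverse matrix.\<close>
 have "\<exists>X. \<forall>t<n. (\<Sum>i<n. X i * int (corner (e i) (e t))) = (if s = t then 1 else 0)" if s: "s < n" for s
 proof -
  have s': "s \<in> {..<n}" using s by simp
  obtain Q d \<epsilon> where Q: "fin_resolution (simple s) (Q :: nat \<Rightarrow> ('k, 'k \<times> 'a list \<Rightarrow> 'a, 'a) rmod) d \<epsilon> L"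
   using L[OF simple_module[OF s']] by blast
  have "(\<Sum>i<n. mult Q L i * int (corner (e i) (e t))) = (if s = t then 1 else 0)" if t: "t < n" for t
   using dim_mult[OF simple_module[OF s'] Q, of t] simple_dim[OF s t] t by (simp split: if_splits)
  then show ?thesis by blast
 qed
 then obtain X where X: "\<And>s t. s < n ==> t < n ==> (\<Sum>i<n. X s i * int (corner (e i) (e t))) = (if s = t then 1 else 0)" by metis
 define D where "D = mat n n (\<lambda>(i, s). X s i)"
 have D: "D \<in> carrier_mat n n" by (simp add: D_def)
 have CD: "C * D = 1\<^sub>m n"
 proof (rule eq_matI)
  fix t s assume "t < dim_row (1\<^sub>m n :: int mat)" "s < dim_col (1\<^sub>m n :: int mat)"
  then have ts: "t < n" "s < n" by auto
  have "(C * D) $$ (t, s) = (\<Sum>i<n. X s i * int (corner (e i) (e t)))"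
   unfolding mat_mult_entry[OF C_carrier D ts] using ts by (intro sum.cong) (simp_all add: C_entry D_def)
  then show "(C * D) $$ (t, s) = 1\<^sub>m n $$ (t, s)" using X[OF ts(2,1)] ts by auto
 qed (use C_carrier D in auto)
 show thesis by (rule that[OF D CD int_mat_left_inverse[OF C_carrier D CD] inverse_matrix_eq[OF C_carrier D CD]])
qed

lemma one_sided_resolution:
 assumes M: "rmodule (M :: ('k, 'm, 'a) rmod)" and fin: "findim M"
 obtains L d \<epsilon> and Q :: "nat \<Rightarrow> ('k, 'm \<times> 'a list \<Rightarrow> 'a, 'a) rmod" where "fin_resolution M Q d \<epsilon> L"
  "\<And>s. s < n ==> mult Q L s = (inverse_matrix C *\<^sub>v dim_vec_right K n e M) $ s"
proof -
 obtain L where L: "\<And>M :: ('k, 'm, 'a) rmod. rmodule M ==> findim M ==>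
  \<exists>(Q :: nat \<Rightarrow> ('k, 'm \<times> 'a list \<Rightarrow> 'a, 'a) rmod) d \<epsilon>. fin_resolution M Q d \<epsilon> L"
  by (rule global_resolution[OF finite_gd fin_A]) blast
 obtain Q d \<epsilon> where Q: "fin_resolution M (Q :: nat \<Rightarrow> ('k, 'm \<times> 'a list \<Rightarrow> 'a, 'a) rmod) d \<epsilon> L" using L[OF M fin] by blast
 obtain D where D: "D \<in> carrier_mat n n" "C * D = 1\<^sub>m n" "D * C = 1\<^sub>m n" "inverse_matrix C = D" by (rule cartan_inverse)
 let ?x = "vec n (mult Q L)"
 have "C *\<^sub>v ?x = dim_vec_right K n e M"
 proof (rule eq_vecI)
  fix t assume "t < dim_vec (dim_vec_right K n e M)"
  then have t: "t < n" by (simp add: dim_vec_right_def)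
  show "(C *\<^sub>v ?x) $ t = dim_vec_right K n e M $ t"
   unfolding mat_vec_entry[OF C_carrier vec_carrier t]
   using dim_mult[OF M fin Q, of t] t by (auto simp: dim_vec_right_def C_entry mult.commute intro: sum.cong)
 qed (use C_carrier in \<open>simp add: dim_vec_right_def\<close>)
 then have "D *\<^sub>v dim_vec_right K n e M = D *\<^sub>v (C *\<^sub>v ?x)" by simp
 also have "\<dots> = ?x" using assoc_mult_mat_vec[OF D(1) C_carrier vec_carrier, of "mult Q L"] D(3) by simp
 finally show thesis using that[OF Q] D(4) by simp
qed

lemma ext_euler_ringel:
 assumes M: "fd_right_module K A (M :: ('k, 'm, 'a) rmod)" and N: "fd_right_module K A (N :: ('k, 'n, 'a) rmod)"
 shows "has_euler_characteristic K (\<lambda>l. Ext K A M N l) (ringel_form C (dim_vec_right K n e M) (dim_vec_right K n e N))"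
proof -
 have M': "rmodule M" "findim M" and N': "rmodule N" "findim N"
  using M N by (auto simp: fd_right_module_def)
 obtain L d \<epsilon> and Q :: "nat \<Rightarrow> ('k, 'm \<times> 'a list \<Rightarrow> 'a, 'a) rmod" where Q: "fin_resolution M Q d \<epsilon> L"
  and x: "\<And>s. s < n ==> mult Q L s = (inverse_matrix C *\<^sub>v dim_vec_right K n e M) $ s"
  by (rule one_sided_resolution[OF M']) blast
 obtain D where D: "D \<in> carrier_mat n n" "inverse_matrix C = D" by (rule cartan_inverse)
 let ?m = "dim_vec_right K n e M" and ?n = "dim_vec_right K n e N"
 have mn: "?m \<in> carrier_vec n" "?n \<in> carrier_vec n" by (simp_all add: dim_vec_right_def)
 \<comment> \<open>With D the inverse of C, x^T D^T y pairs D x with y; and D x is the vector of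
   multiplicities.\<close>
 have "ringel_form C ?m ?n = (\<Sum>i<n. ?m $ i * (\<Sum>s<n. D $$ (s, i) * ?n $ s))"
  using D mn by (simp add: ringel_form_def scalar_prod_def atLeast0LessThan row_def)
 also have "\<dots> = (\<Sum>s<n. (\<Sum>i<n. D $$ (s, i) * ?m $ i) * ?n $ s)"
  by (simp add: sum_distrib_left sum_distrib_right mult_ac) (rule sum.swap)
 also have "\<dots> = (\<Sum>s<n. mult Q L s * ?n $ s)"
  using x D(2) by (intro sum.cong) (simp_all add: mat_vec_entry[OF D(1) mn(1)])
 also have "\<dots> = (\<Sum>s\<in>{..<n}. mult Q L s * int (vdim (N\<langle>(\<lambda>m. ract N m (e s)) ` carrier N\<rangle>)))"
  by (intro sum.cong) (simp_all add: dim_vec_right_def)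
 finally show ?thesis using ext_euler_mult[OF M'(1) N' Q] fin_resolutionD(1)[OF Q] by auto
qed

lemma tor_euler_ringel:
 assumes M: "fd_right_module K A (M :: ('k, 'm, 'a) rmod)" and N: "fd_left_module K A (N :: ('k, 'n, 'a) lmod)"
 shows "has_euler_characteristic K (\<lambda>l. Tor K A M N l) (ringel_form_op C (dim_vec_left K n e N) (dim_vec_right K n e M))"
proof -
 have M': "rmodule M" "findim M" and N': "left_module K A N" "findim N"
  using M N by (auto simp: fd_right_module_def fd_left_module_def)
 obtain L d \<epsilon> and Q :: "nat \<Rightarrow> ('k, 'm \<times> 'a list \<Rightarrow> 'a, 'a) rmod" where Q: "fin_resolution M Q d \<epsilon> L"
  and x: "\<And>s. s < n ==> mult Q L s = (inverse_matrix C *\<^sub>v dim_vec_right K n e M) $ s"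
  by (rule one_sided_resolution[OF M']) blast
 obtain D where D: "D \<in> carrier_mat n n" "inverse_matrix C = D" by (rule cartan_inverse)
 have "ringel_form_op C (dim_vec_left K n e N) (dim_vec_right K n e M)
  = (\<Sum>s\<in>{..<n}. mult Q L s * int (vdim (N\<langle>(\<lambda>m. lact N (e s) m) ` carrier N\<rangle>)))"
  using D x by (simp add: ringel_form_op_def scalar_prod_def[of _ "D *\<^sub>v _"] atLeast0LessThan dim_vec_left_def mult.commute)
 then show ?thesis using tor_euler_mult[OF M'(1) N' Q] fin_resolutionD(1)[OF Q] by auto
qed

text \<open>The multiplicities X of the regular bimodule do not depend on M, so they can be
  determined once, from the dimensions of e_i A e_j; the bimodule M then enters only through its own
  dimension matrix.\<close>

lemma hochschild_euler:
 assumes M: "fd_bimodule K A (M :: ('k, 'm, 'a) bimod)"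
 shows "has_euler_characteristic K (\<lambda>l. hochschild_cohomology K A M l)
   (matrix_trace (transpose_mat (inverse_matrix C) * dim_matrix K n e M))"
  and "has_euler_characteristic K (\<lambda>l. hochschild_homology K A M l)
   (matrix_trace (inverse_matrix C * dim_matrix K n e M))"
proof -
 interpret B: basic_algebra K Env "{..<n} \<times> {..<n}" "\<lambda>(p, q). u (e p) (e q)" env_char by (rule env_basic)
 have M': "bimodule K A M" "findim M" using M by (auto simp: fd_bimodule_def)
 note V = lmodD(1)[OF bimoduleD(1)[OF M'(1)]] and env = env_modules[OF M'(1)]
 obtain L where L: "\<And>M :: ('k, 'k, 'a) rmod. rmodule M ==> findim M ==>
  \<exists>(Q :: nat \<Rightarrow> ('k, 'k \<times> 'a list \<Rightarrow> 'a, 'a) rmod) d \<epsilon>. fin_resolution M Q d \<epsilon> L"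
  by (rule global_resolution[OF finite_gd fin_A]) blast
 \<comment> \<open>The index type is the one that \<open>some_resolution\<close> uses for the
   regular bimodule over \<open>Env\<close>; so the finite resolution also proves that the choice
   made there yields a resolution.\<close>
 have inf: "infinite (UNIV :: ('a \<times> ('a \<times> 'a \<Rightarrow> 'k) set list) set)" by (simp add: finite_prod infinite_UNIV_listI)
 obtain Q d \<epsilon> where Q: "B.fin_resolution Reg (Q :: nat \<Rightarrow> ('k, 'a \<times> ('a \<times> 'a \<Rightarrow> 'k) set list \<Rightarrow> ('a \<times> 'a \<Rightarrow> 'k) set, ('a \<times> 'a \<Rightarrow> 'k) set) rmod) d \<epsilon> (Suc L)"
  using regular_resolution[OF L[OF simple_module] inf] by blast
 have ex: "\<exists>(P :: nat \<Rightarrow> ('k, 'a \<times> ('a \<times> 'a \<Rightarrow> 'k) set list \<Rightarrow> ('a \<times> 'a \<Rightarrow> 'k) set, ('a \<times> 'a \<Rightarrow> 'k) set) rmod) d \<epsilon>. projective_resolution K Env Reg P d \<epsilon>"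
  using B.fin_resolutionD(1)[OF Q] by blast
 define X where "X p q = B.mult Q (Suc L) (p, q)" for p q
 obtain D where D: "D \<in> carrier_mat n n" "C * D = 1\<^sub>m n" "D * C = 1\<^sub>m n" "inverse_matrix C = D" by (rule cartan_inverse)
 have fR: "findim Reg" using dim_cong(1)[OF alg_simps(1), of Reg] fin_A by simp
 \<comment> \<open>By \<open>env_corner\<close>, X p q stands between C (j, q) and C (p, i).
   Exchanging the indices turns the sum into a matrix product.\<close>
 define Y where "Y = mat n n (\<lambda>(q, p). X p q)"
 have Y: "Y \<in> carrier_mat n n" by (simp add: Y_def)
 have "C * Y * C = C"
 proof (rule eq_matI)
  fix j i assume "j < dim_row C" "i < dim_col C"
  then have ij: "j < n" "i < n" using C_carrier by auto
  have em: "e i <: A" "e j <: A" using e_mem ij by auto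
  have "vdim (Reg\<langle>(\<lambda>m. ract Reg m (u (e i) (e j))) ` carrier Reg\<rangle>) = corner (e i) (e j)"
   unfolding corner_def
  proof (rule dim_cong(2)[OF sub_vs[OF corner_sub[OF em]] _ _ _ _ sub_fin[OF corner_sub[OF em] fin_A]])
   have "ract Reg m (u (e i) (e j)) = e i \<otimes>\<^bsub>A\<^esub> (m \<otimes>\<^bsub>A\<^esub> e j)" if "m <: A" for m
    using regular_env(6)[OF that em] that em by (simp add: alg_assoc)
   then show "carrier (Reg\<langle>(\<lambda>m. ract Reg m (u (e i) (e j))) ` carrier Reg\<rangle>)
    = carrier (A\<langle>(\<lambda>b. e i \<otimes>\<^bsub>A\<^esub> (b \<otimes>\<^bsub>A\<^esub> e j)) ` carrier A\<rangle>)" by simp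
  qed simp_all
  then have "int (corner (e i) (e j)) = (\<Sum>s\<in>{..<n} \<times> {..<n}. B.mult Q (Suc L) s * int (B.corner ((\<lambda>(p, q). u (e p) (e q)) s) (u (e i) (e j))))"
   using B.dim_mult[OF regular_env(1) fR Q, of "(i, j)"] ij by simp
  also have "\<dots> = (\<Sum>p<n. \<Sum>q<n. X p q * int (corner (e i) (e p) * corner (e q) (e j)))"
   unfolding sum.cartesian_product by (intro sum.cong refl) (use ij in \<open>clarsimp simp: X_def env_corner\<close>)
  also have "\<dots> = (\<Sum>p<n. \<Sum>q<n. C $$ (j, q) * Y $$ (q, p) * C $$ (p, i))"
   using ij by (intro sum.cong) (simp_all add: C_entry Y_def)
  also have "\<dots> = (C * Y * C) $$ (j, i)"
   using mat_mult_entry[OF mult_carrier_mat[OF C_carrier Y] C_carrier ij] ij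
   by (simp add: mat_mult_entry[OF C_carrier Y] sum_distrib_right)
  finally show "(C * Y * C) $$ (j, i) = C $$ (j, i)" using C_entry[OF ij] by simp
 qed (use C_carrier Y in auto)
 then have "D * (C * Y * C) = 1\<^sub>m n" using D(3) by simp
 then have YC: "Y * C = 1\<^sub>m n"
  using assoc_mult_mat[OF C_carrier Y C_carrier] assoc_mult_mat[OF D(1) C_carrier mult_carrier_mat[OF Y C_carrier]] D(3)
   left_mult_one_mat[OF mult_carrier_mat[OF Y C_carrier]] by simp
 have "Y = Y * (C * D)" using D(2) Y by simp
 also have "\<dots> = D" using assoc_mult_mat[OF Y C_carrier D(1)] YC D(1) by simp
 finally have XD: "X p q = D $$ (q, p)" if "p < n" "q < n" for p q using that by (auto simp: Y_def)
 have em: "e i <: A" if "i < n" for i using e_mem that by auto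
 have fM: "findim (env_rmod K M)" "findim (env_lmod K M)"
  using dim_cong(1)[OF V, of "env_rmod K M"] dim_cong(1)[OF V, of "env_lmod K M"] M'(2) by simp_all
 let ?DM = "dim_matrix K n e M"
 have DM: "?DM \<in> carrier_mat n n" by (simp add: dim_matrix_def)
 \<comment> \<open>e_p \<otimes> e_q acts from the right as e_p m e_q and from the left as e_q m
   e_p. This exchange of indices is why a transpose appears in the trace for cohomology and none in
   that for homology.\<close>
 have c: "vdim ((env_rmod K M)\<langle>(\<lambda>m. ract (env_rmod K M) m (u (e p) (e q))) ` carrier (env_rmod K M)\<rangle>)
   = ?DM $$ (q, p)"
  and h: "vdim ((env_lmod K M)\<langle>(\<lambda>m. lact (env_lmod K M) (u (e p) (e q)) m) ` carrier (env_lmod K M)\<rangle>)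
   = ?DM $$ (p, q)" if pq: "p < n" "q < n" for p q
 proof -
  have m: "vdim W = vdim (M\<langle>(\<lambda>m. bract M (lact M (e j) m) (e i)) ` carrier M\<rangle>)"
   if W: "carrier W = (\<lambda>m. bract M (lact M (e j) m) (e i)) ` carrier M" "\<zero>\<^bsub>W\<^esub> = \<zero>\<^bsub>M\<^esub>" "add W = add M" "smult W = smult M"
    and ij: "i < n" "j < n" for W :: "('k, 'm, 'z) module_scheme" and i j
  proof -
   note l = lmodD[OF bimoduleD(1)[OF M'(1)]] and r = rmodD[OF bimoduleD(2)[OF M'(1)], simplified]
   have "(\<lambda>m. bract M (lact M (e j) m) (e i)) \<in> lin K M M" using em ij by (intro linI) (simp_all add: l r)
   note s = lin_im_sub[OF V V this sub_self[OF V]]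
   show ?thesis by (rule dim_cong(2)[OF sub_vs[OF s]]) (use W sub_fin[OF s M'(2)] in simp_all)
  qed
  show "vdim ((env_rmod K M)\<langle>(\<lambda>m. ract (env_rmod K M) m (u (e p) (e q))) ` carrier (env_rmod K M)\<rangle>) = ?DM $$ (q, p)"
   using m[of "(env_rmod K M)\<langle>(\<lambda>m. ract (env_rmod K M) m (u (e p) (e q))) ` carrier (env_rmod K M)\<rangle>" p q] pq env(3) em
   by (simp add: dim_matrix_def)
  show "vdim ((env_lmod K M)\<langle>(\<lambda>m. lact (env_lmod K M) (u (e p) (e q)) m) ` carrier (env_lmod K M)\<rangle>) = ?DM $$ (p, q)"
   using m[of "(env_lmod K M)\<langle>(\<lambda>m. lact (env_lmod K M) (u (e p) (e q)) m) ` carrier (env_lmod K M)\<rangle>" q p] pq env(4) em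
    bimoduleD(3)[OF M'(1)] by (simp add: dim_matrix_def)
 qed
 have "matrix_trace (transpose_mat (inverse_matrix C) * ?DM) = (\<Sum>p<n. \<Sum>q<n. X p q * ?DM $$ (q, p))"
  using D DM by (simp add: matrix_trace_mult[of _ n] XD)
 also have "\<dots> = (\<Sum>s\<in>{..<n} \<times> {..<n}. B.mult Q (Suc L) s * int (vdim ((env_rmod K M)\<lparr>carrier :=
   (\<lambda>m. ract (env_rmod K M) m ((\<lambda>(p, q). u (e p) (e q)) s)) ` carrier (env_rmod K M)\<rparr>)))"
  unfolding sum.cartesian_product by (intro sum.cong refl) (clarsimp simp: c X_def simp del: env_mod_simps)
 finally show "has_euler_characteristic K (\<lambda>l. hochschild_cohomology K A M l) (matrix_trace (transpose_mat (inverse_matrix C) * ?DM))"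
  using B.ext_euler_mult[OF regular_env(1) env(1) fM(1) Q ex] by (simp add: hochschild_cohomology_def del: env_mod_simps)
 have "matrix_trace (inverse_matrix C * ?DM) = (\<Sum>q<n. \<Sum>p<n. X p q * ?DM $$ (p, q))"
  using D DM by (simp add: matrix_trace_mult[of _ n] XD)
 also have "\<dots> = (\<Sum>p<n. \<Sum>q<n. X p q * ?DM $$ (p, q))" by (rule sum.swap)
 also have "\<dots> = (\<Sum>s\<in>{..<n} \<times> {..<n}. B.mult Q (Suc L) s * int (vdim ((env_lmod K M)\<lparr>carrier :=
   (\<lambda>m. lact (env_lmod K M) ((\<lambda>(p, q). u (e p) (e q)) s) m) ` carrier (env_lmod K M)\<rparr>)))"
  unfolding sum.cartesian_product by (intro sum.cong refl) (clarsimp simp: h X_def simp del: env_mod_simps)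
 finally show "has_euler_characteristic K (\<lambda>l. hochschild_homology K A M l) (matrix_trace (inverse_matrix C * ?DM))"
  using B.tor_euler_mult[OF regular_env(1) env(2) fM(2) Q ex] by (simp add: hochschild_homology_def del: env_mod_simps)
qed

end

theorem theorem1:
  fixes K :: "('k, 'x) ring_scheme" and A :: "('k, 'a) module"
    and n :: nat and e :: "nat \<Rightarrow> 'a"
  assumes "field K"
    and "k_algebra K A"
    and "vectorspace.fin_dim K A"
    and "elementary K A"
    and "finite_global_dimension K A"
    and "complete_primitive_idempotents A n e"
  shows "let C = cartan_matrix K A n e in
    invertible_mat C \<and>
    (\<forall>(M :: ('k, 'm1, 'a) rmod) (N :: ('k, 'n1, 'a) rmod).
       fd_right_module K A M \<and> fd_right_module K A N \<longrightarrow>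
       has_euler_characteristic K (\<lambda>l. Ext K A M N l)
         (ringel_form C (dim_vec_right K n e M) (dim_vec_right K n e N))) \<and>
    (\<forall>(M :: ('k, 'm2, 'a) rmod) (N :: ('k, 'n2, 'a) lmod).
       fd_right_module K A M \<and> fd_left_module K A N \<longrightarrow>
       has_euler_characteristic K (\<lambda>l. Tor K A M N l)
         (ringel_form_op C (dim_vec_left K n e N) (dim_vec_right K n e M))) \<and>
    (\<forall>M :: ('k, 'm3, 'a) bimod. fd_bimodule K A M \<longrightarrow>
       has_euler_characteristic K (\<lambda>l. hochschild_cohomology K A M l)
         (matrix_trace (transpose_mat (inverse_matrix C) * dim_matrix K n e M))) \<and>
    (\<forall>M :: ('k, 'm4, 'a) bimod. fd_bimodule K A M \<longrightarrow>
       has_euler_characteristic K (\<lambda>l. hochschild_homology K A M l)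
         (matrix_trace (inverse_matrix C * dim_matrix K n e M)))"
proof -
 interpret alg_over K A by (intro alg_over.intro base_field.intro alg_over_axioms.intro assms)
 obtain \<chi> where "basic_algebra K A {..<n} e \<chi>" using elementary_basic[OF assms(4,3,6)] by blast
 then interpret basic_cartan K A n e \<chi> by (intro basic_cartan.intro basic_cartan_axioms.intro assms(5))
 have "invertible_mat (cartan_matrix K A n e)" by (rule cartan_inverse)
 then show ?thesis
  unfolding Let_def using ext_euler_ringel tor_euler_ringel hochschild_euler by blast
qed

end
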